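(* Let $B$ be a circle with center $A$ or, more generally, a smooth conic with center $A$, and let $\ell_1=0$, $\ell_2=0$ be the equations of the two lines $L_1, L_2$ joining $A$ to the two points of $B\cap L_\infty$. Let $C$ be a reduced and irreducible curve in $\mathbf{P}^2$ of degree $\delta$ with equation $G(x,y,z)=0$. Then the proper conchoid $\tilde{\mathcal{C}}_B(C)$ is reducible if and only if there exist homogeneous polynomials $H_1$ and $H_2$ such that: 1. $G = H_1^2-\ell_1\ell_2H_2^2$, if $\delta$ is even; or 2. $G = \ell_1 H_1^2 - \ell_2 H_2^2$, if $\delta$ is odd.
   Context: $k$ is an algebraically closed field of characteristic $0$ or of prime characteristic greater than the degrees of the curves considered; $\mathbf{P}^2$ is the projective plane over $k$ with coordinates $[x:y:z]$, $L_\infty$ is the line $z=0$, $A=[0:0:1]$. "Curve" means effective divisor in $\mathbf{P}^2$. A conic has center $A$ if $A$ is the pole of $L_\infty$ with respect to it. $B$ has equation $F(x,y,z)=0$, meets $L_\infty$ in two distinct points $P_1,P_2$, and does not contain $A$; $L_i$ is the line $AP_i$ (these are also the tangents to $B$ through $A$). Incidence surface: $W_B\subset \mathbf{P}^2\times\mathbf{P}^2$, with bihomogeneous coordinates $[x:y:z;\,X:Y:Z]$, is defined by the bihomogeneous ideal $(F(zX-xZ,\,zY-yZ,\,zZ),\ xY-yX)$; it is a reduced irreducible surface. $\pi_1,\pi_2: W_B\to\mathbf{P}^2$ are the projections to the first and second factor. Conchoid: for a curve $C$, $\mathcal{C}_B(C)={\pi_2}_*(\pi_1^*(C))$, where $\pi_1^*$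 is pull-back of divisors (pulling back local equations) and ${\pi_2}_*$ is push-forward of cycles (a reduced irreducible curve $D$ is sent to $0$ if $\pi_2(D)$ is a point, and to $m\,\pi_2(D)$, with $m$ the degree of $\pi_2|_D$, otherwise, extended linearly). Proper conchoid: $\tilde{\mathcal{C}}_B(C)$ is the curve that does not have $B$, $L_1$, $L_2$ as components and such that $\mathcal{C}_B(C)=aB+b_1L_1+b_2L_2+\tilde{\mathcal{C}}_B(C)$ for some integers $a,b_1,b_2$.
   Formalization: The claim is false when C is a line through A, C = B, or C is the image of B under the homothety with center A and ratio 2 (the form exists but the proper conchoid has at most one component); these curves are excluded. "Reducible" means having at least two distinct components. *)

theory Defs
  imports
    "HOL-Algebra.Embedded_Algebras"
    "HOL-Library.Extended_Nat"
    "HOL-Computational_Algebra.Computational_Algebra"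
begin

subsection \<open>Polynomials in three variables and in three plus three variables\<close>

text \<open>
  The polynomial ring \<open>k[x][y][z]\<close>.  Iterating the construction gives
  \<open>'a tpoly tpoly = k[x,y,z][X,Y,Z]\<close>, the bihomogeneous coordinate ring of the product of two
  projective planes; in it \<open>const3\<close> is the embedding of \<open>k[x,y,z]\<close> and
  \<open>varx, vary, varz\<close> are \<open>X, Y, Z\<close>.
\<close>

type_synonym 'a tpoly = "'a poly poly poly"

definition const3 :: "'a::comm_ring_1 \<Rightarrow> 'a tpoly" where
  "const3 c = [:[:[:c:]:]:]"

definition varx :: "'a::comm_ring_1 tpoly" where "varx = [:[:[:0, 1:]:]:]"
definition vary :: "'a::comm_ring_1 tpoly" where "vary = [:[:0, 1:]:]"
definition varz :: "'a::comm_ring_1 tpoly" where "varz = [:0, 1:]"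

definition coeff3 :: "'a::comm_ring_1 tpoly \<Rightarrow> nat \<Rightarrow> nat \<Rightarrow> nat \<Rightarrow> 'a" where
  "coeff3 p i j l = poly.coeff (poly.coeff (poly.coeff p l) j) i"

definition eval3 :: "'a::comm_ring_1 tpoly \<Rightarrow> 'a \<Rightarrow> 'a \<Rightarrow> 'a \<Rightarrow> 'a" where
  "eval3 p x y z = poly (poly (poly p [:[:z:]:]) [:y:]) x"

definition map3 :: "('a::comm_ring_1 \<Rightarrow> 'b::comm_ring_1) \<Rightarrow> 'a tpoly \<Rightarrow> 'b tpoly" where
  "map3 h p = map_poly (map_poly (map_poly h)) p"

definition homogeneous :: "nat \<Rightarrow> 'a::comm_ring_1 tpoly \<Rightarrow> bool" where
  "homogeneous d p \<longleftrightarrow> (\<forall>i j l. coeff3 p i j l \<noteq> 0 \<longrightarrow> i + j + l = d)"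

definition bihomogeneous :: "nat \<Rightarrow> nat \<Rightarrow> 'a::comm_ring_1 tpoly tpoly \<Rightarrow> bool" where
  "bihomogeneous a b p \<longleftrightarrow>
     homogeneous b p \<and> (\<forall>i j l. homogeneous a (coeff3 p i j l))"

definition lift1 :: "'a::comm_ring_1 tpoly \<Rightarrow> 'a tpoly tpoly" where
  "lift1 p = const3 p"

definition lift2 :: "'a::comm_ring_1 tpoly \<Rightarrow> 'a tpoly tpoly" where
  "lift2 p = map3 const3 p"

definition ddx :: "'a::field tpoly \<Rightarrow> 'a tpoly" where "ddx p = map_poly (map_poly pderiv) p"
definition ddy :: "'a::field tpoly \<Rightarrow> 'a tpoly" where "ddy p = map_poly pderiv p"
definition ddz :: "'a::field tpoly \<Rightarrow> 'a tpoly" where "ddz p = pderiv p"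


subsection \<open>Closed subsets of the plane and of the product of two planes\<close>

text \<open>
  A subset of the projective plane is represented by the set of all homogeneous coordinate
  vectors of its points (in particular the zero vector is excluded), a subset of the product of
  two planes by the set of all pairs of such vectors.
\<close>

type_synonym 'a vec3 = "'a \<times> 'a \<times> 'a"

fun pev :: "'a::comm_ring_1 tpoly \<Rightarrow> 'a vec3 \<Rightarrow> 'a" where
  "pev p (x, y, z) = eval3 p x y z"

definition bev :: "'a::comm_ring_1 tpoly tpoly \<Rightarrow> 'a vec3 \<Rightarrow> 'a vec3 \<Rightarrow> 'a" where
  "bev f v w = pev (map3 (\<lambda>c. pev c v) f) w"

definition ppoint :: "'a::field vec3 \<Rightarrow> 'a vec3 set" where
  "ppoint v = (case v of (x, y, z) \<Rightarrow> {(c * x, c * y, c * z) |c. c \<noteq> 0})"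

definition zeros :: "'a::field tpoly \<Rightarrow> 'a vec3 set" where
  "zeros f = {v. v \<noteq> (0, 0, 0) \<and> pev f v = 0}"

definition closed1 :: "'a::field vec3 set set" where
  "closed1 = {{v. v \<noteq> (0, 0, 0) \<and> (\<forall>f\<in>S. pev f v = 0)} |S. \<forall>f\<in>S. \<exists>d. homogeneous d f}"

definition closed2 :: "('a::field vec3 \<times> 'a vec3) set set" where
  "closed2 = {{(v, w). v \<noteq> (0, 0, 0) \<and> w \<noteq> (0, 0, 0) \<and> (\<forall>f\<in>S. bev f v w = 0)} |S.
                \<forall>f\<in>S. \<exists>a b. bihomogeneous a b f}"

text \<open>Irreducibility and Krull dimension with respect to a given family \<open>\<C>\<close> of closed sets.\<close>

definition irred_closed :: "'p set set \<Rightarrow> 'p set \<Rightarrow> bool" where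
  "irred_closed \<C> Z \<longleftrightarrow>
     Z \<in> \<C> \<and> Z \<noteq> {} \<and> (\<forall>S\<in>\<C>. \<forall>T\<in>\<C>. Z \<subseteq> S \<union> T \<longrightarrow> Z \<subseteq> S \<or> Z \<subseteq> T)"

definition krull_dim :: "'p set set \<Rightarrow> 'p set \<Rightarrow> enat" where
  "krull_dim \<C> S =
     (SUP n \<in> {n. \<exists>Z :: nat \<Rightarrow> 'p set.
                 (\<forall>i\<le>n. irred_closed \<C> (Z i) \<and> Z i \<subseteq> S) \<and> (\<forall>i<n. Z i \<subset> Z (Suc i))}. enat n)"

definition irred_curve :: "'p set set \<Rightarrow> 'p set \<Rightarrow> bool" where
  "irred_curve \<C> D \<longleftrightarrow> irred_closed \<C> D \<and> krull_dim \<C> D = 1"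


subsection \<open>Divisors of the plane\<close>

text \<open>A divisor is given by the multiplicities of the irreducible curves in it.\<close>

type_synonym 'p divisor = "'p set \<Rightarrow> int"

definition prime_divisor :: "'p set \<Rightarrow> 'p divisor" where
  "prime_divisor E = (\<lambda>E'. if E' = E then 1 else 0)"

definition effective :: "'a::field vec3 divisor \<Rightarrow> bool" where
  "effective K \<longleftrightarrow> finite {E. K E \<noteq> 0} \<and> (\<forall>E. K E \<noteq> 0 \<longrightarrow> K E > 0 \<and> irred_curve closed1 E)"

definition reducible_curve :: "'a::field vec3 divisor \<Rightarrow> bool" where
  "reducible_curve K \<longleftrightarrow> (\<exists>E E'. E \<noteq> E' \<and> K E \<noteq> 0 \<and> K E' \<noteq> 0)"


subsection \<open>Conics\<close>

definition smooth_curve :: "'a::field tpoly \<Rightarrow> bool" where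
  "smooth_curve F \<longleftrightarrow>
     (\<forall>v\<in>zeros F. \<not> (pev (ddx F) v = 0 \<and> pev (ddy F) v = 0 \<and> pev (ddz F) v = 0))"

definition polar :: "'a::field vec3 \<Rightarrow> 'a tpoly \<Rightarrow> 'a vec3 set" where
  "polar a F = (case a of (a1, a2, a3) \<Rightarrow>
     {v. v \<noteq> (0, 0, 0) \<and> a1 * pev (ddx F) v + a2 * pev (ddy F) v + a3 * pev (ddz F) v = 0})"

definition ptA :: "'a::field vec3" where "ptA = (0, 0, 1)"

definition Linf :: "'a::field vec3 set" where "Linf = zeros varz"

definition smooth_conic_with_center_A :: "'a::field tpoly \<Rightarrow> bool" where
  "smooth_conic_with_center_A F \<longleftrightarrow> homogeneous 2 F \<and> F \<noteq> 0 \<and> smooth_curve F \<and> polar ptA F = Linf"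

definition line_eq_through :: "'a::field tpoly \<Rightarrow> 'a vec3 \<Rightarrow> 'a vec3 \<Rightarrow> bool" where
  "line_eq_through l p q \<longleftrightarrow> l \<noteq> 0 \<and> homogeneous 1 l \<and> pev l p = 0 \<and> pev l q = 0"


subsection \<open>The incidence surface\<close>

text \<open>The two generators \<open>F(zX - xZ, zY - yZ, zZ)\<close> and \<open>xY - yX\<close> of the ideal of \<open>W\<^sub>B\<close>.\<close>

definition W_eq1 :: "'a::field tpoly \<Rightarrow> 'a tpoly tpoly" where
  "W_eq1 F = eval3 (map3 (\<lambda>c. const3 (const3 c)) F)
     (lift1 varz * lift2 varx - lift1 varx * lift2 varz)
     (lift1 varz * lift2 vary - lift1 vary * lift2 varz)
     (lift1 varz * lift2 varz)"

definition W_eq2 :: "'a::field tpoly tpoly" where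
  "W_eq2 = lift1 varx * lift2 vary - lift1 vary * lift2 varx"

definition W_ideal :: "'a::field tpoly \<Rightarrow> 'a tpoly tpoly set" where
  "W_ideal F = {p * W_eq1 F + q * W_eq2 |p q. True}"

definition W_surface :: "'a::field tpoly \<Rightarrow> ('a vec3 \<times> 'a vec3) set" where
  "W_surface F = {(v, w). v \<noteq> (0, 0, 0) \<and> w \<noteq> (0, 0, 0) \<and> (\<forall>f\<in>W_ideal F. bev f v w = 0)}"


subsection \<open>Local rings, lengths and degrees\<close>

text \<open>
  The local ring of the product of two planes along an irreducible closed subset \<open>D\<close>, as a
  subring of the field of fractions of the bihomogeneous coordinate ring.
\<close>

definition local_carrier ::
    "('a::field vec3 \<times> 'a vec3) set \<Rightarrow> 'a tpoly tpoly fract set" where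
  "local_carrier D = {Fract f g |f g. \<exists>a b. bihomogeneous a b f \<and> bihomogeneous a b g \<and>
                                      (\<exists>(v, w)\<in>D. bev g v w \<noteq> 0)}"

definition local_ring ::
    "('a::field vec3 \<times> 'a vec3) set \<Rightarrow> 'a tpoly tpoly fract ring" where
  "local_ring D = \<lparr>carrier = local_carrier D, monoid.mult = (*), one = 1, zero = 0, add = (+)\<rparr>"

definition local_max_ideal ::
    "('a::field vec3 \<times> 'a vec3) set \<Rightarrow> 'a tpoly tpoly fract set" where
  "local_max_ideal D = {Fract f g |f g. \<exists>a b. bihomogeneous a b f \<and> bihomogeneous a b g \<and>
                          (\<forall>(v, w)\<in>D. bev f v w = 0) \<and> (\<exists>(v, w)\<in>D. bev g v w \<noteq> 0)}"

text \<open>The stalk along \<open>D\<close> of the ideal sheaf of \<open>W\<^sub>B\<close>.\<close>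

definition W_local_ideal ::
    "'a::field tpoly \<Rightarrow> ('a vec3 \<times> 'a vec3) set \<Rightarrow> 'a tpoly tpoly fract set" where
  "W_local_ideal F D = {Fract f g |f g. f \<in> W_ideal F \<and>
      (\<exists>a b. bihomogeneous a b f \<and> bihomogeneous a b g \<and> (\<exists>(v, w)\<in>D. bev g v w \<noteq> 0))}"

text \<open>
  The pull-backs along the first projection of the local equations \<open>G / q\<close> of the curve
  \<open>G = 0\<close> at the generic point of the image of \<open>D\<close>.  Any two of them differ by a unit.
\<close>

definition pullback_local_eqs ::
    "'a::field tpoly \<Rightarrow> ('a vec3 \<times> 'a vec3) set \<Rightarrow> 'a tpoly tpoly fract set" where
  "pullback_local_eqs G D = {Fract (lift1 G) (lift1 q) |q.
      \<exists>d. homogeneous d G \<and> homogeneous d q \<and> (\<exists>(v, w)\<in>D. pev q v \<noteq> 0)}"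

text \<open>
  The length of \<open>R / J\<close>: its submodules correspond to the ideals of \<open>R\<close> that contain \<open>J\<close>.
\<close>

definition quot_length :: "('r, 'm) ring_scheme \<Rightarrow> 'r set \<Rightarrow> enat" where
  "quot_length R J =
     (SUP n \<in> {n. \<exists>I :: nat \<Rightarrow> 'r set.
                 (\<forall>i\<le>n. ideal (I i) R \<and> J \<subseteq> I i) \<and> (\<forall>i<n. I i \<subset> I (Suc i))}. enat n)"

text \<open>
  The multiplicity of \<open>D\<close> in the pull-back to \<open>W\<^sub>B\<close> of the curve \<open>G = 0\<close>: the length of
  \<open>O / (g)\<close>, where \<open>O\<close> is the local ring of \<open>W\<^sub>B\<close> along \<open>D\<close> and \<open>g\<close> a local equation.
\<close>

definition pullback1 ::
    "'a::field tpoly \<Rightarrow> 'a tpoly \<Rightarrow> ('a vec3 \<times> 'a vec3) divisor" where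
  "pullback1 F G D =
     (if irred_curve closed2 D \<and> D \<subseteq> W_surface F
      then int (the_enat (quot_length (local_ring D)
             (Idl\<^bsub>local_ring D\<^esub> (W_local_ideal F D \<union> pullback_local_eqs G D))))
      else 0)"

text \<open>
  The function field of \<open>D\<close> is the residue field of the local ring along \<open>D\<close>; the function
  field of the image of \<open>D\<close> under the second projection embeds in it.
\<close>

definition function_field ::
    "('a::field vec3 \<times> 'a vec3) set \<Rightarrow> 'a tpoly tpoly fract set ring" where
  "function_field D = local_ring D Quot local_max_ideal D"

definition image_function_field ::
    "('a::field vec3 \<times> 'a vec3) set \<Rightarrow> 'a tpoly tpoly fract set set" where
  "image_function_field D =
     {local_max_ideal D +>\<^bsub>local_ring D\<^esub> Fract (lift2 f) (lift2 g) |f g.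
        \<exists>d. homogeneous d f \<and> homogeneous d g \<and> (\<exists>w\<in>snd ` D. pev g w \<noteq> 0)}"

definition degree2 :: "('a::field vec3 \<times> 'a vec3) set \<Rightarrow> nat" where
  "degree2 D = (THE n. ring.dimension (function_field D) n
                   (image_function_field D) (carrier (function_field D)))"

text \<open>If the image of \<open>D\<close> is a point, it is not an irreducible curve and \<open>D\<close> does not contribute.\<close>

definition pushforward2 ::
    "('a::field vec3 \<times> 'a vec3) divisor \<Rightarrow> 'a vec3 divisor" where
  "pushforward2 Z E =
     (if irred_curve closed1 E
      then \<Sum>D | Z D \<noteq> 0 \<and> snd ` D = E. Z D * int (degree2 D)
      else 0)"


subsection \<open>Conchoids\<close>

definition conchoid :: "'a::field tpoly \<Rightarrow> 'a tpoly \<Rightarrow> 'a vec3 divisor" where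
  "conchoid F G = pushforward2 (pullback1 F G)"

definition proper_conchoid ::
    "'a::field tpoly \<Rightarrow> 'a tpoly \<Rightarrow> 'a tpoly \<Rightarrow> 'a tpoly \<Rightarrow> 'a vec3 divisor" where
  "proper_conchoid F l1 l2 G = (THE K. effective K \<and>
     K (zeros F) = 0 \<and> K (zeros l1) = 0 \<and> K (zeros l2) = 0 \<and>
     (\<exists>a b1 b2. \<forall>E. conchoid F G E =
        a * prime_divisor (zeros F) E + b1 * prime_divisor (zeros l1) E +
        b2 * prime_divisor (zeros l2) E + K E))"

text \<open>
  Curves for which one of the two halves into which the conchoid splits is lost, so that a
  criterion for reducibility has to leave them out.  Put \<open>B: xy = z\<^sup>2\<close>, \<open>\<ell>\<^sub>1 = x\<close>, \<open>\<ell>\<^sub>2 = y\<close>.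
  For a line through \<open>A\<close> both halves coincide: the proper conchoid of \<open>x = c\<^sup>2y\<close>, \<open>c \<noteq> 0\<close>, is
  twice that line (and it is \<open>0\<close> for \<open>x = 0\<close> and \<open>y = 0\<close>).  For \<open>B\<close> itself, one half is
  contracted to the point \<open>A\<close> and the proper conchoid is the irreducible conic \<open>xy = 4z\<^sup>2\<close>.  For
  \<open>xy = 4z\<^sup>2\<close>, the image of \<open>B\<close> under the homothety with center \<open>A\<close> and ratio 2, one half is \<open>B\<close>
  and the other \<open>xy = 9z\<^sup>2\<close>.  Yet \<open>x - c\<^sup>2y\<close> and \<open>xy - c\<^sup>2z\<^sup>2\<close> are of the form
  \<open>\<ell>\<^sub>1 H\<^sub>1\<^sup>2 - \<ell>\<^sub>2 H\<^sub>2\<^sup>2\<close> and \<open>H\<^sub>1\<^sup>2 - \<ell>\<^sub>1 \<ell>\<^sub>2 H\<^sub>2\<^sup>2\<close>.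
\<close>

definition degenerate_curve :: "'a::field tpoly \<Rightarrow> 'a tpoly \<Rightarrow> bool" where
  "degenerate_curve F G \<longleftrightarrow>
     (homogeneous 1 G \<and> pev G ptA = 0) \<or>
     zeros G = zeros F \<or>
     zeros G = {(2 * x, 2 * y, z) |x y z. (x, y, z) \<in> zeros F}"

end

theory Submission
  imports Defs "Berlekamp_Zassenhaus.Unique_Factorization_Poly"
begin

text \<open>
  Normalise \<open>B\<close> to \<open>q = z\<^sup>2\<close>, where \<open>q\<close> is a multiple of \<open>\<ell>\<^sub>1 \<ell>\<^sub>2\<close>.  Over a general point \<open>v\<close> of \<open>C\<close> lie
  two points of the incidence surface, one for each square root \<open>s\<close> of \<open>q(v)\<close>; write \<open>psi s v\<close> for their
  second components.  If \<open>p\<close> is an equation of a component of the proper conchoid and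
  \<open>p (psi s v) = \<alpha> (v) + s \<beta> (v)\<close>, then \<open>G\<close> divides the norm \<open>\<alpha>\<^sup>2 - q \<beta>\<^sup>2\<close>.  If \<open>G\<close> divided \<open>\<alpha>\<close> and \<open>\<beta>\<close>,
  then \<open>p\<close> would vanish at both points over every \<open>v\<close> and there would be no other component.  So for a
  reducible conchoid \<open>q\<close> is a square modulo \<open>G\<close>, and \<open>G\<close> is the norm, up to a factor \<open>\<ell>\<^sub>1\<close>, of a form in the
  double cover branched along \<open>L\<^sub>1\<close> and \<open>L\<^sub>2\<close>, which is the asserted shape.  Conversely \<open>H\<^sub>1\<close> and \<open>H\<^sub>2\<close>
  provide a rational function \<open>s\<close> on \<open>C\<close> with \<open>s\<^sup>2 = q\<close>, and the inverse image of \<open>C\<close> splits into the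
  closures of the graphs of \<open>psi s\<close> and \<open>psi (- s)\<close>.  Both occur with multiplicity one, and their images
  are curves different from \<open>B\<close>, \<open>L\<^sub>1\<close>, \<open>L\<^sub>2\<close>.  They are different from each other, since otherwise \<open>C\<close> would
  be invariant under a translation of the distance from \<open>A\<close>, which has infinite order or order \<open>CHAR('a) > \<delta>\<close>.
\<close>

subsection \<open>Polynomials as functions\<close>

text \<open>With s^2 = q, the quantity s / z is the distance from A, and \<open>psi s\<close> adds 1
  to it. This explains two of the excluded curves: the distance -1 is sent to A, so one half over B
  is contracted, and the distance -2 is sent to -1, so one half over q = 4 z^2 falls on B and is
  discarded. Adjoining only a root of q to k[x, y, z] gives a ring that is not factorial, since this
  root squared is also a product of two lines. This is why roots of both lines are adjoined; the
  parity of the degree then reappears as a sign under (a, b) -> (- a, - b). The push-forward is the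
  other obstacle. A component counts only if its image, as a set, is a curve; its multiplicity is a
  length over a local ring, its degree a degree of fields. So for the converse the image of the
  closure of a graph has to be shown closed, the local ideal maximal, and the extension of residue
  fields finite. Of the degree of the extension only positivity is used, because nothing in the
  conchoid is negative.\<close>

definition smul :: "'a::comm_ring_1 \<Rightarrow> 'a vec3 \<Rightarrow> 'a vec3" where
  "smul t v = (t * fst v, t * fst (snd v), t * snd (snd v))"

lemma smul_simps [simp]: "smul t (x, y, z) = (t * x, t * y, t * z)"
  by (simp add: smul_def)

lemma smul_smul [simp]: "smul t (smul u v) = smul (t * u) v"
  by (simp add: smul_def mult.assoc)

lemma smul_1 [simp]: "smul 1 v = v"
  by (simp add: smul_def)

lemma smul_eq_zero_iff [simp]:
  "smul t v = (0, 0, 0) \<longleftrightarrow> t = 0 \<or> v = (0, 0, 0)" for t :: "'a::idom"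
  by (cases v) auto

lemma eval3_add [simp]: "eval3 (p + q) x y z = eval3 p x y z + eval3 q x y z"
  and eval3_mult [simp]: "eval3 (p * q) x y z = eval3 p x y z * eval3 q x y z"
  and eval3_0 [simp]: "eval3 0 x y z = 0"
  and eval3_1 [simp]: "eval3 1 x y z = 1"
  and eval3_uminus [simp]: "eval3 (- p) x y z = - eval3 p x y z"
  and eval3_diff [simp]: "eval3 (p - q) x y z = eval3 p x y z - eval3 q x y z"
  by (simp_all add: eval3_def)

lemma eval3_basic [simp]:
  "eval3 (const3 c) x y z = c" "eval3 varx x y z = x" "eval3 vary x y z = y" "eval3 varz x y z = z"
  by (simp_all add: eval3_def const3_def varx_def vary_def varz_def)

lemma pev_add [simp]: "pev (p + q) v = pev p v + pev q v"
  and pev_mult [simp]: "pev (p * q) v = pev p v * pev q v"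
  and pev_0 [simp]: "pev 0 v = 0"
  and pev_1 [simp]: "pev 1 v = 1"
  and pev_uminus [simp]: "pev (- p) v = - pev p v"
  and pev_diff [simp]: "pev (p - q) v = pev p v - pev q v"
  and pev_const3 [simp]: "pev (const3 c) v = c"
  and pev_varx [simp]: "pev varx v = fst v"
  and pev_vary [simp]: "pev vary v = fst (snd v)"
  and pev_varz [simp]: "pev varz v = snd (snd v)"
  by (cases v; simp)+

lemma pev_power [simp]: "pev (p ^ n) v = pev p v ^ n"
  by (induction n) auto

lemma pev_sum [simp]: "pev (sum f S) v = (\<Sum>i\<in>S. pev (f i) v)"
  by (induction S rule: infinite_finite_induct) auto

lemma comm_ring_hom_pev: "comm_ring_hom (\<lambda>p. pev p v)"
  by unfold_locales auto

lemma map3_hom: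
  assumes "comm_ring_hom h"
  shows "map3 h (p + q) = map3 h p + map3 h q" "map3 h (p * q) = map3 h p * map3 h q"
    "map3 h 0 = 0" "map3 h (const3 c) = const3 (h c)"
    "map3 h varx = varx" "map3 h vary = vary" "map3 h varz = varz"
proof -
  interpret comm_ring_hom h by fact
  interpret h1: map_poly_comm_ring_hom h ..
  interpret h2: map_poly_comm_ring_hom "map_poly h" ..
  interpret h3: map_poly_comm_ring_hom "map_poly (map_poly h)" ..
  show "map3 h (p + q) = map3 h p + map3 h q" "map3 h (p * q) = map3 h p * map3 h q" "map3 h 0 = 0"
    by (simp_all add: map3_def hom_distribs)
  show "map3 h (const3 c) = const3 (h c)"
    "map3 h varx = varx" "map3 h vary = vary" "map3 h varz = varz"
    by (simp_all add: map3_def const3_def varx_def vary_def varz_def hom_distribs)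
qed

lemma coeff3_map3: "h 0 = 0 \<Longrightarrow> coeff3 (map3 h p) i j l = h (coeff3 p i j l)"
  by (simp add: coeff3_def map3_def coeff_map_poly)

lemma bev_add [simp]: "bev (f + g) v w = bev f v w + bev g v w"
  and bev_mult [simp]: "bev (f * g) v w = bev f v w * bev g v w"
  and bev_0 [simp]: "bev 0 v w = 0"
  and bev_lift1 [simp]: "bev (lift1 p) v w = pev p v"
  and bev_varx [simp]: "bev varx v w = fst w"
  and bev_vary [simp]: "bev vary v w = fst (snd w)"
  and bev_varz [simp]: "bev varz v w = snd (snd w)"
  by (simp_all add: bev_def lift1_def map3_hom[OF comm_ring_hom_pev])

lemma lift1_hom [simp]:
  "lift1 1 = 1" "lift1 (p + q) = lift1 p + lift1 q" "lift1 (p * q) = lift1 p * lift1 q"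
  "lift1 (- p) = - lift1 p" "lift1 (p - q) = lift1 p - lift1 q" "lift1 0 = 0"
  by (simp_all add: lift1_def const3_def)

lemma lift1_power [simp]: "lift1 (p ^ n) = lift1 p ^ n"
  by (induction n) simp_all

lemma bev_1 [simp]: "bev 1 v w = 1"
  using bev_lift1[of 1] by simp

lemma bev_uminus [simp]: "bev (- f) v w = - bev f v w"
  by (metis add_eq_0_iff bev_0 bev_add minus_unique)

lemma bev_diff [simp]: "bev (f - g) v w = bev f v w - bev g v w"
  using bev_add[of f "- g" v w] by (simp del: bev_add)

lemma bev_power [simp]: "bev (f ^ n) v w = bev f v w ^ n"
  by (induction n) auto

lemma bev_sum [simp]: "bev (sum f S) v w = (\<Sum>i\<in>S. bev (f i) v w)"
  by (induction S rule: infinite_finite_induct) auto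

lemma comm_ring_hom_const3: "comm_ring_hom const3"
  by unfold_locales (simp_all add: const3_def)

lemma lift2_hom [simp]:
  "lift2 (p + q) = lift2 p + lift2 q" "lift2 (p * q) = lift2 p * lift2 q"
  "lift2 (const3 c) = lift1 (const3 c)"
  "lift2 varx = varx" "lift2 vary = vary" "lift2 varz = varz" "lift2 0 = 0"
  by (simp_all add: lift2_def map3_hom[OF comm_ring_hom_const3] lift1_def)

definition mono3 :: "'a::comm_ring_1 \<Rightarrow> nat \<Rightarrow> nat \<Rightarrow> nat \<Rightarrow> 'a tpoly" where
  "mono3 c i j l = monom (monom (monom c i) j) l"

lemma monom_sum: "monom (sum f S) n = (\<Sum>i\<in>S. monom (f i) n)"
  by (induction S rule: infinite_finite_induct) (auto simp: add_monom[symmetric])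

lemma tpoly_expansion:
  "p = (\<Sum>l\<le>degree p. \<Sum>j\<le>degree (coeff p l). \<Sum>i\<le>degree (coeff (coeff p l) j).
          mono3 (coeff3 p i j l) i j l)"
  by (simp add: mono3_def coeff3_def monom_sum[symmetric] poly_as_sum_of_monoms)

lemma eval3_mono3 [simp]: "eval3 (mono3 c i j l) x y z = c * x ^ i * y ^ j * z ^ l"
  by (simp add: eval3_def mono3_def poly_monom poly_const_pow mult_ac)

lemma pev_mono3 [simp]: "pev (mono3 c i j l) (x, y, z) = c * x ^ i * y ^ j * z ^ l"
  by simp

lemma sum_closed:
  assumes "P 0" "\<And>a b. P a \<Longrightarrow> P b \<Longrightarrow> P (a + b)" "\<And>i. i \<in> S \<Longrightarrow> P (f i)"
  shows "P (sum f S)"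
  using assms(3) by (induction S rule: infinite_finite_induct) (auto intro: assms)

lemma tpoly_sum_induct [case_names zero add mono]:
  assumes "P 0" "\<And>p q. P p \<Longrightarrow> P q \<Longrightarrow> P (p + q)" "\<And>c i j l. P (mono3 c i j l)"
  shows "P p"
  by (subst tpoly_expansion) (intro sum_closed[where P=P] assms)

lemma mono3_altdef: "mono3 c i j l = const3 c * varx ^ i * vary ^ j * varz ^ l"
proof -
  have z: "p * [:0, 1:] ^ n = monom (coeff p 0) n" if "degree p = 0" for p :: "'b::comm_ring_1 poly" and n
  proof -
    from that obtain a where "p = [:a:]" by (rule degree_eq_zeroE)
    thus ?thesis by (simp add: monom_altdef)
  qed
  have c: "[:p:] ^ n = [:p ^ n:]" for p :: "'b::comm_ring_1" and n
    by (simp add: poly_const_pow)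
  show ?thesis
    by (simp add: mono3_def const3_def varx_def vary_def varz_def c z monom_altdef mult_ac)
qed

lemma tpoly_induct [case_names const x y z add mult]:
  assumes "\<And>c. P (const3 c)" "P varx" "P vary" "P varz"
    "\<And>p q. P p \<Longrightarrow> P q \<Longrightarrow> P (p + q)" "\<And>p q. P p \<Longrightarrow> P q \<Longrightarrow> P (p * q)"
  shows "P p"
proof -
  have c: "P 0" "P 1" using assms(1)[of 0] assms(1)[of 1] by (simp_all add: const3_def)
  have pow: "P (p ^ n)" if "P p" for p n
    using that by (induction n) (auto intro: c assms)
  show ?thesis
    by (induction p rule: tpoly_sum_induct) (auto simp: mono3_altdef intro!: c assms pow)
qed

lemma bpoly_induct [case_names const x y z add mult]:
  assumes "\<And>c. P (lift1 c)" "P varx" "P vary" "P varz"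
    "\<And>p q. P p \<Longrightarrow> P q \<Longrightarrow> P (p + q)" "\<And>p q. P p \<Longrightarrow> P q \<Longrightarrow> P (p * q)"
  shows "P f"
  by (induction f rule: tpoly_induct) (use assms in \<open>auto simp: lift1_def\<close>)

lemma bev_lift2 [simp]: "bev (lift2 p) v w = pev p w"
  by (induction p rule: tpoly_induct) auto

lemma infinite_UNIV_alg_closed: "infinite (UNIV :: 'a::alg_closed_field set)"
proof
  assume fin: "finite (UNIV :: 'a set)"
  define p :: "'a poly" where "p = (\<Prod>a\<in>UNIV. [:-a, 1:]) + 1"
  have "degree (\<Prod>a\<in>(UNIV::'a set). [:-a, 1:]) = card (UNIV :: 'a set)"
    by (subst degree_prod_eq_sum_degree) auto
  moreover have "card (UNIV :: 'a set) > 0" using fin by (simp add: card_gt_0_iff)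
  ultimately have "degree p > 0"
    unfolding p_def by (subst degree_add_eq_left) auto
  then obtain x where "poly p x = 0" using alg_closed_imp_poly_has_root by blast
  moreover have "poly (\<Prod>a\<in>UNIV. [:-a, 1:]) x = 0"
    using fin by (simp add: poly_prod)
  ultimately show False by (simp add: p_def)
qed

lemma poly_all_zero_imp_zero:
  fixes p :: "'b::idom poly"
  assumes "infinite S" "\<And>x. x \<in> S \<Longrightarrow> poly p x = 0"
  shows "p = 0"
  using poly_roots_finite[of p] assms by (metis (mono_tags, lifting) finite_subset mem_Collect_eq subsetI)

lemma infinite_Diff_singleton: "infinite (UNIV - {a::'a::alg_closed_field})"
  using infinite_UNIV_alg_closed by simp

text \<open>The field is infinite, so the variables can be removed one at a time by evaluation at
  constants. Hence polynomial identities can be verified pointwise, which is how most of them are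
  proved here.\<close>

lemma pev_zero_imp_zero:
  fixes p :: "'a::alg_closed_field tpoly"
  assumes "\<And>v. pev p v = 0"
  shows "p = 0"
proof -
  have inj1: "inj (\<lambda>c::'a. [:[:c:]:])" and inj2: "inj (\<lambda>c::'a. [:c:])" by (auto intro: injI)
  have "poly p [:[:z:]:] = 0" for z
  proof -
    have "poly (poly p [:[:z:]:]) [:y:] = 0" for y
      by (rule poly_all_zero_imp_zero[OF infinite_UNIV_alg_closed])
        (use assms[of "(x, y, z)" for x] in \<open>simp add: eval3_def\<close>)
    thus ?thesis
      by (intro poly_all_zero_imp_zero[of "range (\<lambda>c. [:c:])"])
        (auto simp: finite_image_iff inj2 infinite_UNIV_alg_closed)
  qed
  thus ?thesis
    by (intro poly_all_zero_imp_zero[of "range (\<lambda>c. [:[:c:]:])"])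
      (auto simp: finite_image_iff inj1 infinite_UNIV_alg_closed)
qed

lemma pev_eqI: "(\<And>v. pev p v = pev q v) \<Longrightarrow> p = q" for p :: "'a::alg_closed_field tpoly"
  using pev_zero_imp_zero[of "p - q"] by simp

lemma tpoly_eqI_coeff3: "(\<And>i j l. coeff3 p i j l = coeff3 q i j l) \<Longrightarrow> p = q"
  by (simp add: coeff3_def poly_eq_iff)

lemma bev_zero_imp_zero:
  fixes f :: "'a::alg_closed_field tpoly tpoly"
  assumes "\<And>v w. bev f v w = 0"
  shows "f = 0"
proof (rule tpoly_eqI_coeff3)
  fix i j l
  have "map3 (\<lambda>c. pev c v) f = 0" for v
    using assms by (intro pev_zero_imp_zero) (simp add: bev_def)
  hence "pev (coeff3 f i j l) v = 0" for v
    using coeff3_map3[of "\<lambda>c. pev c v" f i j l] by (simp add: coeff3_def)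
  thus "coeff3 f i j l = coeff3 0 i j l"
    using pev_zero_imp_zero[of "coeff3 f i j l"] by (simp add: coeff3_def)
qed

lemma bev_eqI: "(\<And>v w. bev f v w = bev g v w) \<Longrightarrow> f = g" for f :: "'a::alg_closed_field tpoly tpoly"
  using bev_zero_imp_zero[of "f - g"] by simp

lemma pev_nonzero_ex:
  fixes p :: "'a::alg_closed_field tpoly"
  assumes "p \<noteq> 0"
  obtains v where "pev p v \<noteq> 0"
  using pev_zero_imp_zero assms by blast

declare pev.simps [simp del]

subsection \<open>Homogeneity\<close>

text \<open>Read the sum as a univariate polynomial in t with infinitely many zeros. This separates
  graded components: rescaling a point by t multiplies the component of degree n by t^n.\<close>

lemma sum_powers_zero:
  fixes c :: "nat \<Rightarrow> 'a::alg_closed_field"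
  assumes "finite S" "\<And>t. t \<noteq> 0 \<Longrightarrow> (\<Sum>n\<in>S. t ^ n * c n) = 0" "n \<in> S"
  shows "c n = 0"
proof -
  define p where "p = (\<Sum>n\<in>S. monom (c n) n)"
  have "p = 0"
    by (rule poly_all_zero_imp_zero[OF infinite_Diff_singleton[of 0]])
      (use assms(2) in \<open>auto simp: p_def poly_sum poly_monom mult.commute\<close>)
  moreover have "coeff p n = c n"
    using assms(1,3) by (simp add: p_def coeff_sum)
  ultimately show ?thesis by simp
qed

text \<open>A decomposition into graded pieces only has to be found for the members of a generating family.\<close>

definition decomposable :: "('i \<Rightarrow> 'b::comm_monoid_add \<Rightarrow> bool) \<Rightarrow> 'b \<Rightarrow> bool" where
  "decomposable H p \<longleftrightarrow> (\<exists>S cf. finite S \<and> (\<forall>i. H i (cf i)) \<and> (\<forall>i. i \<notin> S \<longrightarrow> cf i = 0) \<and> p = sum cf S)"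

lemma decomposable_single:
  assumes "H i p" "\<And>i. H i 0"
  shows "decomposable H p"
  unfolding decomposable_def
  by (rule exI[of _ "{i}"], rule exI[of _ "\<lambda>j. if j = i then p else 0"]) (use assms in auto)

lemma decomposable_add:
  assumes "decomposable H p" "decomposable H q" "\<And>i p q. H i p \<Longrightarrow> H i q \<Longrightarrow> H i (p + q)"
  shows "decomposable H (p + q)"
proof -
  obtain S cf T cg where *: "finite S" "\<forall>i. H i (cf i)" "\<forall>i. i \<notin> S \<longrightarrow> cf i = 0" "p = sum cf S"
    "finite T" "\<forall>i. H i (cg i)" "\<forall>i. i \<notin> T \<longrightarrow> cg i = 0" "q = sum cg T"
    using assms(1,2) unfolding decomposable_def by blast
  have "p = sum cf (S \<union> T)" "q = sum cg (S \<union> T)"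
    unfolding *(4,8) by (rule sum.mono_neutral_left; use * in auto)+
  thus ?thesis unfolding decomposable_def
    by (intro exI[of _ "S \<union> T"] exI[of _ "\<lambda>i. cf i + cg i"]) (use * assms(3) in \<open>auto simp: sum.distrib\<close>)
qed

text \<open>Weighted homogeneity, expressed through values. Weights 1 1 1 give ordinary forms;
  weights 1 1 2 are those of the cover k[a, b, z], where x and y are quadratic in a and b.\<close>

definition whom :: "nat \<Rightarrow> nat \<Rightarrow> nat \<Rightarrow> nat \<Rightarrow> 'a::comm_ring_1 tpoly \<Rightarrow> bool" where
  "whom a b c n p \<longleftrightarrow> (\<forall>t x y z. pev p (t ^ a * x, t ^ b * y, t ^ c * z) = t ^ n * pev p (x, y, z))"

lemma whom_decomp: "decomposable (whom a b c) p"
proof (induction p rule: tpoly_sum_induct)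
  case (mono d i j l)
  show ?case
    by (rule decomposable_single[of _ "a * i + b * j + c * l"])
      (auto simp: whom_def power_mult_distrib power_add power_mult mult_ac)
next
  case (add p q)
  thus ?case by (rule decomposable_add) (simp add: whom_def distrib_left)
qed (auto intro!: decomposable_single simp: whom_def)

lemma homogeneous_0 [simp]: "homogeneous d 0"
  and homogeneous_add: "homogeneous d p \<Longrightarrow> homogeneous d q \<Longrightarrow> homogeneous d (p + q)"
  by (auto simp: homogeneous_def coeff3_def) (metis add.left_neutral)

lemma homogeneous_mono3: "homogeneous (i + j + l) (mono3 c i j l)"
  by (auto simp: homogeneous_def coeff3_def mono3_def split: if_splits)

lemma homogeneous_decomp: "decomposable homogeneous p"
proof (induction p rule: tpoly_sum_induct)
  case (mono c i j l)
  show ?case by (rule decomposable_single[of _ "i + j + l"]) (simp_all add: homogeneous_mono3)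
next
  case (add p q)
  thus ?case by (rule decomposable_add) (rule homogeneous_add)
qed (auto intro!: decomposable_single[of _ 0])

lemma homogeneous_pev:
  assumes "homogeneous d p"
  shows "pev p (smul t v) = t ^ d * pev p v"
proof -
  obtain x y z where v: "v = (x, y, z)" by (cases v)
  have *: "pev p v = (\<Sum>l\<le>degree p. \<Sum>j\<le>degree (coeff p l). \<Sum>i\<le>degree (coeff (coeff p l) j).
          pev (mono3 (coeff3 p i j l) i j l) v)" for v
    using arg_cong[OF tpoly_expansion[of p], of "\<lambda>p. pev p v"] by (simp only: pev_sum)
  have "pev (mono3 (coeff3 p i j l) i j l) (smul t v) = t ^ d * pev (mono3 (coeff3 p i j l) i j l) v" for i j l
  proof (cases "coeff3 p i j l = 0")
    case False
    hence "d = i + j + l" using assms by (auto simp: homogeneous_def)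
    thus ?thesis by (simp add: v power_mult_distrib power_add mult_ac)
  qed (simp add: mono3_def)
  thus ?thesis by (subst (1 2) *) (simp add: sum_distrib_left)
qed

lemma sum_powers_eq_single:
  fixes c :: "nat \<Rightarrow> 'a::alg_closed_field"
  assumes "finite S" "\<And>t. t \<noteq> 0 \<Longrightarrow> (\<Sum>n\<in>S. t ^ n * c n) = t ^ d * e" "n \<in> S" "n \<noteq> d"
  shows "c n = 0"
proof -
  define c' where "c' = (\<lambda>n. (if n \<in> S then c n else 0) - (if n = d then e else 0))"
  have "c' n = 0"
  proof (rule sum_powers_zero[of "insert d S"])
    fix t :: 'a assume t: "t \<noteq> 0"
    have "(\<Sum>n\<in>insert d S. t ^ n * c' n) =
        (\<Sum>n\<in>insert d S. t ^ n * (if n \<in> S then c n else 0)) -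
        (\<Sum>n\<in>insert d S. t ^ n * (if n = d then e else 0))"
      by (simp add: c'_def right_diff_distrib sum_subtractf del: sum.insert_if)
    also have "(\<Sum>n\<in>insert d S. t ^ n * (if n = d then e else 0)) = t ^ d * e"
      using assms(1) by (simp add: if_distrib sum.delta cong: if_cong del: sum.insert_if)
    also have "(\<Sum>n\<in>insert d S. t ^ n * (if n \<in> S then c n else 0)) = (\<Sum>n\<in>S. t ^ n * c n)"
      by (rule sum.mono_neutral_cong_right) (use assms(1) in auto)
    finally show "(\<Sum>n\<in>insert d S. t ^ n * c' n) = 0" using assms(2)[OF t] by simp
  qed (use assms in auto)
  thus ?thesis using assms(3,4) by (simp add: c'_def)
qed

lemma homogeneousI:
  fixes p :: "'a::alg_closed_field tpoly"
  assumes "\<And>t v. t \<noteq> 0 \<Longrightarrow> pev p (smul t v) = t ^ d * pev p v"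
  shows "homogeneous d p"
proof -
  obtain S cf where *: "finite S" "\<And>i. homogeneous i (cf i)" "\<And>i. i \<notin> S \<Longrightarrow> cf i = 0" "p = sum cf S"
    using homogeneous_decomp[of p] unfolding decomposable_def by blast
  have "pev (cf n) v = 0" if "n \<in> S" "n \<noteq> d" for n v
    by (rule sum_powers_eq_single[of S "\<lambda>n. pev (cf n) v" d "pev p v"])
      (use * that assms[of _ v] in \<open>auto simp: homogeneous_pev[OF *(2)]\<close>)
  hence "cf n = 0" if "n \<noteq> d" for n
    using *(3) that pev_zero_imp_zero[of "cf n"] by blast
  hence "sum cf S = (\<Sum>n\<in>S. if n = d then cf d else 0)"
    by (intro sum.cong) auto
  hence "p = cf d"
    using * by (auto simp: sum.delta)
  thus ?thesis using * by simp
qed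

lemma homogeneous_iff:
  "homogeneous d p \<longleftrightarrow> (\<forall>t v. pev p (smul t v) = t ^ d * pev p v)" for p :: "'a::alg_closed_field tpoly"
  by (intro iffI allI homogeneousI) (simp_all only: homogeneous_pev)

lemma homogeneous_iff_whom: "homogeneous d p \<longleftrightarrow> whom 1 1 1 d p" for p :: "'a::alg_closed_field tpoly"
  by (auto simp: homogeneous_iff whom_def)

lemma homogeneous_mult: "homogeneous a p \<Longrightarrow> homogeneous b q \<Longrightarrow> homogeneous (a + b) (p * q)"
  and homogeneous_uminus: "homogeneous a p \<Longrightarrow> homogeneous a (- p)"
  and homogeneous_diff: "homogeneous a p \<Longrightarrow> homogeneous a r \<Longrightarrow> homogeneous a (p - r)"
  and homogeneous_const3 [simp]: "homogeneous 0 (const3 c :: 'a tpoly)"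
  and homogeneous_1 [simp]: "homogeneous 0 (1 :: 'a tpoly)"
  and homogeneous_power: "homogeneous a p \<Longrightarrow> homogeneous (n * a) (p ^ n)"
  for p :: "'a::alg_closed_field tpoly"
  by (simp_all add: homogeneous_iff power_add algebra_simps power_mult_distrib flip: power_mult)

lemma homogeneous_vars [simp]:
  "homogeneous (Suc 0) (varx :: 'a::alg_closed_field tpoly)" "homogeneous (Suc 0) (vary :: 'a tpoly)"
  "homogeneous (Suc 0) (varz :: 'a tpoly)"
  by (auto simp: homogeneous_iff)

lemma homogeneous_unique:
  fixes p :: "'a::alg_closed_field tpoly"
  assumes "homogeneous a p" "homogeneous b p" "p \<noteq> 0"
  shows "a = b"
proof (rule ccontr)
  assume "a \<noteq> b"
  obtain i j l where "coeff3 p i j l \<noteq> 0"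
    using assms(3) tpoly_eqI_coeff3[of p 0] by (auto simp: coeff3_def)
  thus False using assms \<open>a \<noteq> b\<close> by (auto simp: homogeneous_def)
qed

lemma homogeneous_0_const:
  fixes p :: "'a::alg_closed_field tpoly"
  assumes "homogeneous 0 p"
  obtains c where "p = const3 c"
proof
  show "p = const3 (pev p (0, 0, 0))"
    by (rule pev_eqI) (use homogeneous_pev[OF assms, of 0] in \<open>simp add: smul_def, metis\<close>)
qed

lemma homogeneous_at_0: "homogeneous (Suc n) p \<Longrightarrow> pev p (0, 0, 0) = 0"
  using homogeneous_pev[of "Suc n" p 0 "(0,0,0)"] by simp

lemma whom_component:
  fixes p :: "'a::alg_closed_field tpoly"
  assumes "p \<noteq> 0"
  obtains S cf where "finite S" "\<And>i. whom a b c i (cf i)" "\<And>i. i \<notin> S \<Longrightarrow> cf i = 0" "p = sum cf S"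
    "\<exists>n\<in>S. cf n \<noteq> 0"
proof -
  obtain S cf where *: "finite S" "\<And>i. whom a b c i (cf i)" "\<And>i. i \<notin> S \<Longrightarrow> cf i = 0" "p = sum cf S"
    using whom_decomp[of a b c p] unfolding decomposable_def by blast
  with assms have "\<exists>n\<in>S. cf n \<noteq> 0" by (metis sum.neutral)
  with * that show thesis by blast
qed

text \<open>Only 0 can be a root of P, so P is a constant times a power of the variable and has a
  single nonzero coefficient.\<close>

lemma dvd_monom_imp_monom:
  fixes P :: "'a::alg_closed_field poly"
  assumes "P * Q = monom c N" "c \<noteq> 0" "coeff P n \<noteq> 0" "coeff P m \<noteq> 0"
  shows "n = m"
proof -
  have nz: "P \<noteq> 0" using assms by auto
  obtain R where R: "P = [:-0, 1:] ^ order 0 P * R" "\<not> [:-0, 1:] dvd R"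
    using order_decomp[OF nz, of 0] by blast
  have "degree R = 0"
  proof (rule ccontr)
    assume "degree R \<noteq> 0"
    then obtain r where r: "poly R r = 0" using alg_closed_imp_poly_has_root[of R] by auto
    moreover have "r \<noteq> 0" using r R(2) by (auto simp: poly_eq_0_iff_dvd)
    moreover have "poly (P * Q) r = 0" by (subst R(1)) (simp add: r)
    ultimately show False using assms(1,2) by (simp add: poly_monom)
  qed
  then obtain r where "R = [:r:]" by (rule degree_eq_zeroE)
  hence "P = monom r (order 0 P)" using R(1) by (simp add: monom_altdef)
  hence "k = order 0 P" if "coeff P k \<noteq> 0" for k
    using that by (metis coeff_monom)
  thus ?thesis using assms by metis
qed

text \<open>Along the weighted scaling orbit of a point, p and q become univariate polynomials whose
  product is a monomial, so p becomes a monomial too. Two nonzero components of p would give two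
  nonzero coefficients at a suitable point.\<close>

lemma whom_factor:
  fixes p q :: "'a::alg_closed_field tpoly"
  assumes "whom a b c N (p * q)" "p * q \<noteq> 0"
  shows "\<exists>n. whom a b c n p"
proof -
  obtain S f where f: "finite S" "\<And>i. whom a b c i (f i)" "\<And>i. i \<notin> S \<Longrightarrow> f i = 0" "p = sum f S"
      "\<exists>n\<in>S. f n \<noteq> 0"
    by (rule whom_component[of p a b c]) (use assms(2) in auto)
  obtain T g where g: "finite T" "\<And>i. whom a b c i (g i)" "\<And>i. i \<notin> T \<Longrightarrow> g i = 0" "q = sum g T"
    by (rule whom_component[of q a b c]) (use assms(2) in auto)
  from f(5) obtain n where n: "n \<in> S" "f n \<noteq> 0" by blast
  have "f m = 0" if m: "m \<noteq> n" for m
  proof (rule ccontr)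
    assume "f m \<noteq> 0"
    \<comment> \<open>The product provides one point at which both components and p * q are
      nonzero.\<close>
    hence "f n * f m * (p * q) \<noteq> 0" using n assms(2) by simp
    then obtain v where v: "pev (f n * f m * (p * q)) v \<noteq> 0" by (rule pev_nonzero_ex)
    obtain x y z where xyz: "v = (x, y, z)" by (cases v)
    define P where "P = (\<Sum>i\<in>S. monom (pev (f i) v) i)"
    define Q where "Q = (\<Sum>i\<in>T. monom (pev (g i) v) i)"
    have ev: "poly P t = pev p (t ^ a * x, t ^ b * y, t ^ c * z)"
      "poly Q t = pev q (t ^ a * x, t ^ b * y, t ^ c * z)" for t
      using f(2) g(2) by (simp_all add: P_def Q_def poly_sum poly_monom f(4) g(4) whom_def xyz mult.commute)
    have "P * Q - monom (pev (p * q) v) N = 0"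
      by (rule poly_all_zero_imp_zero[OF infinite_UNIV_alg_closed])
        (use assms(1) in \<open>simp add: ev poly_monom whom_def xyz mult.commute\<close>)
    hence PQ: "P * Q = monom (pev (p * q) v) N" by simp
    have coeffP: "coeff P i = pev (f i) v" for i
      using f(1,3) by (simp add: P_def coeff_sum)
    show False
      using dvd_monom_imp_monom[OF PQ, of n m] v m by (simp add: coeffP)
  qed
  hence "p = f n"
    using f n by (auto simp: sum.remove intro!: sum.neutral)
  thus ?thesis using f(2) by metis
qed

lemma homogeneous_factor:
  fixes p q :: "'a::alg_closed_field tpoly"
  assumes "homogeneous N (p * q)" "p * q \<noteq> 0"
  obtains a b where "homogeneous a p" "homogeneous b q" "a + b = N"
proof -
  obtain a where a: "homogeneous a p"
    using whom_factor[of 1 1 1 N p q] assms by (auto simp: homogeneous_iff_whom)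
  obtain b where b: "homogeneous b q"
    using whom_factor[of 1 1 1 N q p] assms by (auto simp: homogeneous_iff_whom mult.commute)
  show thesis using that[OF a b] homogeneous_unique[OF homogeneous_mult[OF a b] assms] by simp
qed

section \<open>Bihomogeneous forms on the product of two planes\<close>

lemma bihomogeneous_bev:
  assumes "bihomogeneous a b f"
  shows "bev f (smul t v) (smul u w) = t ^ a * u ^ b * bev f v w"
proof -
  have "bev f (smul t v) w' = t ^ a * bev f v w'" for w'
  proof -
    obtain x y z where w': "w' = (x, y, z)" by (cases w')
    have *: "bev f v w' = (\<Sum>l\<le>degree f. \<Sum>j\<le>degree (coeff f l). \<Sum>i\<le>degree (coeff (coeff f l) j).
          pev (coeff3 f i j l) v * (x ^ i * y ^ j * z ^ l))" for v
    proof -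
      have "bev (mono3 c i j l) v w' = pev c v * (x ^ i * y ^ j * z ^ l)" for c i j l
        using bev_lift1[of c v w'] by (simp add: mono3_altdef lift1_def w' mult.assoc)
      thus ?thesis
        using arg_cong[OF tpoly_expansion[of f], of "\<lambda>f. bev f v w'"] by (simp only: bev_sum)
    qed
    have "pev (coeff3 f i j l) (smul t v) = t ^ a * pev (coeff3 f i j l) v" for i j l
      using assms by (intro homogeneous_pev) (auto simp: bihomogeneous_def)
    thus ?thesis by (subst (1 2) *) (simp add: sum_distrib_left mult.assoc)
  qed
  moreover have "bev f v (smul u w) = u ^ b * bev f v w"
  proof -
    have "homogeneous b (map3 (\<lambda>c. pev c v) f)"
      using assms by (simp add: homogeneous_def bihomogeneous_def coeff3_map3) (metis pev_0)
    thus ?thesis by (simp add: bev_def homogeneous_pev)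
  qed
  ultimately show ?thesis by simp
qed

lemma coeff3_simps [simp]:
  "coeff3 0 i j l = 0" "coeff3 (p + q) i j l = coeff3 p i j l + coeff3 q i j l"
  "coeff3 (mono3 c i' j' l') i j l = (if i = i' \<and> j = j' \<and> l = l' then c else 0)"
  by (auto simp: coeff3_def mono3_def)

lemma bihomogeneous_0 [simp]: "bihomogeneous a b 0"
  by (simp add: bihomogeneous_def)

lemma bihomogeneous_add: "bihomogeneous a b p \<Longrightarrow> bihomogeneous a b q \<Longrightarrow> bihomogeneous a b (p + q)"
  unfolding bihomogeneous_def by (simp add: homogeneous_add)

lemma bihomogeneous_mono3:
  "bihomogeneous (i + j + l) (i' + j' + l') (mono3 (mono3 c i j l) i' j' l')"
  unfolding bihomogeneous_def by (simp add: homogeneous_mono3)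

lemma bpoly_sum_induct [case_names zero add mono]:
  assumes "P 0" "\<And>p q. P p \<Longrightarrow> P q \<Longrightarrow> P (p + q)"
    "\<And>c i j l i' j' l'. P (mono3 (mono3 c i j l) i' j' l')"
  shows "P f"
proof (induction f rule: tpoly_sum_induct)
  case (mono d i' j' l')
  show ?case
  proof (induction d rule: tpoly_sum_induct)
    case (add p q)
    have "mono3 (p + q) i' j' l' = mono3 p i' j' l' + mono3 q i' j' l'"
      by (simp add: mono3_def add_monom)
    with add assms(2) show ?case by metis
  qed (use assms in \<open>auto simp: mono3_def\<close>)
qed (use assms in auto)

lemma bihomogeneous_decomp: "decomposable (\<lambda>(a, b). bihomogeneous a b) f"
proof (induction f rule: bpoly_sum_induct)
  case (mono c i j l i' j' l')
  show ?case
    by (rule decomposable_single[of _ "(i + j + l, i' + j' + l')"]) (auto simp: bihomogeneous_mono3)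
next
  case (add p q)
  thus ?case by (rule decomposable_add) (auto simp: bihomogeneous_add)
qed (auto intro!: decomposable_single[of _ "(0,0)"])

lemma bihomogeneous_decomp':
  obtains M cf where "\<And>a b. bihomogeneous a b (cf a b)" "f = (\<Sum>a\<le>M. \<Sum>b\<le>M. cf a b)"
    "\<And>a b. a > M \<or> b > M \<Longrightarrow> cf a b = (0 :: 'a::comm_ring_1 tpoly tpoly)"
proof -
  obtain S cf where *: "finite S" "\<And>a b. bihomogeneous a b (cf (a, b))" "\<And>i. i \<notin> S \<Longrightarrow> cf i = 0" "f = sum cf S"
    using bihomogeneous_decomp[of f] unfolding decomposable_def by (auto simp: split_def)
  obtain M where M: "\<And>a b. (a, b) \<in> S \<Longrightarrow> a \<le> M \<and> b \<le> M"
  proof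
    fix a b assume "(a, b) \<in> S"
    hence "a \<le> Max (fst ` S)" "b \<le> Max (snd ` S)" using *(1) by (auto intro!: Max_ge image_eqI[of _ _ "(a,b)"])
    thus "a \<le> max (Max (fst ` S)) (Max (snd ` S)) \<and> b \<le> max (Max (fst ` S)) (Max (snd ` S))" by auto
  qed
  have "sum cf S = (\<Sum>(a, b)\<in>{..M} \<times> {..M}. cf (a, b))"
    by (rule sum.mono_neutral_cong_left) (use * M in auto)
  hence "f = (\<Sum>a\<le>M. \<Sum>b\<le>M. cf (a, b))" by (simp add: *(4) sum.cartesian_product)
  moreover have "cf (a, b) = 0" if "a > M \<or> b > M" for a b
    using M[of a b] that *(3) by force
  ultimately show thesis using that[of "\<lambda>a b. cf (a, b)" M] * by blast
qed

text \<open>Varying t with u fixed kills every row except row d; within a row, u is varied.\<close>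

lemma sum_powers2_eq_single:
  fixes c :: "nat \<Rightarrow> nat \<Rightarrow> 'a::alg_closed_field"
  assumes "\<And>t u. t \<noteq> 0 \<Longrightarrow> u \<noteq> 0 \<Longrightarrow> (\<Sum>a\<le>M. \<Sum>b\<le>M. t ^ a * u ^ b * c a b) = t ^ d * u ^ d' * e"
    "a \<le> M" "b \<le> M" "(a, b) \<noteq> (d, d')"
  shows "c a b = 0"
proof -
  have A: "(\<Sum>b\<le>M. u ^ b * c a b) = 0" if "u \<noteq> 0" "a \<noteq> d" "a \<le> M" for u a
    by (rule sum_powers_eq_single[of "{..M}" "\<lambda>a. \<Sum>b\<le>M. u ^ b * c a b" d "u ^ d' * e"])
      (use assms(1) that in \<open>simp_all add: sum_distrib_left mult_ac\<close>)
  show ?thesis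
  proof (cases "a = d")
    case False
    show ?thesis
      by (rule sum_powers_zero[of "{..M}" "c a" b]) (use A False assms in auto)
  next
    case True
    have "(\<Sum>b\<le>M. u ^ b * c d b) = u ^ d' * e" if u: "u \<noteq> 0" for u
    proof -
      have "(\<Sum>a\<le>M. \<Sum>b\<le>M. u ^ b * c a b) = u ^ d' * e" using assms(1)[of 1 u] u by simp
      also have "(\<Sum>a\<le>M. \<Sum>b\<le>M. u ^ b * c a b) = (\<Sum>a\<in>{d}. \<Sum>b\<le>M. u ^ b * c a b)"
        by (rule sum.mono_neutral_right) (use A[OF u] True assms(2) in auto)
      finally show ?thesis by simp
    qed
    hence "c d b = 0"
      by (rule sum_powers_eq_single[of "{..M}" "c d" d' e b, rotated]) (use True assms in auto)
    thus ?thesis using True by simp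
  qed
qed

lemma bihomogeneousI:
  fixes f :: "'a::alg_closed_field tpoly tpoly"
  assumes "\<And>t u v w. t \<noteq> 0 \<Longrightarrow> u \<noteq> 0 \<Longrightarrow> bev f (smul t v) (smul u w) = t ^ a * u ^ b * bev f v w"
  shows "bihomogeneous a b f"
proof -
  obtain M cf where *: "\<And>a b. bihomogeneous a b (cf a b)" "f = (\<Sum>a\<le>M. \<Sum>b\<le>M. cf a b)"
    "\<And>a b. a > M \<or> b > M \<Longrightarrow> cf a b = 0"
    by (rule bihomogeneous_decomp') blast
  have "bev (cf i j) v w = 0" if "i \<le> M" "j \<le> M" "(i, j) \<noteq> (a, b)" for i j v w
    by (rule sum_powers2_eq_single[where c = "\<lambda>a b. bev (cf a b) v w" and M = M and d = a and d' = b and e = "bev f v w"])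
      (use * that assms[of _ _ v w] in \<open>auto simp: bihomogeneous_bev[OF *(1)]\<close>)
  hence "cf i j = 0" if "(i, j) \<noteq> (a, b)" for i j
    using *(3)[of i j] that bev_zero_imp_zero[of "cf i j"] by (meson not_le_imp_less)
  hence 0: "cf i j = (if i = a then if j = b then cf a b else 0 else 0)" for i j by auto
  have "f = (if a \<le> M then if b \<le> M then cf a b else 0 else 0)"
  proof -
    have "f = (\<Sum>i\<le>M. \<Sum>j\<le>M. if i = a then if j = b then cf a b else 0 else 0)"
      by (subst *(2)) (intro sum.cong refl 0)
    also have "\<dots> = (\<Sum>i\<le>M. if i = a then (\<Sum>j\<le>M. if j = b then cf a b else 0) else 0)"
      by (rule sum.cong) auto
    finally show ?thesis by simp
  qed
  thus ?thesis using *(1)[of a b] by (auto split: if_splits)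
qed

lemma bihomogeneous_iff:
  "bihomogeneous a b f \<longleftrightarrow> (\<forall>t u v w. bev f (smul t v) (smul u w) = t ^ a * u ^ b * bev f v w)"
  for f :: "'a::alg_closed_field tpoly tpoly"
  by (intro iffI allI bihomogeneousI) (simp_all only: bihomogeneous_bev)

lemma bihomogeneous_mult:
  "bihomogeneous a b f \<Longrightarrow> bihomogeneous a' b' g \<Longrightarrow> bihomogeneous (a + a') (b + b') (f * g)"
  and bihomogeneous_uminus: "bihomogeneous a b f \<Longrightarrow> bihomogeneous a b (- f)"
  and bihomogeneous_diff: "bihomogeneous a b f \<Longrightarrow> bihomogeneous a b h \<Longrightarrow> bihomogeneous a b (f - h)"
  for f :: "'a::alg_closed_field tpoly tpoly"
  by (simp_all add: bihomogeneous_iff power_add algebra_simps)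

lemma bihomogeneous_lift1: "homogeneous a p \<Longrightarrow> bihomogeneous a 0 (lift1 p)"
  and bihomogeneous_lift2: "homogeneous b p \<Longrightarrow> bihomogeneous 0 b (lift2 p)"
  for p :: "'a::alg_closed_field tpoly"
  by (simp_all add: bihomogeneous_iff homogeneous_iff)

subsection \<open>Restriction to lines\<close>

lemma restrict_line:
  "\<exists>P :: 'a::comm_ring_1 poly. \<forall>t. poly P t = pev p (a1 + t * b1, a2 + t * b2, a3 + t * b3)"
proof (induction p rule: tpoly_induct)
  case (const c)
  show ?case by (rule exI[of _ "[:c:]"]) simp
next
  case x
  show ?case by (rule exI[of _ "[:a1, b1:]"]) simp
next
  case y
  show ?case by (rule exI[of _ "[:a2, b2:]"]) simp
next
  case z
  show ?case by (rule exI[of _ "[:a3, b3:]"]) simp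
next
  case (add p q)
  thus ?case by (metis pev_add poly_add)
next
  case (mult p q)
  thus ?case by (metis pev_mult poly_mult)
qed

text \<open>The restriction to the line joining A to (x, y, 0), as a polynomial in z. It is formed
  coefficientwise so that its degree and its leading coefficient can be compared with those of
  p.\<close>

definition slice :: "'a::comm_ring_1 tpoly \<Rightarrow> 'a \<Rightarrow> 'a \<Rightarrow> 'a poly" where
  "slice p x y = map_poly (\<lambda>r. poly (poly r [:y:]) x) p"

lemma coeff_slice: "coeff (slice p x y) n = poly (poly (coeff p n) [:y:]) x"
  by (simp add: slice_def coeff_map_poly)

lemma poly_slice [simp]: "poly (slice p x y) z = pev p (x, y, z)"
proof -
  interpret comm_ring_hom "\<lambda>r. poly (poly r [:y:]) x"
    by unfold_locales auto
  have "poly (slice p x y) (poly (poly [:[:z:]:] [:y:]) x) = poly (poly (poly p [:[:z:]:]) [:y:]) x"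
    unfolding slice_def by (rule poly_map_poly)
  thus ?thesis by (simp add: pev.simps eval3_def)
qed

lemma degree_slice: "homogeneous d p \<Longrightarrow> degree (slice p x y) \<le> d"
proof (rule degree_le, intro allI impI)
  fix i assume p: "homogeneous d p" and "d < i"
  hence "coeff3 p a b i = 0" for a b by (auto simp: homogeneous_def)
  hence "coeff p i = 0" by (simp add: coeff3_def poly_eq_iff)
  thus "coeff (slice p x y) i = 0" by (simp add: coeff_slice)
qed

subsection \<open>Linear and binary forms\<close>

definition linform :: "'a::comm_ring_1 \<Rightarrow> 'a \<Rightarrow> 'a \<Rightarrow> 'a tpoly" where
  "linform a b c = mono3 a 1 0 0 + mono3 b 0 1 0 + mono3 c 0 0 1"

lemma pev_linform [simp]: "pev (linform a b c) (x, y, z) = a * x + b * y + c * z"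
  by (simp add: linform_def)

lemma homogeneous_linform [simp]: "homogeneous (Suc 0) (linform a b c)"
  unfolding linform_def using homogeneous_mono3[of 1 0 0 a] homogeneous_mono3[of 0 1 0 b] homogeneous_mono3[of 0 0 1 c]
  by (auto intro!: homogeneous_add)

lemma coeff3_linform: "coeff3 (linform a b c) i j l =
   (if (i, j, l) = (1, 0, 0) then a else if (i, j, l) = (0, 1, 0) then b else if (i, j, l) = (0, 0, 1) then c else 0)"
  by (auto simp: linform_def)

lemma linform_eq_0_iff [simp]: "linform a b c = 0 \<longleftrightarrow> a = 0 \<and> b = 0 \<and> c = 0"
proof
  assume "linform a b c = 0"
  hence "coeff3 (linform a b c) i j l = 0" for i j l by simp
  from this[of 1 0 0] this[of 0 1 0] this[of 0 0 1] show "a = 0 \<and> b = 0 \<and> c = 0"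
    by (simp add: coeff3_linform)
qed (simp add: linform_def mono3_def)

lemma homogeneous_1_linform:
  assumes "homogeneous (Suc 0) p"
  obtains a b c where "p = linform a b c"
proof
  show "p = linform (coeff3 p 1 0 0) (coeff3 p 0 1 0) (coeff3 p 0 0 1)"
  proof (rule tpoly_eqI_coeff3)
    fix i j l :: nat
    consider "i + j + l \<noteq> 1" | "(i, j, l) = (1, 0, 0)" | "(i, j, l) = (0, 1, 0)" | "(i, j, l) = (0, 0, 1)"
      by (cases i; cases j; cases l) auto
    thus "coeff3 p i j l = coeff3 (linform (coeff3 p 1 0 0) (coeff3 p 0 1 0) (coeff3 p 0 0 1)) i j l"
    proof cases
      case 1
      hence "coeff3 p i j l = 0" using assms by (auto simp: homogeneous_def)
      with 1 show ?thesis by (auto simp: coeff3_linform)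
    qed (auto simp: coeff3_linform)
  qed
qed

lemma homogeneous_2_quadratic:
  assumes "homogeneous 2 p"
  obtains a b c d e f where
    "p = mono3 a 2 0 0 + mono3 b 1 1 0 + mono3 c 0 2 0 + mono3 d 1 0 1 + mono3 e 0 1 1 + mono3 f 0 0 2"
proof
  show "p = mono3 (coeff3 p 2 0 0) 2 0 0 + mono3 (coeff3 p 1 1 0) 1 1 0 + mono3 (coeff3 p 0 2 0) 0 2 0 +
    mono3 (coeff3 p 1 0 1) 1 0 1 + mono3 (coeff3 p 0 1 1) 0 1 1 + mono3 (coeff3 p 0 0 2) 0 0 2" (is "p = ?q")
  proof (rule tpoly_eqI_coeff3)
    fix i j l :: nat
    consider "i + j + l \<noteq> 2" | "i = 2" "j = 0" "l = 0" | "i = 1" "j = 1" "l = 0" | "i = 0" "j = 2" "l = 0"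
      | "i = 1" "j = 0" "l = 1" | "i = 0" "j = 1" "l = 1" | "i = 0" "j = 0" "l = 2"
      by atomize_elim presburger
    thus "coeff3 p i j l = coeff3 ?q i j l"
    proof cases
      case 1
      hence "coeff3 p i j l = 0" using assms by (auto simp: homogeneous_def)
      with 1 show ?thesis by auto
    qed auto
  qed
qed

text \<open>Projecting along \<open>e\<close> onto the plane \<open>l = 0\<close> changes the value of \<open>h\<close> by a multiple of \<open>l\<close>.\<close>

lemma linform_dvd_aux:
  fixes l h :: "'a::comm_ring_1 tpoly"
  shows "\<exists>A. \<forall>x y z. pev h (x, y, z) -
    pev h (x - pev l (x, y, z) * e1, y - pev l (x, y, z) * e2, z - pev l (x, y, z) * e3) =
    pev l (x, y, z) * pev A (x, y, z)"
proof (induction h rule: tpoly_induct)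
  case (const c)
  show ?case by (rule exI[of _ 0]) simp
next
  case x
  show ?case by (rule exI[of _ "const3 e1"]) simp
next
  case y
  show ?case by (rule exI[of _ "const3 e2"]) simp
next
  case z
  show ?case by (rule exI[of _ "const3 e3"]) simp
next
  case (add p q)
  then obtain A B where *: "\<And>x y z. pev p (x, y, z) -
    pev p (x - pev l (x, y, z) * e1, y - pev l (x, y, z) * e2, z - pev l (x, y, z) * e3) =
    pev l (x, y, z) * pev A (x, y, z)" "\<And>x y z. pev q (x, y, z) -
    pev q (x - pev l (x, y, z) * e1, y - pev l (x, y, z) * e2, z - pev l (x, y, z) * e3) =
    pev l (x, y, z) * pev B (x, y, z)" by blast
  show ?case
    by (rule exI[of _ "A + B"]) (simp add: distrib_left flip: *)
next
  case (mult p q)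
  then obtain A B where *: "\<And>x y z. pev p (x, y, z) -
    pev p (x - pev l (x, y, z) * e1, y - pev l (x, y, z) * e2, z - pev l (x, y, z) * e3) =
    pev l (x, y, z) * pev A (x, y, z)" "\<And>x y z. pev q (x, y, z) -
    pev q (x - pev l (x, y, z) * e1, y - pev l (x, y, z) * e2, z - pev l (x, y, z) * e3) =
    pev l (x, y, z) * pev B (x, y, z)" by blast
  have **: "pev p (x - pev l (x, y, z) * e1, y - pev l (x, y, z) * e2, z - pev l (x, y, z) * e3) =
      pev p (x, y, z) - pev l (x, y, z) * pev A (x, y, z)"
    "pev q (x - pev l (x, y, z) * e1, y - pev l (x, y, z) * e2, z - pev l (x, y, z) * e3) =
      pev q (x, y, z) - pev l (x, y, z) * pev B (x, y, z)" for x y z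
    using *[of x y z] by (simp_all add: algebra_simps)
  show ?case
    by (rule exI[of _ "A * q + B * p - l * A * B"]) (simp only: pev_mult pev_add pev_diff **, simp add: algebra_simps)
qed

text \<open>The Nullstellensatz for a line: if l(e) = 1, then v - l(v) e lies in the plane l = 0,
  where h vanishes.\<close>

lemma linform_dvdI:
  fixes h :: "'a::alg_closed_field tpoly"
  assumes "homogeneous (Suc 0) l" "l \<noteq> 0" "\<And>v. pev l v = 0 \<Longrightarrow> pev h v = 0"
  shows "l dvd h"
proof -
  obtain a b c where l: "l = linform a b c" using assms(1) by (rule homogeneous_1_linform)
  obtain e1 e2 e3 where e: "pev l (e1, e2, e3) = 1"
  proof -
    obtain w where w: "pev l w \<noteq> 0" using assms(2) by (rule pev_nonzero_ex)
    have "pev l (smul (inverse (pev l w)) w) = 1"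
      using w homogeneous_pev[OF assms(1), of "inverse (pev l w)" w] by simp
    thus thesis using that by (cases w) auto
  qed
  obtain A where A: "\<And>x y z. pev h (x, y, z) -
    pev h (x - pev l (x, y, z) * e1, y - pev l (x, y, z) * e2, z - pev l (x, y, z) * e3) =
    pev l (x, y, z) * pev A (x, y, z)" using linform_dvd_aux[of h l e1 e2 e3] by blast
  have "h = l * A"
  proof (rule pev_eqI)
    fix v :: "'a vec3"
    obtain x y z where v: "v = (x, y, z)" by (cases v)
    have "pev l (x - pev l (x, y, z) * e1, y - pev l (x, y, z) * e2, z - pev l (x, y, z) * e3) =
        pev l (x, y, z) - pev l (x, y, z) * pev l (e1, e2, e3)"
      by (simp add: l algebra_simps)
    hence "pev h (x - pev l (x, y, z) * e1, y - pev l (x, y, z) * e2, z - pev l (x, y, z) * e3) = 0"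
      by (intro assms(3)) (simp add: e)
    with A[of x y z] show "pev h v = pev (l * A) v" by (simp add: v)
  qed
  thus ?thesis by simp
qed

lemma degree_linform [simp]: "degree (linform a b 0) = 0"
  by (simp add: linform_def mono3_def monom_0)

text \<open>The \<open>degree\<close> of a \<open>tpoly\<close> is its degree in z, the outermost
  variable. A form of degree 0 in this sense is a binary form in x and y.\<close>

lemma pev_degree_0:
  assumes "degree p = 0"
  shows "pev p (x, y, z) = pev p (x, y, z')"
proof -
  from assms obtain c where "p = [:c:]" by (rule degree_eq_zeroE)
  thus ?thesis by (simp add: pev.simps eval3_def)
qed

lemma degree_0I:
  fixes p :: "'a::alg_closed_field tpoly"
  assumes "\<And>x y z z'. pev p (x, y, z) = pev p (x, y, z')"
  shows "degree p = 0"
proof -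
  have "coeff p n = 0" if "n > 0" for n
  proof -
    have "pev [:coeff p n:] (x, y, z) = 0" for x y z
    proof -
      have "slice p x y - [:pev p (x, y, 0):] = 0"
        by (rule poly_all_zero_imp_zero[OF infinite_UNIV_alg_closed]) (use assms in simp)
      hence "coeff (slice p x y) n = 0" using that by (cases n) auto
      thus ?thesis by (simp add: coeff_slice pev.simps eval3_def)
    qed
    hence "[:coeff p n:] = 0" using pev_zero_imp_zero[of "[:coeff p n:]"] by (metis prod_cases3)
    thus ?thesis by simp
  qed
  thus ?thesis by (metis gr0I leading_coeff_0_iff degree_0)
qed

text \<open>If p(a) \<noteq> 0, the restriction to b + t a has degree d with leading coefficient
  p(a). Instead of coefficients the proof uses the reversed parametrisation a + t b: were the first
  restriction constant, this one would be a multiple of t^d and vanish at t = 0.\<close>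

lemma homogeneous_zero_on_line:
  fixes p :: "'a::alg_closed_field tpoly"
  assumes "homogeneous d p" "d > 0"
  obtains s t where "s \<noteq> 0 \<or> t \<noteq> 0" "pev p (s * a1 + t * b1, s * a2 + t * b2, s * a3 + t * b3) = 0"
proof (cases "pev p (a1, a2, a3) = 0")
  case True
  thus thesis using that[of 1 0] by simp
next
  case False
  obtain P where P: "\<And>t. poly P t = pev p (b1 + t * a1, b2 + t * a2, b3 + t * a3)"
    using restrict_line[of p b1 a1 b2 a2 b3 a3] by blast
  have "degree P > 0"
  proof (rule ccontr)
    assume "\<not> degree P > 0"
    then obtain c where c: "P = [:c:]" by (auto elim: degree_eq_zeroE)
    obtain Q where Q: "\<And>t. poly Q t = pev p (a1 + t * b1, a2 + t * b2, a3 + t * b3)"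
      using restrict_line[of p a1 b1 a2 b2 a3 b3] by blast
    have "Q - monom c d = 0"
    proof (rule poly_all_zero_imp_zero[OF infinite_Diff_singleton[of 0]])
      fix t :: 'a assume "t \<in> UNIV - {0}"
      hence t: "t \<noteq> 0" by simp
      have "poly Q t = pev p (smul t (b1 + inverse t * a1, b2 + inverse t * a2, b3 + inverse t * a3))"
        using t by (simp add: Q algebra_simps)
      also have "\<dots> = t ^ d * c"
        using P[of "inverse t"] by (simp add: homogeneous_pev[OF assms(1)] c del: smul_simps)
      finally show "poly (Q - monom c d) t = 0" by (simp add: poly_monom)
    qed
    hence "Q = monom c d" by simp
    hence "poly Q 0 = 0" using assms(2) by (simp add: poly_monom)
    thus False using Q[of 0] False by simp
  qed
  then obtain t where "poly P t = 0" using alg_closed_imp_poly_has_root by blast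
  thus thesis using that[of t 1] P[of t] by (simp add: algebra_simps)
qed

lemma binary_form_factor:
  fixes p :: "'a::alg_closed_field tpoly"
  assumes "homogeneous (Suc d) p" "degree p = 0"
  obtains a b q where "a \<noteq> 0 \<or> b \<noteq> 0" "p = linform a b 0 * q"
proof -
  obtain s t where st: "s \<noteq> 0 \<or> t \<noteq> 0" "pev p (s, t, 0) = 0"
    using homogeneous_zero_on_line[OF assms(1), of 1 0 0 1 0 0] by auto
  have "linform t (- s) 0 dvd p"
  proof (rule linform_dvdI)
    fix v assume v: "pev (linform t (- s) 0) v = 0"
    obtain x y z where xyz: "v = (x, y, z)" by (cases v)
    with v have e: "t * x = s * y" by simp
    obtain c where c: "x = c * s" "y = c * t"
    proof (cases "s = 0")
      case False
      thus thesis using that[of "x / s"] e by (simp add: field_simps)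
    next
      case True
      thus thesis using that[of "y / t"] e st by (simp add: field_simps)
    qed
    have "pev p v = pev p (smul c (s, t, 0))"
      using pev_degree_0[OF assms(2), of x y z 0] by (simp add: xyz c)
    thus "pev p v = 0" using st by (simp add: homogeneous_pev[OF assms(1)] del: smul_simps)
  qed (use st in auto)
  then obtain q where "p = linform t (- s) 0 * q" by blast
  with st show thesis using that[of t "- s" q] by auto
qed

lemma binary_form_splits:
  fixes p :: "'a::alg_closed_field tpoly"
  assumes "homogeneous d p" "degree p = 0" "p \<noteq> 0"
  shows "\<exists>c ls. c \<noteq> 0 \<and> p = const3 c * prod_list ls \<and>
    (\<forall>l\<in>set ls. \<exists>a b. (a \<noteq> 0 \<or> b \<noteq> 0) \<and> l = linform a b 0)"
  using assms
proof (induction d arbitrary: p)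
  case 0
  from 0(1) obtain c where "p = const3 c" by (rule homogeneous_0_const)
  with 0 show ?case by (intro exI[of _ c] exI[of _ "[]"]) (auto simp: const3_def)
next
  case (Suc d)
  obtain a b q where q: "a \<noteq> 0 \<or> b \<noteq> 0" "p = linform a b 0 * q"
    using binary_form_factor Suc.prems(1,2) by blast
  have "q \<noteq> 0" using q Suc.prems by auto
  obtain m where m: "homogeneous m q" "Suc 0 + m = Suc d"
  proof (rule homogeneous_factor[of "Suc d" "linform a b 0" q])
    fix k m assume *: "homogeneous k (linform a b 0)" "homogeneous m q" "k + m = Suc d"
    hence "k = Suc 0" using homogeneous_unique[OF *(1) homogeneous_linform] q by auto
    with * show thesis using that by simp
  qed (use q Suc.prems in auto)
  have "degree q = 0"
    using Suc.prems(2,3) q(2) by (simp add: degree_mult_eq)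
  with m \<open>q \<noteq> 0\<close> obtain c ls where "c \<noteq> 0" "q = const3 c * prod_list ls"
    "\<forall>l\<in>set ls. \<exists>a b. (a \<noteq> 0 \<or> b \<noteq> 0) \<and> l = linform a b 0"
    using Suc.IH[of q] by auto
  with q show ?case
    by (intro exI[of _ c] exI[of _ "linform a b 0 # ls"]) (auto simp: mult_ac)
qed

lemma const3_dvd_1: "c \<noteq> 0 \<Longrightarrow> const3 c dvd 1" for c :: "'a::field"
  by (rule dvdI[of _ _ "const3 (inverse c)"]) (simp add: const3_def)

lemma unit_homogeneous_const:
  fixes u :: "'a::alg_closed_field tpoly"
  assumes "u dvd 1"
  obtains c where "c \<noteq> 0" "u = const3 c"
proof -
  obtain w where w: "u * w = 1" using assms by (metis dvdE)
  obtain a b where "homogeneous a u" "a + b = 0"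
    using homogeneous_factor[of 0 u w] w by auto
  then obtain c where "u = const3 c" using homogeneous_0_const by auto
  moreover have "c \<noteq> 0" using w calculation by (auto simp: const3_def)
  ultimately show thesis using that by blast
qed

lemma irreducible_homogeneous_pos:
  fixes G :: "'a::alg_closed_field tpoly"
  assumes "irreducible G" "homogeneous d G"
  shows "d > 0"
proof (rule ccontr)
  assume "\<not> d > 0"
  then obtain c where c: "G = const3 c" using assms(2) homogeneous_0_const by auto
  moreover have "c \<noteq> 0" using assms(1) c by (auto simp: const3_def)
  ultimately show False using assms(1) const3_dvd_1 by (auto simp: irreducible_def)
qed

lemma irreducible_dvd_irreducible:
  fixes p q :: "'a::alg_closed_field tpoly"
  assumes "irreducible p" "irreducible q" "p dvd q"
  obtains c where "c \<noteq> 0" "q = const3 c * p"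
proof -
  obtain u where u: "q = p * u" using assms(3) by blast
  hence "u dvd 1" using assms(1,2) by (auto simp: irreducible_def)
  then obtain c where "c \<noteq> 0" "u = const3 c" by (rule unit_homogeneous_const)
  thus thesis using that u by (simp add: mult.commute)
qed

lemma irreducible_linform:
  fixes l :: "'a::alg_closed_field tpoly"
  assumes "homogeneous (Suc 0) l" "l \<noteq> 0"
  shows "irreducible l"
proof (rule irreducibleI)
  show "\<not> l dvd 1"
  proof
    assume "l dvd 1"
    then obtain c where "l = const3 c" by (rule unit_homogeneous_const)
    hence "homogeneous 0 l" by simp
    thus False using homogeneous_unique[OF assms(1) _ assms(2)] by blast
  qed
next
  fix a b assume ab: "l = a * b"
  obtain i j where "homogeneous i a" "homogeneous j b" "i + j = Suc 0"
    using assms ab homogeneous_factor by metis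
  moreover have "p dvd 1" if "homogeneous 0 p" "p \<noteq> 0" for p :: "'a tpoly"
    using that const3_dvd_1 homogeneous_0_const[of p] by (metis const3_def pCons_0_0)
  ultimately show "a dvd 1 \<or> b dvd 1" using ab assms(2) by (cases i) auto
qed fact

subsection \<open>Intersections of plane curves\<close>

text \<open>Elimination of \<open>z\<close>: an element of least \<open>z\<close>-degree in the ideal \<open>(G, h)\<close> divides, up to
  factors free of \<open>z\<close>, all others, by pseudo-division.\<close>

lemma eliminate_z:
  fixes G h :: "'a::field tpoly"
  assumes "irreducible G" "degree G > 0" "\<not> G dvd h"
  obtains A B r where "A * G + B * h = [:r:]" "r \<noteq> 0"
proof -
  define I where "I = {A * G + B * h |A B. True}"
  have I_lin: "a * x - b * y \<in> I" if xy: "x \<in> I" "y \<in> I" for a b x y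
  proof -
    obtain A B A' B' where "x = A * G + B * h" "y = A' * G + B' * h" using xy unfolding I_def by blast
    hence "a * x - b * y = (a * A - b * A') * G + (a * B - b * B') * h" by (simp add: algebra_simps)
    thus ?thesis unfolding I_def by blast
  qed
  have GI: "G \<in> I" and hI: "h \<in> I"
    unfolding I_def by (metis (mono_tags, lifting) add_0_right mem_Collect_eq mult_1 mult_zero_left)
      (metis (mono_tags, lifting) add_0 mem_Collect_eq mult_1 mult_zero_left)
  have G0: "G \<noteq> 0" using assms(1) by auto
  define g where "g = (ARG_MIN degree x. x \<in> I \<and> x \<noteq> 0)"
  have g: "g \<in> I" "g \<noteq> 0" and g_min: "\<And>x. x \<in> I \<Longrightarrow> x \<noteq> 0 \<Longrightarrow> degree g \<le> degree x"
    using arg_min_nat_lemma[of "\<lambda>x. x \<in> I \<and> x \<noteq> 0" G degree] GI G0 unfolding g_def by auto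
  have div: "\<exists>c q. c \<noteq> 0 \<and> smult c x = g * q" if x: "x \<in> I" for x
  proof -
    define r where "r = pseudo_mod x g"
    obtain c q where cq: "c \<noteq> 0" "smult c x = g * q + r" using pseudo_mod(1)[OF g(2), of x] unfolding r_def by blast
    have r: "r = 0 \<or> degree r < degree g" using pseudo_mod(2)[OF g(2), of x] unfolding r_def .
    have "r = [:c:] * x - q * g" using cq by (simp add: algebra_simps)
    hence "r \<in> I" using I_lin[OF x g(1), of "[:c:]" q] by simp
    with r g_min have "r = 0" by (meson not_le)
    thus ?thesis using cq by auto
  qed
  have prime: "prime_elem G" using assms(1) by simp
  have Gc: "\<not> G dvd [:c:]" if "c \<noteq> 0" for c
    using that assms(2) by (metis degree_pCons_0 dvd_imp_degree_le not_le pCons_eq_0_iff)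
  obtain c q where cq: "c \<noteq> 0" "smult c G = g * q" using div[OF GI] by blast
  obtain c' q' where cq': "c' \<noteq> 0" "smult c' h = g * q'" using div[OF hI] by blast
  \<comment> \<open>Otherwise G divides c' h; it cannot divide c', which is free of z, so it would
    divide h.\<close>
  have "\<not> G dvd g"
  proof
    assume "G dvd g"
    hence "G dvd [:c':] * h" using cq'(2) by simp
    thus False using prime_elem_dvd_mult_iff[OF prime] Gc[OF cq'(1)] assms(3) by blast
  qed
  moreover have "G dvd g * q" by (simp add: dvd_smult flip: cq(2))
  ultimately obtain q2 where q2: "q = G * q2" using prime_elem_dvd_mult_iff[OF prime] by blast
  have "G * [:c:] = G * (g * q2)" using cq(2) q2 by (simp add: mult_ac)
  hence "[:c:] = g * q2" using G0 by (metis mult_left_cancel)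
  \<comment> \<open>Cancelling G leaves c = g * q2 with c free of z, so g is free of z as
    well.\<close>
  hence "degree g = 0" using cq(1) by (metis degree_mult_eq degree_pCons_0 g(2) add_is_0 mult_zero_right pCons_eq_0_iff)
  then obtain r where "g = [:r:]" by (rule degree_eq_zeroE)
  moreover obtain A B where "g = A * G + B * h" using g(1) unfolding I_def by blast
  ultimately have "A * G + B * h = [:r:]" "r \<noteq> 0" using g(2) by auto
  thus thesis by (rule that)
qed

text \<open>The eliminant of two forms need not be a form. Its homogeneous components are free of z
  too, and a nonzero one can take its place.\<close>

lemma z_free_component:
  fixes p :: "'a::alg_closed_field tpoly"
  assumes "degree p = 0" "p \<noteq> 0"
  obtains S cf n where "finite S" "\<And>i. homogeneous i (cf i)" "p = sum cf S" "n \<in> S" "cf n \<noteq> 0" "degree (cf n) = 0"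
proof -
  obtain S cf n where *: "finite S" "\<And>i. homogeneous i (cf i)" "p = sum cf S" "n \<in> S" "cf n \<noteq> 0"
    using whom_component[OF assms(2), of 1 1 1] by (metis homogeneous_iff_whom)
  have "pev (cf n) (x, y, z) - pev (cf n) (x, y, z') = 0" for x y z z'
  proof (rule sum_powers_zero[OF *(1) _ *(4)])
    fix t :: 'a
    have "pev p (smul t (x, y, z)) = pev p (smul t (x, y, z'))"
      using pev_degree_0[OF assms(1)] by simp
    thus "(\<Sum>n\<in>S. t ^ n * (pev (cf n) (x, y, z) - pev (cf n) (x, y, z'))) = 0"
      by (simp add: *(3) homogeneous_pev[OF *(2)] right_diff_distrib sum_subtractf del: smul_simps)
  qed
  hence "degree (cf n) = 0" by (intro degree_0I) auto
  with * that show thesis by blast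
qed

section \<open>Points of the plane as orbits of nonzero scalars\<close>

lemma ppoint_altdef: "ppoint v = {smul c v |c. c \<noteq> 0}"
  by (cases v) (auto simp: ppoint_def)

lemma in_own_ppoint [simp]: "v \<in> ppoint v"
  by (auto simp: ppoint_altdef intro: exI[of _ 1])

lemma ppoint_smul [simp]:
  assumes "c \<noteq> 0"
  shows "ppoint (smul c v) = ppoint v"
proof -
  have "\<exists>d. smul a v = smul (d * c) v \<and> d \<noteq> 0" if "a \<noteq> 0" for a
    using that assms by (intro exI[of _ "a / c"]) auto
  thus ?thesis using assms by (auto simp: ppoint_altdef)
qed

lemma ppoint_eq_iff: "ppoint v = ppoint w \<longleftrightarrow> (\<exists>c. c \<noteq> 0 \<and> w = smul c v)"
proof
  assume "ppoint v = ppoint w"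
  hence "w \<in> ppoint v" by simp
  thus "\<exists>c. c \<noteq> 0 \<and> w = smul c v" by (auto simp: ppoint_altdef)
qed auto

lemma finite_ppoints:
  assumes "finite T" "\<And>v. v \<in> X \<Longrightarrow> \<exists>c. c \<noteq> 0 \<and> smul c v \<in> T"
  shows "finite (ppoint ` X)"
proof (rule finite_subset)
  show "ppoint ` X \<subseteq> ppoint ` T"
  proof
    fix P assume "P \<in> ppoint ` X"
    then obtain v where v: "v \<in> X" "P = ppoint v" by blast
    with assms(2) obtain c where "c \<noteq> 0" "smul c v \<in> T" by blast
    thus "P \<in> ppoint ` T" using v ppoint_smul by (metis imageI)
  qed
qed (use assms in simp)

lemma in_zeros: "v \<in> zeros p \<longleftrightarrow> v \<noteq> (0, 0, 0) \<and> pev p v = 0"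
  by (simp add: zeros_def)

lemma zeros_smul: "homogeneous d p \<Longrightarrow> v \<in> zeros p \<Longrightarrow> c \<noteq> 0 \<Longrightarrow> smul c v \<in> zeros p"
  by (simp add: in_zeros homogeneous_pev)

text \<open>If G vanished on a whole line through A, it would be proportional to the equation of
  this line and would not involve z.\<close>

lemma slice_nonzero:
  fixes G :: "'a::alg_closed_field tpoly"
  assumes "irreducible G" "homogeneous d G" "degree G > 0" "x \<noteq> 0 \<or> y \<noteq> 0"
  shows "slice G x y \<noteq> 0"
proof
  assume s: "slice G x y = 0"
  have "linform y (- x) 0 dvd G"
  proof (rule linform_dvdI)
    fix v assume v: "pev (linform y (- x) 0) v = 0"
    obtain x' y' z where xyz: "v = (x', y', z)" by (cases v)
    with v have e: "y * x' = x * y'" by simp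
    obtain c where c: "x' = c * x" "y' = c * y"
    proof (cases "x = 0")
      case False
      thus thesis using that[of "x' / x"] e by (simp add: field_simps)
    next
      case True
      thus thesis using that[of "y' / y"] e assms(4) by (simp add: field_simps)
    qed
    have line: "poly (slice G x y) t = 0" for t using s by simp
    show "pev G v = 0"
    proof (cases "c = 0")
      case False
      have "v = smul c (x, y, z / c)" using False by (simp add: xyz c)
      thus ?thesis using line[of "z / c"] by (simp add: homogeneous_pev[OF assms(2)] del: smul_simps)
    next
      case True
      \<comment> \<open>The point A is reached as a limit: along (t x, t y, z) the form vanishes for
        t \<noteq> 0, hence identically in t.\<close>
      have "poly (slice G 0 0) z = 0"
      proof -
        obtain P where P: "\<And>t. poly P t = pev G (0 + t * x, 0 + t * y, z + t * 0)"
          using restrict_line[of G 0 x 0 y z 0] by blast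
        have "P = 0"
        proof (rule poly_all_zero_imp_zero[OF infinite_Diff_singleton[of 0]])
          fix t :: 'a assume "t \<in> UNIV - {0}"
          hence "(t * x, t * y, z) = smul t (x, y, z / t)" by simp
          thus "poly P t = 0" using line[of "z / t"]
            by (simp add: P homogeneous_pev[OF assms(2)] del: smul_simps)
        qed
        thus ?thesis using P[of 0] by simp
      qed
      thus ?thesis by (simp add: xyz c True)
    qed
  qed (use assms in auto)
  then obtain c where "c \<noteq> 0" "G = const3 c * linform y (- x) 0"
    using irreducible_dvd_irreducible[OF _ assms(1)] irreducible_linform[of "linform y (- x) 0"] assms(4)
    by (metis homogeneous_linform linform_eq_0_iff neg_equal_0_iff_equal)
  thus False using assms(3) by (simp add: const3_def)
qed

text \<open>A weak form of Bezout's theorem. The eliminant leaves finitely many directions (x : y)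
  as seen from A, and G leaves finitely many points in each. If z does not occur in G, then G is a
  line through A and h is restricted to it instead.\<close>

lemma finite_common_zeros:
  fixes G h :: "'a::alg_closed_field tpoly"
  assumes "irreducible G" "homogeneous d G" "homogeneous e h" "\<not> G dvd h"
  shows "finite (ppoint ` (zeros G \<inter> zeros h))"
proof (cases "degree G = 0")
  case False
  then obtain A B r where r: "A * G + B * h = [:r:]" "r \<noteq> 0"
    using eliminate_z[of G h] assms by blast
  obtain S cf n where *: "finite S" "\<And>i. homogeneous i (cf i)" "[:r:] = sum cf S" "n \<in> S" "cf n \<noteq> 0" "degree (cf n) = 0"
    using z_free_component[of "[:r:]"] r(2) by auto
  have van: "pev (cf n) v = 0" if v: "v \<in> zeros G" "v \<in> zeros h" for v
  proof (rule sum_powers_zero[OF *(1) _ *(4), where c = "\<lambda>n. pev (cf n) v"])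
    fix t :: 'a
    have "pev [:r:] (smul t v) = 0"
      using v by (simp add: in_zeros homogeneous_pev[OF assms(2)] homogeneous_pev[OF assms(3)] flip: r(1))
    thus "(\<Sum>n\<in>S. t ^ n * pev (cf n) v) = 0" by (simp add: *(3) homogeneous_pev[OF *(2)])
  qed
  obtain P where P: "\<And>t. poly P t = pev (cf n) (0 + t * 1, 1 + t * 0, 0 + t * 0)"
    using restrict_line[of "cf n" 0 1 1 0 0 0] by blast
  have "P \<noteq> 0"
  proof
    assume "P = 0"
    hence "pev (cf n) (x, 1, 0) = 0" for x using P[of x] by simp
    hence 0: "pev (cf n) (x, 1, z) = 0" for x z using pev_degree_0[OF *(6), of x 1 z 0] by simp
    have "pev (vary * cf n) (x, y, z) = 0" for x y z
    proof (cases "y = 0")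
      case False
      hence "(x, y, z) = smul y (x / y, 1, z / y)" by simp
      thus ?thesis using 0 by (simp add: homogeneous_pev[OF *(2)] del: smul_simps)
    qed simp
    hence "vary * cf n = 0" by (intro pev_zero_imp_zero) (metis prod_cases3)
    thus False using *(5) by (auto simp: vary_def)
  qed
  \<comment> \<open>Normalised directions (1 : 0) and (x : 1). The point A has no direction and is
    added to \<open>T\<close> separately.\<close>
  define D where "D = insert (1::'a, 0::'a) ((\<lambda>x. (x, 1)) ` {x. poly P x = 0})"
  define T where "T = insert (0, 0, 1) (\<Union>(x, y)\<in>D. (\<lambda>z. (x, y, z)) ` {z. poly (slice G x y) z = 0})"
  have "finite D" using \<open>P \<noteq> 0\<close> by (simp add: D_def poly_roots_finite)
  have "finite T" unfolding T_def
  proof (intro finite.insertI finite_UN_I \<open>finite D\<close>)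
    fix p assume "p \<in> D"
    then obtain x y where "p = (x, y)" "x \<noteq> 0 \<or> y \<noteq> 0" by (auto simp: D_def)
    with slice_nonzero[OF assms(1,2)] False
    show "finite (case p of (x, y) \<Rightarrow> (\<lambda>z. (x, y, z)) ` {z. poly (slice G x y) z = 0})"
      by (simp add: poly_roots_finite del: poly_slice)
  qed
  show ?thesis
  proof (rule finite_ppoints[OF \<open>finite T\<close>])
    fix v assume v: "v \<in> zeros G \<inter> zeros h"
    obtain x y z where xyz: "v = (x, y, z)" by (cases v)
    consider "y \<noteq> 0" | "y = 0" "x \<noteq> 0" | "y = 0" "x = 0" "z \<noteq> 0" using v xyz by (auto simp: in_zeros)
    thus "\<exists>c. c \<noteq> 0 \<and> smul c v \<in> T"
    proof cases
      case 1
      let ?w = "smul (inverse y) v"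
      have w: "?w \<in> zeros G" "?w \<in> zeros h"
        using v 1 zeros_smul[OF assms(2)] zeros_smul[OF assms(3)] by auto
      have wxyz: "?w = (x / y, 1, z / y)" using 1 by (simp add: xyz field_simps)
      have "poly P (x / y) = 0"
        using van[OF w] pev_degree_0[OF *(6), of "x / y" 1 "z / y" 0] by (simp add: P wxyz)
      hence "?w \<in> T" using w(1) unfolding wxyz by (auto simp: T_def D_def in_zeros)
      thus ?thesis using 1 by (intro exI[of _ "inverse y"]) auto
    next
      case 2
      let ?w = "smul (inverse x) v"
      have w: "?w \<in> zeros G" using v 2 zeros_smul[OF assms(2)] by auto
      have wxyz: "?w = (1, 0, z / x)" using 2 by (simp add: xyz field_simps)
      hence "?w \<in> T" using w(1) unfolding wxyz by (auto simp: T_def D_def in_zeros)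
      thus ?thesis using 2 by (intro exI[of _ "inverse x"]) auto
    next
      case 3
      thus ?thesis by (intro exI[of _ "inverse z"]) (auto simp: xyz T_def)
    qed
  qed
next
  case True
  obtain d' where d': "d = Suc d'" using irreducible_homogeneous_pos[OF assms(1,2)] by (cases d) auto
  obtain a b q where ab: "a \<noteq> 0 \<or> b \<noteq> 0" "G = linform a b 0 * q"
    using binary_form_factor assms(2) True d' by blast
  have "irreducible (linform a b 0)" using ab by (intro irreducible_linform) auto
  then obtain c where c: "c \<noteq> 0" "G = const3 c * linform a b 0"
    by (rule irreducible_dvd_irreducible[OF _ assms(1)]) (use ab in auto)
  obtain P where P: "\<And>t. poly P t = pev h (0 + t * b, 0 + t * (- a), 1 + t * 0)"
    using restrict_line[of h 0 b 0 "- a" 1 0] by blast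
  have "P \<noteq> 0"
  proof
    assume "P = 0"
    have 0: "pev h (t * b, - (t * a), 1) = 0" for t using P[of t] \<open>P = 0\<close> by simp
    have 1: "pev h (t * b, - (t * a), z) = 0" for t z
    proof -
      obtain Q where Q: "\<And>z. poly Q z = pev h (t * b + z * 0, - (t * a) + z * 0, 0 + z * 1)"
        using restrict_line[of h "t * b" 0 "- (t * a)" 0 0 1] by blast
      have "Q = 0"
      proof (rule poly_all_zero_imp_zero[OF infinite_Diff_singleton[of 0]])
        fix z :: 'a assume "z \<in> UNIV - {0}"
        hence "(t * b, - (t * a), z) = smul z ((t / z) * b, - ((t / z) * a), 1)" by simp
        thus "poly Q z = 0" using 0[of "t / z"] by (simp add: Q homogeneous_pev[OF assms(3)] del: smul_simps)
      qed
      thus ?thesis using Q[of z] by simp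
    qed
    have "linform a b 0 dvd h"
    proof (rule linform_dvdI)
      fix v assume v: "pev (linform a b 0) v = 0"
      obtain x y z where xyz: "v = (x, y, z)" by (cases v)
      with v have e: "a * x = - (b * y)" by (simp add: add_eq_0_iff)
      obtain t where t: "x = t * b" "y = - (t * a)"
      proof (cases "a = 0")
        case False
        show thesis using that[of "- y / a"] e False by (simp add: field_simps)
      next
        case True
        thus thesis using that[of "x / b"] e ab by (simp add: field_simps)
      qed
      thus "pev h v = 0" using 1[of t z] by (simp add: xyz)
    qed (use ab in auto)
    moreover have "G dvd linform a b 0"
      using c by (intro dvdI[of _ _ "const3 (inverse c)"]) (simp add: const3_def)
    ultimately show False using assms(4) dvd_trans by blast
  qed
  define T where "T = insert (b, - a, 0) ((\<lambda>t. (t * b, - (t * a), 1 :: 'a)) ` {t. poly P t = 0})"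
  have "finite T" using \<open>P \<noteq> 0\<close> by (simp add: T_def poly_roots_finite)
  show ?thesis
  proof (rule finite_ppoints[OF \<open>finite T\<close>])
    fix v assume v: "v \<in> zeros G \<inter> zeros h"
    obtain x y z where xyz: "v = (x, y, z)" by (cases v)
    have e: "a * x = - (b * y)" using v c by (simp add: in_zeros xyz add_eq_0_iff)
    obtain t where t: "x = t * b" "y = - (t * a)"
    proof (cases "a = 0")
      case False
      show thesis using that[of "- y / a"] e False by (simp add: field_simps)
    next
      case True
      thus thesis using that[of "x / b"] e ab by (simp add: field_simps)
    qed
    show "\<exists>c. c \<noteq> 0 \<and> smul c v \<in> T"
    proof (cases "z = 0")
      case True
      hence "t \<noteq> 0" using v by (auto simp: xyz in_zeros t)
      thus ?thesis by (intro exI[of _ "inverse t"]) (simp add: xyz t True T_def)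
    next
      case False
      have "smul (inverse z) v = ((t / z) * b, - ((t / z) * a), 1)"
        using False by (simp add: xyz t field_simps)
      moreover have "smul (inverse z) v \<in> zeros h" using v False zeros_smul[OF assms(3)] by auto
      ultimately have "smul (inverse z) v \<in> T" by (auto simp: T_def P in_zeros intro!: image_eqI[of _ _ "t / z"])
      thus ?thesis using False by (intro exI[of _ "inverse z"]) auto
    qed
  qed
qed

text \<open>Take the pencil of lines through a point Q off the curve. Each line meets the curve, and
  never in Q, so different lines give different points.\<close>

lemma infinite_zeros:
  fixes p :: "'a::alg_closed_field tpoly"
  assumes "homogeneous d p" "d > 0" "p \<noteq> 0"
  shows "infinite (ppoint ` zeros p)"
proof -
  obtain Q where Q: "pev p Q \<noteq> 0" using assms(3) by (rule pev_nonzero_ex)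
  obtain Q1 Q2 Q3 where Q': "Q = (Q1, Q2, Q3)" by (cases Q)
  have main: ?thesis
    if indep: "\<And>a b c. a * Q1 + b * R1 + c * S1 = 0 \<Longrightarrow> a * Q2 + b * R2 + c * S2 = 0 \<Longrightarrow>
      a * Q3 + b * R3 + c * S3 = 0 \<Longrightarrow> a = 0 \<and> b = 0 \<and> c = 0" for R1 R2 R3 S1 S2 S3
  proof -
    let ?v = "\<lambda>s u. (s * Q1 + (u * R1 + S1), s * Q2 + (u * R2 + S2), s * Q3 + (u * R3 + S3))"
    have "\<exists>s. ?v s u \<in> zeros p" for u
    proof -
      obtain s t where st: "s \<noteq> 0 \<or> t \<noteq> 0" "pev p (s * Q1 + t * (u * R1 + S1), s * Q2 + t * (u * R2 + S2), s * Q3 + t * (u * R3 + S3)) = 0"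
        using homogeneous_zero_on_line[OF assms(1,2)] by metis
      have "t \<noteq> 0"
      proof
        assume "t = 0"
        hence "pev p (smul s Q) = 0" using st by (simp add: Q')
        thus False using st Q \<open>t = 0\<close> by (simp add: homogeneous_pev[OF assms(1)])
      qed
      have "pev p (smul t (?v (s / t) u)) = 0"
        using st(2) \<open>t \<noteq> 0\<close> by (simp add: distrib_left)
      hence "pev p (?v (s / t) u) = 0"
        using \<open>t \<noteq> 0\<close> by (simp add: homogeneous_pev[OF assms(1)] del: smul_simps)
      moreover have "?v (s / t) u \<noteq> (0, 0, 0)"
        using indep[of "s / t" u 1] by (auto simp: add.assoc)
      ultimately show ?thesis unfolding in_zeros by blast
    qed
    then obtain s where s: "\<And>u. ?v (s u) u \<in> zeros p" by metis
    have inj: "inj (\<lambda>u. ppoint (?v (s u) u))"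
    proof (rule injI)
      fix u u' assume "ppoint (?v (s u) u) = ppoint (?v (s u') u')"
      then obtain c where c: "?v (s u') u' = smul c (?v (s u) u)" by (auto simp: ppoint_eq_iff)
      hence "s u' - c * s u = 0 \<and> u' - c * u = 0 \<and> 1 - c = 0"
        by (intro indep) (simp_all add: algebra_simps)
      thus "u = u'" by auto
    qed
    show ?thesis
    proof
      assume "finite (ppoint ` zeros p)"
      moreover have "range (\<lambda>u. ppoint (?v (s u) u)) \<subseteq> ppoint ` zeros p" using s by auto
      ultimately show False
        using inj infinite_UNIV_alg_closed finite_subset finite_imageD by blast
    qed
  qed
  have "Q \<noteq> (0, 0, 0)"
    using Q homogeneous_at_0 assms(1,2) by (metis Suc_pred)
  \<comment> \<open>Two standard basis vectors complete Q to a basis; which two depends on a nonzero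
    coordinate of Q.\<close>
  then consider "Q1 \<noteq> 0" | "Q2 \<noteq> 0" | "Q3 \<noteq> 0" by (auto simp: Q')
  thus ?thesis
  proof cases
    case 1
    show ?thesis by (rule main[of 0 0 1 0 0 1]) (use 1 in auto)
  next
    case 2
    show ?thesis by (rule main[of 1 0 0 0 0 1]) (use 2 in auto)
  next
    case 3
    show ?thesis by (rule main[of 1 0 0 1 0 0]) (use 3 in auto)
  qed
qed

lemma infinite_zeros_minus:
  fixes p h :: "'a::alg_closed_field tpoly"
  assumes "irreducible p" "homogeneous d p" "homogeneous e h" "\<not> p dvd h"
  shows "infinite (ppoint ` {v \<in> zeros p. pev h v \<noteq> 0})"
proof
  assume "finite (ppoint ` {v \<in> zeros p. pev h v \<noteq> 0})"
  hence "finite (ppoint ` {v \<in> zeros p. pev h v \<noteq> 0} \<union> ppoint ` (zeros p \<inter> zeros h))"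
    using finite_common_zeros[OF assms] by simp
  moreover have "ppoint ` zeros p \<subseteq> ppoint ` {v \<in> zeros p. pev h v \<noteq> 0} \<union> ppoint ` (zeros p \<inter> zeros h)"
    by (auto simp: in_zeros)
  ultimately show False
    using infinite_zeros[OF assms(2) irreducible_homogeneous_pos[OF assms(1,2)]] assms(1) finite_subset
    by auto
qed

text \<open>The Nullstellensatz for an irreducible curve: a form not divisible by p has only
  finitely many zeros on the infinite set \<open>zeros p\<close>.\<close>

lemma irreducible_dvdI:
  fixes p h :: "'a::alg_closed_field tpoly"
  assumes "irreducible p" "homogeneous d p" "homogeneous e h" "\<And>v. v \<in> zeros p \<Longrightarrow> pev h v = 0"
  shows "p dvd h"
proof (rule ccontr)
  assume "\<not> p dvd h"
  hence "infinite (ppoint ` {v \<in> zeros p. pev h v \<noteq> 0})"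
    using assms(1-3) by (intro infinite_zeros_minus)
  thus False using assms(4) by (metis (mono_tags, lifting) empty_Collect_eq finite.emptyI image_empty)
qed

lemma dvd_imp_pev_eq_0: "p dvd h \<Longrightarrow> pev p v = 0 \<Longrightarrow> pev h v = 0"
  by auto

lemma zeros_eq_imp_eq:
  fixes p q :: "'a::alg_closed_field tpoly"
  assumes "irreducible p" "homogeneous d p" "irreducible q" "homogeneous e q" "zeros p \<subseteq> zeros q"
  shows "zeros p = zeros q" "p dvd q"
proof -
  show "p dvd q" 
    by (rule irreducible_dvdI[OF assms(1,2,4)]) (use subsetD[OF assms(5)] in \<open>simp add: in_zeros\<close>)
  then obtain c where "c \<noteq> 0" "q = const3 c * p" using irreducible_dvd_irreducible assms by blast
  thus "zeros p = zeros q" by (auto simp: in_zeros)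
qed

subsection \<open>Irreducible closed sets and curves\<close>

lemma krull_dim_1I:
  assumes "irred_closed C D" "irred_closed C P" "P \<subset> D"
    "\<And>Z Z'. irred_closed C Z \<Longrightarrow> Z \<subset> D \<Longrightarrow> irred_closed C Z' \<Longrightarrow> \<not> Z' \<subset> Z"
  shows "krull_dim C D = 1"
  unfolding krull_dim_def
proof (rule antisym)
  let ?N = "{n. \<exists>Z. (\<forall>i\<le>n. irred_closed C (Z i) \<and> Z i \<subseteq> D) \<and> (\<forall>i<n. Z i \<subset> Z (Suc i))}"
  show "(SUP n\<in>?N. enat n) \<le> 1"
  proof (rule SUP_least)
    fix n assume "n \<in> ?N"
    then obtain Z where Z: "\<forall>i\<le>n. irred_closed C (Z i) \<and> Z i \<subseteq> D" "\<forall>i<n. Z i \<subset> Z (Suc i)" by blast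
    have "n \<le> 1"
    proof (rule ccontr)
      assume "\<not> n \<le> 1"
      hence "Z 0 \<subset> Z 1" "Z 1 \<subset> Z 2" "Z 2 \<subseteq> D" "irred_closed C (Z 0)" "irred_closed C (Z 1)"
        using Z by (auto simp: numeral_2_eq_2)
      thus False using assms(4)[of "Z 1" "Z 0"] by blast
    qed
    thus "enat n \<le> 1" by (simp add: one_enat_def)
  qed
  have "1 \<in> ?N"
    by (intro CollectI exI[of _ "\<lambda>i. if i = 0 then P else D"]) (use assms(1-3) in auto)
  hence "enat 1 \<le> (SUP n\<in>?N. enat n)" by (rule SUP_upper)
  thus "1 \<le> (SUP n\<in>?N. enat n)" by (simp add: one_enat_def)
qed

text \<open>What the plane and the product of two planes have in common: closed sets are unions of
  orbits of scalars, and the orbits in them, that is their points, are closed. Orbits are the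
  minimal irreducible closed sets.\<close>

locale orbit_space =
  fixes C :: "'p set set" and orb :: "'p \<Rightarrow> 'p set"
  assumes Un_closed: "S \<in> C \<Longrightarrow> T \<in> C \<Longrightarrow> S \<union> T \<in> C"
    and orb_closed: "S \<in> C \<Longrightarrow> v \<in> S \<Longrightarrow> orb v \<in> C"
    and orb_subset: "S \<in> C \<Longrightarrow> v \<in> S \<Longrightarrow> orb v \<subseteq> S"
    and in_orb: "v \<in> orb v"
    and orb_eq: "u \<in> orb v \<Longrightarrow> orb u = orb v"
begin

lemma irred_orb:
  assumes "S \<in> C" "v \<in> S"
  shows "irred_closed C (orb v)"
  unfolding irred_closed_def
proof (intro conjI ballI impI)
  show "orb v \<in> C" by (rule orb_closed[OF assms])
  show "orb v \<noteq> {}" using in_orb by blast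
  fix S' T' assume *: "S' \<in> C" "T' \<in> C" "orb v \<subseteq> S' \<union> T'"
  hence "v \<in> S' \<or> v \<in> T'" using in_orb by blast
  thus "orb v \<subseteq> S' \<or> orb v \<subseteq> T'" using orb_subset *(1,2) by metis
qed

lemma irred_subset_orb:
  assumes "irred_closed C Z" "Z \<subseteq> orb v"
  shows "Z = orb v"
proof -
  have Z: "Z \<in> C" "Z \<noteq> {}" using assms(1) by (auto simp: irred_closed_def)
  then obtain u where "u \<in> Z" by blast
  hence "orb u \<subseteq> Z" "orb u = orb v" using orb_subset[OF Z(1)] orb_eq assms(2) by auto
  thus ?thesis using assms(2) by auto
qed

lemma irred_Union:
  assumes "irred_closed C Z" "finite F" "F \<subseteq> C" "Z \<subseteq> \<Union>F"
  shows "\<exists>T\<in>F. Z \<subseteq> T"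
proof -
  from assms(2-4) show ?thesis
  proof (induction F)
    case empty
    thus ?case using assms(1) by (auto simp: irred_closed_def)
  next
    case (insert T F)
    show ?case
    proof (cases "F = {}")
      case True
      thus ?thesis using insert by auto
    next
      case False
      have "\<Union>F \<in> C \<or> F = {}" using insert(1,4) by (induction F) (auto simp: Un_closed)
      with False insert(4,5) assms(1) have "Z \<subseteq> T \<or> Z \<subseteq> \<Union>F"
        unfolding irred_closed_def by auto
      thus ?thesis using insert by auto
    qed
  qed
qed

lemma irred_finite_orbits:
  assumes "irred_closed C Z" "finite (orb ` Z)"
  obtains v where "v \<in> Z" "Z = orb v"
proof -
  have Z: "Z \<in> C" using assms(1) by (simp add: irred_closed_def)
  obtain T where T: "T \<in> orb ` Z" "Z \<subseteq> T"
    using irred_Union[OF assms] orb_closed[OF Z] in_orb by blast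
  then obtain v where "v \<in> Z" "T = orb v" by blast
  with T irred_subset_orb[OF assms(1)] that show thesis by blast
qed

text \<open>An irreducible closed set with finitely many points is a single point. So every proper
  irreducible subset of D is a point, and a chain has at most one strict inclusion.\<close>

lemma irred_curveI:
  assumes "irred_closed C D" "infinite (orb ` D)"
    "\<And>Z. irred_closed C Z \<Longrightarrow> Z \<subset> D \<Longrightarrow> finite (orb ` Z)"
  shows "irred_curve C D"
proof -
  have D: "D \<in> C" "D \<noteq> {}" using assms(1) by (auto simp: irred_closed_def)
  then obtain v where v: "v \<in> D" by blast
  have "orb ` orb v \<subseteq> {orb v}" using orb_eq by blast
  hence "orb v \<noteq> D" using assms(2) finite_subset by blast
  hence "orb v \<subset> D" using orb_subset[OF D(1) v] by blast
  moreover have "\<not> Z' \<subset> Z" if "irred_closed C Z" "Z \<subset> D" "irred_closed C Z'" for Z Z'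
    using irred_finite_orbits[OF that(1) assms(3)[OF that(1,2)]] irred_subset_orb[OF that(3)]
    by (metis psubsetE)
  ultimately show ?thesis
    using krull_dim_1I[OF assms(1) irred_orb[OF D(1) v]] assms(1) by (auto simp: irred_curve_def)
qed

lemma irred_curve_infinite:
  assumes "irred_curve C D"
  shows "infinite (orb ` D)"
proof
  assume fin: "finite (orb ` D)"
  have D: "irred_closed C D" "krull_dim C D = 1" using assms by (auto simp: irred_curve_def)
  obtain v where v: "v \<in> D" "D = orb v" using irred_finite_orbits[OF D(1) fin] .
  let ?N = "{n. \<exists>Z. (\<forall>i\<le>n. irred_closed C (Z i) \<and> Z i \<subseteq> D) \<and> (\<forall>i<n. Z i \<subset> Z (Suc i))}"
  have "(SUP n\<in>?N. enat n) \<le> 0"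
  proof (rule SUP_least)
    fix n assume "n \<in> ?N"
    then obtain Z where Z: "\<forall>i\<le>n. irred_closed C (Z i) \<and> Z i \<subseteq> D" "\<forall>i<n. Z i \<subset> Z (Suc i)" by blast
    have "n = 0"
    proof (rule ccontr)
      assume "n \<noteq> 0"
      hence "Z 0 \<subset> Z 1" "Z 1 \<subseteq> D" "irred_closed C (Z 0)" using Z by auto
      thus False using irred_subset_orb[of "Z 0" v] v(2) by blast
    qed
    thus "enat n \<le> 0" by (simp add: zero_enat_def)
  qed
  thus False using D(2) by (simp add: krull_dim_def)
qed

end

section \<open>Closed sets in the plane and in the product of two planes\<close>

lemma closed1I: "(\<And>f. f \<in> S \<Longrightarrow> \<exists>d. homogeneous d f) \<Longrightarrow> {v. v \<noteq> (0, 0, 0) \<and> (\<forall>f\<in>S. pev f v = 0)} \<in> closed1"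
  unfolding closed1_def by blast

lemma closed1E:
  assumes "Z \<in> closed1"
  obtains S where "\<And>f. f \<in> S \<Longrightarrow> \<exists>d. homogeneous d f" "Z = {v. v \<noteq> (0, 0, 0) \<and> (\<forall>f\<in>S. pev f v = 0)}"
  using assms unfolding closed1_def by blast

lemma closed2I: "(\<And>f. f \<in> S \<Longrightarrow> \<exists>a b. bihomogeneous a b f) \<Longrightarrow>
    {(v, w). v \<noteq> (0, 0, 0) \<and> w \<noteq> (0, 0, 0) \<and> (\<forall>f\<in>S. bev f v w = 0)} \<in> closed2"
  unfolding closed2_def by blast

lemma closed2E:
  assumes "Z \<in> closed2"
  obtains S where "\<And>f. f \<in> S \<Longrightarrow> \<exists>a b. bihomogeneous a b f"
    "Z = {(v, w). v \<noteq> (0, 0, 0) \<and> w \<noteq> (0, 0, 0) \<and> (\<forall>f\<in>S. bev f v w = 0)}"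
  using assms unfolding closed2_def by blast

lemma zeros_closed1: "homogeneous d p \<Longrightarrow> zeros p \<in> closed1"
  using closed1I[of "{p}"] by (auto simp: zeros_def)

text \<open>The 2 by 2 minors of the matrix with rows v and (x, y, z), which are equations of the
  point v.\<close>

fun cross_forms :: "'a::comm_ring_1 vec3 \<Rightarrow> 'a tpoly set" where
  "cross_forms (a, b, c) = {linform b (- a) 0, linform c 0 (- a), linform 0 c (- b)}"

lemma homogeneous_cross_forms: "f \<in> cross_forms v \<Longrightarrow> homogeneous (Suc 0) f"
  by (cases v) auto

lemma cross_forms_iff:
  fixes u v :: "'a::field vec3"
  assumes "v \<noteq> (0, 0, 0)" "u \<noteq> (0, 0, 0)"
  shows "(\<forall>f\<in>cross_forms v. pev f u = 0) \<longleftrightarrow> u \<in> ppoint v"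
proof -
  obtain a b c where v: "v = (a, b, c)" by (cases v)
  obtain x y z where u: "u = (x, y, z)" by (cases u)
  show ?thesis
  proof
    assume "\<forall>f\<in>cross_forms v. pev f u = 0"
    hence e: "b * x = a * y" "c * x = a * z" "c * y = b * z" by (auto simp: v u)
    consider "a \<noteq> 0" | "b \<noteq> 0" | "c \<noteq> 0" using assms(1) v by auto
    hence "\<exists>t. u = smul t v"
    proof cases
      case 1
      thus ?thesis using e by (intro exI[of _ "x / a"]) (auto simp: u v field_simps)
    next
      case 2
      thus ?thesis using e by (intro exI[of _ "y / b"]) (auto simp: u v field_simps)
    next
      case 3
      thus ?thesis using e by (intro exI[of _ "z / c"]) (auto simp: u v field_simps)
    qed
    thus "u \<in> ppoint v" using assms(2) by (auto simp: ppoint_altdef)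
  qed (auto simp: ppoint_altdef v)
qed

lemma in_ppoint_iff:
  fixes u v :: "'a::field vec3"
  assumes "v \<noteq> (0, 0, 0)"
  shows "u \<in> ppoint v \<longleftrightarrow> u \<noteq> (0, 0, 0) \<and> (\<forall>f\<in>cross_forms v. pev f u = 0)"
proof -
  have "u \<noteq> (0, 0, 0)" if "u \<in> ppoint v"
  proof -
    from that obtain c where "c \<noteq> 0" "u = smul c v" by (auto simp: ppoint_altdef)
    thus ?thesis using assms by simp
  qed
  thus ?thesis using cross_forms_iff[OF assms] by blast
qed

lemma ppoint_closed1:
  assumes "v \<noteq> (0, 0, 0)"
  shows "ppoint v \<in> closed1"
proof -
  have "ppoint v = {u. u \<noteq> (0, 0, 0) \<and> (\<forall>f\<in>cross_forms v. pev f u = 0)}"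
    by (rule Set.set_eqI) (simp only: in_ppoint_iff[OF assms] mem_Collect_eq)
  also have "\<dots> \<in> closed1" using homogeneous_cross_forms by (intro closed1I) blast
  finally show ?thesis .
qed

definition bipoint :: "'a::field vec3 \<times> 'a vec3 \<Rightarrow> ('a vec3 \<times> 'a vec3) set" where
  "bipoint P = ppoint (fst P) \<times> ppoint (snd P)"

lemma fst_point_closed2:
  fixes v :: "'a::alg_closed_field vec3"
  assumes "v \<noteq> (0, 0, 0)"
  shows "ppoint v \<times> {w. w \<noteq> (0, 0, 0)} \<in> closed2"
proof -
  have "ppoint v \<times> {w. w \<noteq> (0, 0, 0)} = {(u, w). u \<noteq> (0, 0, 0) \<and> w \<noteq> (0, 0, 0) \<and>
      (\<forall>f\<in>lift1 ` cross_forms v. bev f u w = 0)}"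
    by (rule Set.set_eqI, clarify)
      (simp only: mem_Times_iff fst_conv snd_conv in_ppoint_iff[OF assms] mem_Collect_eq split ball_simps bev_lift1, blast)
  also have "\<dots> \<in> closed2" using homogeneous_cross_forms bihomogeneous_lift1 by (intro closed2I) blast
  finally show ?thesis .
qed

lemma bipoint_closed2:
  fixes P :: "'a::alg_closed_field vec3 \<times> 'a vec3"
  assumes "fst P \<noteq> (0, 0, 0)" "snd P \<noteq> (0, 0, 0)"
  shows "bipoint P \<in> closed2"
proof -
  have "bipoint P = {(u, w). u \<noteq> (0, 0, 0) \<and> w \<noteq> (0, 0, 0) \<and>
      (\<forall>f\<in>lift1 ` cross_forms (fst P) \<union> lift2 ` cross_forms (snd P). bev f u w = 0)}"
    by (rule Set.set_eqI, clarify)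
      (simp only: bipoint_def mem_Times_iff fst_conv snd_conv in_ppoint_iff[OF assms(1)] in_ppoint_iff[OF assms(2)]
        mem_Collect_eq split ball_simps ball_Un bev_lift1 bev_lift2, blast)
  also have "\<dots> \<in> closed2"
    using homogeneous_cross_forms bihomogeneous_lift1 bihomogeneous_lift2 by (intro closed2I) blast
  finally show ?thesis .
qed

text \<open>The union of two closed sets is defined by the pairwise products of their
  equations.\<close>

lemma ball_products_iff:
  fixes ev :: "'b::times \<Rightarrow> 'c::idom"
  assumes "\<And>f g. ev (f * g) = ev f * ev g"
  shows "(\<forall>h\<in>{f * g |f g. f \<in> A \<and> g \<in> B}. ev h = 0) \<longleftrightarrow> (\<forall>f\<in>A. ev f = 0) \<or> (\<forall>g\<in>B. ev g = 0)"
proof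
  assume *: "\<forall>h\<in>{f * g |f g. f \<in> A \<and> g \<in> B}. ev h = 0"
  show "(\<forall>f\<in>A. ev f = 0) \<or> (\<forall>g\<in>B. ev g = 0)"
  proof (rule ccontr)
    assume "\<not> ?thesis"
    then obtain f g where fg: "f \<in> A" "g \<in> B" "ev f \<noteq> 0" "ev g \<noteq> 0" by blast
    hence "ev (f * g) = 0" using * by blast
    thus False using fg by (simp add: assms)
  qed
qed (auto simp: assms)

interpretation closed1: orbit_space "closed1 :: 'a::alg_closed_field vec3 set set" ppoint
proof
  fix S T :: "'a vec3 set" assume "S \<in> closed1" "T \<in> closed1"
  then obtain A B where A: "\<And>f. f \<in> A \<Longrightarrow> \<exists>d. homogeneous d f" "S = {v. v \<noteq> (0, 0, 0) \<and> (\<forall>f\<in>A. pev f v = 0)}"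
    and B: "\<And>f. f \<in> B \<Longrightarrow> \<exists>d. homogeneous d f" "T = {v. v \<noteq> (0, 0, 0) \<and> (\<forall>f\<in>B. pev f v = 0)}"
    by (auto elim!: closed1E)
  have "S \<union> T = {v. v \<noteq> (0, 0, 0) \<and> (\<forall>h\<in>{f * g |f g. f \<in> A \<and> g \<in> B}. pev h v = 0)}"
    by (rule Set.set_eqI) (simp only: A B Un_iff mem_Collect_eq ball_products_iff[of "\<lambda>f. pev f _", OF pev_mult], blast)
  also have "\<dots> \<in> closed1"
    using A(1) B(1) homogeneous_mult by (intro closed1I) blast
  finally show "S \<union> T \<in> closed1" .
next
  fix S :: "'a vec3 set" and v assume S: "S \<in> closed1" "v \<in> S"
  then obtain A where A: "\<And>f. f \<in> A \<Longrightarrow> \<exists>d. homogeneous d f" "S = {v. v \<noteq> (0, 0, 0) \<and> (\<forall>f\<in>A. pev f v = 0)}"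
    by (auto elim!: closed1E)
  thus "ppoint v \<in> closed1" using ppoint_closed1 S by blast
  have v: "v \<noteq> (0, 0, 0)" "\<And>f. f \<in> A \<Longrightarrow> pev f v = 0" using S(2) A(2) by blast+
  have "pev f (smul c v) = 0" if "f \<in> A" for f c
    using A(1)[OF that] v(2)[OF that] by (metis homogeneous_pev mult_zero_right)
  moreover have "smul c v \<noteq> (0, 0, 0)" if "c \<noteq> 0" for c using that v(1) by simp
  ultimately have "smul c v \<in> S" if "c \<noteq> 0" for c unfolding A(2) using that by (simp del: smul_simps)
  thus "ppoint v \<subseteq> S" unfolding ppoint_altdef by blast
next
  fix u v :: "'a vec3" assume "u \<in> ppoint v"
  thus "ppoint u = ppoint v" by (auto simp: ppoint_altdef[of v] simp del: smul_simps)
qed simp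

interpretation closed2: orbit_space "closed2 :: ('a::alg_closed_field vec3 \<times> 'a vec3) set set" bipoint
proof
  fix S T :: "('a vec3 \<times> 'a vec3) set" assume "S \<in> closed2" "T \<in> closed2"
  then obtain A B where A: "\<And>f. f \<in> A \<Longrightarrow> \<exists>a b. bihomogeneous a b f"
      "S = {(v, w). v \<noteq> (0, 0, 0) \<and> w \<noteq> (0, 0, 0) \<and> (\<forall>f\<in>A. bev f v w = 0)}"
    and B: "\<And>f. f \<in> B \<Longrightarrow> \<exists>a b. bihomogeneous a b f"
      "T = {(v, w). v \<noteq> (0, 0, 0) \<and> w \<noteq> (0, 0, 0) \<and> (\<forall>f\<in>B. bev f v w = 0)}"
    by (auto elim!: closed2E)
  have "S \<union> T = {(v, w). v \<noteq> (0, 0, 0) \<and> w \<noteq> (0, 0, 0) \<and> (\<forall>h\<in>{f * g |f g. f \<in> A \<and> g \<in> B}. bev h v w = 0)}"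
    by (rule Set.set_eqI, clarify)
      (simp only: A B Un_iff mem_Collect_eq split ball_products_iff[of "\<lambda>f. bev f _ _", OF bev_mult], blast)
  also have "\<dots> \<in> closed2"
    using A(1) B(1) bihomogeneous_mult by (intro closed2I) blast
  finally show "S \<union> T \<in> closed2" .
next
  fix S :: "('a vec3 \<times> 'a vec3) set" and P assume S: "S \<in> closed2" "P \<in> S"
  then obtain A where A: "\<And>f. f \<in> A \<Longrightarrow> \<exists>a b. bihomogeneous a b f"
      "S = {(v, w). v \<noteq> (0, 0, 0) \<and> w \<noteq> (0, 0, 0) \<and> (\<forall>f\<in>A. bev f v w = 0)}"
    by (auto elim!: closed2E)
  obtain v w where P: "P = (v, w)" by (cases P)
  have vw: "v \<noteq> (0, 0, 0)" "w \<noteq> (0, 0, 0)" "\<And>f. f \<in> A \<Longrightarrow> bev f v w = 0" using S(2) A(2) P by blast+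
  show "bipoint P \<in> closed2" using vw P by (intro bipoint_closed2) simp_all
  have "bev f (smul c v) (smul d w) = 0" if "f \<in> A" for f c d
    using A(1)[OF that] vw(3)[OF that] by (metis bihomogeneous_bev mult_zero_right)
  moreover have "smul c v \<noteq> (0, 0, 0)" if "c \<noteq> 0" for c using that vw(1) by simp
  moreover have "smul c w \<noteq> (0, 0, 0)" if "c \<noteq> 0" for c using that vw(2) by simp
  ultimately have "(smul c v, smul d w) \<in> S" if "c \<noteq> 0" "d \<noteq> 0" for c d
    unfolding A(2) using that by (simp del: smul_simps)
  thus "bipoint P \<subseteq> S" unfolding bipoint_def ppoint_altdef P fst_conv snd_conv by blast
next
  fix P Q :: "'a vec3 \<times> 'a vec3" assume "P \<in> bipoint Q"
  thus "bipoint P = bipoint Q"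
    by (auto simp: bipoint_def ppoint_altdef[of "fst Q"] ppoint_altdef[of "snd Q"] simp del: smul_simps)
qed (simp add: bipoint_def mem_Times_iff)

text \<open>Irreducibility of the zero set is primality of p: forms that separate the curve from two
  closed sets have a product not divisible by p. Proper irreducible closed subsets are finite by
  \<open>finite_common_zeros\<close>.\<close>

lemma irred_curve_zeros:
  fixes p :: "'a::alg_closed_field tpoly"
  assumes p: "irreducible p" "homogeneous d p"
  shows "irred_curve closed1 (zeros p)"
proof (rule closed1.irred_curveI)
  have inf: "infinite (ppoint ` zeros p)"
    using p irreducible_homogeneous_pos by (intro infinite_zeros[of d]) auto
  thus "infinite (ppoint ` zeros p)" .
  have prime: "prime_elem p" using p(1) by simp
  have sep: "\<exists>f\<in>A. \<not> p dvd f" if "\<not> zeros p \<subseteq> {v. v \<noteq> (0, 0, 0) \<and> (\<forall>f\<in>A. pev f v = 0)}" for A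
    using that by (auto simp: zeros_def dest: dvd_imp_pev_eq_0)
  show "irred_closed closed1 (zeros p)"
    unfolding irred_closed_def
  proof (intro conjI ballI impI)
    show "zeros p \<in> closed1" by (rule zeros_closed1[OF p(2)])
    show "zeros p \<noteq> {}" using inf by auto
    fix S T :: "'a vec3 set" assume ST: "S \<in> closed1" "T \<in> closed1" "zeros p \<subseteq> S \<union> T"
    then obtain A B where A: "\<And>f. f \<in> A \<Longrightarrow> \<exists>d. homogeneous d f" "S = {v. v \<noteq> (0, 0, 0) \<and> (\<forall>f\<in>A. pev f v = 0)}"
      and B: "\<And>f. f \<in> B \<Longrightarrow> \<exists>d. homogeneous d f" "T = {v. v \<noteq> (0, 0, 0) \<and> (\<forall>f\<in>B. pev f v = 0)}"
      by (auto elim!: closed1E)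
    show "zeros p \<subseteq> S \<or> zeros p \<subseteq> T"
    proof (rule ccontr)
      assume "\<not> ?thesis"
      hence "\<not> zeros p \<subseteq> S" "\<not> zeros p \<subseteq> T" by blast+
      then obtain f g where fg: "f \<in> A" "\<not> p dvd f" "g \<in> B" "\<not> p dvd g"
        using sep[of A] sep[of B] unfolding A(2) B(2) by blast
      obtain i where i: "homogeneous i f" using A(1)[OF fg(1)] by blast
      obtain j where j: "homogeneous j g" using B(1)[OF fg(3)] by blast
      have "pev f v = 0 \<or> pev g v = 0" if "v \<in> zeros p" for v
        using subsetD[OF ST(3) that] fg(1,3) unfolding A(2) B(2) by blast
      hence "p dvd f * g"
        using irreducible_dvdI[OF p homogeneous_mult[OF i j]] by simp
      thus False using fg prime by (simp add: prime_elem_dvd_mult_iff)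
    qed
  qed
  fix Z assume Z: "irred_closed closed1 Z" "Z \<subset> zeros p"
  hence "Z \<in> closed1" by (simp add: irred_closed_def)
  then obtain A where A: "\<And>f. f \<in> A \<Longrightarrow> \<exists>d. homogeneous d f" "Z = {v. v \<noteq> (0, 0, 0) \<and> (\<forall>f\<in>A. pev f v = 0)}"
    by (auto elim!: closed1E)
  then obtain f where f: "f \<in> A" "\<not> p dvd f" using sep[of A] Z(2) by auto
  then obtain e where "homogeneous e f" using A by blast
  hence "finite (ppoint ` (zeros p \<inter> zeros f))" using f p finite_common_zeros by blast
  moreover have "Z \<subseteq> zeros p \<inter> zeros f" using Z(2) A(2) f(1) by (auto simp: zeros_def)
  ultimately show "finite (ppoint ` Z)" using finite_subset image_mono by metis
qed

lemma irred_closed_component: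
  fixes f :: "'a::alg_closed_field tpoly"
  assumes "irred_closed closed1 E" "E \<subseteq> zeros f" "homogeneous d f" "f \<noteq> 0"
  shows "\<exists>p e. irreducible p \<and> homogeneous e p \<and> E \<subseteq> zeros p"
  using assms(2-4)
proof (induction d arbitrary: f rule: less_induct)
  case (less d)
  show ?case
  proof (cases "irreducible f")
    case True
    thus ?thesis using less by blast
  next
    case False
    have "\<not> f dvd 1"
    proof
      assume "f dvd 1"
      then obtain c where "c \<noteq> 0" "f = const3 c" by (rule unit_homogeneous_const)
      thus False using less.prems(1) assms(1) by (auto simp: irred_closed_def zeros_def)
    qed
    with False less.prems(3) obtain a b where ab: "f = a * b" "\<not> a dvd 1" "\<not> b dvd 1"
      by (auto simp: irreducible_def)
    obtain i j where ij: "homogeneous i a" "homogeneous j b" "i + j = d"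
      using less.prems(2,3) ab(1) homogeneous_factor by blast
    have pos: "n > 0" if "homogeneous n p" "\<not> p dvd 1" "p \<noteq> 0" for n and p :: "'a tpoly"
    proof (rule ccontr)
      assume "\<not> n > 0"
      with that(1) obtain c where "p = const3 c" by (auto elim: homogeneous_0_const)
      thus False using that const3_dvd_1[of c] by (auto simp: const3_def)
    qed
    have "i > 0" "j > 0" using pos ij ab less.prems(3) by auto
    moreover have "E \<subseteq> zeros a \<union> zeros b" using less.prems(1) ab(1) by (auto simp: zeros_def)
    hence "E \<subseteq> zeros a \<or> E \<subseteq> zeros b"
      using assms(1) ij zeros_closed1 unfolding irred_closed_def by blast
    ultimately show ?thesis
      using less.IH[of i a] less.IH[of j b] ij less.prems(3) ab(1) by auto
  qed
qed

text \<open>An irreducible closed set of dimension one lies on an irreducible plane curve and fills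
  it because it is infinite.\<close>

lemma irred_curve_closed1E:
  fixes E :: "'a::alg_closed_field vec3 set"
  assumes "irred_curve closed1 E"
  obtains p d where "irreducible p" "homogeneous d p" "E = zeros p"
proof -
  have E: "irred_closed closed1 E" "krull_dim closed1 E = 1" using assms by (auto simp: irred_curve_def)
  hence "E \<in> closed1" by (simp add: irred_closed_def)
  then obtain A where A: "\<And>f. f \<in> A \<Longrightarrow> \<exists>d. homogeneous d f" "E = {v. v \<noteq> (0, 0, 0) \<and> (\<forall>f\<in>A. pev f v = 0)}"
    by (auto elim!: closed1E)
  have "\<exists>f\<in>A. f \<noteq> 0"
  proof (rule ccontr)
    assume "\<not> ?thesis"
    hence Eall: "E = {v. v \<noteq> (0, 0, 0)}" using A(2) by auto
    \<comment> \<open>The whole plane has dimension at least two: it contains the chain of a point,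
      the line x = 0 and the plane.\<close>
    define Z where "Z = (\<lambda>i::nat. if i = 0 then ppoint (0, 0, 1) else if i = 1 then zeros varx else E)"
    have irr: "irreducible (varx :: 'a tpoly)"
      by (rule irreducible_linform[OF homogeneous_vars(1)]) (simp add: varx_def)
    have "irred_closed closed1 (zeros (varx :: 'a tpoly))"
      using irred_curve_zeros[OF irr, of 1] by (simp add: irred_curve_def)
    moreover have "irred_closed closed1 (ppoint (0, 0, 1 :: 'a))"
      using closed1.irred_orb[OF \<open>E \<in> closed1\<close>] by (simp add: Eall)
    ultimately have "\<forall>i\<le>2. irred_closed closed1 (Z i) \<and> Z i \<subseteq> E"
      using E(1) by (auto simp: Z_def Eall zeros_def ppoint_altdef)
    moreover have "ppoint (0, 0, 1 :: 'a) \<subset> zeros varx"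
    proof -
      have "(0, 1, 0) \<in> zeros (varx :: 'a tpoly)" "(0, 1, 0) \<notin> ppoint (0, 0, 1 :: 'a)"
        by (auto simp: zeros_def ppoint_altdef)
      moreover have "ppoint (0, 0, 1 :: 'a) \<subseteq> zeros varx" by (auto simp: zeros_def ppoint_altdef)
      ultimately show ?thesis by blast
    qed
    moreover have "zeros varx \<subset> E"
    proof -
      have "(1, 0, 0) \<in> E" "(1, 0, 0) \<notin> zeros (varx :: 'a tpoly)" by (auto simp: Eall zeros_def)
      moreover have "zeros varx \<subseteq> E" by (auto simp: Eall zeros_def)
      ultimately show ?thesis by blast
    qed
    ultimately have "\<forall>i<2. Z i \<subset> Z (Suc i)" by (auto simp: Z_def less_2_cases_iff)
    with \<open>\<forall>i\<le>2. _ i\<close> have "enat 2 \<le> krull_dim closed1 E"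
      unfolding krull_dim_def by (intro SUP_upper) blast
    thus False using E(2) by (simp add: one_enat_def)
  qed
  then obtain f where f: "f \<in> A" "f \<noteq> 0" by blast
  then obtain d where d: "homogeneous d f" using A by blast
  have "E \<subseteq> zeros f" using A(2) f by (auto simp: zeros_def)
  then obtain p e where p: "irreducible p" "homogeneous e p" "E \<subseteq> zeros p"
    using irred_closed_component[OF E(1) _ d f(2)] by blast
  have "pev g v = 0" if g: "g \<in> A" and v: "v \<in> zeros p" for g v
  proof (rule ccontr)
    assume "pev g v \<noteq> 0"
    hence "\<not> p dvd g" using v by (auto simp: zeros_def dest: dvd_imp_pev_eq_0)
    moreover obtain n where "homogeneous n g" using A(1)[OF g] by blast
    ultimately have "finite (ppoint ` (zeros p \<inter> zeros g))" using p finite_common_zeros by blast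
    moreover have "E \<subseteq> zeros p \<inter> zeros g" using p(3) A(2) g by (auto simp: zeros_def)
    ultimately show False using closed1.irred_curve_infinite[OF assms] finite_subset image_mono by metis
  qed
  hence "zeros p \<subseteq> E" using A(2) by (auto simp: zeros_def)
  with p that show thesis by blast
qed

subsection \<open>Divisibility in factorial rings\<close>

text \<open>The prime factors of p are distributed, one at a time, between a and b.\<close>

lemma dvd_mult_decomp:
  fixes p a b :: "'b::ufd"
  assumes "p \<noteq> 0" "p dvd a * b"
  shows "\<exists>g h. p = g * h \<and> g dvd a \<and> h dvd b"
proof (cases "p dvd 1")
  case True
  thus ?thesis by (intro exI[of _ p] exI[of _ 1]) (auto intro: dvd_trans)
next
  case False
  then obtain F where F: "\<And>f. f \<in># F \<Longrightarrow> irreducible f" "prod_mset F = p"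
    using mset_factors_exist[OF assms(1)] by (metis mset_factorsD(1,3))
  have "\<exists>g h. prod_mset F = g * h \<and> g dvd a \<and> h dvd b"
    if "\<And>f. f \<in># F \<Longrightarrow> irreducible f" "prod_mset F dvd a * b" for F and a b :: 'b
    using that
  proof (induction F arbitrary: a b)
    case empty
    show ?case by (intro exI[of _ 1]) simp
  next
    case (add f F)
    have "irreducible f" using add.prems(1)[of f] by simp
    hence f: "prime_elem f" by simp
    have f0: "f \<noteq> 0" using \<open>irreducible f\<close> by auto
    have "f dvd a * b" using add.prems(2) dvd_mult_left[of f "prod_mset F" "a * b"] by simp
    then consider "f dvd a" | "f dvd b" using f by (metis prime_elem_dvd_multD)
    thus ?case
    proof cases
      case 1
      then obtain a' where a': "a = f * a'" by blast
      hence "prod_mset F dvd a' * b" using add.prems(2) f0 by (simp add: mult.assoc)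
      then obtain g h where "prod_mset F = g * h" "g dvd a'" "h dvd b"
        using add.IH[of a' b] add.prems(1) by auto
      thus ?thesis using a' by (intro exI[of _ "f * g"] exI[of _ h]) (simp add: mult_ac mult_dvd_mono)
    next
      case 2
      then obtain b' where b': "b = f * b'" by blast
      hence "prod_mset F dvd a * b'" using add.prems(2) f0 by (simp add: mult.left_commute)
      then obtain g h where "prod_mset F = g * h" "g dvd a" "h dvd b'"
        using add.IH[of a b'] add.prems(1) by auto
      thus ?thesis using b' by (intro exI[of _ g] exI[of _ "f * h"]) (simp add: mult_ac mult_dvd_mono)
    qed
  qed
  from this[of F a b, OF F(1)] assms(2) F(2) show ?thesis by simp
qed

lemma dvd_mult_coprime:
  fixes p a b :: "'b::ufd"
  assumes "p \<noteq> 0" "p dvd a * b" "\<And>d. d dvd p \<Longrightarrow> d dvd a \<Longrightarrow> d dvd 1"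
  shows "p dvd b"
proof -
  obtain g h where gh: "p = g * h" "g dvd a" "h dvd b" using dvd_mult_decomp[OF assms(1,2)] by blast
  hence "g dvd 1" using assms(3)[of g] by simp
  then obtain u where "1 = g * u" by blast
  hence "h = p * u" using gh(1) by (simp add: mult_ac)
  hence "p dvd h" by simp
  thus ?thesis using gh(3) dvd_trans by blast
qed

lemma prime_power_dvd_mult:
  fixes p :: "'b::idom"
  assumes "prime_elem p" "p ^ k dvd n * m" "\<not> p dvd n"
  shows "p ^ k dvd m"
  using assms(2)
proof (induction k arbitrary: m)
  case (Suc k)
  have "p dvd n * m" using Suc.prems dvd_mult_left[of p "p ^ k" "n * m"] by simp
  hence "p dvd m" using prime_elem_dvd_multD[OF assms(1)] assms(3) by blast
  then obtain m' where m': "m = p * m'" by blast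
  hence "p ^ k dvd n * m'" using Suc.prems assms(1) by (simp add: mult.left_commute prime_elem_def)
  hence "p ^ k dvd m'" by (rule Suc.IH)
  thus ?case unfolding m' power_Suc by (rule mult_dvd_mono[OF dvd_refl])
qed simp

lemma vars_nonzero [simp]: "varx \<noteq> 0" "vary \<noteq> 0" "varz \<noteq> 0"
  by (simp_all add: varx_def vary_def varz_def)

lemma pev_numeral [simp]: "pev (numeral n) v = numeral n"
  by (induction n) (simp_all only: numeral.simps pev_add pev_1)

subsection \<open>Substitutions\<close>

definition subst3 :: "'a::comm_ring_1 tpoly \<Rightarrow> 'a tpoly \<Rightarrow> 'a tpoly \<Rightarrow> 'a tpoly \<Rightarrow> 'a tpoly" where
  "subst3 a b c p = eval3 (map3 const3 p) a b c"

lemma pev_subst3 [simp]: "pev (subst3 a b c p) v = pev p (pev a v, pev b v, pev c v)"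
  by (induction p rule: tpoly_induct) (simp_all add: subst3_def map3_hom[OF comm_ring_hom_const3])

subsection \<open>The double cover branched along two lines\<close>

text \<open>
  The ring \<open>k[a, b, z]\<close> contains \<open>k[x, y, z]\<close> by \<open>\<ell>\<^sub>1 = a\<^sup>2\<close>, \<open>\<ell>\<^sub>2 = b\<^sup>2\<close>, with the sign changes of
  \<open>a\<close> and \<open>b\<close> as Galois group. It is factorial and contains the square root \<open>ab\<close> of \<open>\<ell>\<^sub>1 \<ell>\<^sub>2\<close>.
\<close>

locale two_lines =
  fixes a1 b1 a2 b2 :: "'a::alg_closed_field"
  assumes det: "a1 * b2 - a2 * b1 \<noteq> 0" and two: "(2::'a) \<noteq> 0"
begin

definition l1 :: "'a tpoly" where "l1 = linform a1 b1 0"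
definition l2 :: "'a tpoly" where "l2 = linform a2 b2 0"

text \<open>Cramer's rule for the point (x, y) at which l1 = a^2 and l2 = b^2.\<close>

definition cx :: "'a \<Rightarrow> 'a \<Rightarrow> 'a" where "cx a b = (b2 * a\<^sup>2 - b1 * b\<^sup>2) / (a1 * b2 - a2 * b1)"
definition cy :: "'a \<Rightarrow> 'a \<Rightarrow> 'a" where "cy a b = (a1 * b\<^sup>2 - a2 * a\<^sup>2) / (a1 * b2 - a2 * b1)"

definition hat :: "'a tpoly \<Rightarrow> 'a tpoly" where
  "hat = subst3
     (const3 (b2 / (a1 * b2 - a2 * b1)) * varx\<^sup>2 - const3 (b1 / (a1 * b2 - a2 * b1)) * vary\<^sup>2)
     (const3 (a1 / (a1 * b2 - a2 * b1)) * vary\<^sup>2 - const3 (a2 / (a1 * b2 - a2 * b1)) * varx\<^sup>2) varz"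

definition tau1 :: "'a tpoly \<Rightarrow> 'a tpoly" where "tau1 = subst3 (- varx) vary varz"
definition tau2 :: "'a tpoly \<Rightarrow> 'a tpoly" where "tau2 = subst3 varx (- vary) varz"

lemma pev_hat [simp]: "pev (hat p) (a, b, z) = pev p (cx a b, cy a b, z)"
  by (simp add: hat_def cx_def cy_def diff_divide_distrib)

lemma pev_tau [simp]: "pev (tau1 p) (a, b, z) = pev p (- a, b, z)" "pev (tau2 p) (a, b, z) = pev p (a, - b, z)"
  by (simp_all add: tau1_def tau2_def)

lemma pev_eqI': "(\<And>a b z. pev p (a, b, z) = pev q (a, b, z)) \<Longrightarrow> p = q" for p q :: "'a tpoly"
  by (rule pev_eqI) auto

lemma l_cxy: "a1 * cx a b + b1 * cy a b = a\<^sup>2" "a2 * cx a b + b2 * cy a b = b\<^sup>2"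
  using det by (simp_all add: cx_def cy_def divide_simps) (simp_all add: algebra_simps)

lemma hat_hom [simp]: "hat (p + q) = hat p + hat q" "hat (p * q) = hat p * hat q"
  "hat (p - q) = hat p - hat q" "hat 0 = 0" "hat 1 = 1" "hat (p ^ n) = hat p ^ n"
  "hat l1 = varx\<^sup>2" "hat l2 = vary\<^sup>2" "hat (const3 c) = const3 c"
  by (auto intro!: pev_eqI' simp: l1_def l2_def l_cxy)

lemma tau_hom [simp]: "tau1 (p + q) = tau1 p + tau1 q" "tau1 (p * q) = tau1 p * tau1 q"
  "tau1 (p - q) = tau1 p - tau1 q" "tau1 1 = 1" "tau1 (const3 c) = const3 c"
  "tau2 (p + q) = tau2 p + tau2 q" "tau2 (p * q) = tau2 p * tau2 q"
  "tau2 (p - q) = tau2 p - tau2 q" "tau2 1 = 1" "tau2 (const3 c) = const3 c"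
  by (auto intro!: pev_eqI')

lemma tau_vars [simp]: "tau1 varx = - varx" "tau1 vary = vary" "tau2 varx = varx" "tau2 vary = - vary"
  by (auto intro!: pev_eqI')

lemma tau_tau [simp]: "tau1 (tau1 p) = p" "tau2 (tau2 p) = p" "tau2 (tau1 p) = tau1 (tau2 p)"
  by (auto intro!: pev_eqI')

lemma tau_hat [simp]: "tau1 (hat p) = hat p" "tau2 (hat p) = hat p"
  by (auto intro!: pev_eqI' simp: cx_def cy_def)

lemma tau_dvd: "p dvd q \<Longrightarrow> tau1 p dvd tau1 q" "p dvd q \<Longrightarrow> tau2 p dvd tau2 q"
  by auto

lemma cxy_surj: obtains a b where "x = cx a b" "y = cy a b"
proof -
  obtain a b where ab: "a\<^sup>2 = a1 * x + b1 * y" "b\<^sup>2 = a2 * x + b2 * y"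
    using nth_root_exists[of 2] by (metis zero_less_numeral)
  show thesis
    by (rule that[of a b]; use det in \<open>simp add: cx_def cy_def ab eq_divide_eq\<close>) (simp_all add: algebra_simps)
qed

lemma hat_eq_iff [simp]: "hat p = hat q \<longleftrightarrow> p = q"
proof
  assume *: "hat p = hat q"
  show "p = q"
  proof (rule pev_eqI')
    fix x y z :: 'a
    obtain a b where "x = cx a b" "y = cy a b" by (rule cxy_surj)
    thus "pev p (x, y, z) = pev q (x, y, z)" using pev_hat[of p a b z] pev_hat[of q a b z] * by simp
  qed
qed simp

lemma hat_eq_0_iff [simp]: "hat p = 0 \<longleftrightarrow> p = 0"
  using hat_eq_iff[of p 0] by simp

text \<open>Over the image of \<open>hat\<close>, the ring k[a, b, z] is generated by 1, a, b and a
  b; products are reduced by a^2 = l1 and b^2 = l2.\<close>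

lemma hat_decomp: "\<exists>p q r s. f = hat p + varx * hat q + vary * hat r + varx * vary * hat s"
proof (induction f rule: tpoly_induct)
  case (const c)
  show ?case by (rule exI[of _ "const3 c"], (rule exI[of _ 0])+) simp
next
  case x
  show ?case by (rule exI[of _ 0], rule exI[of _ 1], (rule exI[of _ 0])+) simp
next
  case y
  show ?case by (rule exI[of _ 0], rule exI[of _ 0], rule exI[of _ 1], rule exI[of _ 0]) simp
next
  case z
  have "hat varz = varz" by (rule pev_eqI') simp
  show ?case by (rule exI[of _ varz], (rule exI[of _ 0])+) (simp add: \<open>hat varz = varz\<close>)
next
  case (add f g)
  then obtain p q r s p' q' r' s' where "f = hat p + varx * hat q + vary * hat r + varx * vary * hat s"
    "g = hat p' + varx * hat q' + vary * hat r' + varx * vary * hat s'" by blast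
  thus ?case by (intro exI[of _ "p + p'"] exI[of _ "q + q'"] exI[of _ "r + r'"] exI[of _ "s + s'"])
    (simp add: algebra_simps)
next
  case (mult f g)
  then obtain p q r s p' q' r' s' where fg: "f = hat p + varx * hat q + vary * hat r + varx * vary * hat s"
    "g = hat p' + varx * hat q' + vary * hat r' + varx * vary * hat s'" by blast
  show ?case
    unfolding fg
    by (intro exI[of _ "p * p' + l1 * q * q' + l2 * r * r' + l1 * l2 * s * s'"]
        exI[of _ "p * q' + q * p' + l2 * (r * s' + s * r')"]
        exI[of _ "p * r' + r * p' + l1 * (q * s' + s * q')"]
        exI[of _ "p * s' + s * p' + q * r' + r * q'"])
      (simp add: algebra_simps power2_eq_square)
qed

lemma four: "(4::'a) \<noteq> 0"
proof -
  have "(4::'a) = 2 * 2" by simp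
  thus ?thesis using two by (metis mult_eq_0_iff)
qed

lemma cxy_neg [simp]: "cx (- a) b = cx a b" "cx a (- b) = cx a b" "cy (- a) b = cy a b" "cy a (- b) = cy a b"
  by (simp_all add: cx_def cy_def)

text \<open>Averaging over the four sign changes leaves only the first summand of
  \<open>hat_decomp\<close>; this divides by 4.\<close>

lemma invariant_hat:
  assumes "tau1 f = f" "tau2 f = f"
  obtains p where "f = hat p"
proof -
  obtain p q r s where f: "f = hat p + varx * hat q + vary * hat r + varx * vary * hat s" using hat_decomp by blast
  have "f = hat p"
  proof (rule pev_eqI')
    fix a b z :: 'a
    have e: "pev f (- a, b, z) = pev f (a, b, z)" "pev f (a, - b, z) = pev f (a, b, z)"
      "pev f (- a, - b, z) = pev f (a, b, z)"
      using assms by (metis pev_tau)+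
    have "4 * pev f (a, b, z) = pev f (a, b, z) + pev f (- a, b, z) + pev f (a, - b, z) + pev f (- a, - b, z)"
      by (simp add: e)
    also have "\<dots> = 4 * pev (hat p) (a, b, z)" by (simp add: f)
    finally show "pev f (a, b, z) = pev (hat p) (a, b, z)" using four by (metis mult_cancel_left)
  qed
  thus thesis by (rule that)
qed

text \<open>The invariants of the simultaneous sign change of a and b form the double cover,
  generated by the root a b of l1 l2. The anti-invariants in \<open>odd_hat\<close> belong to curves
  of odd degree.\<close>

lemma even_hat:
  assumes "tau1 (tau2 f) = f"
  obtains p q where "f = hat p + varx * vary * hat q"
proof -
  obtain p q r s where f: "f = hat p + varx * hat q + vary * hat r + varx * vary * hat s" using hat_decomp by blast
  have "f = hat p + varx * vary * hat s"
  proof (rule pev_eqI')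
    fix a b z :: 'a
    have e: "pev f (- a, - b, z) = pev f (a, b, z)"
      using assms by (metis pev_tau)
    have "2 * pev f (a, b, z) = pev f (a, b, z) + pev f (- a, - b, z)"
      by (simp add: e)
    also have "\<dots> = 2 * pev (hat p + varx * vary * hat s) (a, b, z)" by (simp add: f algebra_simps)
    finally show "pev f (a, b, z) = pev (hat p + varx * vary * hat s) (a, b, z)"
      using two by (metis mult_cancel_left)
  qed
  thus thesis by (rule that)
qed

lemma odd_hat:
  assumes "tau1 (tau2 f) = - f"
  obtains p q where "f = varx * hat p + vary * hat q"
proof -
  obtain p q r s where f: "f = hat p + varx * hat q + vary * hat r + varx * vary * hat s" using hat_decomp by blast
  have "f = varx * hat q + vary * hat r"
  proof (rule pev_eqI')
    fix a b z :: 'a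
    have e: "pev f (- a, - b, z) = - pev f (a, b, z)"
      using assms by (metis pev_tau pev_uminus)
    have "2 * pev f (a, b, z) = pev f (a, b, z) - pev f (- a, - b, z)"
      by (simp add: e)
    also have "\<dots> = 2 * pev (varx * hat q + vary * hat r) (a, b, z)" by (simp add: f algebra_simps)
    finally show "pev f (a, b, z) = pev (varx * hat q + vary * hat r) (a, b, z)"
      using two by (metis mult_cancel_left)
  qed
  thus thesis by (rule that)
qed

text \<open>A quotient of invariants is itself invariant and hence comes from k[x, y, z].\<close>

lemma hat_dvd_hat:
  assumes "hat p dvd hat q"
  shows "p dvd q"
proof (cases "p = 0")
  case False
  obtain f where f: "hat q = hat p * f" using assms by blast
  have "hat q = hat p * tau1 f" using arg_cong[OF f, of tau1] by simp
  moreover have "hat q = hat p * tau2 f" using arg_cong[OF f, of tau2] by simp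
  ultimately have "hat p * tau1 f = hat p * f" "hat p * tau2 f = hat p * f" using f by metis+
  hence "tau1 f = f" "tau2 f = f" using False by auto
  then obtain r where "f = hat r" by (rule invariant_hat)
  with f have "hat q = hat (p * r)" by simp
  thus ?thesis by (simp only: hat_eq_iff) simp
qed (use assms in auto)

text \<open>Descent by the norm: the product N of the four conjugates of d comes from k[x, y, z] and
  divides the fourth powers of G and of al there. As G is prime and does not divide al, N is a
  unit.\<close>

lemma hat_common_divisor:
  assumes G: "prime_elem G" "\<not> G dvd al" and d: "d dvd hat G" "d dvd hat al"
  shows "d dvd 1"
proof -
  define N where "N = d * tau1 d * (tau2 d * tau1 (tau2 d))"
  have "tau1 N = N" "tau2 N = N" by (simp_all add: N_def mult_ac)
  then obtain n where n: "N = hat n" by (rule invariant_hat)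
  have Nd: "hat n dvd hat (p ^ 4)" if "d dvd hat p" for p
  proof -
    have "tau1 d dvd hat p" "tau2 d dvd hat p" "tau1 (tau2 d) dvd hat p"
      using tau_dvd[OF that] tau_dvd(1)[OF tau_dvd(2)[OF that]] by simp_all
    hence "N dvd hat p * hat p * (hat p * hat p)" using that unfolding N_def by (intro mult_dvd_mono)
    thus ?thesis by (simp add: n power4_eq_xxxx mult.assoc)
  qed
  have "n dvd G ^ 4" "n dvd al ^ 4" using Nd[OF d(1)] Nd[OF d(2)] by (simp_all only: hat_dvd_hat)
  have "\<not> G dvd n"
  proof
    assume "G dvd n"
    hence "G dvd al ^ 4" using \<open>n dvd al ^ 4\<close> by (rule dvd_trans)
    thus False using prime_elem_dvd_power[OF G(1)] G(2) by blast
  qed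
  obtain m where m: "G ^ 4 = n * m" using \<open>n dvd G ^ 4\<close> by blast
  hence "G ^ 4 dvd m" using prime_power_dvd_mult[OF G(1), of 4 n m] \<open>\<not> G dvd n\<close> by simp
  then obtain r where r: "m = G ^ 4 * r" by blast
  have "G ^ 4 * 1 = n * m" using m by simp
  also have "\<dots> = G ^ 4 * (n * r)" unfolding r by (simp only: mult_ac)
  finally have "1 = n * r" using G(1) by (metis mult_left_cancel power_not_zero prime_elem_def)
  have "N * hat r = hat (n * r)" unfolding n by simp
  also have "\<dots> = 1" using \<open>1 = n * r\<close>[symmetric] by simp
  finally have "N * hat r = 1" .
  hence "d * (tau1 d * (tau2 d * tau1 (tau2 d)) * hat r) = 1" by (simp add: N_def mult_ac)
  thus ?thesis by (metis dvd_triv_left)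
qed

text \<open>For A = al + a b be, G divides the norm of A, which is A times \<open>tau1 A\<close>; so
  G splits into a factor g of A and a factor of \<open>tau1 A\<close>. The two factors of the norm
  share no divisor of G except units, hence \<open>tau1\<close> exchanges the two parts up to a
  constant. As A is fixed by the simultaneous sign change, g is fixed up to sign.\<close>

lemma hat_factor_halves:
  assumes G: "irreducible G" "\<not> G dvd al" and dvd: "G dvd al\<^sup>2 - l1 * l2 * be\<^sup>2"
  obtains g c where "c \<noteq> 0" "hat G = const3 c * (g * tau1 g)"
    "tau1 (tau2 g) = g \<or> tau1 (tau2 g) = - g"
proof -
  define A where "A = hat al + varx * vary * hat be"
  have prime: "prime_elem G" using G(1) by simp
  have P0: "hat G \<noteq> 0" using G(1) by auto
  have AA: "A * tau1 A = hat (al\<^sup>2 - l1 * l2 * be\<^sup>2)"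
    by (simp add: A_def algebra_simps power2_eq_square)
  obtain k where "al\<^sup>2 - l1 * l2 * be\<^sup>2 = G * k" using dvd by blast
  hence "A * tau1 A = hat G * hat k" unfolding AA by (simp only: hat_hom)
  hence "hat G dvd A * tau1 A" by simp
  then obtain g h where gh: "hat G = g * h" "g dvd A" "h dvd tau1 A" using dvd_mult_decomp[OF P0] by blast
  \<comment> \<open>A common divisor of A and its conjugate divides their sum 2 al.\<close>
  have cop: "d dvd 1" if "d dvd hat G" "d dvd A" "d dvd tau1 A" for d
  proof (rule hat_common_divisor[OF prime G(2) that(1)])
    have "A + tau1 A = const3 2 * hat al" by (rule pev_eqI') (simp add: A_def)
    moreover have "d dvd A + tau1 A" using that by simp
    ultimately have "d dvd const3 2 * hat al" by simp
    moreover have "hat al = const3 (1/2) * (const3 2 * hat al)"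
      by (rule pev_eqI') (use two in simp)
    ultimately show "d dvd hat al" by (metis dvd_mult)
  qed
  have "tau1 (hat G) = tau1 g * tau1 h" unfolding gh(1) by simp
  hence tP: "g * h = tau1 g * tau1 h" using gh(1) by (metis tau_hat(1))
  have nz: "g \<noteq> 0" "h \<noteq> 0" using P0 gh by auto
  have tG: "hat G = tau1 g * tau1 h" using gh(1) tP by (rule trans)
  have gP: "g dvd hat G" "h dvd hat G" unfolding gh(1) by simp_all
  have tgP: "tau1 g dvd hat G" "tau1 h dvd hat G" unfolding tG by simp_all
  have gA: "tau1 g dvd tau1 A" "tau1 h dvd A" using tau_dvd(1)[OF gh(2)] tau_dvd(1)[OF gh(3)] by simp_all
  have "g dvd tau1 g * tau1 h" by (simp flip: tP)
  hence "g dvd tau1 h"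
    by (rule dvd_mult_coprime[OF nz(1)]) (meson cop dvd_trans gP gh gA)
  then obtain u where u: "tau1 h = g * u" by blast
  have "tau1 h dvd h * g" using tP by (simp add: mult.commute)
  hence "tau1 h dvd g"
    by (rule dvd_mult_coprime[rotated]) (use tgP P0 in auto, meson cop dvd_trans gP gh gA)
  then obtain w where "g = tau1 h * w" by blast
  hence "g * (u * w) = g * 1" using u by (simp add: mult_ac)
  hence "u * w = 1" using nz by simp
  hence "u dvd 1" by (metis dvd_triv_left)
  then obtain c where c: "c \<noteq> 0" "u = const3 c" by (rule unit_homogeneous_const)
  have "h = tau1 g * const3 c" using arg_cong[OF u, of tau1] by (simp add: c)
  hence P: "hat G = const3 c * (g * tau1 g)" using gh(1) by (simp add: mult_ac)
  define s where "s = tau1 (tau2 g)"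
  have sA: "s dvd A"
  proof -
    have "tau1 (tau2 A) = A" by (simp add: A_def)
    thus ?thesis using tau_dvd(1)[OF tau_dvd(2)[OF gh(2)]] by (simp add: s_def)
  qed
  have sP: "s dvd hat G" using tau_dvd(1)[OF tau_dvd(2)[OF gP(1)]] by (simp add: s_def)
  have s0: "s \<noteq> 0" using P0 sP by auto
  have "s dvd h * g" using sP gh(1) by (simp add: mult.commute)
  hence "s dvd g"
    by (rule dvd_mult_coprime[OF s0]) (meson cop dvd_trans sP sA gh)
  then obtain w where w: "g = s * w" by blast
  have s: "s = g * tau1 (tau2 w)" using arg_cong[OF w, of "\<lambda>p. tau1 (tau2 p)"] by (simp add: s_def)
  have "g * 1 = s * w" using w by simp
  also have "\<dots> = g * tau1 (tau2 w) * w" by (subst s) (rule refl)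
  also have "\<dots> = g * (w * tau1 (tau2 w))" by (simp only: mult_ac)
  finally have w1: "w * tau1 (tau2 w) = 1" using nz(1) by (metis mult_left_cancel)
  hence "w dvd 1" by (metis dvd_triv_left)
  then obtain e where e: "w = const3 e" by (rule unit_homogeneous_const)
  \<comment> \<open>As a constant, w equals its conjugate, so its square is 1.\<close>
  have "pev (w * tau1 (tau2 w)) (0, 0, 0) = 1" by (simp only: w1 pev_1)
  hence "e * e = 1" unfolding e by simp
  hence "e = 1 \<or> e = - 1" by (simp add: square_eq_1_iff)
  moreover have "const3 1 = (1 :: 'a tpoly)" "const3 (- 1) = (- 1 :: 'a tpoly)" by (auto intro!: pev_eqI)
  ultimately have "w = 1 \<or> w = - 1" using e by auto
  hence "s = g \<or> s = - g" using w by auto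
  with P c(1) show thesis using that unfolding s_def by blast
qed

text \<open>Up to a constant, G is g times its conjugate. An even g = u + a b w yields u^2 - l1 l2
  w^2, an odd g = a u + b w yields l2 w^2 - l1 u^2. Which case occurs depends on the weight d of g,
  because t = -1 in the weighted scaling is the simultaneous sign change.\<close>

lemma splitting_form:
  assumes G: "irreducible G" "homogeneous d G" "\<not> G dvd al" and dvd: "G dvd al\<^sup>2 - l1 * l2 * be\<^sup>2"
  shows "\<exists>H1 H2. (\<exists>d1. homogeneous d1 H1) \<and> (\<exists>d2. homogeneous d2 H2) \<and>
       ((even d \<and> G = H1\<^sup>2 - l1 * l2 * H2\<^sup>2) \<or> (odd d \<and> G = l1 * H1\<^sup>2 - l2 * H2\<^sup>2))"
proof -
  obtain g c where g: "c \<noteq> 0" "hat G = const3 c * (g * tau1 g)"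
    "tau1 (tau2 g) = g \<or> tau1 (tau2 g) = - g" using hat_factor_halves[OF G(1,3) dvd] .
  have g0: "g \<noteq> 0" using G(1) g(2) by auto
  have cxy_scale: "cx (t * a) (t * b) = t\<^sup>2 * cx a b" "cy (t * a) (t * b) = t\<^sup>2 * cy a b" for t a b
    by (simp_all add: cx_def cy_def power_mult_distrib algebra_simps)
  have hat_scale: "pev (hat p) (t * a, t * b, t\<^sup>2 * z) = pev p (smul (t\<^sup>2) (cx a b, cy a b, z))" for p t a b z
    by (simp add: cxy_scale)
  \<comment> \<open>Scaling a and b by t and z by t^2 scales x, y and z by t^2, so a form of degree
    d acquires weight 2 d.\<close>
  have "whom 1 1 2 (2 * d) (hat G)"
    by (simp add: whom_def hat_scale[unfolded smul_simps] cxy_scale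
        homogeneous_pev[OF G(2), of _ "(_, _, _)", unfolded smul_simps] power_mult)
  hence "whom 1 1 2 (2 * d) (g * (const3 c * tau1 g))" using g(2) by (simp add: mult_ac)
  moreover have "g * (const3 c * tau1 g) \<noteq> 0" using g(2) G(1) by (auto simp: mult_ac)
  ultimately obtain n where n: "whom 1 1 2 n g" using whom_factor by blast
  have gn: "pev g (t * a, t * b, t\<^sup>2 * z) = t ^ n * pev g (a, b, z)" for t a b z
    using n by (simp add: whom_def)
  \<comment> \<open>g and its conjugate both have weight n, and their product has weight 2
    d.\<close>
  have "n = d"
  proof -
    have "hat G \<noteq> 0" using G(1) by auto
    then obtain v where v: "pev (hat G) v \<noteq> 0" by (rule pev_nonzero_ex)
    obtain a b z where abz: "v = (a, b, z)" by (cases v)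
    have "monom (pev (hat G) v) (2 * d) - monom (pev (hat G) v) (2 * n) = 0"
    proof (rule poly_all_zero_imp_zero[OF infinite_UNIV_alg_closed])
      fix t :: 'a
      have "t ^ (2 * n) = t ^ n * t ^ n" by (simp add: mult_2 power_add)
      hence "pev (hat G) (t * a, t * b, t\<^sup>2 * z) = t ^ (2 * n) * pev (hat G) v"
        unfolding g(2) using gn[of t a b z] gn[of t "- a" b z] by (simp add: abz mult_ac)
      moreover have "pev (hat G) (t * a, t * b, t\<^sup>2 * z) = t ^ (2 * d) * pev (hat G) v"
        unfolding hat_scale homogeneous_pev[OF G(2)] by (simp add: abz power_mult)
      ultimately show "poly (monom (pev (hat G) v) (2 * d) - monom (pev (hat G) v) (2 * n)) t = 0"
        by (auto simp: poly_monom mult_ac)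
    qed
    hence "coeff (monom (pev (hat G) v) (2 * d)) (2 * d) = coeff (monom (pev (hat G) v) (2 * n)) (2 * d)"
      by simp
    thus ?thesis using v by (auto split: if_splits)
  qed
  \<comment> \<open>The cover only shows scalings by squares, but every scalar is a square.\<close>
  have scale_hom: "\<exists>e. homogeneous e p" if p: "\<And>t v. t \<noteq> 0 \<Longrightarrow> pev p (smul (t\<^sup>2) v) = (t\<^sup>2) ^ m * pev p v" for p :: "'a tpoly" and m
  proof
    show "homogeneous m p"
    proof (rule homogeneousI)
      fix t :: 'a and v assume "t \<noteq> 0"
      obtain s where s: "s\<^sup>2 = t" using nth_root_exists[of 2] by (metis zero_less_numeral)
      with \<open>t \<noteq> 0\<close> have "s \<noteq> 0" by auto
      show "pev p (smul t v) = t ^ m * pev p v" using p[OF \<open>s \<noteq> 0\<close>, of v] unfolding s .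
    qed
  qed
  have via_cxy: "pev p (smul (t\<^sup>2) v) = r * pev p v"
    if "\<And>a b z. pev (hat p) (t * a, t * b, t\<^sup>2 * z) = r * pev (hat p) (a, b, z)" for p t r v
  proof -
    obtain x y z where v: "v = (x, y, z)" by (cases v)
    obtain a b where "x = cx a b" "y = cy a b" by (rule cxy_surj)
    thus ?thesis using that[of a b z] hat_scale[of p t a b z] by (simp add: v)
  qed
  have zero: "p = 0" if "\<And>v. pev p v = - pev p v" for p :: "'a tpoly"
  proof (rule pev_zero_imp_zero)
    fix v
    have "2 * pev p v = 0" using that[of v] by (metis add.right_inverse mult_2)
    thus "pev p v = 0" using two by simp
  qed
  have sq: "\<exists>r. r\<^sup>2 = x" for x :: 'a using nth_root_exists[of 2] by (metis zero_less_numeral)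
  from g(3) show ?thesis
  proof
    assume "tau1 (tau2 g) = g"
    then obtain u w where uw: "g = hat u + varx * vary * hat w" by (rule even_hat)
    have u2: "2 * pev (hat u) (a, b, z) = pev g (a, b, z) + pev g (- a, b, z)" for a b z by (simp add: uw)
    have w2: "2 * (a * b * pev (hat w) (a, b, z)) = pev g (a, b, z) - pev g (- a, b, z)" for a b z by (simp add: uw)
    have u: "pev (hat u) (t * a, t * b, t\<^sup>2 * z) = t ^ n * pev (hat u) (a, b, z)" for t a b z
    proof -
      have "2 * pev (hat u) (t * a, t * b, t\<^sup>2 * z) = 2 * (t ^ n * pev (hat u) (a, b, z))"
        using u2[of "t * a" "t * b" "t\<^sup>2 * z"] u2[of a b z] gn[of t a b z] gn[of t "- a" b z]
        by (simp only: distrib_left[symmetric] mult_minus_right mult.left_commute[of 2])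
      thus ?thesis using two by (metis mult_cancel_left)
    qed
    have w: "t * t * pev (hat w) (t * a, t * b, t\<^sup>2 * z) = t ^ n * pev (hat w) (a, b, z)" for t a b z
    proof -
      have "2 * ((t * a) * (t * b) * pev (hat w) (t * a, t * b, t\<^sup>2 * z)) = 2 * (t ^ n * (a * b * pev (hat w) (a, b, z)))"
        if "True" for a b z
        using w2[of "t * a" "t * b" "t\<^sup>2 * z"] w2[of a b z] gn[of t a b z] gn[of t "- a" b z]
        by (simp only: right_diff_distrib[symmetric] mult_minus_right mult.left_commute[of 2])
      hence *: "(t * a) * (t * b) * pev (hat w) (t * a, t * b, t\<^sup>2 * z) = t ^ n * (a * b * pev (hat w) (a, b, z))" for a b z
        using two by (metis mult_cancel_left)
      \<comment> \<open>The relation is known up to the factor a b. Cancelling this factor as a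
        polynomial also covers the points where it is 0.\<close>
      define p where "p = const3 (t * t) * subst3 (const3 t * varx) (const3 t * vary) (const3 (t\<^sup>2) * varz) (hat w) - const3 (t ^ n) * hat w"
      have "varx * vary * p = 0"
        by (rule pev_eqI') (use * in \<open>simp add: p_def algebra_simps\<close>)
      hence "p = 0" by (simp add: varx_def vary_def)
      hence "pev p (a, b, z) = 0" by simp
      thus ?thesis by (simp add: p_def)
    qed
    have "even d"
    proof (rule ccontr)
      assume "odd d"
      hence m: "(-1 :: 'a) ^ n = - 1" using \<open>n = d\<close> by simp
      have "pev u v = - pev u v" for v
        using via_cxy[of u "-1" "-1" v] u[of "-1"] m by simp
      moreover have "pev w v = - pev w v" for v
        using via_cxy[of w "-1" "-1" v] w[of "-1"] m by simp
      ultimately have "u = 0" "w = 0" using zero by blast+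
      thus False using uw g0 by simp
    qed
    then obtain m where m: "d = 2 * m" by blast
    have mpos: "m > 0" using irreducible_homogeneous_pos[OF G(1,2)] m by auto
    have "\<exists>e. homogeneous e u"
      by (rule scale_hom[of _ m], rule via_cxy) (use u m \<open>n = d\<close> in \<open>simp add: power_mult\<close>)
    moreover have "\<exists>e. homogeneous e w"
    proof (rule scale_hom[of _ "m - 1"], rule via_cxy)
      fix t a b z :: 'a assume t: "t \<noteq> 0"
      have "n = 2 + 2 * (m - 1)" using mpos \<open>n = d\<close> m by simp
      hence "t ^ n = t * t * (t\<^sup>2) ^ (m - 1)" by (simp only: power_add power_mult power2_eq_square)
      hence "t * t * pev (hat w) (t * a, t * b, t\<^sup>2 * z) = t * t * ((t\<^sup>2) ^ (m - 1) * pev (hat w) (a, b, z))"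
        unfolding w by (simp only: mult.assoc)
      thus "pev (hat w) (t * a, t * b, t\<^sup>2 * z) = (t\<^sup>2) ^ (m - 1) * pev (hat w) (a, b, z)"
        using t by simp
    qed
    moreover have G': "G = const3 c * (u\<^sup>2 - l1 * l2 * w\<^sup>2)"
    proof -
      have "hat G = hat (const3 c * (u\<^sup>2 - l1 * l2 * w\<^sup>2))"
        unfolding g(2) uw by (simp add: power2_eq_square algebra_simps)
      thus ?thesis by (simp only: hat_eq_iff)
    qed
    \<comment> \<open>The constant is absorbed into both forms through its square root.\<close>
    moreover obtain r where r: "c = r\<^sup>2" using sq by metis
    have "G = (const3 r * u)\<^sup>2 - l1 * l2 * (const3 r * w)\<^sup>2"
      unfolding G' r by (rule pev_eqI) (simp add: power_mult_distrib algebra_simps)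
    thus ?thesis using \<open>even d\<close> \<open>\<exists>e. homogeneous e u\<close> \<open>\<exists>e. homogeneous e w\<close> homogeneous_mult[OF homogeneous_const3]
      by blast
  next
    assume "tau1 (tau2 g) = - g"
    then obtain u w where uw: "g = varx * hat u + vary * hat w" by (rule odd_hat)
    have u2: "2 * (a * pev (hat u) (a, b, z)) = pev g (a, b, z) - pev g (- a, b, z)" for a b z by (simp add: uw)
    have w2: "2 * (b * pev (hat w) (a, b, z)) = pev g (a, b, z) + pev g (- a, b, z)" for a b z by (simp add: uw)
    have lemma_scale: "t * pev (hat p) (t * a, t * b, t\<^sup>2 * z) = t ^ n * pev (hat p) (a, b, z)"
      if "\<And>a b z. pev q (t * a, t * b, t\<^sup>2 * z) * (t * pev (hat p) (t * a, t * b, t\<^sup>2 * z)) = t * pev q (a, b, z) * (t ^ n * pev (hat p) (a, b, z))"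
        "q \<noteq> 0" "\<And>a b z. pev q (t * a, t * b, t\<^sup>2 * z) = t * pev q (a, b, z)" "t \<noteq> 0" for p q t a b z
    proof -
      define r where "r = const3 t * subst3 (const3 t * varx) (const3 t * vary) (const3 (t\<^sup>2) * varz) (hat p) - const3 (t ^ n) * hat p"
      have "q * r = 0"
        by (rule pev_eqI') (use that(1) that(3,4) in \<open>simp add: r_def algebra_simps\<close>)
      hence "r = 0" using that(2) by simp
      hence "pev r (a, b, z) = 0" by simp
      thus ?thesis by (simp add: r_def)
    qed
    have u: "t * pev (hat u) (t * a, t * b, t\<^sup>2 * z) = t ^ n * pev (hat u) (a, b, z)" if "t \<noteq> 0" for t a b z
    proof (rule lemma_scale[of varx])
      fix a b z
      have "2 * ((t * a) * pev (hat u) (t * a, t * b, t\<^sup>2 * z)) = 2 * (t ^ n * (a * pev (hat u) (a, b, z)))"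
        using u2[of "t * a" "t * b" "t\<^sup>2 * z"] u2[of a b z] gn[of t a b z] gn[of t "- a" b z]
        by (simp only: right_diff_distrib[symmetric] mult_minus_right mult.left_commute[of 2])
      hence "(t * a) * pev (hat u) (t * a, t * b, t\<^sup>2 * z) = t ^ n * (a * pev (hat u) (a, b, z))"
        using two by (metis mult_cancel_left)
      thus "pev varx (t * a, t * b, t\<^sup>2 * z) * (t * pev (hat u) (t * a, t * b, t\<^sup>2 * z)) = t * pev varx (a, b, z) * (t ^ n * pev (hat u) (a, b, z))"
        by (auto simp: algebra_simps)
    qed (use that in simp_all)
    have w: "t * pev (hat w) (t * a, t * b, t\<^sup>2 * z) = t ^ n * pev (hat w) (a, b, z)" if "t \<noteq> 0" for t a b z
    proof (rule lemma_scale[of vary])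
      fix a b z
      have "2 * ((t * b) * pev (hat w) (t * a, t * b, t\<^sup>2 * z)) = 2 * (t ^ n * (b * pev (hat w) (a, b, z)))"
        using w2[of "t * b" "t * a" "t\<^sup>2 * z"] w2[of b a z] gn[of t a b z] gn[of t "- a" b z]
        by (simp only: distrib_left[symmetric] mult_minus_right mult.left_commute[of 2])
      hence "(t * b) * pev (hat w) (t * a, t * b, t\<^sup>2 * z) = t ^ n * (b * pev (hat w) (a, b, z))"
        using two by (metis mult_cancel_left)
      thus "pev vary (t * a, t * b, t\<^sup>2 * z) * (t * pev (hat w) (t * a, t * b, t\<^sup>2 * z)) = t * pev vary (a, b, z) * (t ^ n * pev (hat w) (a, b, z))"
        by (auto simp: algebra_simps)
    qed (use that in simp_all)
    have "odd d"
    proof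
      assume "even d"
      hence m: "(-1 :: 'a) ^ n = 1" using \<open>n = d\<close> by simp
      have "pev u v = - pev u v" for v
        using via_cxy[of u "-1" "-1" v] u[of "-1"] m by (simp add: minus_equation_iff)
      moreover have "pev w v = - pev w v" for v
        using via_cxy[of w "-1" "-1" v] w[of "-1"] m by (simp add: minus_equation_iff)
      ultimately have "u = 0" "w = 0" using zero by blast+
      thus False using uw g0 by simp
    qed
    then obtain m where m: "d = 2 * m + 1" by (rule oddE)
    have hom: "\<exists>e. homogeneous e p"
      if p: "\<And>t a b z. t \<noteq> 0 \<Longrightarrow> t * pev (hat p) (t * a, t * b, t\<^sup>2 * z) = t ^ n * pev (hat p) (a, b, z)" for p
    proof (rule scale_hom[of _ m], rule via_cxy)
      fix t a b z :: 'a assume t: "t \<noteq> 0"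
      have "t * pev (hat p) (t * a, t * b, t\<^sup>2 * z) = t * ((t\<^sup>2) ^ m * pev (hat p) (a, b, z))"
        unfolding p[OF t] using \<open>n = d\<close> m by (simp add: mult_ac flip: power_mult)
      thus "pev (hat p) (t * a, t * b, t\<^sup>2 * z) = (t\<^sup>2) ^ m * pev (hat p) (a, b, z)"
        using t by simp
    qed
    have hu: "\<exists>e. homogeneous e u" and hw: "\<exists>e. homogeneous e w" using hom u w by blast+
    have G': "G = const3 c * (l2 * w\<^sup>2 - l1 * u\<^sup>2)"
    proof -
      have "hat G = hat (const3 c * (l2 * w\<^sup>2 - l1 * u\<^sup>2))"
        unfolding g(2) uw by (simp add: power2_eq_square algebra_simps)
      thus ?thesis by (simp only: hat_eq_iff)
    qed
    obtain r where "r\<^sup>2 = - c" using sq by blast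
    hence c: "c = - r\<^sup>2" by simp
    have "G = l1 * (const3 r * u)\<^sup>2 - l2 * (const3 r * w)\<^sup>2"
      unfolding G' c by (rule pev_eqI) (simp add: power_mult_distrib algebra_simps)
    thus ?thesis using \<open>odd d\<close> hu hw homogeneous_mult[OF homogeneous_const3] by blast
  qed
qed

end

subsection \<open>The conic and its incidence surface\<close>

lemma comm_ring_hom_const33: "comm_ring_hom (\<lambda>c. const3 (const3 c))"
  by unfold_locales (simp_all add: const3_def)

lemma bev_const3 [simp]: "bev (const3 p) v w = pev p v"
  using bev_lift1 by (simp add: lift1_def)

lemma bev_W_eq1: "bev (W_eq1 F) (x, y, z) (X, Y, Z) = pev F (z * X - x * Z, z * Y - y * Z, z * Z)"
proof -
  have "bev (eval3 (map3 (\<lambda>c. const3 (const3 c)) F) a b c) v w = pev F (bev a v w, bev b v w, bev c v w)"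
    for a b c v w
    by (induction F rule: tpoly_induct)
      (simp_all add: map3_hom[OF comm_ring_hom_const33])
  thus ?thesis by (simp add: W_eq1_def)
qed

lemma bev_W_eq2: "bev W_eq2 (x, y, z) (X, Y, Z) = x * Y - y * X"
  by (simp add: W_eq2_def)

lemma W_surface_iff: "(v, w) \<in> W_surface F \<longleftrightarrow>
    v \<noteq> (0, 0, 0) \<and> w \<noteq> (0, 0, 0) \<and> bev (W_eq1 F) v w = 0 \<and> bev W_eq2 v w = 0"
proof -
  have "W_eq1 F \<in> W_ideal F" "W_eq2 \<in> W_ideal F"
    unfolding W_ideal_def by (metis (mono_tags, lifting) add_0_right mem_Collect_eq mult_1 mult_zero_left)
      (metis (mono_tags, lifting) add_0 mem_Collect_eq mult_1 mult_zero_left)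
  moreover have "bev f v w = 0" if "f \<in> W_ideal F" "bev (W_eq1 F) v w = 0" "bev W_eq2 v w = 0" for f
    using that by (auto simp: W_ideal_def)
  ultimately show ?thesis by (auto simp: W_surface_def)
qed

text \<open>
  The conic is normalised to \<open>\<epsilon> (q - z\<^sup>2)\<close> with \<open>q = \<mu> \<ell>\<^sub>1 \<ell>\<^sub>2\<close>.  If \<open>s\<^sup>2 = q(x, y)\<close>, then \<open>s\<close> plays the role
  of the distance from \<open>A\<close>, and \<open>psi s v\<close> is one of the two points of the conchoid on the line \<open>Av\<close>.
\<close>

locale conic = two_lines a1 b1 a2 b2 for a1 b1 a2 b2 :: "'a::alg_closed_field" +
  fixes \<epsilon> \<mu> :: 'a
  assumes eps: "\<epsilon> \<noteq> 0" and mu: "\<mu> \<noteq> 0"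
begin

definition qf :: "'a \<Rightarrow> 'a \<Rightarrow> 'a" where "qf x y = \<mu> * ((a1 * x + b1 * y) * (a2 * x + b2 * y))"
definition q :: "'a tpoly" where "q = const3 \<mu> * (l1 * l2)"
definition F :: "'a tpoly" where "F = const3 \<epsilon> * (q - varz\<^sup>2)"
text \<open>At the image, q takes the value ((s + z) s)^2 and the last coordinate is s z, so s / z
  becomes s / z + 1 while the direction from A is kept. On a line through A this adds 1 / s to 1 /
  z.\<close>

definition psi :: "'a \<Rightarrow> 'a vec3 \<Rightarrow> 'a vec3" where
  "psi s v = (case v of (x, y, z) \<Rightarrow> ((s + z) * x, (s + z) * y, s * z))"

lemma psi_simp [simp]: "psi s (x, y, z) = ((s + z) * x, (s + z) * y, s * z)"
  by (simp add: psi_def)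

lemma pev_l [simp]: "pev l1 (x, y, z) = a1 * x + b1 * y" "pev l2 (x, y, z) = a2 * x + b2 * y"
  by (simp_all add: l1_def l2_def)

lemma pev_q [simp]: "pev q (x, y, z) = qf x y"
  by (simp add: q_def qf_def)

lemma pev_F [simp]: "pev F (x, y, z) = \<epsilon> * (qf x y - z\<^sup>2)"
  by (simp add: F_def)

lemma qf_scale [simp]: "qf (t * x) (t * y) = t\<^sup>2 * qf x y"
  by (simp add: qf_def power2_eq_square algebra_simps)

lemma qf_0 [simp]: "qf 0 0 = 0" by (simp add: qf_def)

lemma l_nonzero: "l1 \<noteq> 0" "l2 \<noteq> 0"
  using det by (auto simp: l1_def l2_def)

lemma l_homogeneous [simp]: "homogeneous (Suc 0) l1" "homogeneous (Suc 0) l2"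
  by (simp_all add: l1_def l2_def)

lemma l_irreducible: "irreducible l1" "irreducible l2"
  using l_nonzero by (auto intro: irreducible_linform)

lemma homogeneous_q [simp]: "homogeneous 2 q"
  by (auto simp: homogeneous_iff)

lemma homogeneous_F [simp]: "homogeneous 2 F"
  by (auto simp: homogeneous_iff power_mult_distrib algebra_simps)

lemma psi_scale: "psi (t * s) (smul t v) = smul (t\<^sup>2) (psi s v)"
  by (cases v) (simp add: power2_eq_square algebra_simps)

lemma sqrt_ex: obtains s where "s\<^sup>2 = (r::'a)"
  using nth_root_exists[of 2 r] by auto

text \<open>In a product of two linear forms the terms linear in z must cancel, which makes the
  parts in x and y proportional and q a multiple of a square. But q vanishes on two different
  lines.\<close>

lemma q_irreducible_aux:
  assumes c: "c \<noteq> 0"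
  shows "irreducible (q - const3 c * varz\<^sup>2)" (is "irreducible ?K")
proof -
  have ev: "pev ?K (x, y, z) = qf x y - c * z\<^sup>2" for x y z by simp
  have hom: "homogeneous 2 ?K" by (auto simp: homogeneous_iff power_mult_distrib algebra_simps)
  have K0: "?K \<noteq> 0"
  proof
    assume "?K = 0"
    hence "pev ?K (0, 0, 1) = 0" by (simp only: pev_0)
    thus False using c unfolding ev by simp
  qed
  show ?thesis
  proof (rule irreducibleI)
    show "\<not> ?K dvd 1"
    proof
      assume "?K dvd 1"
      then obtain d where "?K = const3 d" by (rule unit_homogeneous_const)
      hence "homogeneous 0 ?K" by simp
      thus False using homogeneous_unique[OF hom _ K0] by fastforce
    qed
  next
    fix a b assume ab: "?K = a * b"
    have nz: "a \<noteq> 0" "b \<noteq> 0" using ab K0 by auto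
    obtain i j where ij: "homogeneous i a" "homogeneous j b" "i + j = 2"
      using homogeneous_factor[of 2 a b] hom K0 unfolding ab by blast
    have unit: "p dvd 1" if "homogeneous 0 p" "p \<noteq> 0" for p :: "'a tpoly"
    proof -
      from that(1) obtain d where "p = const3 d" by (rule homogeneous_0_const)
      thus ?thesis using that(2) const3_dvd_1[of d] by (auto simp: const3_def)
    qed
    consider "i = 0" | "j = 0" | "i = 1" "j = 1" using ij(3) by linarith
    thus "a dvd 1 \<or> b dvd 1"
    proof cases
      case 3
      hence ij1: "homogeneous (Suc 0) a" "homogeneous (Suc 0) b" using ij by auto
      obtain c1 c2 c3 where a: "a = linform c1 c2 c3" using ij1(1) by (rule homogeneous_1_linform)
      obtain d1 d2 d3 where b: "b = linform d1 d2 d3" using ij1(2) by (rule homogeneous_1_linform)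
      have e: "(c1 * x + c2 * y + c3 * z) * (d1 * x + d2 * y + d3 * z) = qf x y - c * z\<^sup>2" for x y z
        using arg_cong[OF ab, of "\<lambda>p. pev p (x, y, z)"] by (simp add: a b)
      have cd: "c3 * d3 = - c" using e[of 0 0 1] by simp
      hence c3: "c3 \<noteq> 0" using c by auto
      \<comment> \<open>The difference of the values at z = 1 and z = -1 isolates twice the part
        linear in z.\<close>
      have lin: "(c1 * x + c2 * y) * d3 + (d1 * x + d2 * y) * c3 = 0" for x y
      proof -
        have e': "(c1 * x + c2 * y + c3) * (d1 * x + d2 * y + d3) = qf x y - c"
          "(c1 * x + c2 * y - c3) * (d1 * x + d2 * y - d3) = qf x y - c"
          using e[of x y 1] e[of x y "-1"] by simp_all
        have "2 * ((c1 * x + c2 * y) * d3 + (d1 * x + d2 * y) * c3) =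
            (c1 * x + c2 * y + c3) * (d1 * x + d2 * y + d3) - (c1 * x + c2 * y - c3) * (d1 * x + d2 * y - d3)"
          by (simp add: algebra_simps)
        hence "2 * ((c1 * x + c2 * y) * d3 + (d1 * x + d2 * y) * c3) = 0" unfolding e' by simp
        thus ?thesis using two by (metis mult_eq_0_iff)
      qed
      have sq: "qf x y * c3 = - d3 * (c1 * x + c2 * y)\<^sup>2" for x y
      proof -
        have "qf x y * c3 = (c1 * x + c2 * y) * ((d1 * x + d2 * y) * c3)" using e[of x y 0] by (simp add: mult_ac)
        also have "(d1 * x + d2 * y) * c3 = - ((c1 * x + c2 * y) * d3)" using lin[of x y] by (simp add: eq_neg_iff_add_eq_0 add.commute)
        finally show ?thesis by (simp add: power2_eq_square algebra_simps)
      qed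
      have d3: "d3 \<noteq> 0" using cd c by auto
      have "qf b1 (- a1) = 0" "qf b2 (- a2) = 0" by (simp_all add: qf_def)
      hence "c1 * b1 - c2 * a1 = 0" "c1 * b2 - c2 * a2 = 0" using sq[of b1 "- a1"] sq[of b2 "- a2"] d3 by simp_all
      \<comment> \<open>The linear form vanishes in the directions of both lines, hence at their
        sum, where q does not vanish.\<close>
      hence "c1 * (b1 + b2) + c2 * (- a1 - a2) = 0" by (simp add: algebra_simps)
      hence "qf (b1 + b2) (- a1 - a2) = 0" using sq[of "b1 + b2" "- a1 - a2"] c3 by simp
      moreover have "qf (b1 + b2) (- a1 - a2) = - \<mu> * (a1 * b2 - a2 * b1)\<^sup>2"
        by (simp add: qf_def power2_eq_square algebra_simps)
      ultimately show ?thesis using mu det by simp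
    qed (use ij unit nz in auto)
  qed fact
qed

lemma F_irreducible: "irreducible F"
proof -
  have "irreducible (q - const3 1 * varz\<^sup>2)" by (rule q_irreducible_aux) simp
  hence K: "irreducible (q - varz\<^sup>2)" by (simp add: const3_def)
  have u: "const3 \<epsilon> dvd 1" using eps by (rule const3_dvd_1)
  show ?thesis unfolding F_def
  proof (rule irreducibleI)
    show "const3 \<epsilon> * (q - varz\<^sup>2) \<noteq> 0" using K eps by (auto simp: const3_def irreducible_def)
    show "\<not> const3 \<epsilon> * (q - varz\<^sup>2) dvd 1" using K dvd_mult_right irreducible_def by blast
    fix a b assume ab: "const3 \<epsilon> * (q - varz\<^sup>2) = a * b"
    have "q - varz\<^sup>2 = const3 (inverse \<epsilon>) * (const3 \<epsilon> * (q - varz\<^sup>2))"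
      by (rule pev_eqI) (use eps in simp)
    hence "q - varz\<^sup>2 = (const3 (inverse \<epsilon>) * a) * b" by (simp only: ab mult.assoc)
    hence "const3 (inverse \<epsilon>) * a dvd 1 \<or> b dvd 1" by (rule irreducibleD[OF K])
    thus "a dvd 1 \<or> b dvd 1" using dvd_mult_right by blast
  qed
qed

lemma bev_W1: "bev (W_eq1 F) (x, y, z) (X, Y, Z) = \<epsilon> * (qf (z * X - x * Z) (z * Y - y * Z) - (z * Z)\<^sup>2)"
  by (simp add: bev_W_eq1)

text \<open>With (x, y) = t (X, Y) the incidence equation becomes (z - t Z)^2 q(w) = (z Z)^2, and
  the condition on w keeps t, z and z - t Z away from 0.\<close>

lemma W_generic:
  assumes W: "(v, w) \<in> W_surface F" and w: "pev (F * q * varz) w \<noteq> 0"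
  obtains s k where "s\<^sup>2 = pev q v" "k \<noteq> 0" "w = smul k (psi s v)"
proof -
  obtain x y z where v: "v = (x, y, z)" by (cases v)
  obtain X Y Z where w': "w = (X, Y, Z)" by (cases w)
  have nz: "qf X Y - Z\<^sup>2 \<noteq> 0" "qf X Y \<noteq> 0" "Z \<noteq> 0" using w by (auto simp: w')
  have e: "qf (z * X - x * Z) (z * Y - y * Z) = (z * Z)\<^sup>2" "x * Y = y * X" "v \<noteq> (0, 0, 0)"
    using W eps by (auto simp: W_surface_iff v w' bev_W1 bev_W_eq2)
  have XY: "X \<noteq> 0 \<or> Y \<noteq> 0" using nz(2) by auto
  obtain t where t: "x = t * X" "y = t * Y"
  proof (cases "X = 0")
    case False
    thus thesis using that[of "x / X"] e(2) by (simp add: field_simps)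
  next
    case True
    thus thesis using that[of "y / Y"] e(2) XY by (simp add: field_simps)
  qed
  have "qf (z * X - x * Z) (z * Y - y * Z) = qf ((z - t * Z) * X) ((z - t * Z) * Y)"
    by (simp add: t algebra_simps)
  hence e1: "(z - t * Z)\<^sup>2 * qf X Y = (z * Z)\<^sup>2" using e(1) by (simp only: qf_scale)
  have t0: "t \<noteq> 0"
  proof
    assume "t = 0"
    hence "z \<noteq> 0" using e(3) v t by auto
    thus False using e1 nz(1) \<open>t = 0\<close> by (simp add: power_mult_distrib)
  qed
  have z0: "z \<noteq> 0"
  proof
    assume "z = 0"
    thus False using e1 nz t0 by simp
  qed
  \<comment> \<open>The solution of s z = (s + z) t Z, which compares the last coordinates of
    \<open>psi s v\<close> and of a multiple of w. The case z = t Z is ruled out next.\<close>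
  define s where "s = (if z = t * Z then 0 else t * z * Z / (z - t * Z))"
  have zt: "z - t * Z \<noteq> 0"
  proof
    assume "z - t * Z = 0"
    thus False using e1 z0 nz(3) by simp
  qed
  have s_eq: "s * (z - t * Z) = t * z * Z" using zt by (simp add: s_def)
  have "s\<^sup>2 * (z - t * Z)\<^sup>2 = t\<^sup>2 * qf X Y * (z - t * Z)\<^sup>2"
    using e1 by (simp add: power_mult_distrib[symmetric] s_eq) (simp add: power_mult_distrib mult_ac)
  hence "s\<^sup>2 = pev q v" using zt by (simp add: v t)
  have s0: "s \<noteq> 0" using s_eq t0 z0 nz(3) by auto
  have sz: "s * z = (s + z) * t * Z" using s_eq by (simp add: algebra_simps)
  have k0: "(s + z) * t \<noteq> 0" using sz s0 z0 by auto
  define k where "k = (s + z) * t"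
  have "psi s v = smul k w" using sz by (simp add: v w' t k_def algebra_simps)
  moreover have "k \<noteq> 0" using k0 by (simp add: k_def)
  ultimately have "w = smul (inverse k) (psi s v)" by simp
  with \<open>s\<^sup>2 = pev q v\<close> \<open>k \<noteq> 0\<close> show thesis using that[of s "inverse k"] by simp
qed

text \<open>\<open>psi s v\<close> is linear in s, and s^2 can be replaced by q, so only an even and
  an odd part remain.\<close>

lemma psi_split:
  "\<exists>al be. \<forall>x y z s. s\<^sup>2 = qf x y \<longrightarrow> pev p (psi s (x, y, z)) = pev al (x, y, z) + s * pev be (x, y, z)"
proof (induction p rule: tpoly_induct)
  case (const c)
  show ?case by (rule exI[of _ "const3 c"], rule exI[of _ 0]) simp
next
  case x
  show ?case by (rule exI[of _ "varz * varx"], rule exI[of _ varx]) (simp add: algebra_simps)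
next
  case y
  show ?case by (rule exI[of _ "varz * vary"], rule exI[of _ vary]) (simp add: algebra_simps)
next
  case z
  show ?case by (rule exI[of _ 0], rule exI[of _ varz]) simp
next
  case (add p p')
  then obtain al be al' be' where *: "\<And>x y z s. s\<^sup>2 = qf x y \<Longrightarrow> pev p (psi s (x, y, z)) = pev al (x, y, z) + s * pev be (x, y, z)"
    "\<And>x y z s. s\<^sup>2 = qf x y \<Longrightarrow> pev p' (psi s (x, y, z)) = pev al' (x, y, z) + s * pev be' (x, y, z)" by blast
  show ?case
    by (rule exI[of _ "al + al'"], rule exI[of _ "be + be'"]) (simp add: * algebra_simps del: psi_simp)
next
  case (mult p p')
  then obtain al be al' be' where *: "\<And>x y z s. s\<^sup>2 = qf x y \<Longrightarrow> pev p (psi s (x, y, z)) = pev al (x, y, z) + s * pev be (x, y, z)"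
    "\<And>x y z s. s\<^sup>2 = qf x y \<Longrightarrow> pev p' (psi s (x, y, z)) = pev al' (x, y, z) + s * pev be' (x, y, z)" by blast
  show ?case
    by (rule exI[of _ "al * al' + q * be * be'"], rule exI[of _ "al * be' + be * al'"])
      (simp add: * del: psi_simp, simp add: algebra_simps power2_eq_square flip: power2_eq_square)
qed

lemma irreducible_dvd_zeros_eq:
  fixes p r :: "'a tpoly"
  assumes "irreducible p" "irreducible r" "p dvd r"
  shows "zeros p = zeros r"
proof -
  obtain c where "c \<noteq> 0" "r = const3 c * p" by (rule irreducible_dvd_irreducible[OF assms])
  thus ?thesis by (auto simp: zeros_def)
qed

text \<open>B, the two lines and the line at infinity. If w avoids these curves, every point (v, w)
  of the incidence surface has the form of \<open>W_generic\<close>.\<close>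

definition exceptional :: "'a tpoly" where "exceptional = F * q * varz"

lemma homogeneous_exceptional: "homogeneous 5 exceptional"
  using homogeneous_mult[OF homogeneous_mult[OF homogeneous_F homogeneous_q] homogeneous_vars(3)]
  by (simp add: exceptional_def)

lemma not_dvd_exceptional:
  assumes p: "irreducible p" "homogeneous d p"
    "zeros p \<noteq> zeros F" "zeros p \<noteq> zeros l1" "zeros p \<noteq> zeros l2" "zeros p \<noteq> zeros varz"
  shows "\<not> p dvd exceptional"
proof
  assume "p dvd exceptional"
  hence "p dvd F * (const3 \<mu> * (l1 * l2)) * varz" by (simp add: exceptional_def q_def)
  moreover have prime: "prime_elem p" using p(1) by simp
  ultimately have "p dvd F \<or> p dvd const3 \<mu> \<or> p dvd l1 \<or> p dvd l2 \<or> p dvd varz"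
    by (simp only: prime_elem_dvd_mult_iff) blast
  moreover have "\<not> p dvd const3 \<mu>"
    using p(1) const3_dvd_1[OF mu] dvd_trans unfolding irreducible_def by blast
  moreover have "\<not> p dvd r" if r: "irreducible r" "zeros p \<noteq> zeros r" for r
    using irreducible_dvd_zeros_eq[OF p(1) r(1)] r(2) by blast
  moreover have "irreducible (varz :: 'a tpoly)" by (rule irreducible_linform) simp_all
  ultimately show False using F_irreducible l_irreducible p by blast
qed

text \<open>What remains of being a component of the conchoid when multiplicities are forgotten. It
  is enough for deducing the splitting form from reducibility.\<close>

definition covered :: "'a tpoly \<Rightarrow> 'a vec3 set \<Rightarrow> bool" where
  "covered G E \<longleftrightarrow> (\<forall>w\<in>E. \<exists>v\<in>zeros G. (v, w) \<in> W_surface F)"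

text \<open>The norm is the product of the values of p at \<open>psi s v\<close> and
  \<open>psi (- s) v\<close>. Scaling v and s by t scales both points by t^2, which gives degree 2 e
  + 2 e. The parts al and be are not known to be forms themselves.\<close>

lemma psi_norm_homogeneous:
  assumes p: "homogeneous e p"
    and ab: "\<And>x y z s. s\<^sup>2 = qf x y \<Longrightarrow> pev p (psi s (x, y, z)) = pev al (x, y, z) + s * pev be (x, y, z)"
  shows "homogeneous (4 * e) (al\<^sup>2 - q * be\<^sup>2)"
proof (rule homogeneousI)
  fix t :: 'a and v :: "'a vec3"
  obtain x y z where v: "v = (x, y, z)" by (cases v)
  obtain s where s: "s\<^sup>2 = qf x y" by (rule sqrt_ex)
  have M: "pev (al\<^sup>2 - q * be\<^sup>2) (x, y, z) = pev p (psi s (x, y, z)) * pev p (psi (- s) (x, y, z))"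
    if "s\<^sup>2 = qf x y" for x y z s
  proof -
    have e: "pev p (psi s (x, y, z)) = pev al (x, y, z) + s * pev be (x, y, z)"
      "pev p (psi (- s) (x, y, z)) = pev al (x, y, z) - s * pev be (x, y, z)"
      using ab[of s x y z] ab[of "- s" x y z] that by simp_all
    show ?thesis unfolding e by (simp add: algebra_simps power2_eq_square flip: that)
  qed
  have s': "(t * s)\<^sup>2 = qf (t * x) (t * y)" by (simp add: power_mult_distrib s)
  have "pev (al\<^sup>2 - q * be\<^sup>2) (smul t v) = pev p (psi (t * s) (smul t v)) * pev p (psi (t * (- s)) (smul t v))"
    using M[OF s', of "t * z"] by (simp add: v del: psi_simp)
  also have "\<dots> = (t\<^sup>2) ^ e * (t\<^sup>2) ^ e * (pev p (psi s v) * pev p (psi (- s) v))"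
    unfolding psi_scale homogeneous_pev[OF p] by simp
  also have "pev p (psi s v) * pev p (psi (- s) v) = pev (al\<^sup>2 - q * be\<^sup>2) v"
    using M[OF s, of z] by (simp add: v del: psi_simp)
  also have "(t\<^sup>2) ^ e * (t\<^sup>2) ^ e = t ^ (4 * e)" by (simp flip: power_mult power_add)
  finally show "pev (al\<^sup>2 - q * be\<^sup>2) (smul t v) = t ^ (4 * e) * pev (al\<^sup>2 - q * be\<^sup>2) v" .
qed

text \<open>Otherwise the norm has only finitely many zeros on the curve. Off the exceptional locus,
  each point of the covered curve is one of at most two points over such a zero, so the covered
  curve would be finite.\<close>

lemma covered_dvd_norm:
  assumes G: "irreducible G" "homogeneous d G" and p: "irreducible p" "homogeneous e p" "\<not> p dvd exceptional"
    and cov: "covered G (zeros p)"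
    and ab: "\<And>x y z s. s\<^sup>2 = qf x y \<Longrightarrow> pev p (psi s (x, y, z)) = pev al (x, y, z) + s * pev be (x, y, z)"
  shows "G dvd al\<^sup>2 - q * be\<^sup>2" (is "G dvd ?M")
proof (rule ccontr)
  assume "\<not> G dvd ?M"
  hence fin: "finite (ppoint ` (zeros G \<inter> zeros ?M))"
    using G psi_norm_homogeneous[OF p(2) ab] finite_common_zeros by blast
  let ?X = "zeros G \<inter> zeros ?M"
  let ?R = "\<lambda>P. {ppoint (psi s v) |s v. v \<in> P \<and> s\<^sup>2 = pev q v}"
  have finR: "finite (?R (ppoint v))" for v
  proof -
    obtain s where s: "s\<^sup>2 = pev q v" by (rule sqrt_ex)
    have "?R (ppoint v) \<subseteq> {ppoint (psi s v), ppoint (psi (- s) v)}"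
    proof
      fix P assume "P \<in> ?R (ppoint v)"
      then obtain s' u where u: "P = ppoint (psi s' u)" "u \<in> ppoint v" "s'\<^sup>2 = pev q u" by blast
      then obtain c where c: "c \<noteq> 0" "u = smul c v" by (auto simp: ppoint_altdef)
      have "s'\<^sup>2 = (c * s)\<^sup>2"
        unfolding u(3) c(2) by (simp add: homogeneous_pev[OF homogeneous_q] s power_mult_distrib)
      hence "s' = c * s \<or> s' = c * (- s)" by (simp add: power2_eq_iff)
      thus "P \<in> {ppoint (psi s v), ppoint (psi (- s) v)}"
        unfolding u(1) c(2) using c(1) by (auto simp: psi_scale simp del: mult_minus_right)
    qed
    thus ?thesis by (rule finite_subset) simp
  qed
  have "ppoint ` {w \<in> zeros p. pev exceptional w \<noteq> 0} \<subseteq> (\<Union>P\<in>ppoint ` ?X. ?R P)"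
  proof
    fix P assume "P \<in> ppoint ` {w \<in> zeros p. pev exceptional w \<noteq> 0}"
    then obtain w where w: "P = ppoint w" "w \<in> zeros p" "pev (F * q * varz) w \<noteq> 0" by (auto simp: exceptional_def)
    obtain v where v: "v \<in> zeros G" "(v, w) \<in> W_surface F" using cov w(2) by (auto simp: covered_def)
    obtain s k where sk: "s\<^sup>2 = pev q v" "k \<noteq> 0" "w = smul k (psi s v)" using W_generic[OF v(2) w(3)] .
    have "pev p (psi s v) = 0"
      using w(2) sk(2) by (simp add: in_zeros sk(3) homogeneous_pev[OF p(2)])
    moreover obtain x y z where xyz: "v = (x, y, z)" by (cases v)
    ultimately have "pev al v + s * pev be v = 0" using ab[of s x y z] sk(1) by (simp del: psi_simp)
    hence "pev al v = - (s * pev be v)" by (simp add: add_eq_0_iff2)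
    hence "pev ?M v = 0" using sk(1) by (simp add: power_mult_distrib)
    hence "v \<in> ?X" using v(1) by (simp add: in_zeros)
    moreover have "P \<in> ?R (ppoint v)"
      by (intro CollectI exI[of _ s] exI[of _ v]) (use w(1) sk in simp)
    ultimately show "P \<in> (\<Union>P\<in>ppoint ` ?X. ?R P)" by blast
  qed
  moreover have "finite (\<Union>P\<in>ppoint ` ?X. ?R P)" by (rule finite_UN_I[OF fin]) (use finR in blast)
  ultimately show False
    using infinite_zeros_minus[OF p(1,2) homogeneous_exceptional p(3)] finite_subset by blast
qed

lemma covered_unique:
  assumes p: "irreducible p" "homogeneous e p"
    and p': "irreducible p'" "homogeneous e' p'" "\<not> p' dvd exceptional"
    and cov: "covered G (zeros p')"
    and ab: "\<And>x y z s. s\<^sup>2 = qf x y \<Longrightarrow> pev p (psi s (x, y, z)) = pev al (x, y, z) + s * pev be (x, y, z)"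
    and G: "G dvd al" "G dvd be"
  shows "zeros p' = zeros p"
proof -
  have "p' dvd p * exceptional"
  proof (rule irreducible_dvdI[OF p'(1,2) homogeneous_mult[OF p(2) homogeneous_exceptional]])
    fix w assume w: "w \<in> zeros p'"
    show "pev (p * exceptional) w = 0"
    proof (cases "pev exceptional w = 0")
      case False
      hence ex: "pev (F * q * varz) w \<noteq> 0" by (simp add: exceptional_def)
      obtain v where v: "v \<in> zeros G" "(v, w) \<in> W_surface F" using cov w by (auto simp: covered_def)
      obtain s k where sk: "s\<^sup>2 = pev q v" "k \<noteq> 0" "w = smul k (psi s v)" using W_generic[OF v(2) ex] .
      obtain x y z where xyz: "v = (x, y, z)" by (cases v)
      have "pev al v = 0" "pev be v = 0" using v(1) G by (auto simp: in_zeros dest: dvd_imp_pev_eq_0)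
      hence "pev p (psi s v) = 0" using ab[of s x y z] sk(1) by (simp add: xyz del: psi_simp)
      thus ?thesis by (simp add: sk(3) homogeneous_pev[OF p(2)])
    qed simp
  qed
  hence "p' dvd p" using p'(1,3) by (simp add: prime_elem_dvd_mult_iff)
  then obtain c where "c \<noteq> 0" "p = const3 c * p'" by (rule irreducible_dvd_irreducible[OF p'(1) p(1)])
  thus ?thesis by (auto simp: zeros_def)
qed

lemma varz_irreducible: "irreducible (varz :: 'a tpoly)"
  by (rule irreducible_linform) simp_all

text \<open>The line at infinity is not reached by the argument with \<open>psi\<close>. Over a
  point w at infinity off both lines, the incidence equations force z = 0 and make v and w the same
  point, so this line can only lie over itself; \<open>covered_by_Linf\<close> treats the
  converse.\<close>

lemma covered_Linf:
  assumes G: "irreducible G" "homogeneous d G" and cov: "covered G (zeros varz)"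
  shows "zeros G = zeros varz"
proof -
  have "varz dvd q * G"
  proof (rule irreducible_dvdI[OF varz_irreducible homogeneous_vars(3) homogeneous_mult[OF homogeneous_q G(2)]])
    fix w :: "'a vec3" assume w: "w \<in> zeros varz"
    obtain X Y Z where w': "w = (X, Y, Z)" by (cases w)
    have Z: "Z = 0" using w by (simp add: in_zeros w')
    show "pev (q * G) w = 0"
    proof (cases "qf X Y = 0")
      case False
      obtain v where v: "v \<in> zeros G" "(v, w) \<in> W_surface F" using cov w by (auto simp: covered_def)
      obtain x y z where v': "v = (x, y, z)" by (cases v)
      have e: "z\<^sup>2 * qf X Y = 0" "x * Y = y * X"
        using v(2) eps by (auto simp: W_surface_iff v' w' Z bev_W1 bev_W_eq2)
      have z: "z = 0" using e(1) False by simp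
      have XY: "X \<noteq> 0 \<or> Y \<noteq> 0" using False by auto
      obtain t where t: "x = t * X" "y = t * Y"
      proof (cases "X = 0")
        case False
        thus thesis using that[of "x / X"] e(2) by (simp add: field_simps)
      next
        case True
        thus thesis using that[of "y / Y"] e(2) XY by (simp add: field_simps)
      qed
      have "v = smul t w" by (simp add: v' w' t z Z)
      hence "t ^ d * pev G w = 0" "t \<noteq> 0" using v(1) homogeneous_pev[OF G(2), of t w] by (auto simp: in_zeros)
      thus ?thesis by simp
    qed (simp add: w')
  qed
  hence "varz dvd q \<or> varz dvd G" using varz_irreducible by (simp add: prime_elem_dvd_mult_iff)
  moreover have "\<not> varz dvd q"
  proof
    assume "varz dvd q"
    hence "pev q (b1 + b2, - a1 - a2, 0) = 0" by (rule dvd_imp_pev_eq_0) simp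
    moreover have "qf (b1 + b2) (- a1 - a2) = - \<mu> * (a1 * b2 - a2 * b1)\<^sup>2"
      by (simp add: qf_def power2_eq_square algebra_simps)
    ultimately show False using mu det by simp
  qed
  ultimately show ?thesis using irreducible_dvd_zeros_eq[OF varz_irreducible G(1)] by simp
qed

lemma covered_by_Linf:
  assumes p: "irreducible p" "homogeneous e p" and cov: "covered G (zeros p)" and G: "zeros G = zeros varz"
    and ne: "zeros p \<noteq> zeros l1" "zeros p \<noteq> zeros l2"
  shows "zeros p = zeros varz"
proof -
  have "p dvd q * varz"
  proof (rule irreducible_dvdI[OF p homogeneous_mult[OF homogeneous_q homogeneous_vars(3)]])
    fix w assume w: "w \<in> zeros p"
    obtain X Y Z where w': "w = (X, Y, Z)" by (cases w)
    obtain v where v: "v \<in> zeros G" "(v, w) \<in> W_surface F" using cov w by (auto simp: covered_def)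
    obtain x y z where v': "v = (x, y, z)" by (cases v)
    have z: "z = 0" using v(1) G v' by (auto simp: in_zeros)
    have e: "qf (- (x * Z)) (- (y * Z)) = 0" "x * Y = y * X" "v \<noteq> (0, 0, 0)"
      using v(2) eps by (auto simp: W_surface_iff v' w' z bev_W1 bev_W_eq2)
    have "qf (- (x * Z)) (- (y * Z)) = Z\<^sup>2 * qf x y" using qf_scale[of "- Z" x y] by (simp add: mult_ac)
    hence "Z = 0 \<or> qf x y = 0" using e(1) by simp
    moreover have "qf X Y = 0" if "qf x y = 0"
    proof -
      have xy: "x \<noteq> 0 \<or> y \<noteq> 0" using e(3) v' z by auto
      obtain t where t: "X = t * x" "Y = t * y"
      proof (cases "x = 0")
        case False
        thus thesis using that[of "X / x"] e(2) by (simp add: field_simps)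
      next
        case True
        thus thesis using that[of "Y / y"] e(2) xy by (simp add: field_simps)
      qed
      thus ?thesis using that by simp
    qed
    ultimately show "pev (q * varz) w = 0" by (auto simp: w')
  qed
  hence "p dvd const3 \<mu> \<or> p dvd l1 \<or> p dvd l2 \<or> p dvd varz"
    unfolding q_def using p(1) by (simp add: prime_elem_dvd_mult_iff)
  moreover have "\<not> p dvd const3 \<mu>"
    using p(1) const3_dvd_1[OF mu] dvd_trans unfolding irreducible_def by blast
  ultimately show ?thesis
    using irreducible_dvd_zeros_eq[OF p(1)] ne l_irreducible varz_irreducible by blast
qed

lemma two_covered_imp_splitting:
  assumes G: "irreducible G" "homogeneous d G" "\<not> G dvd l1" "\<not> G dvd l2"
    and E: "irred_curve closed1 E" "covered G E" "E \<noteq> zeros F" "E \<noteq> zeros l1" "E \<noteq> zeros l2"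
    and E': "irred_curve closed1 E'" "covered G E'" "E' \<noteq> zeros F" "E' \<noteq> zeros l1" "E' \<noteq> zeros l2"
    and "E \<noteq> E'"
  shows "\<exists>H1 H2. (\<exists>d1. homogeneous d1 H1) \<and> (\<exists>d2. homogeneous d2 H2) \<and>
       ((even d \<and> G = H1\<^sup>2 - l1 * l2 * H2\<^sup>2) \<or> (odd d \<and> G = l1 * H1\<^sup>2 - l2 * H2\<^sup>2))"
proof -
  obtain p e where p: "irreducible p" "homogeneous e p" "E = zeros p" using irred_curve_closed1E[OF E(1)] .
  obtain p' e' where p': "irreducible p'" "homogeneous e' p'" "E' = zeros p'" using irred_curve_closed1E[OF E'(1)] .
  have nL: "zeros G \<noteq> zeros varz"
  proof
    assume "zeros G = zeros varz"
    hence "E = zeros varz" "E' = zeros varz"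
      using covered_by_Linf[OF p(1,2)] covered_by_Linf[OF p'(1,2)] E E' p p' by auto
    thus False using \<open>E \<noteq> E'\<close> by simp
  qed
  have "E \<noteq> zeros varz" "E' \<noteq> zeros varz" using covered_Linf[OF G(1,2)] E(2) E'(2) nL by auto
  hence ne: "\<not> p dvd exceptional" "\<not> p' dvd exceptional"
    using not_dvd_exceptional[OF p(1,2)] not_dvd_exceptional[OF p'(1,2)] E E' p(3) p'(3) by auto
  obtain al be where ab: "\<And>x y z s. s\<^sup>2 = qf x y \<Longrightarrow> pev p (psi s (x, y, z)) = pev al (x, y, z) + s * pev be (x, y, z)"
    using psi_split[of p] by blast
  have dvd: "G dvd al\<^sup>2 - q * be\<^sup>2"
    by (rule covered_dvd_norm[OF G(1,2) p(1,2) ne(1) _ ab]) (use E(2) p(3) in auto)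
  have prime: "prime_elem G" using G(1) by simp
  \<comment> \<open>If G divides al, the norm shows that G divides q be^2, and hence be, as G
    divides neither l1 nor l2. Then p vanishes on both halves, which leaves no room for p'.\<close>
  have nal: "\<not> G dvd al"
  proof
    assume al: "G dvd al"
    hence "G dvd al\<^sup>2" by (simp add: power2_eq_square)
    hence "G dvd al\<^sup>2 - (al\<^sup>2 - q * be\<^sup>2)" using dvd by (rule dvd_diff)
    hence "G dvd const3 \<mu> * (l1 * l2) * be\<^sup>2" by (simp add: q_def)
    moreover have "\<not> G dvd const3 \<mu>"
      using G(1) const3_dvd_1[OF mu] dvd_trans unfolding irreducible_def by blast
    ultimately have "G dvd be" using prime G(3,4) by (simp add: prime_elem_dvd_mult_iff power2_eq_square)
    hence "zeros p' = zeros p"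
      by (intro covered_unique[OF p(1,2) p'(1,2) ne(2) _ ab al]) (use E'(2) p'(3) in auto)
    thus False using \<open>E \<noteq> E'\<close> p p' by simp
  qed
  obtain r where r: "\<mu> = r\<^sup>2" using sqrt_ex[of \<mu>] by metis
  have "al\<^sup>2 - q * be\<^sup>2 = al\<^sup>2 - l1 * l2 * (const3 r * be)\<^sup>2"
    by (rule pev_eqI') (simp add: qf_def power_mult_distrib algebra_simps flip: r)
  with dvd have "G dvd al\<^sup>2 - l1 * l2 * (const3 r * be)\<^sup>2" by simp
  thus ?thesis by (rule splitting_form[OF G(1,2) nal])
qed

text \<open>The fibre over v is cut out by a line m and a conic K, so it meets the curve p in
  finitely many points unless p divides both. If v is A, then m degenerates and K is B; otherwise K
  can contain m only if m is one of the two lines, which p is not.\<close>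

lemma finite_fibre:
  assumes p: "irreducible p" "homogeneous e p" "zeros p \<noteq> zeros F" "zeros p \<noteq> zeros l1" "zeros p \<noteq> zeros l2"
    and v: "v \<noteq> (0, 0, 0)"
  shows "finite (ppoint ` {w \<in> zeros p. (v, w) \<in> W_surface F})"
proof -
  obtain x y z where v': "v = (x, y, z)" by (cases v)
  define m where "m = linform (- y) x 0"
  define K where "K = subst3 (const3 z * varx - const3 x * varz) (const3 z * vary - const3 y * varz) (const3 z * varz) F"
  have K: "pev K (X, Y, Z) = bev (W_eq1 F) v (X, Y, Z)" for X Y Z
    by (simp add: K_def v' bev_W1)
  have m: "pev m (X, Y, Z) = bev W_eq2 v (X, Y, Z)" for X Y Z
    by (simp add: m_def v' bev_W_eq2)
  have hK: "homogeneous 2 K"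
    unfolding homogeneous_iff
  proof (intro allI)
    fix t :: 'a and w :: "'a vec3"
    obtain X Y Z where w: "w = (X, Y, Z)" by (cases w)
    have "qf (z * (t * X) - x * (t * Z)) (z * (t * Y) - y * (t * Z)) = qf (t * (z * X - x * Z)) (t * (z * Y - y * Z))"
      by (simp add: algebra_simps)
    moreover have "pev K (t * X, t * Y, t * Z) =
        \<epsilon> * (qf (z * (t * X) - x * (t * Z)) (z * (t * Y) - y * (t * Z)) - (z * (t * Z))\<^sup>2)"
      by (simp only: K v' bev_W1)
    ultimately show "pev K (smul t w) = t\<^sup>2 * pev K w"
      unfolding w smul_simps qf_scale by (simp add: K v' bev_W1 power_mult_distrib algebra_simps)
  qed
  have sub: "{w \<in> zeros p. (v, w) \<in> W_surface F} \<subseteq> (zeros p \<inter> zeros m) \<inter> zeros K"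
    using K m by (auto simp: W_surface_iff in_zeros)
  have fin: "finite (ppoint ` {w \<in> zeros p. (v, w) \<in> W_surface F})" if "homogeneous n r" "\<not> p dvd r" "zeros m \<inter> zeros K \<subseteq> zeros r" for n r
  proof (rule finite_subset)
    show "ppoint ` {w \<in> zeros p. (v, w) \<in> W_surface F} \<subseteq> ppoint ` (zeros p \<inter> zeros r)"
      using sub that(3) by blast
  qed (rule finite_common_zeros[OF p(1,2) that(1,2)])
  have nd: "\<not> p dvd r" if "irreducible r" "zeros p \<noteq> zeros r" for r
    using irreducible_dvd_zeros_eq[OF p(1)] that by blast
  consider "\<not> p dvd m" | "x = 0" "y = 0" | "\<not> p dvd K" | "p dvd m" "m \<noteq> 0" "p dvd K"
    by (auto simp: m_def)
  thus ?thesis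
  proof cases
    case 1
    show ?thesis by (rule fin[of "Suc 0" m]) (use 1 in \<open>auto simp: m_def\<close>)
  next
    case 2
    hence z: "z \<noteq> 0" using v v' by auto
    show ?thesis
    proof (rule fin[OF homogeneous_F])
      show "\<not> p dvd F" using nd F_irreducible p by blast
      have "pev F w = 0" if "pev K w = 0" for w
      proof -
        obtain X Y Z where w: "w = (X, Y, Z)" by (cases w)
        have "pev K w = \<epsilon> * (z\<^sup>2 * qf X Y - (z * Z)\<^sup>2)" by (simp add: w K v' 2 bev_W1)
        also have "\<dots> = z\<^sup>2 * pev F w" by (simp add: w power_mult_distrib algebra_simps)
        finally show ?thesis using z that by simp
      qed
      thus "zeros m \<inter> zeros K \<subseteq> zeros F" by (auto simp: in_zeros)
    qed
  next
    case 3
    show ?thesis by (rule fin[OF hK 3]) auto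
  next
    case 4
    have mirr: "irreducible m" using 4(2) by (auto simp: m_def intro!: irreducible_linform)
    have pm: "zeros p = zeros m" by (rule irreducible_dvd_zeros_eq[OF p(1) mirr 4(1)])
    have xy: "x \<noteq> 0 \<or> y \<noteq> 0" using 4(2) by (auto simp: m_def)
    have K0: "pev K (t * x, t * y, Z) = 0" if "t \<noteq> 0 \<or> Z \<noteq> 0" for t Z
    proof -
      have "(t * x, t * y, Z) \<in> zeros m" using that xy by (auto simp: in_zeros m_def)
      hence "pev p (t * x, t * y, Z) = 0" using pm by (auto simp: in_zeros)
      thus ?thesis using 4(3) dvd_imp_pev_eq_0 by blast
    qed
    \<comment> \<open>Two points of m are tested: A gives q(v) = z^2, the point at infinity gives
      z^2 q(v) = 0. Together q(v) = 0.\<close>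
    have "qf (- x) (- y) = z\<^sup>2" using K0[of 0 1] eps by (simp add: K v' bev_W1)
    moreover have "z\<^sup>2 * qf x y = 0" using K0[of 1 0] eps by (simp add: K v' bev_W1)
    moreover have "qf (- x) (- y) = qf x y" using qf_scale[of "- 1" x y] by simp
    ultimately have "qf x y = 0" by auto
    hence "a1 * x + b1 * y = 0 \<or> a2 * x + b2 * y = 0" using mu by (simp add: qf_def)
    moreover have "zeros m = zeros (linform a b 0)" if "a * x + b * y = 0" "linform a b 0 \<noteq> 0" for a b
    proof (rule zeros_eq_imp_eq(1)[OF mirr, of "Suc 0" _ "Suc 0"])
      show "zeros m \<subseteq> zeros (linform a b 0)"
      proof
        fix w assume w: "w \<in> zeros m"
        obtain X Y Z where w': "w = (X, Y, Z)" by (cases w)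
        have e: "x * Y = y * X" using w by (simp add: in_zeros w' m_def)
        obtain t where t: "X = t * x" "Y = t * y"
        proof (cases "x = 0")
          case False
          thus thesis using that[of "X / x"] e by (simp add: field_simps)
        next
          case True
          thus thesis using that[of "Y / y"] e xy by (simp add: field_simps)
        qed
        have "a * X + b * Y = t * (a * x + b * y)" by (simp add: t algebra_simps)
        thus "w \<in> zeros (linform a b 0)" using w that by (simp add: in_zeros w')
      qed
    qed (use that in \<open>auto simp: m_def intro: irreducible_linform\<close>)
    ultimately have "zeros m = zeros l1 \<or> zeros m = zeros l2"
      using l_nonzero unfolding l1_def l2_def by blast
    thus ?thesis using pm p by auto
  qed
qed

end

subsection \<open>Homogeneous ideals without zeros\<close>

definition is_ideal :: "'b::comm_ring_1 set \<Rightarrow> bool" where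
  "is_ideal K \<longleftrightarrow> 0 \<in> K \<and> (\<forall>a\<in>K. \<forall>b\<in>K. a + b \<in> K) \<and> (\<forall>a\<in>K. \<forall>r. r * a \<in> K)"

definition adjoin :: "'b::comm_ring_1 set \<Rightarrow> 'b \<Rightarrow> 'b set" where
  "adjoin K f = {a + r * f |a r. a \<in> K}"

text \<open>For a homogeneous ideal this is the algebraic form of having no zero in the
  plane.\<close>

definition cofinite_ideal :: "'a::comm_ring_1 tpoly set \<Rightarrow> bool" where
  "cofinite_ideal K \<longleftrightarrow> (\<exists>N. \<forall>g. homogeneous N g \<longrightarrow> g \<in> K)"

lemma is_idealD:
  assumes "is_ideal K"
  shows "0 \<in> K" "a \<in> K \<Longrightarrow> b \<in> K \<Longrightarrow> a + b \<in> K" "a \<in> K \<Longrightarrow> r * a \<in> K" "a \<in> K \<Longrightarrow> a * r \<in> K"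
    "a \<in> K \<Longrightarrow> b \<in> K \<Longrightarrow> a - b \<in> K"
proof -
  show 1: "0 \<in> K" "\<And>a b. a \<in> K \<Longrightarrow> b \<in> K \<Longrightarrow> a + b \<in> K" "\<And>a r. a \<in> K \<Longrightarrow> r * a \<in> K"
    using assms by (auto simp: is_ideal_def)
  show "a \<in> K \<Longrightarrow> a * r \<in> K" using 1(3)[of a r] by (simp add: mult.commute)
  show "a - b \<in> K" if "a \<in> K" "b \<in> K" using 1(2)[OF that(1) 1(3)[OF that(2), of "- 1"]] by simp
qed

lemma is_ideal_adjoin:
  assumes "is_ideal K"
  shows "is_ideal (adjoin K f)"
  unfolding is_ideal_def
proof (intro conjI ballI allI)
  have "0 = 0 + 0 * f" by simp
  thus "0 \<in> adjoin K f" unfolding adjoin_def using is_idealD(1)[OF assms] by blast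
  fix a assume "a \<in> adjoin K f"
  then obtain a' r' where a: "a' \<in> K" "a = a' + r' * f" unfolding adjoin_def by blast
  {
    fix b assume "b \<in> adjoin K f"
    then obtain b' s' where b: "b' \<in> K" "b = b' + s' * f" unfolding adjoin_def by blast
    have "a + b = (a' + b') + (r' + s') * f" by (simp add: a b algebra_simps)
    thus "a + b \<in> adjoin K f" unfolding adjoin_def using is_idealD(2)[OF assms a(1) b(1)] by blast
  }
  fix r
  have "r * a = r * a' + (r * r') * f" by (simp add: a algebra_simps)
  thus "r * a \<in> adjoin K f" unfolding adjoin_def using is_idealD(3)[OF assms a(1)] by blast
qed

lemma adjoin_self: "is_ideal K \<Longrightarrow> f \<in> adjoin K f"
  unfolding adjoin_def using is_idealD(1)[of K] by (intro CollectI exI[of _ 0] exI[of _ 1]) auto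

lemma subset_adjoin: "K \<subseteq> adjoin K f"
  unfolding adjoin_def by (force intro: exI[of _ 0])

lemma adjoin_mono: "K \<subseteq> K' \<Longrightarrow> adjoin K f \<subseteq> adjoin K' f"
  unfolding adjoin_def by blast

lemma cofinite_ideal_mono: "cofinite_ideal K \<Longrightarrow> K \<subseteq> K' \<Longrightarrow> cofinite_ideal K'"
  unfolding cofinite_ideal_def by blast

lemma mono3_mult: "mono3 c i j l * mono3 c' i' j' l' = mono3 (c * c') (i + i') (j + j') (l + l')"
  by (simp add: mono3_def mult_monom)

text \<open>A monomial of degree N + M is a product of monomials of degrees N and M, and a product
  of elements of K + (f) and K + (g) lies in K + (f g).\<close>

lemma cofinite_ideal_mult:
  assumes K: "is_ideal K" and f: "cofinite_ideal (adjoin K f)" and g: "cofinite_ideal (adjoin K g)"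
    and fg: "f * g \<in> K"
  shows "cofinite_ideal K"
proof -
  obtain N where N: "\<And>h. homogeneous N h \<Longrightarrow> h \<in> adjoin K f" using f by (auto simp: cofinite_ideal_def)
  obtain M where M: "\<And>h. homogeneous M h \<Longrightarrow> h \<in> adjoin K g" using g by (auto simp: cofinite_ideal_def)
  have mono: "mono3 c i j l \<in> K" if ijl: "i + j + l = N + M" for c i j l
  proof -
    \<comment> \<open>A divisor of total degree N is chosen greedily, using up x before y and y
      before z.\<close>
    define i1 where "i1 = min i N"
    define j1 where "j1 = min j (N - i1)"
    define l1 where "l1 = N - i1 - j1"
    have s: "i1 + j1 + l1 = N" "i1 \<le> i" "j1 \<le> j" "l1 \<le> l" using ijl by (auto simp: i1_def j1_def l1_def)
    hence s2: "(i - i1) + (j - j1) + (l - l1) = M" using ijl by simp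
    have "mono3 c i j l = mono3 c i1 j1 l1 * mono3 1 (i - i1) (j - j1) (l - l1)"
      using s by (simp add: mono3_mult)
    moreover obtain a r where ar: "a \<in> K" "mono3 c i1 j1 l1 = a + r * f"
      using N[of "mono3 c i1 j1 l1"] homogeneous_mono3[of i1 j1 l1 c] unfolding adjoin_def s(1) by blast
    moreover obtain b t where bt: "b \<in> K" "mono3 1 (i - i1) (j - j1) (l - l1) = b + t * g"
      using M[of "mono3 1 (i - i1) (j - j1) (l - l1)"] homogeneous_mono3[of "i - i1" "j - j1" "l - l1" 1]
      unfolding adjoin_def s2 by blast
    ultimately have "mono3 c i j l = (b + t * g) * a + ((r * f) * b + (r * t) * (f * g))"
      by (simp add: algebra_simps)
    thus ?thesis using ar(1) bt(1) fg K by (auto intro!: is_idealD(2,3)[OF K])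
  qed
  have "h \<in> K" if h: "homogeneous (N + M) h" for h
  proof -
    have "mono3 (coeff3 h i j l) i j l \<in> K" for i j l
    proof (cases "coeff3 h i j l = 0")
      case True
      thus ?thesis using is_idealD(1)[OF K] by (simp add: mono3_def)
    next
      case False
      hence "i + j + l = N + M" using h by (auto simp: homogeneous_def)
      thus ?thesis by (rule mono)
    qed
    thus ?thesis
      by (subst tpoly_expansion) (intro sum_closed[where P = "\<lambda>x. x \<in> K"] is_idealD(1,2)[OF K])
  qed
  thus ?thesis unfolding cofinite_ideal_def by blast
qed

lemma cofinite_ideal_prod_list:
  assumes "is_ideal K" "prod_list ls \<in> K" "\<And>l. l \<in> set ls \<Longrightarrow> cofinite_ideal (adjoin K l)"
  shows "cofinite_ideal K"
  using assms
proof (induction ls arbitrary: K)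
  case Nil
  hence "r \<in> K" for r using is_idealD(3)[OF Nil(1), of 1 r] by simp
  thus ?case by (simp add: cofinite_ideal_def)
next
  case (Cons l ls)
  show ?case
  proof (rule cofinite_ideal_mult[OF Cons.prems(1), of l "prod_list ls"])
    show "cofinite_ideal (adjoin K (prod_list ls))"
    proof (rule Cons.IH)
      fix l' assume "l' \<in> set ls"
      hence "cofinite_ideal (adjoin K l')" using Cons.prems(3) by simp
      thus "cofinite_ideal (adjoin (adjoin K (prod_list ls)) l')"
        by (rule cofinite_ideal_mono) (intro adjoin_mono subset_adjoin)
    qed (use Cons.prems(1) in \<open>simp_all add: is_ideal_adjoin adjoin_self\<close>)
  qed (use Cons.prems in auto)
qed

lemma subst3_hom [simp]:
  fixes p :: "'a::alg_closed_field tpoly"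
  shows "subst3 a b c (p * q) = subst3 a b c p * subst3 a b c q" "subst3 a b c 1 = 1"
  "subst3 a b c (const3 k) = const3 k"
  by (auto intro!: pev_eqI)

lemma subst3_prod_list: "subst3 a b c (prod_list ls) = prod_list (map (subst3 a b c) ls)"
  for a :: "'a::alg_closed_field tpoly"
  by (induction ls) simp_all

text \<open>
  The projective Nullstellensatz for plane curves.  By \<open>cofinite_ideal_mult\<close> one may adjoin the
  factors of an element one at a time; as forms in two variables split, the ideal can be enlarged
  until it contains all forms that vanish at some point.
\<close>

lemma homogeneous_nullstellensatz:
  fixes G :: "'a::alg_closed_field tpoly"
  assumes G: "irreducible G" "homogeneous d G" "degree G > 0" "G \<in> J"
    and J: "is_ideal J"
    and comp: "\<And>S cf n. finite S \<Longrightarrow> (\<And>i. homogeneous i (cf i)) \<Longrightarrow> sum cf S \<in> J \<Longrightarrow> n \<in> S \<Longrightarrow> cf n \<in> J"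
    and nozero: "\<And>v. v \<noteq> (0, 0, 0) \<Longrightarrow> \<exists>f\<in>J. pev f v \<noteq> 0"
  shows "cofinite_ideal J"
proof -
  have homJ: "\<exists>f e. f \<in> J \<and> homogeneous e f \<and> pev f v \<noteq> 0" if "v \<noteq> (0, 0, 0)" for v
  proof -
    obtain f where f: "f \<in> J" "pev f v \<noteq> 0" using nozero \<open>v \<noteq> (0, 0, 0)\<close> by blast
    obtain S cf where S: "finite S" "\<And>i. homogeneous i (cf i)" "f = sum cf S"
      using homogeneous_decomp[of f] unfolding decomposable_def by blast
    have "pev f v = (\<Sum>i\<in>S. pev (cf i) v)" by (simp add: S(3))
    hence "\<exists>i\<in>S. pev (cf i) v \<noteq> 0"
      using f(2) by (metis (mono_tags, lifting) sum.neutral)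
    then obtain i where "i \<in> S" "pev (cf i) v \<noteq> 0" by blast
    moreover have "cf i \<in> J" using comp[of S cf i] S f(1) \<open>i \<in> S\<close> by simp
    ultimately show ?thesis using S(2) by blast
  qed
  \<comment> \<open>Modulo the two linear forms only the point \<open>?v\<close> is left. Some form
    in J is nonzero there; subtracting a multiple of it makes any form of the same degree vanish at
    \<open>?v\<close> and hence lie in the ideal of the two linear forms.\<close>
  have final: "cofinite_ideal (adjoin (adjoin J (linform a b 0)) (linform (\<gamma> * e1) (\<gamma> * e2) \<delta>))"
    if ab: "a \<noteq> 0 \<or> b \<noteq> 0" and e: "e1 * b - e2 * a = 1" and gd: "\<gamma> \<noteq> 0 \<or> \<delta> \<noteq> 0" for a b e1 e2 \<gamma> \<delta>
  proof -
    let ?v = "(b * \<delta>, - a * \<delta>, - \<gamma>)"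
    let ?l = "linform a b 0" and ?m = "linform (\<gamma> * e1) (\<gamma> * e2) \<delta>"
    have "?v \<noteq> (0, 0, 0)" using ab gd by auto
    then obtain f k where f: "f \<in> J" "homogeneous k f" "pev f ?v \<noteq> 0" using homJ by blast
    have van: "\<exists>A B. h = A * ?l + B * ?m" if h: "homogeneous k h" "pev h ?v = 0" for h
    proof -
      \<comment> \<open>The restriction of h to the line l = 0, parametrised by (b t, - a t, z) and
        written as a binary form in t and z.\<close>
      define hl where "hl = subst3 (const3 b * varx) (const3 (- a) * varx) vary h"
      have hl: "pev hl (t, z, y) = pev h (b * t, - a * t, z)" for t z y by (simp add: hl_def)
      have "linform \<gamma> \<delta> 0 dvd hl"
      proof (rule linform_dvdI)
        fix v assume v: "pev (linform \<gamma> \<delta> 0) v = 0"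
        obtain t z y where tz: "v = (t, z, y)" by (cases v)
        have e': "\<gamma> * t = - (\<delta> * z)" using v by (simp add: tz add_eq_0_iff)
        obtain u where u: "t = u * \<delta>" "z = - (u * \<gamma>)"
        proof (cases "\<gamma> = 0")
          case False
          show thesis using that[of "- z / \<gamma>"] e' False by (simp add: field_simps)
        next
          case True
          thus thesis using that[of "t / \<delta>"] e' gd by (simp add: field_simps)
        qed
        have "pev hl v = pev h (smul u ?v)" by (simp add: tz hl u mult_ac)
        thus "pev hl v = 0" using h(2) by (simp add: homogeneous_pev[OF h(1)] del: smul_simps)
      qed (use gd in auto)
      then obtain B where B: "hl = linform \<gamma> \<delta> 0 * B" by blast
      define B' where "B' = subst3 (linform e1 e2 0) varz 0 B"
      have "?l dvd h - ?m * B'"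
      proof (rule linform_dvdI)
        fix v assume v: "pev ?l v = 0"
        obtain x y z where xyz: "v = (x, y, z)" by (cases v)
        have e': "a * x = - (b * y)" using v by (simp add: xyz add_eq_0_iff)
        obtain t where t: "x = b * t" "y = - a * t"
        proof (cases "a = 0")
          case False
          show thesis using that[of "- y / a"] e' False by (simp add: field_simps)
        next
          case True
          thus thesis using that[of "x / b"] e' ab by (simp add: field_simps)
        qed
        have "e1 * (b * t) - e2 * (a * t) = (e1 * b - e2 * a) * t" by (simp add: algebra_simps)
        hence et: "e1 * (b * t) - e2 * (a * t) = t" using e by simp
        have "pev h v = pev hl (t, z, 0)" by (simp add: hl xyz t)
        also have "\<dots> = (\<gamma> * t + \<delta> * z) * pev B (t, z, 0)" by (simp add: B)
        also have "\<gamma> * t + \<delta> * z = pev ?m v" using et by (simp add: xyz t algebra_simps flip: right_diff_distrib)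
        also have "pev B (t, z, 0) = pev B' v" using et by (simp add: B'_def xyz t)
        finally show "pev (h - ?m * B') v = 0" by simp
      qed (use ab in auto)
      then obtain A where "h - ?m * B' = ?l * A" by blast
      hence "h = A * ?l + B' * ?m" by (simp add: algebra_simps)
      thus ?thesis by blast
    qed
    have "g \<in> adjoin (adjoin J ?l) ?m" if g: "homogeneous k g" for g
    proof -
      let ?c = "const3 (pev g ?v / pev f ?v)"
      have "homogeneous k (?c * f)" using homogeneous_mult[OF homogeneous_const3 f(2)] by simp
      hence "homogeneous k (g - ?c * f)" using g by (rule homogeneous_diff[rotated])
      moreover have "pev (g - ?c * f) ?v = 0" using f(3) by simp
      ultimately obtain A B where "g - ?c * f = A * ?l + B * ?m" using van by blast
      hence "g = (?c * f + A * ?l) + B * ?m" by (simp add: algebra_simps)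
      moreover have "?c * f \<in> J" by (rule is_idealD(3)[OF J f(1)])
      ultimately show ?thesis unfolding adjoin_def by blast
    qed
    thus ?thesis unfolding cofinite_ideal_def by blast
  qed
  have step: "cofinite_ideal (adjoin J (linform a b 0))" if ab: "a \<noteq> 0 \<or> b \<noteq> 0" for a b
  proof -
    let ?l = "linform a b 0"
    \<comment> \<open>On the line (x, y) = (b t, - a t) the form e1 x + e2 y returns the parameter
      t, so polynomials on the line can be lifted to the plane.\<close>
    obtain e1 e2 where e: "e1 * b - e2 * a = 1"
    proof (cases "b = 0")
      case False
      thus thesis using that[of "inverse b" 0] by simp
    next
      case True
      thus thesis using that[of 0 "- inverse a"] ab by simp
    qed
    define Gl where "Gl = subst3 (const3 b * varx) (const3 (- a) * varx) vary G"
    have Gl: "pev Gl (t, z, y) = pev G (b * t, - a * t, z)" for t z y by (simp add: Gl_def)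
    have hom: "homogeneous d Gl"
    proof (rule homogeneousI)
      fix u :: 'a and v :: "'a vec3"
      obtain t z y where v: "v = (t, z, y)" by (cases v)
      have "pev Gl (smul u v) = pev G (smul u (b * t, - a * t, z))" by (simp add: v Gl mult_ac)
      thus "pev Gl (smul u v) = u ^ d * pev Gl v" by (simp add: homogeneous_pev[OF G(2)] v Gl del: smul_simps)
    qed
    have deg: "degree Gl = 0" by (rule degree_0I) (simp add: Gl)
    have "slice G b (- a) \<noteq> 0" using ab by (intro slice_nonzero[OF G(1,2,3)]) auto
    then obtain z where z: "poly (slice G b (- a)) z \<noteq> 0"
      using poly_all_zero_imp_zero[OF infinite_UNIV_alg_closed] by blast
    have "Gl \<noteq> 0" using z Gl[of 1 z 0] by auto
    then obtain c ls where c: "c \<noteq> 0" "Gl = const3 c * prod_list ls"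
      "\<And>l. l \<in> set ls \<Longrightarrow> \<exists>\<gamma> \<delta>. (\<gamma> \<noteq> 0 \<or> \<delta> \<noteq> 0) \<and> l = linform \<gamma> \<delta> 0"
      using binary_form_splits[OF hom deg] by blast
    let ?s = "subst3 (linform e1 e2 0) varz 0"
    have "?l dvd G - ?s Gl"
    proof (rule linform_dvdI)
      fix v assume v: "pev ?l v = 0"
      obtain x y z where xyz: "v = (x, y, z)" by (cases v)
      have e': "a * x = - (b * y)" using v by (simp add: xyz add_eq_0_iff)
      obtain t where t: "x = b * t" "y = - a * t"
      proof (cases "a = 0")
        case False
        show thesis using that[of "- y / a"] e' False by (simp add: field_simps)
      next
        case True
        thus thesis using that[of "x / b"] e' ab by (simp add: field_simps)
      qed
      have "e1 * (b * t) - e2 * (a * t) = (e1 * b - e2 * a) * t" by (simp add: algebra_simps)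
      hence "e1 * (b * t) - e2 * (a * t) = t" using e by simp
      thus "pev (G - ?s Gl) v = 0" by (simp add: xyz t Gl)
    qed (use ab in auto)
    then obtain A where A: "G - ?s Gl = ?l * A" by blast
    have K: "is_ideal (adjoin J ?l)" by (rule is_ideal_adjoin[OF J])
    have "?s Gl = G + (- A) * ?l" using A by (simp add: algebra_simps)
    hence "?s Gl \<in> adjoin J ?l" unfolding adjoin_def using G(4) by blast
    hence "const3 (inverse c) * ?s Gl \<in> adjoin J ?l" by (rule is_idealD(3)[OF K])
    moreover have "const3 (inverse c) * ?s Gl = ?s (prod_list ls)"
      by (rule pev_eqI) (use c in simp)
    ultimately have "prod_list (map ?s ls) \<in> adjoin J ?l" by (simp only: subst3_prod_list)
    thus ?thesis
    proof (rule cofinite_ideal_prod_list[OF K])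
      fix l assume "l \<in> set (map ?s ls)"
      then obtain \<gamma> \<delta> where gd: "\<gamma> \<noteq> 0 \<or> \<delta> \<noteq> 0" "l = ?s (linform \<gamma> \<delta> 0)" using c(3) by force
      have "l = linform (\<gamma> * e1) (\<gamma> * e2) \<delta>" unfolding gd(2) by (rule pev_eqI) (auto simp: algebra_simps)
      thus "cofinite_ideal (adjoin (adjoin J ?l) l)" using final[OF ab e gd(1)] by simp
    qed
  qed
  \<comment> \<open>Eliminating z between G and an element of J not divisible by G yields a binary
    form in J, which splits into lines through A.\<close>
  obtain f where f: "f \<in> J" "\<not> G dvd f"
  proof -
    have "infinite (ppoint ` zeros G)"
      using G irreducible_homogeneous_pos by (intro infinite_zeros[of d]) auto
    then obtain v where v: "v \<in> zeros G" by (metis all_not_in_conv finite.emptyI image_is_empty)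
    hence "v \<noteq> (0, 0, 0)" by (simp add: in_zeros)
    then obtain f where f: "f \<in> J" "pev f v \<noteq> 0" using nozero by blast
    hence "\<not> G dvd f" using v by (auto simp: in_zeros dest: dvd_imp_pev_eq_0)
    with f show thesis using that by blast
  qed
  obtain A B r where r: "A * G + B * f = [:r:]" "r \<noteq> 0" using eliminate_z[OF G(1,3) f(2)] .
  obtain S cf n where S: "finite S" "\<And>i. homogeneous i (cf i)" "[:r:] = sum cf S" "n \<in> S" "cf n \<noteq> 0" "degree (cf n) = 0"
    using z_free_component[of "[:r:]"] r(2) by auto
  have "[:r:] \<in> J" unfolding r(1)[symmetric] using G(4) f(1) by (intro is_idealD(2,3)[OF J])
  hence "cf n \<in> J" using comp[of S cf n] S by simp
  moreover obtain c ls where c: "c \<noteq> 0" "cf n = const3 c * prod_list ls"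
    "\<And>l. l \<in> set ls \<Longrightarrow> \<exists>a b. (a \<noteq> 0 \<or> b \<noteq> 0) \<and> l = linform a b 0"
    using binary_form_splits[OF S(2,6,5)] by blast
  have "prod_list ls = const3 (inverse c) * cf n" unfolding c(2) by (rule pev_eqI) (use c(1) in simp)
  hence "prod_list ls \<in> J" using is_idealD(3)[OF J \<open>cf n \<in> J\<close>] by simp
  thus ?thesis
    by (rule cofinite_ideal_prod_list[OF J]) (use c(3) step in blast)
qed

text \<open>Gaussian elimination with polynomial coefficients, without division.\<close>

lemma polynomial_elimination:
  fixes c :: "'i \<Rightarrow> 'i \<Rightarrow> 'a::alg_closed_field tpoly"
  assumes "finite M" "\<And>i j. i \<in> M \<Longrightarrow> j \<in> M \<Longrightarrow> pev (c i j) w0 = (if i = j then 1 else 0)"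
    "\<And>w. w \<in> \<Omega> \<Longrightarrow> \<exists>m. (\<exists>i\<in>M. m i \<noteq> 0) \<and> (\<forall>i\<in>M. (\<Sum>j\<in>M. pev (c i j) w * m j) = 0)"
  shows "\<exists>h. pev h w0 \<noteq> 0 \<and> (\<forall>w\<in>\<Omega>. pev h w = 0)"
  using assms
proof (induction M arbitrary: c \<Omega> rule: finite_induct)
  case empty
  thus ?case by (intro exI[of _ 1]) auto
next
  case (insert k M)
  \<comment> \<open>A row operation by cross-multiplication. Points where the pivot vanishes are
    left out here; the factor \<open>c k k\<close> of the final polynomial vanishes at them and is 1
    at w0.\<close>
  define c' where "c' = (\<lambda>i j. c k k * c i j - c i k * c k j)"
  define \<Omega>' where "\<Omega>' = {w \<in> \<Omega>. pev (c k k) w \<noteq> 0}"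
  have "\<exists>h. pev h w0 \<noteq> 0 \<and> (\<forall>w\<in>\<Omega>'. pev h w = 0)"
  proof (rule insert.IH)
    fix i j assume "i \<in> M" "j \<in> M"
    thus "pev (c' i j) w0 = (if i = j then 1 else 0)"
      using insert.hyps(2) by (auto simp: c'_def insert.prems(1))
  next
    fix w assume w: "w \<in> \<Omega>'"
    then obtain m where m: "\<exists>i\<in>insert k M. m i \<noteq> 0" "\<And>i. i \<in> insert k M \<Longrightarrow> (\<Sum>j\<in>insert k M. pev (c i j) w * m j) = 0"
      using insert.prems(2)[of w] by (auto simp: \<Omega>'_def)
    have nz: "pev (c k k) w \<noteq> 0" using w by (simp add: \<Omega>'_def)
    have e: "pev (c i k) w * m k + (\<Sum>j\<in>M. pev (c i j) w * m j) = 0" if "i \<in> insert k M" for i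
      using m(2)[OF that] insert.hyps by simp
    have "(\<Sum>j\<in>M. pev (c' i j) w * m j) = 0" if "i \<in> M" for i
    proof -
      have "(\<Sum>j\<in>M. pev (c' i j) w * m j) =
          pev (c k k) w * (\<Sum>j\<in>M. pev (c i j) w * m j) - pev (c i k) w * (\<Sum>j\<in>M. pev (c k j) w * m j)"
        by (simp add: c'_def left_diff_distrib sum_subtractf sum_distrib_left mult.assoc)
      also have "(\<Sum>j\<in>M. pev (c i j) w * m j) = - (pev (c i k) w * m k)"
        using e[of i] that by (simp add: add_eq_0_iff)
      also have "(\<Sum>j\<in>M. pev (c k j) w * m j) = - (pev (c k k) w * m k)"
        using e[of k] by (simp add: add_eq_0_iff)
      finally show ?thesis by simp
    qed
    moreover have "\<exists>i\<in>M. m i \<noteq> 0"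
    proof (rule ccontr)
      assume "\<not> ?thesis"
      hence 0: "\<forall>i\<in>M. m i = 0" by blast
      hence "pev (c k k) w * m k = 0" using e[of k] by simp
      thus False using 0 m(1) nz by auto
    qed
    ultimately show "\<exists>m. (\<exists>i\<in>M. m i \<noteq> 0) \<and> (\<forall>i\<in>M. (\<Sum>j\<in>M. pev (c' i j) w * m j) = 0)" by blast
  qed
  then obtain h where h: "pev h w0 \<noteq> 0" "\<And>w. w \<in> \<Omega>' \<Longrightarrow> pev h w = 0" by blast
  show ?case
    by (rule exI[of _ "c k k * h"]) (use h insert.prems(1) in \<open>auto simp: \<Omega>'_def\<close>)
qed

text \<open>The type presents f as a polynomial in w with coefficients in v. This is the transposed
  expansion, by monomials in v with coefficients in w, as needed for specialising w.\<close>

lemma bpoly_expansion: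
  fixes f :: "'a::alg_closed_field tpoly tpoly"
  obtains S c where "finite S" "f = (\<Sum>(i, j, l)\<in>S. lift1 (mono3 1 i j l) * lift2 (c (i, j, l)))"
    "\<And>i j l. (i, j, l) \<notin> S \<Longrightarrow> c (i, j, l) = 0"
proof -
  let ?H = "\<lambda>(i, j, l) f. \<exists>c. f = lift1 (mono3 1 i j l) * lift2 (c :: 'a tpoly)"
  have "decomposable ?H f"
  proof (induction f rule: bpoly_sum_induct)
    case (mono c i j l i' j' l')
    have m: "mono3 (mono3 c i j l) i' j' l' = lift1 (mono3 1 i j l) * lift2 (mono3 c i' j' l')"
    proof (rule bev_eqI)
      fix v w :: "'a vec3"
      obtain x y z where v: "v = (x, y, z)" by (cases v)
      obtain X Y Z where w: "w = (X, Y, Z)" by (cases w)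
      have "bev (mono3 d i' j' l') v w = pev d v * (X ^ i' * Y ^ j' * Z ^ l')" for d
        by (simp add: mono3_altdef w mult.assoc)
      thus "bev (mono3 (mono3 c i j l) i' j' l') v w = bev (lift1 (mono3 1 i j l) * lift2 (mono3 c i' j' l')) v w"
        by (simp add: v w)
    qed
    show ?case
      by (rule decomposable_single[of _ "(i, j, l)"]) (use m in \<open>auto intro: exI[of _ 0]\<close>)
  next
    case (add p q)
    thus ?case
    proof (rule decomposable_add)
      fix i p q assume "?H i p" "?H i q"
      moreover obtain a b c where "i = (a, b, c)" by (cases i)
      ultimately show "?H i (p + q)" by (auto simp: distrib_left[symmetric] simp flip: lift2_hom(1))
    qed
  qed (auto intro!: decomposable_single[of _ "(0, 0, 0)"] exI[of _ 0])
  then obtain S cf where S: "finite S" "\<And>i. ?H i (cf i)" "\<And>i. i \<notin> S \<Longrightarrow> cf i = 0" "f = sum cf S"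
    unfolding decomposable_def by blast
  have "\<exists>c. cf (i, j, l) = lift1 (mono3 1 i j l) * lift2 c" for i j l using S(2)[of "(i, j, l)"] by simp
  then obtain c where c: "\<And>i j l. cf (i, j, l) = lift1 (mono3 1 i j l) * lift2 (c i j l)" by metis
  show thesis
  proof (rule that[OF S(1), of "\<lambda>(i, j, l). c i j l"])
    show "f = (\<Sum>(i, j, l)\<in>S. lift1 (mono3 1 i j l) * lift2 ((\<lambda>(i, j, l). c i j l) (i, j, l)))"
      unfolding S(4) by (rule sum.cong) (auto simp: c)
    fix i j l assume "(i, j, l) \<notin> S"
    hence "lift1 (mono3 1 i j l) * lift2 (c i j l) = 0" using S(3) c by metis
    hence 0: "bev (lift1 (mono3 1 i j l) * lift2 (c i j l)) (1, 1, 1) w = 0" for w by (simp only: bev_0)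
    have "c i j l = 0" by (rule pev_zero_imp_zero) (use 0 in simp)
    thus "(\<lambda>(i, j, l). c i j l) (i, j, l) = 0" by simp
  qed
qed

subsection \<open>One half of a splitting conchoid\<close>

text \<open>
  On the curve \<open>G = 0\<close> the root \<open>s\<close> of \<open>q\<close> is the rational function \<open>U / V\<close>.  The closure \<open>D\<close> of
  the graph of the rational map \<open>v \<mapsto> psi (U / V) v\<close>, written without denominators as \<open>pp\<close>, is a
  component of the inverse image of the curve in the incidence surface.
\<close>

locale split_curve = conic a1 b1 a2 b2 \<epsilon> \<mu> for a1 b1 a2 b2 \<epsilon> \<mu> :: "'a::alg_closed_field" +
  fixes G U V :: "'a tpoly" and d n :: nat
  assumes G_irr: "irreducible G" and G_hom: "homogeneous d G"
    and U_hom: "homogeneous (Suc n) U" and V_hom: "homogeneous n V"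
    and nU: "\<not> G dvd U" and nV: "\<not> G dvd V" and dvd_norm: "G dvd U\<^sup>2 - q * V\<^sup>2"
    and n_line: "\<And>a b. a \<noteq> 0 \<or> b \<noteq> 0 \<Longrightarrow> \<not> G dvd linform a b 0"
    and nz: "\<not> G dvd varz" and nF: "\<not> G dvd F" and nF2: "\<not> G dvd q - const3 4 * varz\<^sup>2"
begin

lemma G_prime: "prime_elem G" using G_irr by simp

lemma G_dvd_mult: "G dvd a * b \<longleftrightarrow> G dvd a \<or> G dvd b"
  by (rule prime_elem_dvd_mult_iff[OF G_prime])

lemma not_G_dvd_const: "c \<noteq> 0 \<Longrightarrow> \<not> G dvd const3 c"
  using G_irr const3_dvd_1[of c] dvd_trans unfolding irreducible_def by blast

lemma n_l: "\<not> G dvd l1" "\<not> G dvd l2"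
  using n_line det unfolding l1_def l2_def by (metis mult_zero_left mult_zero_right diff_0_right diff_self)+

lemma n_q: "\<not> G dvd q"
  using n_l not_G_dvd_const[OF mu] by (simp add: q_def G_dvd_mult)

lemma degree_G: "degree G > 0"
proof (rule ccontr)
  assume "\<not> degree G > 0"
  moreover obtain d' where "d = Suc d'" using irreducible_homogeneous_pos[OF G_irr G_hom] by (cases d) auto
  ultimately obtain a b r where ab: "a \<noteq> 0 \<or> b \<noteq> 0" "G = linform a b 0 * r"
    using binary_form_factor G_hom by (metis gr0I)
  have "\<not> linform a b 0 dvd 1" using irreducible_linform[of "linform a b 0"] ab(1) by (auto simp: irreducible_def)
  hence "r dvd 1" using irreducibleD[OF G_irr ab(2)] by blast
  then obtain u where "r * u = 1" by (metis dvdE)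
  hence "linform a b 0 = G * u" using ab(2) by (simp add: mult.assoc)
  thus False using n_line[OF ab(1)] by simp
qed

text \<open>With s = U / V one has LL / V = s + z, and \<open>pp\<close> is V times
  \<open>psi s\<close>. In contrast to \<open>psi s\<close> it is polynomial in v.\<close>

definition LL :: "'a tpoly" where "LL = U + V * varz"
definition px :: "'a tpoly" where "px = LL * varx"
definition py :: "'a tpoly" where "py = LL * vary"
definition pz :: "'a tpoly" where "pz = U * varz"
definition pp :: "'a vec3 \<Rightarrow> 'a vec3" where "pp v = (pev px v, pev py v, pev pz v)"
definition gsub :: "'a tpoly tpoly \<Rightarrow> 'a tpoly" where "gsub f = eval3 f px py pz"

lemma on_curve: "v \<in> zeros G \<Longrightarrow> (pev U v)\<^sup>2 = pev q v * (pev V v)\<^sup>2"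
  using dvd_norm dvd_imp_pev_eq_0[of G "U\<^sup>2 - q * V\<^sup>2" v] by (simp add: in_zeros)

lemma n_vars: "\<not> G dvd varx" "\<not> G dvd vary"
proof -
  have "varx = linform 1 0 (0::'a)" "vary = linform 0 1 (0::'a)" by (auto intro!: pev_eqI)
  thus "\<not> G dvd varx" "\<not> G dvd vary" using n_line[of 1 0] n_line[of 0 1] by auto
qed

text \<open>If LL vanished on the curve, then s = - z and q = z^2 there, so the curve would be
  B.\<close>

lemma n_LL: "\<not> G dvd LL"
proof
  assume "G dvd LL"
  hence "G dvd (U\<^sup>2 - q * V\<^sup>2) - (U - V * varz) * LL" by (intro dvd_diff[OF dvd_norm] dvd_mult)
  also have "(U\<^sup>2 - q * V\<^sup>2) - (U - V * varz) * LL = - (V\<^sup>2 * (q - varz\<^sup>2))"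
    by (simp add: LL_def power2_eq_square algebra_simps)
  finally have "G dvd q - varz\<^sup>2" using nV by (simp add: G_dvd_mult power2_eq_square[of V])
  thus False using nF by (simp add: F_def)
qed

text \<open>Here s = - 2 z and hence q = 4 z^2 on the curve. This is the case in which the half
  belonging to s would be mapped into B.\<close>

lemma n_U2: "\<not> G dvd U + const3 2 * V * varz"
proof
  assume "G dvd U + const3 2 * V * varz"
  hence "G dvd (U\<^sup>2 - q * V\<^sup>2) - (U - const3 2 * V * varz) * (U + const3 2 * V * varz)"
    by (intro dvd_diff[OF dvd_norm] dvd_mult)
  also have "(U\<^sup>2 - q * V\<^sup>2) - (U - const3 2 * V * varz) * (U + const3 2 * V * varz) = - (V\<^sup>2 * (q - const3 4 * varz\<^sup>2))"
    by (rule pev_eqI) (simp add: power2_eq_square algebra_simps)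
  finally show False using nV nF2 by (simp add: G_dvd_mult power2_eq_square[of V])
qed

lemma LL_hom: "homogeneous (Suc n) LL"
  unfolding LL_def using homogeneous_mult[OF V_hom homogeneous_vars(3)] U_hom by (intro homogeneous_add) auto

lemma p_hom: "homogeneous (n + 2) px" "homogeneous (n + 2) py" "homogeneous (n + 2) pz"
proof -
  have e: "n + 2 = Suc n + Suc 0" by simp
  show "homogeneous (n + 2) px" "homogeneous (n + 2) py" "homogeneous (n + 2) pz"
    unfolding e px_def py_def pz_def by (intro homogeneous_mult LL_hom U_hom homogeneous_vars)+
qed

lemma pp_scale: "pp (smul t v) = smul (t ^ (n + 2)) (pp v)"
  by (simp add: pp_def homogeneous_pev[OF p_hom(1)] homogeneous_pev[OF p_hom(2)] homogeneous_pev[OF p_hom(3)])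

lemma pp_eq: "pp (x, y, z) = ((pev U (x, y, z) + pev V (x, y, z) * z) * x,
    (pev U (x, y, z) + pev V (x, y, z) * z) * y, pev U (x, y, z) * z)"
  by (simp add: pp_def px_def py_def pz_def LL_def)

lemma pev_gsub: "pev (gsub f) v = bev f v (pp v)"
  by (induction f rule: bpoly_induct) (simp_all add: gsub_def lift1_def pp_def)

lemma gsub_mult: "gsub (f * g) = gsub f * gsub g"
  by (simp add: gsub_def)

lemma gsub_hom:
  assumes "bihomogeneous a b f"
  shows "homogeneous (a + b * (n + 2)) (gsub f)"
proof (rule homogeneousI)
  fix t :: 'a and v
  have "bev f (smul t v) (smul (t ^ (n + 2)) (pp v)) = t ^ a * (t ^ (n + 2)) ^ b * bev f v (pp v)"
    by (rule bihomogeneous_bev[OF assms])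
  also have "t ^ a * (t ^ (n + 2)) ^ b = t ^ (a + b * (n + 2))"
    by (simp only: power_mult[symmetric] power_add[symmetric] mult.commute[of b])
  finally show "pev (gsub f) (smul t v) = t ^ (a + b * (n + 2)) * pev (gsub f) v"
    by (simp only: pev_gsub pp_scale)
qed

text \<open>Only finitely many points of the curve are zeros of this form; at all others the
  denominators in the geometric formulas are nonzero.\<close>

definition bad :: "'a tpoly" where "bad = U * V * exceptional * (q - const3 4 * varz\<^sup>2)"

lemma bad_hom: "homogeneous (n + 1 + n + 5 + 2) bad"
proof -
  have "homogeneous 2 (q - const3 4 * varz\<^sup>2)"
    by (auto simp: homogeneous_iff power_mult_distrib algebra_simps)
  thus ?thesis unfolding bad_def
    using homogeneous_mult[OF homogeneous_mult[OF homogeneous_mult[OF U_hom V_hom] homogeneous_exceptional]]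
    by (metis Suc_eq_plus1)
qed

lemma n_bad: "\<not> G dvd bad"
  unfolding bad_def exceptional_def using nU nV nF n_q nz nF2 by (simp add: G_dvd_mult)

lemma good_point:
  assumes "v \<in> zeros G" "pev bad v \<noteq> 0" "v = (x, y, z)"
  defines "s \<equiv> pev U v / pev V v"
  shows "pev U v \<noteq> 0" "pev V v \<noteq> 0" "z \<noteq> 0" "qf x y \<noteq> 0" "qf x y \<noteq> z\<^sup>2" "qf x y \<noteq> 4 * z\<^sup>2"
    "s\<^sup>2 = qf x y" "s \<noteq> 0" "s + z \<noteq> 0" "s + 2 * z \<noteq> 0" "pp v = smul (pev V v) (psi s v)" "pp v \<noteq> (0, 0, 0)"
proof -
  show 1: "pev U v \<noteq> 0" "pev V v \<noteq> 0" "z \<noteq> 0" "qf x y \<noteq> 0" "qf x y \<noteq> z\<^sup>2" "qf x y \<noteq> 4 * z\<^sup>2"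
    using assms(2) by (auto simp: bad_def exceptional_def assms(3))
  show 2: "s\<^sup>2 = qf x y"
    using on_curve[OF assms(1)] 1(2) by (simp add: s_def power_divide) (simp add: assms(3))
  show "s \<noteq> 0" using 2 1(4) by auto
  show "s + z \<noteq> 0" using 2 1(5) by (auto simp: add_eq_0_iff2)
  show "s + 2 * z \<noteq> 0"
  proof
    assume "s + 2 * z = 0"
    hence "s = - (2 * z)" by (simp add: add_eq_0_iff2)
    thus False using 2 1(6) by (simp add: power_mult_distrib)
  qed
  have "pev V v * s = pev U v" using 1(2) by (simp add: s_def)
  thus pp: "pp v = smul (pev V v) (psi s v)" unfolding assms(3) pp_eq by (simp add: algebra_simps)
  show "pp v \<noteq> (0, 0, 0)" using 1(1,3) by (simp add: assms(3) pp_eq)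
qed

lemma dvd_if_zero_on_good:
  assumes "homogeneous m f" "\<And>v. v \<in> zeros G \<Longrightarrow> pev bad v \<noteq> 0 \<Longrightarrow> pev f v = 0"
  shows "G dvd f"
proof -
  have "G dvd f * bad"
    by (rule irreducible_dvdI[OF G_irr G_hom homogeneous_mult[OF assms(1) bad_hom]]) (use assms(2) in auto)
  thus ?thesis using n_bad G_dvd_mult by blast
qed

lemma good_pointE:
  obtains v x y z where "v \<in> zeros G" "pev bad v \<noteq> 0" "v = (x, y, z)"
proof -
  have "infinite (ppoint ` {v \<in> zeros G. pev bad v \<noteq> 0})"
    by (rule infinite_zeros_minus[OF G_irr G_hom bad_hom n_bad])
  hence "{v \<in> zeros G. pev bad v \<noteq> 0} \<noteq> {}" by (metis finite.emptyI image_empty)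
  then obtain v where "v \<in> zeros G" "pev bad v \<noteq> 0" by blast
  thus thesis using that by (cases v) blast
qed

text \<open>Vanishing on the graph is expressed as divisibility by G after pull-back. This makes D
  irreducible, because G is prime.\<close>

definition D :: "('a vec3 \<times> 'a vec3) set" where
  "D = {(v, w). v \<noteq> (0, 0, 0) \<and> w \<noteq> (0, 0, 0) \<and>
        (\<forall>f\<in>{f. (\<exists>a b. bihomogeneous a b f) \<and> G dvd gsub f}. bev f v w = 0)}"

lemma D_closed: "D \<in> closed2"
  unfolding D_def by (rule closed2I) blast

lemma D_bev: "(v, w) \<in> D \<Longrightarrow> bihomogeneous a b f \<Longrightarrow> G dvd gsub f \<Longrightarrow> bev f v w = 0"
  unfolding D_def by blast

lemma D_nonzero: "(v, w) \<in> D \<Longrightarrow> v \<noteq> (0, 0, 0)" "(v, w) \<in> D \<Longrightarrow> w \<noteq> (0, 0, 0)"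
  unfolding D_def by blast+

lemma graph_in_D:
  assumes "v \<in> zeros G" "pp v \<noteq> (0, 0, 0)"
  shows "(v, pp v) \<in> D"
proof -
  have "bev f v (pp v) = 0" if "G dvd gsub f" for f
    using dvd_imp_pev_eq_0[OF that, of v] assms(1) by (simp add: pev_gsub in_zeros)
  thus ?thesis using assms by (auto simp: D_def in_zeros)
qed

lemma good_ex: "infinite (ppoint ` {v \<in> zeros G. pev bad v \<noteq> 0})"
  by (rule infinite_zeros_minus[OF G_irr G_hom bad_hom n_bad])

lemma D_vanish_iff:
  assumes "bihomogeneous a b f"
  shows "(\<forall>(v, w)\<in>D. bev f v w = 0) \<longleftrightarrow> G dvd gsub f"
proof
  assume *: "\<forall>(v, w)\<in>D. bev f v w = 0"
  show "G dvd gsub f"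
  proof (rule dvd_if_zero_on_good[OF gsub_hom[OF assms]])
    fix v assume v: "v \<in> zeros G" "pev bad v \<noteq> 0"
    obtain x y z where "v = (x, y, z)" by (cases v)
    hence "pp v \<noteq> (0, 0, 0)" using good_point(12)[OF v] by blast
    thus "pev (gsub f) v = 0" using graph_in_D[OF v(1)] * by (auto simp: pev_gsub)
  qed
qed (use D_bev[OF _ assms] in blast)

lemma D_irred: "irred_closed closed2 D"
  unfolding irred_closed_def
proof (intro conjI ballI impI)
  show "D \<in> closed2" by (rule D_closed)
  obtain v x y z where v: "v \<in> zeros G" "pev bad v \<noteq> 0" "v = (x, y, z)" by (rule good_pointE)
  hence "pp v \<noteq> (0, 0, 0)" by (rule good_point(12))
  thus "D \<noteq> {}" using graph_in_D[OF v(1)] by blast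
  fix S T :: "('a vec3 \<times> 'a vec3) set" assume ST: "S \<in> closed2" "T \<in> closed2" "D \<subseteq> S \<union> T"
  obtain A where A: "\<And>f. f \<in> A \<Longrightarrow> \<exists>a b. bihomogeneous a b f"
      "S = {(v, w). v \<noteq> (0, 0, 0) \<and> w \<noteq> (0, 0, 0) \<and> (\<forall>f\<in>A. bev f v w = 0)}"
    using ST(1) by (rule closed2E) blast
  obtain B where B: "\<And>f. f \<in> B \<Longrightarrow> \<exists>a b. bihomogeneous a b f"
      "T = {(v, w). v \<noteq> (0, 0, 0) \<and> w \<noteq> (0, 0, 0) \<and> (\<forall>f\<in>B. bev f v w = 0)}"
    using ST(2) by (rule closed2E) blast
  have sep: "\<exists>f\<in>A. \<not> G dvd gsub f" if A: "\<And>f. f \<in> A \<Longrightarrow> \<exists>a b. bihomogeneous a b f"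
    and n: "\<not> D \<subseteq> {(v, w). v \<noteq> (0, 0, 0) \<and> w \<noteq> (0, 0, 0) \<and> (\<forall>f\<in>A. bev f v w = 0)}" for A
  proof (rule ccontr)
    assume *: "\<not> ?thesis"
    have "bev f v w = 0" if "f \<in> A" "(v, w) \<in> D" for f v w
      using A[OF that(1)] * D_bev[OF that(2)] that(1) by blast
    hence "D \<subseteq> {(v, w). v \<noteq> (0, 0, 0) \<and> w \<noteq> (0, 0, 0) \<and> (\<forall>f\<in>A. bev f v w = 0)}"
      using D_nonzero by blast
    thus False using n by blast
  qed
  show "D \<subseteq> S \<or> D \<subseteq> T"
  proof (rule ccontr)
    assume "\<not> ?thesis"
    hence "\<not> D \<subseteq> S" "\<not> D \<subseteq> T" by blast+
    then obtain f g where fg: "f \<in> A" "\<not> G dvd gsub f" "g \<in> B" "\<not> G dvd gsub g"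
      using sep[OF A(1)] sep[OF B(1)] unfolding A(2) B(2) by blast
    obtain i j where f: "bihomogeneous i j f" using A(1)[OF fg(1)] by blast
    obtain i' j' where g: "bihomogeneous i' j' g" using B(1)[OF fg(3)] by blast
    have "bev (f * g) v w = 0" if "(v, w) \<in> D" for v w
      using subsetD[OF ST(3) that] fg(1,3) unfolding A(2) B(2) by auto
    hence "G dvd gsub (f * g)" using D_vanish_iff[OF bihomogeneous_mult[OF f g]] by blast
    thus False using fg by (simp add: gsub_mult G_dvd_mult)
  qed
qed

lemma D_in_curve: "(v, w) \<in> D \<Longrightarrow> v \<in> zeros G"
proof -
  assume vw: "(v, w) \<in> D"
  have "gsub (lift1 G) = G" by (rule pev_eqI) (simp add: pev_gsub)
  thus ?thesis using D_bev[OF vw bihomogeneous_lift1[OF G_hom]] D_nonzero(1)[OF vw] by (simp add: in_zeros)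
qed

lemma bihomogeneous_W1: "bihomogeneous 2 2 (W_eq1 F)"
proof (rule bihomogeneousI)
  fix t u :: 'a and v w :: "'a vec3"
  obtain x y z where v: "v = (x, y, z)" by (cases v)
  obtain X Y Z where w: "w = (X, Y, Z)" by (cases w)
  have "qf (t * z * (u * X) - t * x * (u * Z)) (t * z * (u * Y) - t * y * (u * Z)) =
      qf (t * u * (z * X - x * Z)) (t * u * (z * Y - y * Z))" by (simp add: algebra_simps)
  also have "\<dots> = (t * u)\<^sup>2 * qf (z * X - x * Z) (z * Y - y * Z)" by (rule qf_scale)
  finally show "bev (W_eq1 F) (smul t v) (smul u w) = t\<^sup>2 * u\<^sup>2 * bev (W_eq1 F) v w"
    by (simp add: v w bev_W1 power_mult_distrib algebra_simps)
qed

lemma bihomogeneous_W2: "bihomogeneous 1 1 (W_eq2 :: 'a tpoly tpoly)"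
proof (rule bihomogeneousI)
  fix t u :: 'a and v w :: "'a vec3"
  obtain x y z where v: "v = (x, y, z)" by (cases v)
  obtain X Y Z where w: "w = (X, Y, Z)" by (cases w)
  show "bev W_eq2 (smul t v) (smul u w) = t ^ 1 * u ^ 1 * bev W_eq2 v w"
    by (simp add: v w bev_W_eq2 algebra_simps)
qed

text \<open>On the graph the first generator becomes \<open>\<epsilon>\<close> z^4 (q V^2 - U^2), a
  multiple of the norm.\<close>

lemma gsub_W: "G dvd gsub (W_eq1 F)" "gsub W_eq2 = 0"
proof -
  have W1: "gsub (W_eq1 F) = const3 \<epsilon> * (varz ^ 4 * (q * V\<^sup>2 - U\<^sup>2))"
  proof (rule pev_eqI')
    fix x y z
    let ?u = "pev U (x, y, z)" and ?v = "pev V (x, y, z)"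
    have "qf (z * ((?u + ?v * z) * x) - x * (?u * z)) (z * ((?u + ?v * z) * y) - y * (?u * z)) =
        qf (?v * z\<^sup>2 * x) (?v * z\<^sup>2 * y)" by (simp add: algebra_simps power2_eq_square)
    also have "\<dots> = (?v * z\<^sup>2)\<^sup>2 * qf x y" by (rule qf_scale)
    finally show "pev (gsub (W_eq1 F)) (x, y, z) = pev (const3 \<epsilon> * (varz ^ 4 * (q * V\<^sup>2 - U\<^sup>2))) (x, y, z)"
      by (simp add: pev_gsub pp_eq bev_W1 power_mult_distrib power2_eq_square power4_eq_xxxx algebra_simps)
  qed
  have "q * V\<^sup>2 - U\<^sup>2 = - (U\<^sup>2 - q * V\<^sup>2)" by simp
  hence "G dvd q * V\<^sup>2 - U\<^sup>2" using dvd_norm by (metis dvd_minus_iff)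
  thus "G dvd gsub (W_eq1 F)" unfolding W1 by (simp add: G_dvd_mult)
  show "gsub W_eq2 = 0" by (rule pev_eqI') (simp add: pev_gsub pp_eq bev_W_eq2)
qed

lemma D_subset_W: "D \<subseteq> W_surface F"
proof
  fix P assume "P \<in> D"
  then obtain v w where P: "P = (v, w)" "(v, w) \<in> D" by (cases P) auto
  thus "P \<in> W_surface F"
    using D_nonzero[OF P(2)] D_bev[OF P(2) bihomogeneous_W1 gsub_W(1)] D_bev[OF P(2) bihomogeneous_W2] gsub_W(2)
    by (simp add: W_surface_iff)
qed

text \<open>The minors of w and \<open>pp v\<close> vanish on D; where \<open>pp v\<close> is
  nonzero they determine the point w.\<close>

lemma D_graph:
  assumes vw: "(v, w) \<in> D" and nz: "pp v \<noteq> (0, 0, 0)"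
  shows "w \<in> ppoint (pp v)"
proof -
  have van: "pev a v * bev f v w - pev b v * bev g v w = 0"
    if "homogeneous (n + 2) a" "homogeneous (n + 2) b" "bihomogeneous 0 1 f" "bihomogeneous 0 1 g"
      "a * gsub f = b * gsub g" for a b f g
  proof -
    have 1: "bihomogeneous (n + 2) 1 (lift1 a * f - lift1 b * g)"
      using bihomogeneous_mult[OF bihomogeneous_lift1[OF that(1)] that(3)]
        bihomogeneous_mult[OF bihomogeneous_lift1[OF that(2)] that(4)] by (intro bihomogeneous_diff) simp_all
    have "gsub (lift1 a * f - lift1 b * g) = a * gsub f - b * gsub g"
      by (rule pev_eqI) (simp add: pev_gsub)
    hence "G dvd gsub (lift1 a * f - lift1 b * g)" using that(5) by simp
    from D_bev[OF vw 1 this] show ?thesis by simp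
  qed
  have b: "bihomogeneous 0 1 (varx :: 'a tpoly tpoly)" "bihomogeneous 0 1 (vary :: 'a tpoly tpoly)" "bihomogeneous 0 1 (varz :: 'a tpoly tpoly)"
    by (auto simp: bihomogeneous_iff)
  have gv: "gsub varx = px" "gsub vary = py" "gsub varz = pz" by (simp_all add: gsub_def)
  have "\<forall>f\<in>cross_forms (pp v). pev f w = 0"
    using van[OF p_hom(2,1) b(1,2)] van[OF p_hom(3,1) b(1,3)] van[OF p_hom(3,2) b(2,3)]
    by (cases w) (simp add: pp_def gv mult.commute)
  thus ?thesis using in_ppoint_iff[OF nz] D_nonzero(2)[OF vw] by blast
qed

text \<open>The closure of the image of the graph in the second plane. That it is the image of D
  itself, as the push-forward requires, is the content of \<open>snd_D\<close>.\<close>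

definition EE :: "'a vec3 set" where
  "EE = {w. w \<noteq> (0, 0, 0) \<and> (\<forall>f\<in>{f. (\<exists>e. homogeneous e f) \<and> G dvd gsub (lift2 f)}. pev f w = 0)}"

lemma pev_gsub_lift2: "pev (gsub (lift2 f)) v = pev f (pp v)"
  by (simp add: pev_gsub)

lemma EE_closed: "EE \<in> closed1"
  unfolding EE_def by (rule closed1I) blast

lemma pp_in_EE: "v \<in> zeros G \<Longrightarrow> pp v \<noteq> (0, 0, 0) \<Longrightarrow> pp v \<in> EE"
  unfolding EE_def by (auto simp: in_zeros simp flip: pev_gsub_lift2 dest: dvd_imp_pev_eq_0)

lemma dvd_gsub_lift2I:
  assumes "homogeneous e f" "\<And>v. v \<in> zeros G \<Longrightarrow> pev bad v \<noteq> 0 \<Longrightarrow> pev f (pp v) = 0"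
  shows "G dvd gsub (lift2 f)"
  by (rule dvd_if_zero_on_good[OF gsub_hom[OF bihomogeneous_lift2[OF assms(1)]]]) (simp add: pev_gsub_lift2 assms(2))

lemma EE_vanish_imp:
  assumes "homogeneous e f" "\<And>w. w \<in> EE \<Longrightarrow> pev f w = 0"
  shows "G dvd gsub (lift2 f)"
proof (rule dvd_gsub_lift2I[OF assms(1)])
  fix v assume v: "v \<in> zeros G" "pev bad v \<noteq> 0"
  obtain x y z where "v = (x, y, z)" by (cases v)
  hence "pp v \<noteq> (0, 0, 0)" using good_point(12)[OF v] by blast
  thus "pev f (pp v) = 0" using assms(2) pp_in_EE[OF v(1)] by blast
qed

lemma EE_irred: "irred_closed closed1 EE"
  unfolding irred_closed_def
proof (intro conjI ballI impI)
  show "EE \<in> closed1" by (rule EE_closed)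
  obtain v x y z where v: "v \<in> zeros G" "pev bad v \<noteq> 0" "v = (x, y, z)" by (rule good_pointE)
  hence "pp v \<noteq> (0, 0, 0)" by (rule good_point(12))
  thus "EE \<noteq> {}" using pp_in_EE[OF v(1)] by blast
  fix S T :: "'a vec3 set" assume ST: "S \<in> closed1" "T \<in> closed1" "EE \<subseteq> S \<union> T"
  obtain A where A: "\<And>f. f \<in> A \<Longrightarrow> \<exists>d. homogeneous d f" "S = {v. v \<noteq> (0, 0, 0) \<and> (\<forall>f\<in>A. pev f v = 0)}"
    using ST(1) by (rule closed1E) blast
  obtain B where B: "\<And>f. f \<in> B \<Longrightarrow> \<exists>d. homogeneous d f" "T = {v. v \<noteq> (0, 0, 0) \<and> (\<forall>f\<in>B. pev f v = 0)}"
    using ST(2) by (rule closed1E) blast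
  have sep: "\<exists>f\<in>A. \<not> G dvd gsub (lift2 f)" if A: "\<And>f. f \<in> A \<Longrightarrow> \<exists>d. homogeneous d f"
    and n: "\<not> EE \<subseteq> {v. v \<noteq> (0, 0, 0) \<and> (\<forall>f\<in>A. pev f v = 0)}" for A
  proof (rule ccontr)
    assume "\<not> ?thesis"
    hence "EE \<subseteq> {v. v \<noteq> (0, 0, 0) \<and> (\<forall>f\<in>A. pev f v = 0)}"
      unfolding EE_def using A by blast
    thus False using n by blast
  qed
  show "EE \<subseteq> S \<or> EE \<subseteq> T"
  proof (rule ccontr)
    assume "\<not> ?thesis"
    hence "\<not> EE \<subseteq> S" "\<not> EE \<subseteq> T" by blast+
    then obtain f g where fg: "f \<in> A" "\<not> G dvd gsub (lift2 f)" "g \<in> B" "\<not> G dvd gsub (lift2 g)"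
      using sep[OF A(1)] sep[OF B(1)] unfolding A(2) B(2) by blast
    obtain i where f: "homogeneous i f" using A(1)[OF fg(1)] by blast
    obtain j where g: "homogeneous j g" using B(1)[OF fg(3)] by blast
    have "pev (f * g) w = 0" if "w \<in> EE" for w
      using subsetD[OF ST(3) that] fg(1,3) unfolding A(2) B(2) by auto
    hence "G dvd gsub (lift2 (f * g))" by (rule EE_vanish_imp[OF homogeneous_mult[OF f g]])
    thus False using fg by (simp add: gsub_mult G_dvd_mult)
  qed
qed

text \<open>The map \<open>w \<mapsto> psi (- \<tau>) w\<close> with \<open>\<tau>\<^sup>2 = q(w)\<close> inverts \<open>psi s\<close>, so that the norm of
  \<open>G(psi \<tau> w)\<close> vanishes on the image.\<close>

lemma EE_form_ex: obtains N e where "N \<noteq> 0" "homogeneous e N" "G dvd gsub (lift2 N)"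
proof -
  obtain al be where ab: "\<And>x y z s. s\<^sup>2 = qf x y \<Longrightarrow> pev G (psi s (x, y, z)) = pev al (x, y, z) + s * pev be (x, y, z)"
    using psi_split[of G] by blast
  let ?N = "al\<^sup>2 - q * be\<^sup>2"
  have M: "pev ?N (x, y, z) = pev G (psi s (x, y, z)) * pev G (psi (- s) (x, y, z))"
    if "s\<^sup>2 = qf x y" for x y z s
  proof -
    have e: "pev G (psi s (x, y, z)) = pev al (x, y, z) + s * pev be (x, y, z)"
      "pev G (psi (- s) (x, y, z)) = pev al (x, y, z) - s * pev be (x, y, z)"
      using ab[of s x y z] ab[of "- s" x y z] that by simp_all
    show ?thesis unfolding e by (simp add: algebra_simps power2_eq_square flip: that)
  qed
  have hom: "homogeneous (4 * d) ?N" by (rule psi_norm_homogeneous[OF G_hom ab])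
  have "G dvd gsub (lift2 ?N)"
  proof (rule dvd_gsub_lift2I[OF hom])
    fix v assume v: "v \<in> zeros G" "pev bad v \<noteq> 0"
    obtain x y z where xyz: "v = (x, y, z)" by (cases v)
    define s where "s = pev U v / pev V v"
    have s: "s\<^sup>2 = qf x y" and pp: "pp v = smul (pev V v) (psi s v)"
      using good_point(7,11)[OF v xyz] by (simp_all add: s_def)
    have t: "(s * (s + z))\<^sup>2 = qf ((s + z) * x) ((s + z) * y)" by (simp add: power_mult_distrib s)
    have "psi (- (s * (s + z))) (psi s v) = smul (- (s\<^sup>2 * (s + z))) v"
      by (simp add: xyz power2_eq_square algebra_simps)
    hence "pev G (psi (- (s * (s + z))) (psi s v)) = 0"
      using v(1) by (simp add: homogeneous_pev[OF G_hom] in_zeros del: smul_simps)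
    hence "pev ?N (psi s v) = 0" using M[OF t, of "s * z"] by (simp add: xyz del: pev_diff pev_mult pev_power)
    thus "pev ?N (pp v) = 0" unfolding pp homogeneous_pev[OF hom] by simp
  qed
  moreover have "?N \<noteq> 0"
  proof -
    have "q \<noteq> 0" using n_q by auto
    then obtain u where "pev q u \<noteq> 0" by (rule pev_nonzero_ex)
    then obtain x y where xy: "qf x y \<noteq> 0" by (cases u) auto
    obtain s where s: "s\<^sup>2 = qf x y" by (rule sqrt_ex)
    have s0: "s \<noteq> 0" using s xy by auto
    \<comment> \<open>The norm is nonzero since neither factor vanishes identically on a line
      through A with q \<noteq> 0: there \<open>psi s\<close> only changes the parameter on the
      line.\<close>
    have half: "\<exists>P. P \<noteq> 0 \<and> (\<forall>z. poly P z = pev G (psi s (x, y, z)))" if s0: "s \<noteq> 0" for s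
    proof -
      obtain P where P: "\<And>z. poly P z = pev G (s * x + z * x, s * y + z * y, 0 + z * s)"
        using restrict_line[of G "s * x" x "s * y" y 0 s] by blast
      have "P \<noteq> 0"
      proof
        assume "P = 0"
        have "slice G x y = 0"
        proof (rule poly_all_zero_imp_zero[OF infinite_Diff_singleton[of s]])
          fix T assume "T \<in> UNIV - {s}"
          hence T: "s - T \<noteq> 0" by auto
          \<comment> \<open>The solution of s z / (s + z) = T, so that \<open>psi s\<close> sends
            (x, y, z) to a multiple of (x, y, T).\<close>
          define z where "z = s * T / (s - T)"
          have sz: "(s + z) * (s - T) = s * s" "z * (s - T) = s * T" using T by (simp_all add: z_def distrib_right) (simp add: algebra_simps)
          define k where "k = s * s / (s - T)"
          have k: "s + z = k" "z * s = k * T" using sz T by (simp_all add: k_def field_simps)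
          have "0 = pev G (s * x + z * x, s * y + z * y, 0 + z * s)" using P[of z] \<open>P = 0\<close> by simp
          also have "(s * x + z * x, s * y + z * y, 0 + z * s) = smul k (x, y, T)"
            using k(2) by (simp add: distrib_right[symmetric] k(1))
          finally have "k ^ d * pev G (x, y, T) = 0" by (simp add: homogeneous_pev[OF G_hom] del: smul_simps)
          moreover have "k \<noteq> 0" using s0 T by (simp add: k_def)
          ultimately show "poly (slice G x y) T = 0" by simp
        qed
        moreover have "x \<noteq> 0 \<or> y \<noteq> 0" using xy by auto
        ultimately show False using slice_nonzero[OF G_irr G_hom degree_G] by blast
      qed
      thus ?thesis using P by (intro exI[of _ P]) (simp add: algebra_simps)
    qed
    obtain P P' where P: "P \<noteq> 0" "\<And>z. poly P z = pev G (psi s (x, y, z))"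
      "P' \<noteq> 0" "\<And>z. poly P' z = pev G (psi (- s) (x, y, z))"
      using half[of s] half[of "- s"] s0 by (metis neg_equal_0_iff_equal)
    hence "P * P' \<noteq> 0" by simp
    then obtain z where "poly (P * P') z \<noteq> 0" using poly_all_zero_imp_zero[OF infinite_UNIV_alg_closed] by blast
    hence "pev ?N (x, y, z) \<noteq> 0" using M[OF s, of z] P by (simp del: pev_diff pev_mult pev_power)
    thus ?thesis by (metis pev_0)
  qed
  ultimately show thesis using that hom by blast
qed

text \<open>By \<open>EE_form_ex\<close> EE lies on an irreducible curve, and it fills this curve
  because it is not a single point.\<close>

lemma EE_equation: "\<exists>p e. irreducible p \<and> homogeneous e p \<and> EE = zeros p \<and>
    (\<forall>f e. homogeneous e f \<longrightarrow> G dvd gsub (lift2 f) \<longrightarrow> p dvd f)"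
proof -
  obtain N e where N: "N \<noteq> 0" "homogeneous e N" "G dvd gsub (lift2 N)" by (rule EE_form_ex)
  have "EE \<subseteq> zeros N" using N unfolding EE_def zeros_def by blast
  then obtain p k where p: "irreducible p" "homogeneous k p" "EE \<subseteq> zeros p"
    using irred_closed_component[OF EE_irred _ N(2,1)] by blast
  have all: "p dvd f" if f: "homogeneous m f" "G dvd gsub (lift2 f)" for f m
  proof (rule ccontr)
    assume "\<not> p dvd f"
    hence "finite (ppoint ` (zeros p \<inter> zeros f))" using p f finite_common_zeros by blast
    moreover have "EE \<subseteq> zeros p \<inter> zeros f" using p(3) f unfolding EE_def zeros_def by blast
    ultimately have "finite (ppoint ` EE)" using finite_subset image_mono by metis
    then obtain w where w: "w \<in> EE" "EE = ppoint w" by (rule closed1.irred_finite_orbits[OF EE_irred])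
    obtain X Y Z where xyz: "w = (X, Y, Z)" by (cases w)
    have w0: "w \<noteq> (0, 0, 0)" using w(1) by (simp add: EE_def)
    \<comment> \<open>If the image were one point (X : Y : Z), all good points of the curve would
      have direction (X : Y) from A. So the curve would be a line through A unless X = Y =
      0.\<close>
    have cr: "G dvd LL * linform Y (- X) 0"
    proof (rule dvd_if_zero_on_good[OF homogeneous_mult[OF LL_hom homogeneous_linform]])
      fix v assume v: "v \<in> zeros G" "pev bad v \<noteq> 0"
      obtain x y z where v': "v = (x, y, z)" by (cases v)
      have "pp v \<in> ppoint w" using pp_in_EE[OF v(1)] good_point(12)[OF v v'] w(2) by blast
      then obtain c where "pp v = smul c w" by (auto simp: ppoint_altdef)
      hence "pev LL v * x = c * X" "pev LL v * y = c * Y" by (simp_all add: pp_def px_def py_def v' xyz)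
      hence "(pev LL v * x) * Y = (pev LL v * y) * X" by simp
      thus "pev (LL * linform Y (- X) 0) v = 0" by (simp add: v' algebra_simps)
    qed
    hence "G dvd linform Y (- X) 0" using n_LL G_dvd_mult by blast
    hence XY: "X = 0" "Y = 0" using n_line[of Y "- X"] by auto
    have "G dvd LL * q"
    proof (rule dvd_if_zero_on_good[OF homogeneous_mult[OF LL_hom homogeneous_q]])
      fix v assume v: "v \<in> zeros G" "pev bad v \<noteq> 0"
      obtain x y z where v': "v = (x, y, z)" by (cases v)
      have "pp v \<in> ppoint w" using pp_in_EE[OF v(1)] good_point(12)[OF v v'] w(2) by blast
      then obtain c where "pp v = smul c w" by (auto simp: ppoint_altdef)
      hence "pev LL v * x = 0" "pev LL v * y = 0" by (simp_all add: pp_def px_def py_def v' xyz XY)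
      moreover have "x \<noteq> 0 \<or> y \<noteq> 0" using good_point(4)[OF v v'] by auto
      ultimately show "pev (LL * q) v = 0" by auto
    qed
    thus False using n_LL n_q G_dvd_mult by blast
  qed
  have "G dvd gsub (lift2 p)" by (rule EE_vanish_imp[OF p(2)]) (use p(3) in \<open>auto simp: in_zeros\<close>)
  have "zeros p \<subseteq> EE"
  proof
    fix w assume w: "w \<in> zeros p"
    have "pev f w = 0" if "homogeneous m f" "G dvd gsub (lift2 f)" for f m
      using dvd_imp_pev_eq_0[OF all[OF that]] w by (simp add: in_zeros)
    moreover have "w \<noteq> (0, 0, 0)" using w by (simp add: in_zeros)
    ultimately show "w \<in> EE" unfolding EE_def by blast
  qed
  thus ?thesis using p all by blast
qed

definition p :: "'a tpoly" where
  "p = (SOME p. (\<exists>e. irreducible p \<and> homogeneous e p \<and> EE = zeros p \<and>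
    (\<forall>f e. homogeneous e f \<longrightarrow> G dvd gsub (lift2 f) \<longrightarrow> p dvd f)))"

lemma p_props: "irreducible p" "\<exists>e. homogeneous e p" "EE = zeros p"
    "homogeneous e f \<Longrightarrow> G dvd gsub (lift2 f) \<Longrightarrow> p dvd f"
  using someI_ex[OF EE_equation] unfolding p_def[symmetric] by blast+

lemma EE_curve: "irred_curve closed1 EE"
  using irred_curve_zeros p_props by metis

lemma EE_dvd_iff:
  assumes "homogeneous e f" "zeros p \<subseteq> zeros f"
  shows "G dvd gsub (lift2 f)"
proof (rule EE_vanish_imp[OF assms(1)])
  fix w assume "w \<in> EE"
  hence "w \<in> zeros f" using assms(2) p_props(3) by blast
  thus "pev f w = 0" by (simp add: in_zeros)
qed

text \<open>At a good point, \<open>psi s v\<close> lies on B only if s^3 (s + 2 z) = 0, which is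
  the case excluded by \<open>n_U2\<close>.\<close>

lemma EE_not_B: "EE \<noteq> zeros F"
proof
  assume "EE = zeros F"
  hence "G dvd gsub (lift2 F)" using EE_dvd_iff[OF homogeneous_F] p_props(3) by simp
  hence F0: "pev F (pp v) = 0" if "v \<in> zeros G" for v
    using dvd_imp_pev_eq_0[of G _ v] that by (simp add: in_zeros flip: pev_gsub_lift2)
  have "G dvd U + const3 2 * V * varz"
  proof (rule dvd_if_zero_on_good)
    show "homogeneous (Suc n) (U + const3 2 * V * varz)"
      using homogeneous_mult[OF homogeneous_mult[OF homogeneous_const3 V_hom] homogeneous_vars(3)] U_hom
      by (intro homogeneous_add) simp_all
    fix v assume v: "v \<in> zeros G" "pev bad v \<noteq> 0"
    obtain x y z where v': "v = (x, y, z)" by (cases v)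
    define s where "s = pev U v / pev V v"
    note g = good_point[OF v v', folded s_def]
    have "pev F (psi s v) = 0"
      using F0[OF v(1)] g(2) unfolding g(11) by (simp add: homogeneous_pev[OF homogeneous_F] del: pev_F)
    hence "(s + z)\<^sup>2 * s\<^sup>2 - (s * z)\<^sup>2 = 0" using eps by (simp add: v' g(7))
    also have "(s + z)\<^sup>2 * s\<^sup>2 - (s * z)\<^sup>2 = s ^ 3 * (s + 2 * z)"
      by (simp add: power2_eq_square power3_eq_cube algebra_simps)
    finally show "pev (U + const3 2 * V * varz) v = 0" using g(8,10) by simp
  qed
  thus False using n_U2 by simp
qed

text \<open>The equation of a line through A pulls back to LL times itself, because
  \<open>psi\<close> preserves such lines.\<close>

lemma EE_not_L: "EE \<noteq> zeros l1" "EE \<noteq> zeros l2"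
proof -
  have aux: False if "EE = zeros l" "homogeneous (Suc 0) l" "\<And>v. pev l (pp v) = pev LL v * pev l v" "\<not> G dvd l" for l
  proof -
    have "G dvd gsub (lift2 l)" using EE_dvd_iff[OF that(2)] p_props(3) that(1) by simp
    moreover have "gsub (lift2 l) = LL * l" by (rule pev_eqI) (simp add: that(3) pev_gsub_lift2)
    ultimately show False using n_LL that(4) by (simp add: G_dvd_mult)
  qed
  have "pev l1 (pp v) = pev LL v * pev l1 v" "pev l2 (pp v) = pev LL v * pev l2 v" for v
    by (cases v; simp add: pp_def px_def py_def algebra_simps)+
  thus "EE \<noteq> zeros l1" "EE \<noteq> zeros l2" using aux n_l l_homogeneous by blast+
qed

lemma W_scale: "c \<noteq> 0 \<Longrightarrow> (smul c v, w) \<in> W_surface F \<longleftrightarrow> (v, w) \<in> W_surface F"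
  using bihomogeneous_bev[OF bihomogeneous_W1, of c v 1 w] bihomogeneous_bev[OF bihomogeneous_W2, of c v 1 w]
  by (simp add: W_surface_iff)

lemma snd_D_subset: "snd ` D \<subseteq> EE"
proof
  fix w assume "w \<in> snd ` D"
  then obtain v where vw: "(v, w) \<in> D" by auto
  thus "w \<in> EE" unfolding EE_def using D_nonzero(2)[OF vw] D_bev[OF vw bihomogeneous_lift2] by auto
qed

lemma finite_over_finite:
  assumes Z: "Z \<subseteq> D" and fin: "finite (ppoint ` (fst ` Z))"
  shows "finite (bipoint ` Z)"
proof (rule finite_subset)
  let ?R = "\<lambda>P. ppoint ` {w \<in> EE. \<exists>v\<in>P. (v, w) \<in> W_surface F}"
  show "bipoint ` Z \<subseteq> (\<Union>P\<in>ppoint ` (fst ` Z). (\<lambda>Q. P \<times> Q) ` ?R P)"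
  proof
    fix B assume "B \<in> bipoint ` Z"
    then obtain v w where vw: "(v, w) \<in> Z" "B = ppoint v \<times> ppoint w" by (auto simp: bipoint_def)
    hence "w \<in> EE" "(v, w) \<in> W_surface F" using Z snd_D_subset D_subset_W by force+
    hence "ppoint w \<in> ?R (ppoint v)" using in_own_ppoint by blast
    moreover have "ppoint v \<in> ppoint ` (fst ` Z)" using vw(1) by force
    ultimately show "B \<in> (\<Union>P\<in>ppoint ` (fst ` Z). (\<lambda>Q. P \<times> Q) ` ?R P)" using vw(2) by blast
  qed
  show "finite (\<Union>P\<in>ppoint ` (fst ` Z). (\<lambda>Q. P \<times> Q) ` ?R P)"
  proof (rule finite_UN_I[OF fin])
    fix P assume "P \<in> ppoint ` (fst ` Z)"
    then obtain v w where v: "(v, w) \<in> Z" "P = ppoint v" by auto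
    have "v \<noteq> (0, 0, 0)" using v(1) Z D_nonzero by blast
    moreover obtain e where e: "homogeneous e p" using p_props(2) by blast
    ultimately have "finite (ppoint ` {w \<in> zeros p. (v, w) \<in> W_surface F})"
      using finite_fibre[OF p_props(1) e] EE_not_B EE_not_L p_props(3) by simp
    moreover have "(\<exists>u\<in>P. (u, w) \<in> W_surface F) \<longleftrightarrow> (v, w) \<in> W_surface F" for w
    proof
      assume "\<exists>u\<in>P. (u, w) \<in> W_surface F"
      then obtain c where "c \<noteq> 0" "(smul c v, w) \<in> W_surface F" by (auto simp: v(2) ppoint_altdef)
      thus "(v, w) \<in> W_surface F" by (simp add: W_scale)
    qed (use in_own_ppoint v(2) in blast)
    hence "{w \<in> EE. \<exists>v\<in>P. (v, w) \<in> W_surface F} = {w \<in> zeros p. (v, w) \<in> W_surface F}"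
      by (simp only: p_props(3))
    ultimately show "finite ((\<lambda>Q. P \<times> Q) ` ?R P)" by simp
  qed
qed

lemma D_curve: "irred_curve closed2 D"
proof (rule closed2.irred_curveI[OF D_irred])
  show "infinite (bipoint ` D)"
  proof
    assume "finite (bipoint ` D)"
    hence "finite ((\<lambda>B. fst ` B) ` bipoint ` D)" by simp
    moreover have "ppoint ` {v \<in> zeros G. pev bad v \<noteq> 0} \<subseteq> (\<lambda>B. fst ` B) ` bipoint ` D"
    proof
      fix P assume "P \<in> ppoint ` {v \<in> zeros G. pev bad v \<noteq> 0}"
      then obtain v where v: "v \<in> zeros G" "pev bad v \<noteq> 0" "P = ppoint v" by blast
      obtain x y z where v': "v = (x, y, z)" by (cases v)
      have "(v, pp v) \<in> D" using graph_in_D[OF v(1) good_point(12)[OF v(1,2) v']] .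
      moreover have "P = fst ` bipoint (v, pp v)"
      proof -
        have "ppoint (pp v) \<noteq> {}" using in_own_ppoint by blast
        thus ?thesis by (simp add: bipoint_def v(3))
      qed
      ultimately show "P \<in> (\<lambda>B. fst ` B) ` bipoint ` D" by blast
    qed
    ultimately show False using good_ex finite_subset by blast
  qed
next
  fix Z assume Z: "irred_closed closed2 Z" "Z \<subset> D"
  hence "Z \<in> closed2" by (simp add: irred_closed_def)
  then obtain A where A: "\<And>f. f \<in> A \<Longrightarrow> \<exists>a b. bihomogeneous a b f"
      "Z = {(v, w). v \<noteq> (0, 0, 0) \<and> w \<noteq> (0, 0, 0) \<and> (\<forall>f\<in>A. bev f v w = 0)}"
    by (rule closed2E) blast
  obtain P where "P \<in> D" "P \<notin> Z" using Z(2) by blast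
  then obtain v0 w0 where "(v0, w0) \<in> D" "(v0, w0) \<notin> Z" by (cases P) blast
  then obtain f where f: "f \<in> A" "bev f v0 w0 \<noteq> 0" using A(2) D_nonzero by blast
  obtain a b where ab: "bihomogeneous a b f" using A(1)[OF f(1)] by blast
  have nf: "\<not> G dvd gsub f" using D_bev[OF \<open>(v0, w0) \<in> D\<close> ab] f(2) by blast
  \<comment> \<open>The factor \<open>pz\<close> accounts for the points where \<open>pp\<close>
    vanishes and D is not controlled by the graph.\<close>
  have "\<not> G dvd gsub f * pz" using nf nU nz by (simp add: G_dvd_mult pz_def)
  hence fin: "finite (ppoint ` (zeros G \<inter> zeros (gsub f * pz)))"
    by (rule finite_common_zeros[OF G_irr G_hom homogeneous_mult[OF gsub_hom[OF ab] p_hom(3)]])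
  have "fst ` Z \<subseteq> zeros G \<inter> zeros (gsub f * pz)"
  proof
    fix v assume "v \<in> fst ` Z"
    then obtain w where vw: "(v, w) \<in> Z" by auto
    hence D: "(v, w) \<in> D" using Z(2) by blast
    have fvw: "bev f v w = 0" using vw f(1) A(2) by blast
    have "pev (gsub f * pz) v = 0"
    proof (cases "pp v = (0, 0, 0)")
      case True
      thus ?thesis by (simp add: pp_def)
    next
      case False
      obtain c where c: "c \<noteq> 0" "w = smul c (pp v)" using D_graph[OF D False] by (auto simp: ppoint_altdef)
      have "c ^ b * bev f v (pp v) = 0" using fvw bihomogeneous_bev[OF ab, of 1 v c "pp v"] by (simp add: c(2))
      thus ?thesis using c(1) by (simp add: pev_gsub)
    qed
    thus "v \<in> zeros G \<inter> zeros (gsub f * pz)" using D_in_curve[OF D] by (simp add: in_zeros)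
  qed
  hence "finite (ppoint ` (fst ` Z))" using fin finite_subset image_mono by metis
  thus "finite (bipoint ` Z)" using finite_over_finite Z(2) by blast
qed

end

lemma coeff3_sum: "coeff3 (sum f S) i j l = (\<Sum>x\<in>S. coeff3 (f x) i j l)"
  by (induction S rule: infinite_finite_induct) auto

text \<open>The coefficients of f with respect to the monomials in v are polynomials in w. At w0
  they form a row of the identity matrix, which makes the elimination start from an invertible
  system.\<close>

lemma v_homogeneous_expansion:
  fixes f :: "'a::alg_closed_field tpoly tpoly"
  assumes hom: "\<And>u v w. u \<noteq> 0 \<Longrightarrow> bev f (smul u v) w = u ^ N * bev f v w"
    and spec: "\<And>v. bev f v w0 = pev (mono3 1 a b c) v"
  defines "M \<equiv> {(i, j, l). i + j + l = N}"
  shows "\<exists>c'. (\<forall>v w. bev f v w = (\<Sum>\<beta>\<in>M. pev (c' \<beta>) w * (case \<beta> of (i, j, l) \<Rightarrow> pev (mono3 1 i j l) v))) \<and>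
    (\<forall>\<beta>. pev (c' \<beta>) w0 = (if \<beta> = (a, b, c) then 1 else 0))"
proof -
  obtain T c' where T: "finite T" "f = (\<Sum>(i, j, l)\<in>T. lift1 (mono3 1 i j l) * lift2 (c' (i, j, l)))"
    "\<And>i j l. (i, j, l) \<notin> T \<Longrightarrow> c' (i, j, l) = 0"
    using bpoly_expansion[of f] by blast
  define P where "P = (\<lambda>w. \<Sum>(i, j, l)\<in>T. mono3 (pev (c' (i, j, l)) w) i j l)"
  have P: "pev (P w) v = bev f v w" for v w
    by (cases v) (simp add: P_def T(2) split_def mult_ac)
  have coeffP: "coeff3 (P w) i j l = pev (c' (i, j, l)) w" for w i j l
  proof -
    have "coeff3 (P w) i j l = (\<Sum>x\<in>T. if x = (i, j, l) then pev (c' (i, j, l)) w else 0)"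
      unfolding P_def coeff3_sum by (rule sum.cong) (auto split: if_splits)
    also have "\<dots> = (if (i, j, l) \<in> T then pev (c' (i, j, l)) w else 0)" using T(1) by simp
    finally show ?thesis using T(3)[of i j l] by auto
  qed
  have homP: "homogeneous N (P w)" for w
    by (rule homogeneousI) (simp add: P hom)
  have c0: "c' (i, j, l) = 0" if "(i, j, l) \<notin> M" for i j l
  proof (rule pev_zero_imp_zero)
    fix w
    have "coeff3 (P w) i j l = 0" using homP[of w] that by (auto simp: homogeneous_def M_def)
    thus "pev (c' (i, j, l)) w = 0" by (simp only: coeffP)
  qed
  have "P w0 = mono3 1 a b c" by (rule pev_eqI) (simp only: P spec)
  hence "pev (c' (i, j, l)) w0 = (if (i, j, l) = (a, b, c) then 1 else 0)" for i j l
    using coeffP[of w0 i j l] by simp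
  hence "\<forall>\<beta>. pev (c' \<beta>) w0 = (if \<beta> = (a, b, c) then 1 else 0)" by (metis prod_cases3)
  moreover have "bev f v w = (\<Sum>\<beta>\<in>M. pev (c' \<beta>) w * (case \<beta> of (i, j, l) \<Rightarrow> pev (mono3 1 i j l) v))" for v w
  proof -
    have finM: "finite M"
      by (rule finite_subset[of _ "{..N} \<times> {..N} \<times> {..N}"]) (auto simp: M_def)
    have "bev f v w = (\<Sum>\<beta>\<in>T. pev (c' \<beta>) w * (case \<beta> of (i, j, l) \<Rightarrow> pev (mono3 1 i j l) v))"
      unfolding T(2) by (simp add: split_def mult_ac)
    also have "\<dots> = (\<Sum>\<beta>\<in>T \<union> M. pev (c' \<beta>) w * (case \<beta> of (i, j, l) \<Rightarrow> pev (mono3 1 i j l) v))"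
      by (rule sum.mono_neutral_left) (use T(1,3) finM in auto)
    also have "\<dots> = (\<Sum>\<beta>\<in>M. pev (c' \<beta>) w * (case \<beta> of (i, j, l) \<Rightarrow> pev (mono3 1 i j l) v))"
      by (rule sum.mono_neutral_right) (use T(1) c0 finM in auto)
    finally show ?thesis .
  qed
  ultimately show ?thesis by blast
qed

section \<open>Closedness of the image and distinctness of the two halves\<close>

context split_curve
begin

text \<open>
  The image of \<open>D\<close> in the second plane is closed: if no point of \<open>D\<close> lies over \<open>w\<^sub>0\<close>, then the ideal of
  \<open>D\<close> specialises at \<open>w\<^sub>0\<close> to an ideal that contains all monomials of some degree.  The determinant of
  the coefficients of elements that specialise to these monomials vanishes on the image, but not at \<open>w\<^sub>0\<close>.
\<close>

lemma snd_D: "snd ` D = EE"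
proof (rule antisym[OF snd_D_subset], rule subsetI, rule ccontr)
  fix w0 assume w0: "w0 \<in> EE" "w0 \<notin> snd ` D"
  have w0nz: "w0 \<noteq> (0, 0, 0)" using w0(1) unfolding EE_def by blast
  obtain X0 Y0 Z0 where w0': "w0 = (X0, Y0, Z0)" by (cases w0)
  define spec where "spec = (\<lambda>f :: 'a tpoly tpoly. eval3 f (const3 X0) (const3 Y0) (const3 Z0))"
  have spec: "pev (spec f) v = bev f v w0" for f v
    unfolding spec_def w0' by (induction f rule: bpoly_induct) (simp_all add: lift1_def)
  \<comment> \<open>Using all scalar multiples of \<open>pp v\<close> builds the scaling of w in
    without requiring f to be bihomogeneous.\<close>
  define I where "I = {f. \<forall>v\<in>zeros G. \<forall>t. bev f v (smul t (pp v)) = 0}"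
  define J where "J = spec ` I"
  have J: "is_ideal J"
    unfolding is_ideal_def
  proof (intro conjI ballI allI)
    show "0 \<in> J" unfolding J_def by (rule image_eqI[of _ _ 0]) (simp_all add: spec_def I_def)
    fix a assume "a \<in> J"
    then obtain f where f: "f \<in> I" "a = spec f" unfolding J_def by blast
    {
      fix b assume "b \<in> J"
      then obtain g where g: "g \<in> I" "b = spec g" unfolding J_def by blast
      show "a + b \<in> J" unfolding J_def
        by (rule image_eqI[of _ _ "f + g"]) (use f g in \<open>simp_all add: spec_def I_def\<close>)
    }
    fix r
    have "r * a = spec (lift1 r * f)" by (rule pev_eqI) (simp add: f spec)
    moreover have "lift1 r * f \<in> I" using f(1) by (simp add: I_def)
    ultimately show "r * a \<in> J" unfolding J_def by (rule image_eqI)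
  qed
  have GJ: "G \<in> J" unfolding J_def
  proof (rule image_eqI[of _ _ "lift1 G"])
    show "G = spec (lift1 G)" by (rule pev_eqI) (simp add: spec)
  qed (simp add: I_def in_zeros)
  have comp: "\<exists>f'\<in>I. spec f' = cf k \<and> (\<forall>u v w. bev f' (smul u v) w = u ^ k * bev f' v w)"
    if f: "f \<in> I" and S: "finite S" "\<And>i. homogeneous i (cf i)" "spec f = sum cf S" "k \<in> S" for f S cf k
  proof -
    obtain M h where h: "\<And>a b. bihomogeneous a b (h a b)" "f = (\<Sum>a\<le>M. \<Sum>b\<le>M. h a b)"
      "\<And>a b. a > M \<or> b > M \<Longrightarrow> h a b = 0"
      by (rule bihomogeneous_decomp') blast
    define fk where "fk = (\<lambda>a. \<Sum>b\<le>M. h a b)"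
    have f_eq: "f = (\<Sum>a\<le>M. fk a)" by (simp add: fk_def h(2))
    have fk_hom: "bev (fk a) (smul u v) w = u ^ a * bev (fk a) v w" for a u v w
      using bihomogeneous_bev[OF h(1), of a _ u v 1 w] by (simp add: fk_def sum_distrib_left)
    have fk0: "fk a = 0" if "a > M" for a using h(3) that by (simp add: fk_def)
    have f_scale: "bev f (smul u v) w = (\<Sum>a\<le>M. u ^ a * bev (fk a) v w)" for u v w
      unfolding f_eq by (simp add: fk_hom)
    have "fk a \<in> I" for a
    proof (cases "a \<le> M")
      case True
      show ?thesis unfolding I_def
      proof (intro CollectI ballI allI)
        fix v t assume v: "v \<in> zeros G"
        show "bev (fk a) v (smul t (pp v)) = 0"
        proof (rule sum_powers_zero[of "{..M}"])
          fix u :: 'a assume u: "u \<noteq> 0"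
          have "smul u v \<in> zeros G" by (rule zeros_smul[OF G_hom v u])
          \<comment> \<open>Rescaling v by u rescales \<open>pp v\<close> by u^(n + 2). The scalar t
            absorbs this, so that u acts on the degree in v only.\<close>
          moreover have "smul t (pp v) = smul (t / u ^ (n + 2)) (pp (smul u v))"
            unfolding pp_scale using u by simp
          ultimately have "bev f (smul u v) (smul t (pp v)) = 0" using f by (simp only: I_def mem_Collect_eq)
          thus "(\<Sum>a\<le>M. u ^ a * bev (fk a) v (smul t (pp v))) = 0" by (simp only: f_scale)
        qed (use True in auto)
      qed
    qed (use fk0 in \<open>simp add: I_def\<close>)
    moreover have "spec (fk k) = cf k"
    proof (rule pev_eqI)
      fix v
      define c where "c = (\<lambda>a. pev (spec (fk a)) v - (if a \<in> S then pev (cf a) v else 0))"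
      have "c k = 0"
      proof (rule sum_powers_zero[of "{..M} \<union> S"])
        fix u :: 'a assume "u \<noteq> 0"
        have "(\<Sum>a\<in>{..M} \<union> S. u ^ a * pev (spec (fk a)) v) = (\<Sum>a\<le>M. u ^ a * pev (spec (fk a)) v)"
          by (rule sum.mono_neutral_right) (use S(1) fk0 in \<open>auto simp: spec not_le\<close>)
        also have "\<dots> = pev (spec f) (smul u v)" by (simp only: spec f_scale)
        also have "\<dots> = (\<Sum>a\<in>S. u ^ a * pev (cf a) v)" by (simp add: S(3) homogeneous_pev[OF S(2)])
        also have "\<dots> = (\<Sum>a\<in>{..M} \<union> S. u ^ a * (if a \<in> S then pev (cf a) v else 0))"
          by (rule sum.mono_neutral_cong_left) (use S(1) in auto)
        finally show "(\<Sum>a\<in>{..M} \<union> S. u ^ a * c a) = 0"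
          by (simp add: c_def right_diff_distrib sum_subtractf)
      qed (use S in auto)
      thus "pev (spec (fk k)) v = pev (cf k) v" using S(4) by (simp add: c_def)
    qed
    ultimately show ?thesis using fk_hom by blast
  qed
  have "cofinite_ideal J"
  proof (rule homogeneous_nullstellensatz[OF G_irr G_hom degree_G GJ J])
    fix S cf k assume "finite S" "\<And>i. homogeneous i (cf i)" "sum cf S \<in> J" "k \<in> S"
    then obtain f where "f \<in> I" "spec f = sum cf S" "finite S" "k \<in> S" "\<And>i. homogeneous i (cf i)"
      unfolding J_def by (metis imageE)
    then obtain f' where "f' \<in> I" "spec f' = cf k" using comp[of f S cf k] by auto
    thus "cf k \<in> J" unfolding J_def by (metis imageI)
  next
    fix v :: "'a vec3" assume v: "v \<noteq> (0, 0, 0)"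
    show "\<exists>g\<in>J. pev g v \<noteq> 0"
    proof (rule ccontr)
      assume none: "\<not> ?thesis"
      \<comment> \<open>A common zero v of J would make (v, w0) a point of D.\<close>
      have "bev f v w0 = 0" if f: "bihomogeneous a b f" "G dvd gsub f" for f a b
      proof -
        have "bev f u (smul t (pp u)) = 0" if "u \<in> zeros G" for u t
          using bihomogeneous_bev[OF f(1), of 1 u t "pp u"] dvd_imp_pev_eq_0[OF f(2), of u] that
          by (simp add: pev_gsub in_zeros)
        hence "f \<in> I" by (simp add: I_def)
        hence "spec f \<in> J" by (simp add: J_def)
        hence "pev (spec f) v = 0" using none by blast
        thus ?thesis by (simp only: spec)
      qed
      hence "(v, w0) \<in> D" using v w0nz unfolding D_def by blast
      hence "snd (v, w0) \<in> snd ` D" by (rule imageI)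
      thus False using w0(2) by simp
    qed
  qed
  then obtain N where N: "\<And>g. homogeneous N g \<Longrightarrow> g \<in> J" by (auto simp: cofinite_ideal_def)
  define M where "M = {(i, j, l). i + j + l = N}"
  have finM: "finite M"
    by (rule finite_subset[of _ "{..N} \<times> {..N} \<times> {..N}"]) (auto simp: M_def)
  define m where "m = (\<lambda>v :: 'a vec3. \<lambda>\<beta>. case \<beta> of (i, j, l) \<Rightarrow> pev (mono3 1 i j l) v)"
  have "\<exists>f c. f \<in> I \<and> (\<forall>v w. bev f v w = (\<Sum>\<beta>\<in>M. pev (c \<beta>) w * m v \<beta>)) \<and>
      (\<forall>\<beta>. pev (c \<beta>) w0 = (if \<beta> = \<alpha> then 1 else 0))" if "\<alpha> \<in> M" for \<alpha>
  proof -
    obtain i j l where ijl: "\<alpha> = (i, j, l)" "i + j + l = N" using \<open>\<alpha> \<in> M\<close> by (auto simp: M_def)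
    have "homogeneous N (mono3 (1 :: 'a) i j l)" using homogeneous_mono3[of i j l "1 :: 'a"] ijl by simp
    hence "mono3 1 i j l \<in> J" by (rule N)
    then obtain f where f: "f \<in> I" "spec f = mono3 1 i j l" unfolding J_def by force
    define cf where "cf = (\<lambda>k. if k = N then mono3 1 i j l else (0 :: 'a tpoly))"
    have "\<And>k. homogeneous k (cf k)" using \<open>homogeneous N _\<close> by (simp add: cf_def)
    moreover have "spec f = sum cf {N}" by (simp add: cf_def f)
    ultimately obtain f' where f': "f' \<in> I" "spec f' = mono3 1 i j l"
      "\<And>u v w. bev f' (smul u v) w = u ^ N * bev f' v w"
      using comp[OF f(1), of "{N}" cf N] by (auto simp: cf_def)
    have "bev f' v w0 = pev (mono3 1 i j l) v" for v by (simp add: f'(2) flip: spec)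
    from v_homogeneous_expansion[of f' N w0 i j l, OF f'(3) this]
    obtain c' where "\<forall>v w. bev f' v w = (\<Sum>\<beta>\<in>M. pev (c' \<beta>) w * m v \<beta>)"
      "\<forall>\<beta>. pev (c' \<beta>) w0 = (if \<beta> = \<alpha> then 1 else 0)"
      unfolding M_def[symmetric] m_def ijl(1)[symmetric] by (elim exE conjE)
    thus ?thesis using f'(1) by (intro exI[of _ f'] exI[of _ c'] conjI)
  qed
  hence "\<forall>\<alpha>\<in>M. \<exists>f c. f \<in> I \<and> (\<forall>v w. bev f v w = (\<Sum>\<beta>\<in>M. pev (c \<beta>) w * m v \<beta>)) \<and>
      (\<forall>\<beta>. pev (c \<beta>) w0 = (if \<beta> = \<alpha> then 1 else 0))" by (rule ballI)
  from bchoice[OF this] obtain f where "\<forall>\<alpha>\<in>M. \<exists>c. f \<alpha> \<in> I \<and>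
      (\<forall>v w. bev (f \<alpha>) v w = (\<Sum>\<beta>\<in>M. pev (c \<beta>) w * m v \<beta>)) \<and>
      (\<forall>\<beta>. pev (c \<beta>) w0 = (if \<beta> = \<alpha> then 1 else 0))" by (elim exE)
  from bchoice[OF this] obtain c where c': "\<forall>\<alpha>\<in>M. f \<alpha> \<in> I \<and>
      (\<forall>v w. bev (f \<alpha>) v w = (\<Sum>\<beta>\<in>M. pev (c \<alpha> \<beta>) w * m v \<beta>)) \<and>
      (\<forall>\<beta>. pev (c \<alpha> \<beta>) w0 = (if \<beta> = \<alpha> then 1 else 0))" by (elim exE)
  have c: "f \<alpha> \<in> I" "bev (f \<alpha>) v w = (\<Sum>\<beta>\<in>M. pev (c \<alpha> \<beta>) w * m v \<beta>)"
    "pev (c \<alpha> \<beta>) w0 = (if \<beta> = \<alpha> then 1 else 0)" if "\<alpha> \<in> M" for \<alpha> \<beta> v w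
    by (rule bspec[OF c' that, THEN conjunct1],
        rule bspec[OF c' that, THEN conjunct2, THEN conjunct1, THEN HOL.spec, THEN HOL.spec],
        rule bspec[OF c' that, THEN conjunct2, THEN conjunct2, THEN HOL.spec])
  \<comment> \<open>The cone over the image. For w in it, the monomials evaluated at v are a nonzero
    solution of the linear system with matrix c.\<close>
  define \<Omega> where "\<Omega> = {smul t (pp v) |t v. v \<in> zeros G}"
  have "\<exists>h. pev h w0 \<noteq> 0 \<and> (\<forall>w\<in>\<Omega>. pev h w = 0)"
  proof (rule polynomial_elimination[OF finM, of c])
    fix w assume "w \<in> \<Omega>"
    then obtain t v where v: "w = smul t (pp v)" "v \<in> zeros G" by (auto simp: \<Omega>_def)
    have "(\<Sum>\<beta>\<in>M. pev (c \<alpha> \<beta>) w * m v \<beta>) = 0" if "\<alpha> \<in> M" for \<alpha>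
    proof -
      have "bev (f \<alpha>) v w = 0" using c(1)[OF that] v by (simp only: I_def mem_Collect_eq)
      thus ?thesis by (simp only: c(2)[OF that])
    qed
    moreover have "\<exists>\<alpha>\<in>M. m v \<alpha> \<noteq> 0"
    proof -
      obtain x y z where xyz: "v = (x, y, z)" by (cases v)
      consider "x \<noteq> 0" | "y \<noteq> 0" | "z \<noteq> 0" using v(2) by (auto simp: in_zeros xyz)
      thus ?thesis
      proof cases
        case 1
        thus ?thesis by (intro bexI[of _ "(N, 0, 0)"]) (auto simp: m_def M_def xyz)
      next
        case 2
        thus ?thesis by (intro bexI[of _ "(0, N, 0)"]) (auto simp: m_def M_def xyz)
      next
        case 3
        thus ?thesis by (intro bexI[of _ "(0, 0, N)"]) (auto simp: m_def M_def xyz)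
      qed
    qed
    ultimately show "\<exists>m. (\<exists>i\<in>M. m i \<noteq> 0) \<and> (\<forall>i\<in>M. (\<Sum>j\<in>M. pev (c i j) w * m j) = 0)"
      by (intro exI[of _ "m v"] conjI ballI)
  qed (use c(3) in \<open>simp add: eq_commute\<close>)
  then obtain h where h: "pev h w0 \<noteq> 0" "\<And>w. w \<in> \<Omega> \<Longrightarrow> pev h w = 0" by blast
  \<comment> \<open>h need not be a form, but its components vanish on the image as well, hence at
    w0, which lies in EE.\<close>
  obtain S cf where S: "finite S" "\<And>i. homogeneous i (cf i)" "h = sum cf S"
    using homogeneous_decomp[of h] unfolding decomposable_def by blast
  have "pev (cf i) w0 = 0" if i: "i \<in> S" for i
  proof -
    have "pev (cf i) (pp v) = 0" if v: "v \<in> zeros G" for v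
    proof (rule sum_powers_zero[OF S(1) _ i, of "\<lambda>i. pev (cf i) (pp v)"])
      fix t :: 'a
      have "smul t (pp v) \<in> \<Omega>" unfolding \<Omega>_def using v by blast
      hence "pev h (smul t (pp v)) = 0" by (rule h(2))
      thus "(\<Sum>i\<in>S. t ^ i * pev (cf i) (pp v)) = 0" by (simp add: S(3) homogeneous_pev[OF S(2)])
    qed
    hence "G dvd gsub (lift2 (cf i))" by (intro dvd_gsub_lift2I[OF S(2)])
    thus ?thesis using w0(1) S(2) unfolding EE_def by blast
  qed
  hence "pev h w0 = 0" by (simp add: S(3))
  thus False using h(1) by simp
qed

text \<open>Changing the sign of U replaces s by - s and gives the other half.\<close>

lemma split_curve_neg: "split_curve a1 b1 a2 b2 \<epsilon> \<mu> G (- U) V d n"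
  by unfold_locales
    (use G_irr G_hom homogeneous_uminus[OF U_hom] V_hom nU nV dvd_norm n_line nz nF nF2 in auto)

text \<open>
  If both halves had the same image, the curve would be invariant under the translation of the distance
  from \<open>A\<close> by \<open>2\<close>, that is \<open>1/z \<mapsto> 1/z + 2/s\<close> on a line through \<open>A\<close>, and would meet this line
  in more than \<open>d\<close> points.
\<close>

lemma EE_neq_neg:
  assumes char: "\<And>m. 0 < m \<Longrightarrow> m \<le> d \<Longrightarrow> of_nat m \<noteq> (0::'a)"
  shows "EE \<noteq> split_curve.EE G (- U) V"
proof
  assume eq: "EE = split_curve.EE G (- U) V"
  interpret neg: split_curve a1 b1 a2 b2 \<epsilon> \<mu> G "- U" V d n by (rule split_curve_neg)
  \<comment> \<open>r is an eliminant of G and \<open>bad\<close>: on a line through A with r(x, y)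
    \<noteq> 0 all points of the curve are good. The leading coefficient keeps the restriction of G
    to this line nonconstant.\<close>
  obtain A B r where r: "A * G + B * bad = [:r:]" "r \<noteq> 0" using eliminate_z[OF G_irr degree_G n_bad] .
  define lc where "lc = lead_coeff G"
  have lc0: "lc \<noteq> 0" using degree_G by (auto simp: lc_def)
  have "[:r * lc:] \<noteq> 0" using r(2) lc0 by simp
  then obtain u where u: "pev [:r * lc:] u \<noteq> 0" by (rule pev_nonzero_ex)
  obtain x y z' where "u = (x, y, z')" by (cases u)
  hence xy: "poly (poly r [:y:]) x \<noteq> 0" "poly (poly lc [:y:]) x \<noteq> 0"
    using u by (auto simp: pev.simps eval3_def)
  have good: "pev bad (x, y, z) \<noteq> 0" if "pev G (x, y, z) = 0" for z
  proof
    assume "pev bad (x, y, z) = 0"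
    hence "pev [:r:] (x, y, z) = 0" using that by (simp flip: r(1))
    thus False using xy(1) by (simp add: pev.simps eval3_def)
  qed
  have "coeff (slice G x y) (degree G) \<noteq> 0" using xy(2) by (simp add: coeff_slice lc_def)
  hence deg: "slice G x y \<noteq> 0" "degree (slice G x y) > 0"
    using degree_G le_degree[of "slice G x y" "degree G"] by auto
  then obtain z0 where z0: "pev G (x, y, z0) = 0" using alg_closed_imp_poly_has_root[of "slice G x y"] by auto
  define s where "s = pev U (x, y, z0) / pev V (x, y, z0)"
  have inC: "(x, y, z) \<in> zeros G" if "pev G (x, y, z) = 0" for z
  proof -
    have "qf x y \<noteq> 0" using good[OF that] by (auto simp: bad_def exceptional_def)
    thus ?thesis using that by (auto simp: in_zeros)
  qed
  note g0 = good_point[OF inC[OF z0] good[OF z0] refl, folded s_def]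
  \<comment> \<open>The line fixes s only up to sign. The condition U = s V with the same s is
    carried along, so that all translations go in the same direction.\<close>
  have step: "\<exists>z. z \<noteq> 0 \<and> pev G (x, y, z) = 0 \<and> pev U (x, y, z) = s * pev V (x, y, z) \<and>
      inverse z = inverse z0 + 2 * of_nat j / s" for j
  proof (induction j)
    case 0
    show ?case by (rule exI[of _ z0]) (use z0 g0 in \<open>simp add: s_def\<close>)
  next
    case (Suc j)
    then obtain z where z: "z \<noteq> 0" "pev G (x, y, z) = 0" "pev U (x, y, z) = s * pev V (x, y, z)"
      "inverse z = inverse z0 + 2 * of_nat j / s" by blast
    let ?v = "(x, y, z)"
    have v: "?v \<in> zeros G" "pev bad ?v \<noteq> 0" using inC good z(2) by blast+
    have sv: "pev U ?v / pev V ?v = s" using good_point(2)[OF v refl] z(3) by simp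
    note g = good_point[OF v refl, unfolded sv]
    have "pp ?v \<in> EE" by (rule pp_in_EE[OF v(1) g(12)])
    hence "pp ?v \<in> snd ` neg.D" unfolding eq neg.snd_D .
    then obtain v' where v': "(v', pp ?v) \<in> neg.D" by auto
    obtain x1 y1 z1 where xyz1: "v' = (x1, y1, z1)" by (cases v')
    define k where "k = pev V ?v * (s + z)"
    have ppv: "pp ?v = (k * x, k * y, pev V ?v * (s * z))" unfolding g(11) by (simp add: k_def mult_ac)
    have k0: "k \<noteq> 0" using g(2,9) by (simp add: k_def)
    have W: "(v', pp ?v) \<in> W_surface F" using v' neg.D_subset_W by blast
    have cross: "x1 * y = y1 * x" using W k0 by (simp add: W_surface_iff xyz1 ppv bev_W_eq2)
    have xy0: "x \<noteq> 0 \<or> y \<noteq> 0" using g(4) by auto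
    obtain t where t: "x1 = t * x" "y1 = t * y"
    proof (cases "x = 0")
      case False
      thus thesis using that[of "x1 / x"] cross by (simp add: field_simps)
    next
      case True
      thus thesis using that[of "y1 / y"] cross xy0 by (simp add: field_simps)
    qed
    \<comment> \<open>Over A the incidence surface consists of points of B, and \<open>pp\<close> of
      a good point lies on B only if s + 2 z = 0.\<close>
    have "t \<noteq> 0"
    proof
      assume t0: "t = 0"
      have z1: "z1 \<noteq> 0" using neg.D_nonzero(1)[OF v'] by (simp add: xyz1 t t0)
      have "qf (z1 * (k * x)) (z1 * (k * y)) = (z1 * (pev V ?v * (s * z)))\<^sup>2"
        using W eps by (simp add: W_surface_iff xyz1 ppv bev_W1 t t0)
      hence "(z1 * k)\<^sup>2 * qf x y = (z1 * (pev V ?v * (s * z)))\<^sup>2" using qf_scale[of "z1 * k" x y] by (simp add: mult.assoc)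
      hence "(z1 * k)\<^sup>2 * s\<^sup>2 - (z1 * (pev V ?v * (s * z)))\<^sup>2 = 0" by (simp only: g(7) diff_self)
      also have "(z1 * k)\<^sup>2 * s\<^sup>2 - (z1 * (pev V ?v * (s * z)))\<^sup>2 = (z1 * pev V ?v)\<^sup>2 * ((s + z)\<^sup>2 * s\<^sup>2 - (s * z)\<^sup>2)"
        unfolding k_def by (simp only: power2_eq_square algebra_simps)
      finally have "(z1 * pev V ?v)\<^sup>2 * ((s + z)\<^sup>2 * s\<^sup>2 - (s * z)\<^sup>2) = 0" .
      moreover have "(s + z)\<^sup>2 * s\<^sup>2 - (s * z)\<^sup>2 = s ^ 3 * (s + 2 * z)"
        by (simp add: power2_eq_square power3_eq_cube algebra_simps)
      ultimately show False using z1 g by simp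
    qed
    define z2 where "z2 = z1 / t"
    have v2: "v' = smul t (x, y, z2)" using \<open>t \<noteq> 0\<close> by (simp add: xyz1 t z2_def)
    have "pev G v' = 0" using neg.D_in_curve[OF v'] by (simp add: in_zeros)
    hence G2: "pev G (x, y, z2) = 0" using \<open>t \<noteq> 0\<close> by (simp add: v2 homogeneous_pev[OF G_hom] del: smul_simps)
    let ?v2 = "(x, y, z2)"
    have v2C: "?v2 \<in> zeros G" "pev bad ?v2 \<noteq> 0" using inC good G2 by blast+
    define \<sigma> where "\<sigma> = pev U ?v2 / pev V ?v2"
    note g2 = good_point[OF v2C refl, folded \<sigma>_def]
    have \<sigma>: "\<sigma> = s \<or> \<sigma> = - s" using g(7) g2(7) by (metis power2_eq_iff)
    have U2: "pev U ?v2 = \<sigma> * pev V ?v2" using g2(2) by (simp add: \<sigma>_def)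
    have npp: "neg.pp ?v2 = smul (pev V ?v2) ((z2 - \<sigma>) * x, (z2 - \<sigma>) * y, - \<sigma> * z2)"
      unfolding neg.pp_eq by (simp add: U2 algebra_simps)
    have npp0: "neg.pp ?v2 \<noteq> (0, 0, 0)" unfolding npp using g2(2,3,8) by simp
    have "neg.pp v' = smul (t ^ (n + 2)) (neg.pp ?v2)" unfolding v2 by (rule neg.pp_scale)
    hence "neg.pp v' \<noteq> (0, 0, 0)" "ppoint (neg.pp v') = ppoint (neg.pp ?v2)"
      using npp0 \<open>t \<noteq> 0\<close> by simp_all
    with neg.D_graph[OF v'] have "pp ?v \<in> ppoint (neg.pp ?v2)" by simp
    then obtain c where c: "c \<noteq> 0" "pp ?v = smul c (neg.pp ?v2)" by (auto simp: ppoint_altdef)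
    define c' where "c' = c * pev V ?v2"
    have "k * x = c' * (z2 - \<sigma>) * x" "k * y = c' * (z2 - \<sigma>) * y" and e3: "pev V ?v * (s * z) = - (c' * (\<sigma> * z2))"
      using c(2) unfolding ppv npp by (simp_all add: c'_def mult_ac)
    hence e1: "k = c' * (z2 - \<sigma>)" using xy0 by auto
    have "c' \<noteq> 0" using c(1) g2(2) by (simp add: c'_def)
    have "k * (s * z) = (s + z) * (pev V ?v * (s * z))" by (simp add: k_def mult_ac)
    hence "c' * ((z2 - \<sigma>) * (s * z)) = c' * (- ((s + z) * (\<sigma> * z2)))" unfolding e1 e3 by (simp add: mult_ac)
    hence e: "(z2 - \<sigma>) * (s * z) = - ((s + z) * (\<sigma> * z2))" using \<open>c' \<noteq> 0\<close> by (metis mult_left_cancel)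
    \<comment> \<open>The other sign gives z2 = z, hence the same point, at which U / V cannot be
      both s and - s.\<close>
    have "\<sigma> = s"
    proof (rule ccontr)
      assume "\<sigma> \<noteq> s"
      hence \<sigma>': "\<sigma> = - s" using \<sigma> by blast
      hence "s * (s * (z - z2)) = 0" using e by (simp add: algebra_simps)
      hence "z2 = z" using g(8) by simp
      hence "s = - s" using sv \<sigma>' by (simp add: \<sigma>_def)
      hence "2 * s = 0" by (metis add.right_inverse mult_2)
      thus False using two g(8) by simp
    qed
    hence "s * (s * z - s * z2 - 2 * z * z2) = 0" using e by (simp add: algebra_simps)
    hence "s * z - s * z2 = 2 * z * z2" using g(8) by simp
    hence "s * z = s * z2 + 2 * z * z2" by (simp add: diff_eq_eq add.commute)
    moreover have "inverse z2 * (s * z * z2) = s * z" "(inverse z + 2 / s) * (s * z * z2) = s * z2 + 2 * z * z2"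
      using g(3,8) g2(3) by (simp_all add: distrib_right)
    ultimately have "inverse z2 * (s * z * z2) = (inverse z + 2 / s) * (s * z * z2)" by argo
    moreover have "s * z * z2 \<noteq> 0" using g(3,8) g2(3) by simp
    ultimately have "inverse z2 = inverse z + 2 / s" using mult_right_cancel by blast
    hence "inverse z2 = inverse z0 + 2 * of_nat (Suc j) / s" unfolding z(4) by (simp add: add_divide_distrib distrib_left)
    thus ?case using g2(3) G2 U2 \<open>\<sigma> = s\<close> by blast
  qed
  then obtain zz where zz: "\<And>j. zz j \<noteq> 0" "\<And>j. pev G (x, y, zz j) = 0" "\<And>j. inverse (zz j) = inverse z0 + 2 * of_nat j / s"
    by metis
  \<comment> \<open>The inverses of these d + 1 values differ by 2 m / s with 0 < m \<le> d, which
    is nonzero by the assumption on the characteristic.\<close>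
  have inj: "inj_on zz {..d}"
  proof (rule inj_onI)
    have *: "i = j" if "i \<le> j" "j \<le> d" "zz i = zz j" for i j
    proof (rule ccontr)
      assume "i \<noteq> j"
      have "2 * of_nat i / s = 2 * of_nat j / s" using zz(3)[of i] zz(3)[of j] that(3) by (metis add_left_cancel)
      hence "of_nat i = (of_nat j :: 'a)" using two g0(8) by (simp add: field_simps)
      hence "of_nat (j - i) = (0::'a)" using that(1) by (simp add: of_nat_diff)
      thus False using char[of "j - i"] that(1,2) \<open>i \<noteq> j\<close> by (metis diff_is_0_eq diff_le_self le_antisym le_trans neq0_conv)
    qed
    fix i j assume "i \<in> {..d}" "j \<in> {..d}" "zz i = zz j"
    thus "i = j" using *[of i j] *[of j i] by (cases "i \<le> j") auto
  qed
  have "zz ` {..d} \<subseteq> {z. poly (slice G x y) z = 0}" using zz(2) by auto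
  hence "card (zz ` {..d}) \<le> card {z. poly (slice G x y) z = 0}"
    by (intro card_mono poly_roots_finite deg)
  also have "\<dots> \<le> degree (slice G x y)" by (rule card_poly_roots_bound[OF deg(1)])
  also have "\<dots> \<le> d" by (rule degree_slice[OF G_hom])
  finally show False using inj by (simp add: card_image)
qed

end

subsection \<open>Bihomogeneous components of ideal members\<close>

text \<open>Terms of any bidegree other than (A, B) cancel among themselves.\<close>

lemma bihomogeneous_select:
  fixes t :: "'i \<Rightarrow> 'a::alg_closed_field tpoly tpoly"
  assumes S: "finite S" and t: "\<And>k. k \<in> S \<Longrightarrow> bihomogeneous (dg k) (dg' k) (t k)"
    and h: "bihomogeneous A B (sum t S)"
  shows "sum t S = sum t {k\<in>S. dg k = A \<and> dg' k = B}"
proof (rule bev_eqI)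
  fix v w
  have "finite (dg ` S \<union> dg' ` S)" using S by simp
  then obtain M where M: "\<And>k. k \<in> S \<Longrightarrow> dg k \<le> M \<and> dg' k \<le> M"
    unfolding finite_nat_set_iff_bounded_le by blast
  define c where "c = (\<lambda>a b. \<Sum>k\<in>{k\<in>S. (dg k, dg' k) = (a, b)}. bev (t k) v w)"
  have group: "(\<Sum>a\<le>M. \<Sum>b\<le>M. x ^ a * u ^ b * c a b) = (\<Sum>k\<in>S. x ^ dg k * u ^ dg' k * bev (t k) v w)" for x u
  proof -
    have "(\<Sum>a\<le>M. \<Sum>b\<le>M. x ^ a * u ^ b * c a b) = (\<Sum>p\<in>{..M} \<times> {..M}. x ^ fst p * u ^ snd p * c (fst p) (snd p))"
      by (simp add: sum.cartesian_product split_def)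
    also have "\<dots> = (\<Sum>p\<in>{..M} \<times> {..M}. \<Sum>k\<in>{k\<in>S. (dg k, dg' k) = p}. x ^ dg k * u ^ dg' k * bev (t k) v w)"
      by (rule sum.cong) (auto simp: c_def sum_distrib_left)
    also have "\<dots> = (\<Sum>k\<in>S. x ^ dg k * u ^ dg' k * bev (t k) v w)"
      by (rule sum.group) (use S M in auto)
    finally show ?thesis .
  qed
  have "(\<Sum>a\<le>M. \<Sum>b\<le>M. x ^ a * u ^ b * c a b) = x ^ A * u ^ B * bev (sum t S) v w" for x u
    unfolding group bihomogeneous_bev[OF h, symmetric] by (simp add: bihomogeneous_bev[OF t])
  hence 1: "c a b = 0" if "a \<le> M" "b \<le> M" "(a, b) \<noteq> (A, B)" for a b
    using sum_powers2_eq_single[where c = c and M = M and d = A and d' = B and e = "bev (sum t S) v w"] that by blast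
  have 2: "c a b = 0" if "a > M \<or> b > M" for a b
  proof -
    have "{k\<in>S. (dg k, dg' k) = (a, b)} = {}" using M that by force
    thus ?thesis by (simp only: c_def sum.empty)
  qed
  have 3: "c a b = (if a = A then if b = B then c A B else 0 else 0)" for a b
    using 1[of a b] 2[of a b] by (cases "a \<le> M \<and> b \<le> M") auto
  have "bev (sum t S) v w = (\<Sum>a\<le>M. \<Sum>b\<le>M. c a b)" using group[of 1 1] by simp
  also have "\<dots> = (\<Sum>a\<le>M. if a = A then (\<Sum>b\<le>M. if b = B then c A B else 0) else 0)"
    by (rule sum.cong) (auto intro!: sum.cong simp: 3[of A] 3)
  also have "\<dots> = c A B" using 2[of A B] by (auto simp: not_le)
  also have "\<dots> = bev (sum t {k\<in>S. dg k = A \<and> dg' k = B}) v w" by (simp add: c_def)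
  finally show "bev (sum t S) v w = bev (sum t {k\<in>S. dg k = A \<and> dg' k = B}) v w" .
qed

text \<open>Taking components turns the coefficients of an ideal member into bihomogeneous ones of
  complementary bidegree. Where the complement would be negative, the coefficient is 0.\<close>

lemma bihomogeneous_coefficients:
  fixes p g :: "'i \<Rightarrow> 'a::alg_closed_field tpoly tpoly"
  assumes I: "finite I" and g: "\<And>i. i \<in> I \<Longrightarrow> bihomogeneous (\<alpha> i) (\<beta> i) (g i)"
    and h: "bihomogeneous A B h" "h = (\<Sum>i\<in>I. p i * g i)"
  shows "\<exists>p'. h = (\<Sum>i\<in>I. p' i * g i) \<and>
    (\<forall>i\<in>I. p' i \<noteq> 0 \<longrightarrow> (\<exists>a b. a + \<alpha> i = A \<and> b + \<beta> i = B \<and> bihomogeneous a b (p' i)))"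
proof -
  have "\<exists>S cf. finite S \<and> (\<forall>k. bihomogeneous (fst k) (snd k) (cf k)) \<and> p i = sum cf S" for i
    using bihomogeneous_decomp[of "p i"] unfolding decomposable_def split_def by blast
  then obtain S cf where S: "\<And>i. finite (S i)" "\<And>i k. bihomogeneous (fst k) (snd k) (cf i k)" "\<And>i. p i = sum (cf i) (S i)"
    by metis
  define t where "t = (\<lambda>(i, k). cf i k * g i)"
  let ?T = "Sigma I S"
  define dg :: "'i \<times> nat \<times> nat \<Rightarrow> nat" where "dg = (\<lambda>(i, k). fst k + \<alpha> i)"
  define dg' :: "'i \<times> nat \<times> nat \<Rightarrow> nat" where "dg' = (\<lambda>(i, k). snd k + \<beta> i)"
  define p' where "p' = (\<lambda>i. \<Sum>k\<in>{k\<in>S i. fst k + \<alpha> i = A \<and> snd k + \<beta> i = B}. cf i k)"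
  have h': "h = sum t ?T"
    unfolding h(2) t_def by (subst sum.Sigma[symmetric]) (use I S in \<open>simp_all add: sum_distrib_right\<close>)
  have "h = sum t {x\<in>?T. dg x = A \<and> dg' x = B}"
    unfolding h'
  proof (rule bihomogeneous_select)
    show "finite ?T" using I S(1) by blast
    show "bihomogeneous A B (sum t ?T)" using h(1) by (simp only: h')
    fix x assume "x \<in> ?T"
    thus "bihomogeneous (dg x) (dg' x) (t x)"
      by (auto simp: dg_def dg'_def t_def intro!: bihomogeneous_mult g) (metis S(2) fst_conv snd_conv)
  qed
  also have "{x\<in>?T. dg x = A \<and> dg' x = B} = Sigma I (\<lambda>i. {k\<in>S i. fst k + \<alpha> i = A \<and> snd k + \<beta> i = B})"
    by (auto simp: dg_def dg'_def)
  also have "sum t \<dots> = (\<Sum>i\<in>I. p' i * g i)"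
    unfolding t_def by (subst sum.Sigma[symmetric]) (use I S in \<open>simp_all add: sum_distrib_right p'_def\<close>)
  finally have "h = (\<Sum>i\<in>I. p' i * g i)" .
  moreover have "\<exists>a b. a + \<alpha> i = A \<and> b + \<beta> i = B \<and> bihomogeneous a b (p' i)" if "p' i \<noteq> 0" for i
  proof -
    have "{k\<in>S i. fst k + \<alpha> i = A \<and> snd k + \<beta> i = B} \<noteq> {}" using that unfolding p'_def by (metis sum.empty)
    then obtain k where k: "fst k + \<alpha> i = A" "snd k + \<beta> i = B" by blast
    let ?T = "{k'\<in>S i. fst k' + \<alpha> i = A \<and> snd k' + \<beta> i = B}"
    have "?T \<subseteq> {k}" using k by (auto simp: prod_eq_iff)
    hence "?T = {} \<or> ?T = {k}" by (rule subset_singletonD)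
    hence "p' i = 0 \<or> p' i = cf i k" unfolding p'_def by (elim disjE) (simp_all only: sum.empty sum.insert finite.emptyI empty_iff not_False_eq_True add_0_right simp_thms)
    thus ?thesis using S(2) k bihomogeneous_0 by metis
  qed
  ultimately show ?thesis by blast
qed

subsection \<open>The local ring along one half\<close>

text \<open>The only ideals above m are m and the whole ring. The length counts strict inclusions
  and is therefore 1.\<close>

lemma quot_length_maximalideal:
  assumes "maximalideal m A"
  shows "quot_length A m = 1"
proof -
  interpret maximalideal m A by fact
  define chain where "chain = (\<lambda>n I. (\<forall>i\<le>n. ideal (I i) A \<and> m \<subseteq> I i) \<and> (\<forall>i<n. I i \<subset> I (Suc i)))"
  have max: "J = m \<or> J = carrier A" if "ideal J A" "m \<subseteq> J" for J
    using I_maximal[OF that] additive_subgroup.a_subset[OF ideal.axioms(1)[OF that(1)]] by blast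
  have le: "n \<le> 1" if c: "chain n I" for n I
  proof (rule ccontr)
    assume "\<not> n \<le> 1"
    hence "I 0 \<subset> I 1" "I 1 \<subset> I 2" "ideal (I 0) A" "ideal (I 1) A" "ideal (I 2) A" "m \<subseteq> I 0" "m \<subseteq> I 1" "m \<subseteq> I 2"
      using c by (simp_all add: chain_def numeral_2_eq_2)
    thus False using max[of "I 1"] max[of "I 2"] by blast
  qed
  have "chain 1 (\<lambda>i. if i = 0 then m else carrier A)"
    using is_ideal oneideal I_notcarr a_subset by (auto simp: chain_def)
  hence "1 \<in> {n. \<exists>I. chain n I}" by blast
  moreover have "enat n \<le> enat 1" if "n \<in> {n. \<exists>I. chain n I}" for n using le that by auto
  ultimately have "(SUP n\<in>{n. \<exists>I. chain n I}. enat n) = enat 1" by (intro antisym SUP_least SUP_upper)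
  thus ?thesis unfolding quot_length_def chain_def one_enat_def .
qed

lemma Fract_add_same: "k \<noteq> 0 \<Longrightarrow> Fract h k + Fract l k = Fract (h + l) k" for h k l :: "'b::idom"
  by (simp add: eq_fract algebra_simps)

context split_curve
begin

text \<open>Not vanishing identically on D: the condition on denominators in the local ring, turned
  into a divisibility by G.\<close>

definition nv :: "'a tpoly tpoly \<Rightarrow> bool" where "nv g \<longleftrightarrow> \<not> G dvd gsub g"

lemma gsub_simps [simp]: "gsub (f + g) = gsub f + gsub g" "gsub (f * g) = gsub f * gsub g"
  "gsub (- f) = - gsub f" "gsub (f - g) = gsub f - gsub g" "gsub (lift1 r) = r" "gsub 0 = 0" "gsub 1 = 1"
  by (rule pev_eqI, simp add: pev_gsub)+

lemma gsub_power [simp]: "gsub (f ^ k) = gsub f ^ k"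
  by (induction k) simp_all

lemma nv_mult: "nv f \<Longrightarrow> nv g \<Longrightarrow> nv (f * g)"
  by (simp add: nv_def G_dvd_mult)

lemma nv_1: "nv 1"
proof -
  have "const3 1 = (1 :: 'a tpoly)" by (rule pev_eqI) simp
  thus ?thesis using not_G_dvd_const[of 1] by (simp add: nv_def)
qed

lemma nv_nonzero: "nv g \<Longrightarrow> g \<noteq> 0"
  by (auto simp: nv_def)

lemma nv_iff: "bihomogeneous a b g \<Longrightarrow> (\<exists>(v, w)\<in>D. bev g v w \<noteq> 0) \<longleftrightarrow> nv g"
  using D_vanish_iff[of a b g] unfolding nv_def by blast

abbreviation "R \<equiv> local_ring D"
abbreviation "M \<equiv> local_max_ideal D"

lemma R_simps [simp]: "carrier R = local_carrier D" "x \<otimes>\<^bsub>R\<^esub> y = x * y" "\<one>\<^bsub>R\<^esub> = 1" "\<zero>\<^bsub>R\<^esub> = 0" "x \<oplus>\<^bsub>R\<^esub> y = x + y"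
  by (simp_all add: local_ring_def)

lemma local_carrierI: "bihomogeneous a b f \<Longrightarrow> bihomogeneous a b g \<Longrightarrow> nv g \<Longrightarrow> Fract f g \<in> local_carrier D"
  unfolding local_carrier_def using nv_iff by blast

lemma local_carrierE:
  assumes "x \<in> local_carrier D"
  obtains f g a b where "x = Fract f g" "bihomogeneous a b f" "bihomogeneous a b g" "nv g"
  using assms unfolding local_carrier_def using nv_iff by blast

lemma M_I: "bihomogeneous a b f \<Longrightarrow> bihomogeneous a b g \<Longrightarrow> nv g \<Longrightarrow> G dvd gsub f \<Longrightarrow> Fract f g \<in> M"
  unfolding local_max_ideal_def using nv_iff[of a b g] D_vanish_iff[of a b f] by blast

lemma M_E:
  assumes "x \<in> M"
  obtains f g a b where "x = Fract f g" "bihomogeneous a b f" "bihomogeneous a b g" "nv g" "G dvd gsub f"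
proof -
  obtain f g a b where *: "x = Fract f g" "bihomogeneous a b f" "bihomogeneous a b g"
    "\<forall>(v, w)\<in>D. bev f v w = 0" "\<exists>(v, w)\<in>D. bev g v w \<noteq> 0"
    using assms unfolding local_max_ideal_def by blast
  thus thesis using that[of f g a b] nv_iff[OF *(3)] D_vanish_iff[OF *(2)] by blast
qed

lemma Fract_in_M_iff:
  assumes "bihomogeneous a b f" "bihomogeneous a b g" "nv g"
  shows "Fract f g \<in> M \<longleftrightarrow> G dvd gsub f"
proof
  assume "Fract f g \<in> M"
  then obtain f' g' where *: "Fract f g = Fract f' g'" "nv g'" "G dvd gsub f'" by (rule M_E)
  hence "f * g' = f' * g" using assms(3) nv_nonzero by (metis eq_fract(1))
  hence "gsub f * gsub g' = gsub f' * gsub g" by (metis gsub_simps(2))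
  hence "G dvd gsub f * gsub g'" using *(3) by simp
  thus "G dvd gsub f" using *(2) by (simp add: G_dvd_mult nv_def)
qed (use M_I[OF assms] in blast)

lemma local_carrier_closed:
  assumes "x \<in> local_carrier D" "y \<in> local_carrier D"
  shows "x + y \<in> local_carrier D" "x * y \<in> local_carrier D" "- x \<in> local_carrier D"
proof -
  obtain f g a b where x: "x = Fract f g" "bihomogeneous a b f" "bihomogeneous a b g" "nv g"
    using assms(1) by (rule local_carrierE)
  obtain f' g' a' b' where y: "y = Fract f' g'" "bihomogeneous a' b' f'" "bihomogeneous a' b' g'" "nv g'"
    using assms(2) by (rule local_carrierE)
  have n: "g \<noteq> 0" "g' \<noteq> 0" using x(4) y(4) nv_nonzero by auto
  have "x + y = Fract (f * g' + f' * g) (g * g')" unfolding x(1) y(1) using n by simp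
  moreover have "bihomogeneous (a + a') (b + b') (f' * g)"
    using bihomogeneous_mult[OF y(2) x(3)] by (simp add: add.commute)
  ultimately show "x + y \<in> local_carrier D"
    using local_carrierI[OF bihomogeneous_add[OF bihomogeneous_mult[OF x(2) y(3)]] bihomogeneous_mult[OF x(3) y(3)] nv_mult[OF x(4) y(4)]]
    by metis
  show "x * y \<in> local_carrier D"
    using local_carrierI[OF bihomogeneous_mult[OF x(2) y(2)] bihomogeneous_mult[OF x(3) y(3)] nv_mult[OF x(4) y(4)]]
    by (simp add: x(1) y(1))
  show "- x \<in> local_carrier D"
    using local_carrierI[OF bihomogeneous_uminus[OF x(2)] x(3,4)] by (simp add: x(1))
qed

lemma bihomogeneous_1: "bihomogeneous 0 0 (1 :: 'a tpoly tpoly)"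
  by (simp add: bihomogeneous_iff)

lemma local_carrier_0_1: "0 \<in> local_carrier D" "1 \<in> local_carrier D"
  using local_carrierI[OF bihomogeneous_0 bihomogeneous_1 nv_1] local_carrierI[OF bihomogeneous_1 bihomogeneous_1 nv_1]
  by (simp_all add: Zero_fract_def One_fract_def)

lemma cring_R: "cring R"
proof (rule cringI)
  show "abelian_group R"
  proof (rule abelian_groupI)
    fix x assume "x \<in> carrier R"
    thus "\<exists>y\<in>carrier R. y \<oplus>\<^bsub>R\<^esub> x = \<zero>\<^bsub>R\<^esub>" using local_carrier_closed(3)
      by (intro bexI[of _ "- x"]) auto
  qed (use local_carrier_closed local_carrier_0_1 in \<open>auto simp: add_ac\<close>)
  show "comm_monoid R"
    by (rule comm_monoidI) (use local_carrier_closed local_carrier_0_1 in \<open>auto simp: mult_ac\<close>)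
qed (simp add: distrib_right)

lemma R_uminus: "x \<in> local_carrier D \<Longrightarrow> \<ominus>\<^bsub>R\<^esub> x = - x"
proof -
  interpret cring R by (rule cring_R)
  assume x: "x \<in> local_carrier D"
  thus ?thesis using minus_equality[of "- x" x] local_carrier_closed(3) by simp
qed

lemma M_subset: "M \<subseteq> local_carrier D"
proof
  fix x assume "x \<in> M"
  then obtain f g a b where "x = Fract f g" "bihomogeneous a b f" "bihomogeneous a b g" "nv g" by (rule M_E)
  thus "x \<in> local_carrier D" using local_carrierI by blast
qed

lemma M_add_mult:
  assumes "x \<in> M"
  shows "y \<in> M \<Longrightarrow> x + y \<in> M" "y \<in> local_carrier D \<Longrightarrow> x * y \<in> M"
proof -
  obtain f g a b where x: "x = Fract f g" "bihomogeneous a b f" "bihomogeneous a b g" "nv g" "G dvd gsub f"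
    using assms(1) by (rule M_E)
  {
    assume "y \<in> M"
    then obtain f' g' a' b' where y: "y = Fract f' g'" "bihomogeneous a' b' f'" "bihomogeneous a' b' g'" "nv g'" "G dvd gsub f'"
      by (rule M_E)
    have n: "g \<noteq> 0" "g' \<noteq> 0" using x(4) y(4) nv_nonzero by auto
    have "x + y = Fract (f * g' + f' * g) (g * g')" unfolding x(1) y(1) using n by simp
    moreover have "bihomogeneous (a + a') (b + b') (f' * g)"
      using bihomogeneous_mult[OF y(2) x(3)] by (simp add: add.commute)
    moreover have "G dvd gsub (f * g' + f' * g)" using x(5) y(5) by simp
    ultimately show "x + y \<in> M"
      using M_I[OF bihomogeneous_add[OF bihomogeneous_mult[OF x(2) y(3)]] bihomogeneous_mult[OF x(3) y(3)] nv_mult[OF x(4) y(4)]]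
      by metis
  next
    assume "y \<in> local_carrier D"
    then obtain f' g' a' b' where y: "y = Fract f' g'" "bihomogeneous a' b' f'" "bihomogeneous a' b' g'" "nv g'"
      by (rule local_carrierE)
    show "x * y \<in> M"
      using M_I[OF bihomogeneous_mult[OF x(2) y(2)] bihomogeneous_mult[OF x(3) y(3)] nv_mult[OF x(4) y(4)]] x(5)
      by (simp add: x(1) y(1))
  }
qed

lemma ideal_M: "ideal M R"
proof (rule idealI)
  show "ring R" using cring_R by (rule cring.axioms)
  show "subgroup M (add_monoid R)"
  proof
    show "M \<subseteq> carrier (add_monoid R)" using M_subset by simp
    show "x \<otimes>\<^bsub>add_monoid R\<^esub> y \<in> M" if "x \<in> M" "y \<in> M" for x y using M_add_mult(1)[OF that] by simp
    show "\<one>\<^bsub>add_monoid R\<^esub> \<in> M"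
      using M_I[OF bihomogeneous_0 bihomogeneous_1 nv_1] by (simp add: Zero_fract_def)
    show "inv\<^bsub>add_monoid R\<^esub> x \<in> M" if "x \<in> M" for x
    proof -
      have "inv\<^bsub>add_monoid R\<^esub> x = - x" using R_uminus[of x] M_subset that by (auto simp: a_inv_def)
      also have "\<dots> = x * (- 1)" by simp
      finally show ?thesis using M_add_mult(2)[OF that local_carrier_closed(3)[OF local_carrier_0_1(2) local_carrier_0_1(2)]] by simp
    qed
  qed
qed (use M_add_mult(2) in \<open>simp_all add: mult.commute\<close>)

lemma unit_if_not_M:
  assumes "x \<in> local_carrier D" "x \<notin> M"
  shows "x \<noteq> 0" "inverse x \<in> local_carrier D"
proof -
  obtain f g a b where x: "x = Fract f g" "bihomogeneous a b f" "bihomogeneous a b g" "nv g"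
    using assms(1) by (rule local_carrierE)
  have "nv f" using assms(2) Fract_in_M_iff[OF x(2,3,4)] by (simp add: x(1) nv_def)
  thus "inverse x \<in> local_carrier D" using local_carrierI[OF x(3,2)] by (simp add: x(1))
  show "x \<noteq> 0" using x nv_nonzero[OF \<open>nv f\<close>] nv_nonzero[OF x(4)] by (simp add: Zero_fract_def eq_fract)
qed

lemma ideal_above_M:
  assumes "ideal I R" "M \<subseteq> I"
  shows "I = M \<or> I = carrier R"
proof (rule disjCI)
  interpret ideal I R by fact
  assume "I \<noteq> carrier R"
  have "I \<subseteq> M"
  proof (rule subsetI, rule ccontr)
    fix x assume x: "x \<in> I" "x \<notin> M"
    hence c: "x \<in> local_carrier D" using a_subset by auto
    have "inverse x \<otimes>\<^bsub>R\<^esub> x \<in> I" using I_l_closed[OF x(1)] unit_if_not_M(2)[OF c x(2)] by simp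
    hence "\<one>\<^bsub>R\<^esub> \<in> I" using unit_if_not_M(1)[OF c x(2)] by simp
    hence "I = carrier R" by (rule one_imp_carrier)
    thus False using \<open>I \<noteq> carrier R\<close> by blast
  qed
  thus "I = M" using assms(2) by blast
qed

lemma M_not_carrier: "M \<noteq> carrier R"
proof
  assume "M = carrier R"
  hence "Fract 1 1 \<in> M" using local_carrier_0_1 by (simp add: One_fract_def)
  thus False using Fract_in_M_iff[OF bihomogeneous_1 bihomogeneous_1 nv_1] nv_1 by (simp add: nv_def)
qed

lemma maximalideal_M: "maximalideal M R"
  by (rule maximalidealI[OF ideal_M]) (use M_not_carrier ideal_above_M in auto)

subsection \<open>Multiplicity one\<close>

text \<open>The ideal of the inverse image of the curve in the incidence surface, before
  localisation.\<close>

definition WG :: "'a tpoly tpoly set" where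
  "WG = {f * W_eq1 F + g * W_eq2 + h * lift1 G |f g h. True}"

lemma WG_I: "f * W_eq1 F + g * W_eq2 + h * lift1 G \<in> WG"
  unfolding WG_def by blast

lemma WG_add: "f \<in> WG \<Longrightarrow> g \<in> WG \<Longrightarrow> f + g \<in> WG"
  unfolding WG_def
proof clarify
  fix a b c a' b' c'
  show "\<exists>f g h. (a * W_eq1 F + b * W_eq2 + c * lift1 G) + (a' * W_eq1 F + b' * W_eq2 + c' * lift1 G) =
      f * W_eq1 F + g * W_eq2 + h * lift1 G \<and> True"
    by (intro exI[of _ "a + a'"] exI[of _ "b + b'"] exI[of _ "c + c'"]) (simp add: algebra_simps)
qed

lemma WG_mult: "f \<in> WG \<Longrightarrow> g * f \<in> WG"
  unfolding WG_def
proof clarify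
  fix a b c
  show "\<exists>f g' h. g * (a * W_eq1 F + b * W_eq2 + c * lift1 G) = f * W_eq1 F + g' * W_eq2 + h * lift1 G \<and> True"
    by (intro exI[of _ "g * a"] exI[of _ "g * b"] exI[of _ "g * c"]) (simp add: algebra_simps)
qed

lemma WG_dvd: "G dvd g \<Longrightarrow> lift1 g \<in> WG"
proof -
  assume "G dvd g"
  then obtain k where "g = G * k" by (rule dvdE)
  hence "lift1 g = 0 * W_eq1 F + 0 * W_eq2 + lift1 k * lift1 G" by (intro bev_eqI) simp
  thus ?thesis using WG_I by metis
qed

text \<open>\<open>Lp\<close> and \<open>Lm\<close> are equations of the graphs of
  \<open>psi s\<close> and \<open>psi (- s)\<close>: for w = \<open>psi s v\<close> one has z X - x
  Z = x z^2 and Z = s z. \<open>Ly\<close> is \<open>Lp\<close> with y in place of x.\<close>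

definition da :: "'a tpoly tpoly" where "da = lift1 varz * varx - lift1 varx * varz"
definition Lp :: "'a tpoly tpoly" where "Lp = lift1 U * da - lift1 (V * varx * varz) * varz"
definition Lm :: "'a tpoly tpoly" where "Lm = lift1 U * da + lift1 (V * varx * varz) * varz"
definition Ly :: "'a tpoly tpoly" where
  "Ly = lift1 U * (lift1 varz * vary - lift1 vary * varz) - lift1 (V * vary * varz) * varz"

text \<open>The inverse image of the curve splits. Modulo \<open>W_eq2\<close> one may replace x (z
  Y - y Z) by y (z X - x Z), which turns x^2 times the first generator into q (z X - x Z)^2 - (x z
  Z)^2, up to \<open>\<epsilon>\<close>. As q V^2 is U^2 modulo G, V^2 times this is a product of
  two factors.\<close>

lemma Lp_Lm: "Lp * Lm \<in> WG"
proof -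
  \<comment> \<open>The cofactor of z times \<open>W_eq2\<close> when x (z Y - y Z) = y
    \<open>da\<close> + z \<open>W_eq2\<close> is inserted into q and expanded.\<close>
  define Sp where "Sp = lift1 (const3 \<mu>) * (lift1 (const3 b2 * l1 + const3 b1 * l2) * da + lift1 (const3 (b1 * b2) * varz) * W_eq2)"
  have "lift1 (const3 \<epsilon>) * (Lp * Lm) = lift1 (V\<^sup>2 * varx\<^sup>2) * W_eq1 F + (- lift1 (const3 \<epsilon> * V\<^sup>2 * varz) * Sp) * W_eq2
      + (lift1 (const3 \<epsilon>) * da\<^sup>2) * lift1 (U\<^sup>2 - q * V\<^sup>2)"
  proof (rule bev_eqI)
    fix v w :: "'a vec3"
    obtain x y z where v: "v = (x, y, z)" by (cases v)
    obtain X Y Z where w: "w = (X, Y, Z)" by (cases w)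
    define a where "a = z * X - x * Z"
    define c where "c = z * (x * Y - y * X)"
    define u where "u = pev U v"
    define r where "r = pev V v"
    define S where "S = \<mu> * ((b2 * (a1 * x + b1 * y) + b1 * (a2 * x + b2 * y)) * a + b1 * b2 * c)"
    have "x\<^sup>2 * qf a (z * Y - y * Z) = qf (x * a) (x * (z * Y - y * Z))" by simp
    also have "x * (z * Y - y * Z) = y * a + c" by (simp add: a_def c_def algebra_simps)
    also have "qf (x * a) (y * a + c) = qf x y * a\<^sup>2 + c * S"
      by (simp add: S_def qf_def power2_eq_square algebra_simps)
    finally have *: "x\<^sup>2 * qf a (z * Y - y * Z) = qf x y * a\<^sup>2 + c * S" .
    have "\<epsilon> * ((u * a - r * x * z * Z) * (u * a + r * x * z * Z)) =
        \<epsilon> * r\<^sup>2 * (qf x y * a\<^sup>2 + c * S) - \<epsilon> * r\<^sup>2 * x\<^sup>2 * (z * Z)\<^sup>2 - \<epsilon> * r\<^sup>2 * (c * S) + \<epsilon> * a\<^sup>2 * (u\<^sup>2 - qf x y * r\<^sup>2)"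
      by (simp add: power2_eq_square algebra_simps)
    also have "\<dots> = r\<^sup>2 * x\<^sup>2 * (\<epsilon> * (qf a (z * Y - y * Z) - (z * Z)\<^sup>2)) - \<epsilon> * r\<^sup>2 * (c * S) + \<epsilon> * a\<^sup>2 * (u\<^sup>2 - qf x y * r\<^sup>2)"
      unfolding *[symmetric] by (simp add: algebra_simps)
    finally have **: "\<epsilon> * ((u * a - r * x * z * Z) * (u * a + r * x * z * Z)) = \<dots>" .
    have bd: "bev da v w = a" "pev U v = u" "pev V v = r" "pev varx v = x" "pev varz v = z" "bev varz v w = Z"
      "bev (W_eq1 F) v w = \<epsilon> * (qf a (z * Y - y * Z) - (z * Z)\<^sup>2)" "z * bev W_eq2 v w = c"
      "pev l1 v = a1 * x + b1 * y" "pev l2 v = a2 * x + b2 * y" "pev q v = qf x y"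
      by (simp_all add: da_def a_def u_def r_def v w bev_W1 bev_W_eq2 c_def)
    have 1: "bev Sp v w = S * 1"
      by (simp only: Sp_def bev_mult bev_add bev_lift1 pev_add pev_mult pev_const3 bd S_def mult.assoc mult_1_right)
    have "bev (lift1 (const3 \<epsilon>) * (Lp * Lm)) v w = \<epsilon> * ((u * a - r * x * z * Z) * (u * a + r * x * z * Z))"
      by (simp only: Lp_def Lm_def bev_mult bev_add bev_diff bev_lift1 pev_mult pev_const3 bd mult.assoc)
    also have "\<dots> = r\<^sup>2 * x\<^sup>2 * (\<epsilon> * (qf a (z * Y - y * Z) - (z * Z)\<^sup>2)) - \<epsilon> * r\<^sup>2 * ((z * bev W_eq2 v w) * S) + \<epsilon> * a\<^sup>2 * (u\<^sup>2 - qf x y * r\<^sup>2)"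
      unfolding ** bd ..
    also have "\<dots> = r\<^sup>2 * x\<^sup>2 * (\<epsilon> * (qf a (z * Y - y * Z) - (z * Z)\<^sup>2)) + (- (\<epsilon> * r\<^sup>2 * z)) * S * bev W_eq2 v w + \<epsilon> * a\<^sup>2 * (u\<^sup>2 - qf x y * r\<^sup>2)"
      by (simp add: mult_ac)
    also have "\<dots> = bev (lift1 (V\<^sup>2 * varx\<^sup>2) * W_eq1 F + (- lift1 (const3 \<epsilon> * V\<^sup>2 * varz) * Sp) * W_eq2
      + (lift1 (const3 \<epsilon>) * da\<^sup>2) * lift1 (U\<^sup>2 - q * V\<^sup>2)) v w"
      by (simp only: bev_add bev_mult bev_uminus bev_lift1 bev_power pev_mult pev_power pev_diff pev_const3 1 bd mult_1_right)
    finally show "bev (lift1 (const3 \<epsilon>) * (Lp * Lm)) v w = \<dots>" .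
  qed
  also have "\<dots> \<in> WG"
  proof (rule WG_add)
    show "(lift1 (const3 \<epsilon>) * da\<^sup>2) * lift1 (U\<^sup>2 - q * V\<^sup>2) \<in> WG" by (rule WG_mult[OF WG_dvd[OF dvd_norm]])
    show "lift1 (V\<^sup>2 * varx\<^sup>2) * W_eq1 F + (- lift1 (const3 \<epsilon> * V\<^sup>2 * varz) * Sp) * W_eq2 \<in> WG"
      using WG_I[of "lift1 (V\<^sup>2 * varx\<^sup>2)" "- lift1 (const3 \<epsilon> * V\<^sup>2 * varz) * Sp" 0] by simp
  qed
  finally have "lift1 (const3 (inverse \<epsilon>)) * (lift1 (const3 \<epsilon>) * (Lp * Lm)) \<in> WG" by (rule WG_mult)
  also have "lift1 (const3 (inverse \<epsilon>)) * (lift1 (const3 \<epsilon>) * (Lp * Lm)) = Lp * Lm"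
    by (rule bev_eqI) (use eps in simp)
  finally show ?thesis .
qed

lemma x_Ly: "lift1 varx * Ly = lift1 vary * Lp + lift1 (U * varz) * W_eq2"
proof (rule bev_eqI)
  fix v w :: "'a vec3"
  show "bev (lift1 varx * Ly) v w = bev (lift1 vary * Lp + lift1 (U * varz) * W_eq2) v w"
    by (cases v; cases w) (simp add: Ly_def Lp_def da_def bev_W_eq2 algebra_simps)
qed

text \<open>Modulo \<open>Lp\<close> and \<open>Ly\<close>, the vectors \<open>U z w\<close> and \<open>Z (pp v)\<close> agree.\<close>

lemma subst_cong: "\<exists>f1 f2 \<alpha> \<beta>. (\<forall>v w. bev f1 v w = bev f v (smul (pev (U * varz) v) w)) \<and>
    (\<forall>v w. bev f2 v w = bev f v (smul (snd (snd w)) (pp v))) \<and> f1 = f2 + \<alpha> * Lp + \<beta> * Ly"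
proof (induction f rule: bpoly_induct)
  case (const c)
  show ?case by (rule exI[of _ "lift1 c"], rule exI[of _ "lift1 c"], rule exI[of _ 0], rule exI[of _ 0]) simp
next
  case x
  have "lift1 (U * varz) * varx = varz * lift1 px + 1 * Lp + 0 * Ly"
    by (rule bev_eqI) (simp add: Lp_def da_def px_def LL_def algebra_simps)
  moreover have "bev (lift1 (U * varz) * varx) v w = bev varx v (smul (pev (U * varz) v) w)"
    "bev (varz * lift1 px) v w = bev varx v (smul (snd (snd w)) (pp v))" for v w
    by (cases w; simp add: pp_def)+
  ultimately show ?case by blast
next
  case y
  have "lift1 (U * varz) * vary = varz * lift1 py + 0 * Lp + 1 * Ly"
    by (rule bev_eqI) (simp add: Ly_def py_def LL_def algebra_simps)
  moreover have "bev (lift1 (U * varz) * vary) v w = bev vary v (smul (pev (U * varz) v) w)"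
    "bev (varz * lift1 py) v w = bev vary v (smul (snd (snd w)) (pp v))" for v w
    by (cases w; simp add: pp_def)+
  ultimately show ?case by blast
next
  case z
  have "lift1 (U * varz) * varz = varz * lift1 pz + 0 * Lp + 0 * Ly"
    by (rule bev_eqI) (simp add: pz_def algebra_simps)
  moreover have "bev (lift1 (U * varz) * varz) v w = bev varz v (smul (pev (U * varz) v) w)"
    "bev (varz * lift1 pz) v w = bev varz v (smul (snd (snd w)) (pp v))" for v w
    by (cases w; simp add: pp_def)+
  ultimately show ?case by blast
next
  case (add f g)
  then obtain f1 f2 \<alpha> \<beta> g1 g2 \<alpha>' \<beta>' where *:
    "\<And>v w. bev f1 v w = bev f v (smul (pev (U * varz) v) w)" "\<And>v w. bev f2 v w = bev f v (smul (snd (snd w)) (pp v))"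
    "f1 = f2 + \<alpha> * Lp + \<beta> * Ly"
    "\<And>v w. bev g1 v w = bev g v (smul (pev (U * varz) v) w)" "\<And>v w. bev g2 v w = bev g v (smul (snd (snd w)) (pp v))"
    "g1 = g2 + \<alpha>' * Lp + \<beta>' * Ly" by blast
  have "f1 + g1 = (f2 + g2) + (\<alpha> + \<alpha>') * Lp + (\<beta> + \<beta>') * Ly" by (simp add: *(3,6) algebra_simps)
  moreover have "bev (f1 + g1) v w = bev (f + g) v (smul (pev (U * varz) v) w)"
    "bev (f2 + g2) v w = bev (f + g) v (smul (snd (snd w)) (pp v))" for v w
    by (simp_all only: bev_add *(1,2,4,5))
  ultimately show ?case by blast
next
  case (mult f g)
  then obtain f1 f2 \<alpha> \<beta> g1 g2 \<alpha>' \<beta>' where *: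
    "\<And>v w. bev f1 v w = bev f v (smul (pev (U * varz) v) w)" "\<And>v w. bev f2 v w = bev f v (smul (snd (snd w)) (pp v))"
    "f1 = f2 + \<alpha> * Lp + \<beta> * Ly"
    "\<And>v w. bev g1 v w = bev g v (smul (pev (U * varz) v) w)" "\<And>v w. bev g2 v w = bev g v (smul (snd (snd w)) (pp v))"
    "g1 = g2 + \<alpha>' * Lp + \<beta>' * Ly" by blast
  have "f1 * g1 = (f2 * g2) + (\<alpha> * g1 + f2 * \<alpha>') * Lp + (\<beta> * g1 + f2 * \<beta>') * Ly"
    unfolding *(3,6) by (simp add: algebra_simps)
  moreover have "bev (f1 * g1) v w = bev (f * g) v (smul (pev (U * varz) v) w)"
    "bev (f2 * g2) v w = bev (f * g) v (smul (snd (snd w)) (pp v))" for v w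
    by (simp_all only: bev_mult *(1,2,4,5))
  ultimately show ?case by blast
qed

lemma Lm_bihomogeneous: "bihomogeneous (n + 2) 1 Lm"
proof -
  have da: "bihomogeneous 1 1 da" by (auto simp: da_def bihomogeneous_iff algebra_simps)
  have Z: "bihomogeneous 0 1 (varz :: 'a tpoly tpoly)" by (auto simp: bihomogeneous_iff)
  have 1: "bihomogeneous (n + 2) 1 (lift1 U * da)"
    using bihomogeneous_mult[OF bihomogeneous_lift1[OF U_hom] da] by simp
  have "homogeneous (n + 1 + 1) (V * varx * varz)"
    using homogeneous_mult[OF homogeneous_mult[OF V_hom homogeneous_vars(1)] homogeneous_vars(3)] by simp
  from bihomogeneous_mult[OF bihomogeneous_lift1[OF this] Z]
  show ?thesis unfolding Lm_def using 1 by (intro bihomogeneous_add) simp_all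
qed

lemma gsub_Lm: "gsub Lm = const3 2 * U * V * varx * varz\<^sup>2"
  by (rule pev_eqI') (simp add: pev_gsub Lm_def da_def pp_eq power2_eq_square algebra_simps)

text \<open>\<open>Lm\<close> is a unit along D, so by \<open>Lp_Lm\<close> and \<open>x_Ly\<close>
  the forms \<open>Lp\<close> and \<open>Ly\<close> belong to the ideal locally. Modulo these two, f
  becomes a power of Z times its pull-back, a multiple of G. Hence the two equations of the surface
  and G generate the maximal ideal, and D has multiplicity one.\<close>

lemma unit_multiple_in_WG:
  assumes f: "bihomogeneous a b f" "G dvd gsub f"
  obtains u i j where "bihomogeneous i j u" "nv u" "u * f \<in> WG"
proof -
  \<comment> \<open>The factor x turns \<open>Ly\<close> into \<open>Lp\<close> modulo
    \<open>W_eq2\<close>, \<open>Lm\<close> turns \<open>Lp\<close> into an element of the ideal,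
    and the power of U z permits the replacement of w by \<open>pp v\<close>.\<close>
  let ?u = "lift1 varx * Lm * lift1 ((U * varz) ^ b)"
  obtain f1 f2 \<alpha> \<beta> where *:
    "\<And>v w. bev f1 v w = bev f v (smul (pev (U * varz) v) w)" "\<And>v w. bev f2 v w = bev f v (smul (snd (snd w)) (pp v))"
    "f1 = f2 + \<alpha> * Lp + \<beta> * Ly" using subst_cong[of f] by blast
  have sc: "bev f v (smul u w) = u ^ b * bev f v w" for u v w
    using bihomogeneous_bev[OF f(1), of 1 v u w] by simp
  have f1: "f1 = lift1 ((U * varz) ^ b) * f"
    by (rule bev_eqI) (simp only: *(1) sc bev_mult bev_lift1 pev_power)
  have f2: "f2 = varz ^ b * lift1 (gsub f)"
    by (rule bev_eqI) (simp only: *(2) sc bev_mult bev_power bev_varz bev_lift1 pev_gsub)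
  have "?u * f = lift1 varx * Lm * f1" by (simp add: f1 mult_ac)
  also have "\<dots> = (lift1 varx * Lm * varz ^ b) * lift1 (gsub f) + (lift1 varx * \<alpha>) * (Lp * Lm) + \<beta> * Lm * (lift1 varx * Ly)"
    unfolding *(3) f2 by (simp add: algebra_simps)
  also have "\<dots> = (lift1 varx * Lm * varz ^ b) * lift1 (gsub f) + (lift1 varx * \<alpha> + \<beta> * lift1 vary) * (Lp * Lm)
      + (0 * W_eq1 F + (\<beta> * Lm * lift1 (U * varz)) * W_eq2 + 0 * lift1 G)"
    unfolding x_Ly by (simp add: algebra_simps)
  also have "\<dots> \<in> WG" by (intro WG_add WG_mult[OF WG_dvd[OF f(2)]] WG_mult[OF Lp_Lm] WG_I)
  finally have "?u * f \<in> WG" .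
  moreover have "bihomogeneous (1 + (n + 2) + b * (Suc n + Suc 0)) (0 + 1 + 0) ?u"
  proof (intro bihomogeneous_mult Lm_bihomogeneous bihomogeneous_lift1)
    show "homogeneous 1 (varx :: 'a tpoly)" by simp
    have "homogeneous (Suc n + Suc 0) (U * varz)" by (intro homogeneous_mult U_hom homogeneous_vars)
    from homogeneous_power[OF this, of b] show "homogeneous (b * (Suc n + Suc 0)) ((U * varz) ^ b)" by (simp add: mult.commute)
  qed
  moreover have "\<not> G dvd const3 2" using not_G_dvd_const two by blast
  hence "nv ?u" unfolding nv_def
    by (auto simp: gsub_Lm G_dvd_mult n_vars nU nV nz power2_eq_square[of varz] dest!: prime_elem_dvd_power[OF G_prime])
  ultimately show thesis using that by blast
qed

lemma Idl_eq_M: "Idl\<^bsub>R\<^esub> (W_local_ideal F D \<union> pullback_local_eqs G D) = M"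
proof
  have W: "G dvd gsub f" if "f \<in> W_ideal F" for f
    using that gsub_W by (auto simp: W_ideal_def)
  have "W_local_ideal F D \<subseteq> M"
    unfolding W_local_ideal_def using W nv_iff M_I by blast
  moreover have "pullback_local_eqs G D \<subseteq> M"
  proof
    fix x assume "x \<in> pullback_local_eqs G D"
    then obtain r e where r: "x = Fract (lift1 G) (lift1 r)" "homogeneous e G" "homogeneous e r" "\<exists>(v, w)\<in>D. pev r v \<noteq> 0"
      unfolding pullback_local_eqs_def by blast
    have "\<exists>(v, w)\<in>D. bev (lift1 r) v w \<noteq> 0" using r(4) by simp
    hence "nv (lift1 r)" using nv_iff[OF bihomogeneous_lift1[OF r(3)]] by blast
    thus "x \<in> M" unfolding r(1) using M_I[OF bihomogeneous_lift1[OF r(2)] bihomogeneous_lift1[OF r(3)]] by simp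
  qed
  ultimately show "Idl\<^bsub>R\<^esub> (W_local_ideal F D \<union> pullback_local_eqs G D) \<subseteq> M"
    unfolding genideal_def using ideal_M by blast
  show "M \<subseteq> Idl\<^bsub>R\<^esub> (W_local_ideal F D \<union> pullback_local_eqs G D)"
    unfolding genideal_def
  proof (rule Inter_greatest)
    fix I assume "I \<in> {I. ideal I R \<and> W_local_ideal F D \<union> pullback_local_eqs G D \<subseteq> I}"
    hence I: "ideal I R" "W_local_ideal F D \<subseteq> I" "pullback_local_eqs G D \<subseteq> I" by auto
    interpret I: ideal I R by fact
    show "M \<subseteq> I"
    proof
      fix x assume "x \<in> M"
      then obtain f g a b where x: "x = Fract f g" "bihomogeneous a b f" "bihomogeneous a b g" "nv g" "G dvd gsub f" by (rule M_E)
      obtain u i j where u: "bihomogeneous i j u" "nv u" "u * f \<in> WG" by (rule unit_multiple_in_WG[OF x(2,5)])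
      have ug: "bihomogeneous (i + a) (j + b) (u * g)" "nv (u * g)" and uf: "bihomogeneous (i + a) (j + b) (u * f)"
        using bihomogeneous_mult u x nv_mult by blast+
      obtain p0 q0 r0 where pqr: "u * f = p0 * W_eq1 F + q0 * W_eq2 + r0 * lift1 G" using u(3) unfolding WG_def by blast
      let ?g = "\<lambda>k::nat. if k = 0 then W_eq1 F else if k = 1 then W_eq2 else lift1 G"
      let ?p = "\<lambda>k::nat. if k = 0 then p0 else if k = 1 then q0 else r0"
      let ?al = "\<lambda>k::nat. if k = 0 then 2 else if k = 1 then 1 else d"
      let ?be = "\<lambda>k::nat. if k = 0 then 2 else if k = 1 then 1 else 0 :: nat"
      \<comment> \<open>The coefficients have to be bihomogeneous as well, since the local ring
        contains only quotients of forms of equal bidegree.\<close>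
      have "\<exists>p'. u * f = (\<Sum>k\<in>{0, 1, 2}. p' k * ?g k) \<and>
          (\<forall>k\<in>{0, 1, 2}. p' k \<noteq> 0 \<longrightarrow> (\<exists>a' b'. a' + ?al k = i + a \<and> b' + ?be k = j + b \<and> bihomogeneous a' b' (p' k)))"
      proof (rule bihomogeneous_coefficients[OF _ _ uf])
        show "u * f = (\<Sum>k\<in>{0, 1, 2}. ?p k * ?g k)" by (simp add: pqr)
        fix k assume "k \<in> {0, 1, 2 :: nat}"
        thus "bihomogeneous (?al k) (?be k) (?g k)"
          using bihomogeneous_W1 bihomogeneous_W2 bihomogeneous_lift1[OF G_hom] by auto
      qed simp
      then obtain p' where p': "u * f = (\<Sum>k\<in>{0, 1, 2}. p' k * ?g k)"
          "\<And>k. k \<in> {0, 1, 2} \<Longrightarrow> p' k \<noteq> 0 \<Longrightarrow> \<exists>a' b'. a' + ?al k = i + a \<and> b' + ?be k = j + b \<and> bihomogeneous a' b' (p' k)"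
        by blast
      define r where "r = p' 2"
      define h where "h = p' 0 * W_eq1 F + p' 1 * W_eq2"
      have fh: "u * f = h + r * lift1 G" using p'(1) by (simp add: h_def r_def)
      have hW: "h \<in> W_ideal F" unfolding h_def W_ideal_def by blast
      have rG: "bihomogeneous (i + a) (j + b) (r * lift1 (varz ^ d)) \<and> bihomogeneous (i + a) (j + b) (r * lift1 G)"
      proof (cases "r = 0")
        case False
        then obtain a' b' where *: "a' + d = i + a" "b' + 0 = j + b" "bihomogeneous a' b' r"
          using p'(2)[of 2] by (auto simp: r_def)
        have "homogeneous d (varz ^ d :: 'a tpoly)" using homogeneous_power[OF homogeneous_vars(3), of d] by simp
        from bihomogeneous_mult[OF *(3) bihomogeneous_lift1[OF this]] bihomogeneous_mult[OF *(3) bihomogeneous_lift1[OF G_hom]]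
        show ?thesis using *(1,2) by simp
      qed simp
      \<comment> \<open>z^d is the denominator that makes G a local equation; z does not vanish
        identically on the curve.\<close>
      have nzd: "nv (lift1 (varz ^ d))" unfolding nv_def
        using nz prime_elem_dvd_power[OF G_prime] by auto
      have "h = u * f - r * lift1 G" by (simp add: fh)
      hence "bihomogeneous (i + a) (j + b) h" using bihomogeneous_diff uf rG by metis
      hence "Fract h (u * g) \<in> W_local_ideal F D" unfolding W_local_ideal_def using hW ug nv_iff by blast
      hence 1: "Fract h (u * g) \<in> I" using I(2) by blast
      have hz: "homogeneous d (varz ^ d :: 'a tpoly)" using homogeneous_power[OF homogeneous_vars(3), of d] by simp
      have "\<exists>(v, w)\<in>D. bev (lift1 (varz ^ d)) v w \<noteq> 0" using nzd nv_iff[OF bihomogeneous_lift1[OF hz]] by blast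
      hence "\<exists>(v, w)\<in>D. pev (varz ^ d) v \<noteq> 0" by (simp only: bev_lift1)
      hence "Fract (lift1 G) (lift1 (varz ^ d)) \<in> pullback_local_eqs G D"
        unfolding pullback_local_eqs_def using G_hom hz by blast
      hence 2: "Fract (lift1 G) (lift1 (varz ^ d)) \<in> I" using I(3) by blast
      have "Fract (r * lift1 (varz ^ d)) (u * g) \<in> carrier R"
        using local_carrierI[OF _ ug] rG by simp
      from I.I_l_closed[OF 2 this] have "Fract (r * lift1 (varz ^ d)) (u * g) * Fract (lift1 G) (lift1 (varz ^ d)) \<in> I"
        by simp
      from additive_subgroup.a_closed[OF ideal.axioms(1)[OF I(1)] 1 this]
      have "Fract h (u * g) + Fract (r * lift1 (varz ^ d)) (u * g) * Fract (lift1 G) (lift1 (varz ^ d)) \<in> I" by simp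
      also have "Fract h (u * g) + Fract (r * lift1 (varz ^ d)) (u * g) * Fract (lift1 G) (lift1 (varz ^ d)) = x"
      proof -
        have n: "u \<noteq> 0" "g \<noteq> 0" "lift1 (varz ^ d) \<noteq> (0 :: 'a tpoly tpoly)"
          using nv_nonzero[OF u(2)] nv_nonzero[OF x(4)] nv_nonzero[OF nzd] by blast+
        hence ug0: "u * g \<noteq> 0" by simp
        have "Fract (r * lift1 (varz ^ d)) (u * g) * Fract (lift1 G) (lift1 (varz ^ d)) = Fract (r * lift1 G) (u * g)"
          unfolding mult_fract by (rule eq_fract(1)[THEN iffD2]) (use n ug0 in \<open>simp_all only: mult_ac mult_eq_0_iff simp_thms\<close>)
        moreover have "Fract h (u * g) + Fract (r * lift1 G) (u * g) = Fract (h + r * lift1 G) (u * g)"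
          by (rule Fract_add_same[OF ug0])
        moreover have "Fract (u * f) (u * g) = Fract f g" by (rule mult_fract_cancel[OF n(1)])
        ultimately have "Fract h (u * g) + Fract (r * lift1 (varz ^ d)) (u * g) * Fract (lift1 G) (lift1 (varz ^ d)) = Fract f g"
          by (simp only: fh[symmetric])
        thus ?thesis by (simp only: x(1))
      qed
      finally show "x \<in> I" .
    qed
  qed
qed

lemma quot_length_1: "quot_length R M = 1"
  by (rule quot_length_maximalideal[OF maximalideal_M])

lemma pullback_D: "pullback1 F G D = 1"
  using D_curve D_subset_W by (simp add: pullback1_def Idl_eq_M quot_length_1 one_enat_def)

end

subsection \<open>The degree over the image\<close>

text \<open>The elements k + l \<theta> are closed under inversion because multiplying by the
  conjugate k - l \<theta> reduces an inverse to that of the norm, which lies in K. If they exhaust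
  the field, \<theta> and 1 span it over K.\<close>

lemma (in field) quadratic_extension:
  assumes K: "subfield K R" and \<theta>: "\<theta> \<in> carrier R" "\<theta> \<otimes> \<theta> \<in> K"
  defines "T \<equiv> {k \<oplus> l \<otimes> \<theta> |k l. k \<in> K \<and> l \<in> K}"
  shows "K \<subseteq> T" "\<theta> \<in> T" "\<And>x y. x \<in> T \<Longrightarrow> y \<in> T \<Longrightarrow> x \<oplus> y \<in> T" "\<And>x y. x \<in> T \<Longrightarrow> y \<in> T \<Longrightarrow> x \<otimes> y \<in> T"
    "\<And>x. x \<in> T \<Longrightarrow> x \<noteq> \<zero> \<Longrightarrow> inv x \<in> T" "T = carrier R \<Longrightarrow> finite_dimension K (carrier R)"
proof -
  note Kr = subringE[OF subfieldE(1)[OF K]]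
  have Kc: "k \<in> carrier R" if "k \<in> K" for k using Kr(1) that by blast
  have I: "k \<oplus> l \<otimes> \<theta> \<in> T" if "k \<in> K" "l \<in> K" for k l using that unfolding T_def by blast
  show 1: "K \<subseteq> T"
  proof
    fix k assume "k \<in> K"
    thus "k \<in> T" using I[of k \<zero>] Kr(2) Kc \<theta>(1) by simp
  qed
  show 2: "\<theta> \<in> T" using I[of \<zero> \<one>] Kr(2,3) \<theta>(1) by simp
  have add_mult: "x \<oplus> y \<in> T \<and> x \<otimes> y \<in> T" if xy: "x \<in> T" "y \<in> T" for x y
  proof -
    obtain k l where kl: "x = k \<oplus> l \<otimes> \<theta>" "k \<in> K" "l \<in> K" using xy(1) unfolding T_def by blast
    obtain k' l' where kl': "y = k' \<oplus> l' \<otimes> \<theta>" "k' \<in> K" "l' \<in> K" using xy(2) unfolding T_def by blast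
    note c = Kc[OF kl(2)] Kc[OF kl(3)] Kc[OF kl'(2)] Kc[OF kl'(3)]
    have "x \<oplus> y = (k \<oplus> k') \<oplus> (l \<oplus> l') \<otimes> \<theta>" unfolding kl(1) kl'(1) using c \<theta>(1) by algebra
    moreover have "x \<otimes> y = (k \<otimes> k' \<oplus> l \<otimes> l' \<otimes> (\<theta> \<otimes> \<theta>)) \<oplus> (k \<otimes> l' \<oplus> l \<otimes> k') \<otimes> \<theta>"
      unfolding kl(1) kl'(1) using c \<theta>(1) by algebra
    ultimately show ?thesis using I Kr(6,7) kl kl' \<theta>(2) by simp
  qed
  show "x \<oplus> y \<in> T" "x \<otimes> y \<in> T" if "x \<in> T" "y \<in> T" for x y
    using add_mult[OF that] by blast+
  have Kinv: "inv k \<in> K" if "k \<in> K" "k \<noteq> \<zero>" for k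
    using subfield_m_inv(1)[OF K, of k] that by blast
  show "inv x \<in> T" if x: "x \<in> T" and x0: "x \<noteq> \<zero>" for x
  proof -
    obtain k l where kl: "x = k \<oplus> l \<otimes> \<theta>" "k \<in> K" "l \<in> K" using x unfolding T_def by blast
    note c = Kc[OF kl(2)] Kc[OF kl(3)]
    have xc: "x \<in> carrier R" using c \<theta>(1) by (simp add: kl(1))
    show ?thesis
    proof (cases "\<theta> \<in> K")
      case True
      hence "x \<in> K" using kl Kr(6,7) by simp
      thus ?thesis using Kinv x0 1 by blast
    next
      case False
      let ?c = "k \<oplus> (\<ominus> l) \<otimes> \<theta>"
      let ?N = "k \<otimes> k \<oplus> (\<ominus> l) \<otimes> l \<otimes> (\<theta> \<otimes> \<theta>)"
      have N: "x \<otimes> ?c = ?N" unfolding kl(1) using c \<theta>(1) by algebra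
      have cT: "?c \<in> T" by (rule I) (use kl Kr(5) in auto)
      have cc: "?c \<in> carrier R" using c \<theta>(1) by simp
      have NK: "?N \<in> K" using kl \<theta>(2) Kr(5,6,7) by simp
      \<comment> \<open>A vanishing norm makes the conjugate zero and \<theta> a quotient of
        elements of K, the case already split off.\<close>
      have "?N \<noteq> \<zero>"
      proof
        assume "?N = \<zero>"
        hence "?c = \<zero>" using integral[OF _ xc cc] x0 by (simp only: N) blast
        have "k = ?c \<oplus> l \<otimes> \<theta>" using c \<theta>(1) by algebra
        hence k: "k = l \<otimes> \<theta>" using \<open>?c = \<zero>\<close> c \<theta>(1) by simp
        show False
        proof (cases "l = \<zero>")
          case True
          thus False using x0 k \<theta>(1) by (simp add: kl(1))
        next
          case l: False
          have lc: "inv l \<in> carrier R" "inv l \<otimes> l = \<one>" using Kinv[OF kl(3) l] Kc subfield_m_inv(3)[OF K, of l] kl(3) l by auto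
          have "\<theta> = inv l \<otimes> k" unfolding k using lc c \<theta>(1) by (simp add: m_assoc[symmetric])
          thus False using False Kr(6) Kinv[OF kl(3) l] kl(2) by simp
        qed
      qed
      hence Ni: "inv ?N \<in> K" "?N \<otimes> inv ?N = \<one>" using NK Kinv subfield_m_inv(2)[OF K, of ?N] by auto
      have "x \<otimes> (?c \<otimes> inv ?N) = \<one>" using Ni Kc[OF Ni(1)] xc cc by (simp add: m_assoc[symmetric] N)
      hence "inv x = ?c \<otimes> inv ?N" using comm_inv_char[of x "?c \<otimes> inv ?N"] xc cc Kc[OF Ni(1)] by simp
      thus ?thesis using add_mult cT 1 Ni(1) by auto
    qed
  qed
next
  assume T: "T = carrier R"
  note Kr = subringE[OF subfieldE(1)[OF K]]
  have "Span K [\<theta>, \<one>] = carrier R"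
  proof
    have "set [\<theta>, \<one>] \<subseteq> carrier R" using \<theta>(1) by simp
    thus "Span K [\<theta>, \<one>] \<subseteq> carrier R" using Span_in_carrier[OF Kr(1)] by blast
    show "carrier R \<subseteq> Span K [\<theta>, \<one>]"
    proof
      fix x assume "x \<in> carrier R"
      then obtain k l where kl: "x = k \<oplus> l \<otimes> \<theta>" "k \<in> K" "l \<in> K" using T unfolding T_def by blast
      have c: "k \<in> carrier R" "l \<in> carrier R" using kl Kr(1) by auto
      have "k = k \<otimes> \<one> \<oplus> \<zero>" using c by simp
      hence "k \<in> line_extension K \<one> {\<zero>}" unfolding line_extension_mem_iff using kl(2) by blast
      moreover have "x = l \<otimes> \<theta> \<oplus> k" unfolding kl(1) using c \<theta>(1) by (simp add: a_comm)
      ultimately have "x \<in> line_extension K \<theta> (line_extension K \<one> {\<zero>})"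
        unfolding line_extension_mem_iff[of x] using kl(3) by blast
      thus "x \<in> Span K [\<theta>, \<one>]" by simp
    qed
  qed
  thus "finite_dimension K (carrier R)" using Span_finite_dimension[OF K, of "[\<theta>, \<one>]"] \<theta>(1) by simp
qed

section \<open>The residue field of D over the function field of its image\<close>

context split_curve
begin

abbreviation "L \<equiv> function_field D"
abbreviation "cls x \<equiv> M +>\<^bsub>R\<^esub> x"

lemma field_L: "field L"
  unfolding function_field_def by (rule maximalideal.quotient_is_field[OF maximalideal_M cring_R])

lemma cls_hom: "ring_hom_ring R L (\<lambda>x. cls x)"
  unfolding function_field_def by (rule ideal.rcos_ring_hom_ring[OF ideal_M])

lemma L_carrier: "A \<in> carrier L \<longleftrightarrow> (\<exists>x\<in>local_carrier D. A = cls x)"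
  by (auto simp: function_field_def FactRing_def A_RCOSETS_def')

lemma cls_eq_iff:
  assumes "x \<in> local_carrier D" "y \<in> local_carrier D"
  shows "cls x = cls y \<longleftrightarrow> x - y \<in> M"
proof -
  interpret cring R by (rule cring_R)
  have "x \<ominus>\<^bsub>R\<^esub> y = x - y" using assms by (simp add: a_minus_def R_uminus)
  thus ?thesis using quotient_eq_iff_same_a_r_cos[OF ideal_M, of x y] assms by simp
qed

lemma cls_simps:
  assumes "x \<in> local_carrier D" "y \<in> local_carrier D"
  shows "cls x \<in> carrier L" "cls (x + y) = cls x \<oplus>\<^bsub>L\<^esub> cls y" "cls (x * y) = cls x \<otimes>\<^bsub>L\<^esub> cls y"
    "cls 1 = \<one>\<^bsub>L\<^esub>" "cls 0 = \<zero>\<^bsub>L\<^esub>" "cls x = \<zero>\<^bsub>L\<^esub> \<longleftrightarrow> x \<in> M"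
proof -
  interpret H: ring_hom_ring R L "\<lambda>x. cls x" by (rule cls_hom)
  show "cls x \<in> carrier L" "cls (x + y) = cls x \<oplus>\<^bsub>L\<^esub> cls y" "cls (x * y) = cls x \<otimes>\<^bsub>L\<^esub> cls y"
    using H.hom_closed[of x] H.hom_add[of x y] H.hom_mult[of x y] assms by simp_all
  show "cls 1 = \<one>\<^bsub>L\<^esub>" and z: "cls 0 = \<zero>\<^bsub>L\<^esub>" using H.hom_one H.hom_zero by simp_all
  show "cls x = \<zero>\<^bsub>L\<^esub> \<longleftrightarrow> x \<in> M" using cls_eq_iff[OF assms(1) local_carrier_0_1(1)] by (simp add: z)
qed

lemma cls_Fract_eq:
  assumes f: "bihomogeneous a b f" "bihomogeneous a b g" "nv g"
    and f': "bihomogeneous a' b' f'" "bihomogeneous a' b' g'" "nv g'"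
    and dvd: "G dvd gsub f * gsub g' - gsub f' * gsub g"
  shows "cls (Fract f g) = cls (Fract f' g')"
proof -
  have n: "g \<noteq> 0" "g' \<noteq> 0" using nv_nonzero[OF f(3)] nv_nonzero[OF f'(3)] .
  have "Fract f g - Fract f' g' = Fract (f * g' - f' * g) (g * g')" using n by simp
  moreover have "bihomogeneous (a + a') (b + b') (f' * g)"
    using bihomogeneous_mult[OF f'(1) f(2)] by (simp add: add.commute)
  hence "Fract (f * g' - f' * g) (g * g') \<in> M"
    by (intro M_I[OF bihomogeneous_diff[OF bihomogeneous_mult[OF f(1) f'(2)]] bihomogeneous_mult[OF f(2) f'(2)] nv_mult[OF f(3) f'(3)]])
      (use dvd in simp_all)
  ultimately show ?thesis using cls_eq_iff[OF local_carrierI[OF f] local_carrierI[OF f']] by simp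
qed

definition K0 :: "'a tpoly tpoly fract set" where
  "K0 = {Fract (lift2 f) (lift2 g) |f g. \<exists>e. homogeneous e f \<and> homogeneous e g \<and> nv (lift2 g)}"

lemma K0_I: "homogeneous e f \<Longrightarrow> homogeneous e g \<Longrightarrow> nv (lift2 g) \<Longrightarrow> Fract (lift2 f) (lift2 g) \<in> K0"
  unfolding K0_def by blast

lemma K0_E:
  assumes "x \<in> K0"
  obtains f g e where "x = Fract (lift2 f) (lift2 g)" "homogeneous e f" "homogeneous e g" "nv (lift2 g)"
  using assms unfolding K0_def by blast

lemma K_eq: "image_function_field D = (\<lambda>x. cls x) ` K0"
proof -
  have nv: "(\<exists>w\<in>snd ` D. pev g w \<noteq> 0) \<longleftrightarrow> nv (lift2 g)" if "homogeneous e g" for e g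
    unfolding nv_iff[OF bihomogeneous_lift2[OF that], symmetric] bev_lift2 by (simp add: split_def)
  show ?thesis
  proof (rule Set.set_eqI, rule iffI)
    fix A assume "A \<in> image_function_field D"
    then obtain f g e where *: "A = cls (Fract (lift2 f) (lift2 g))" "homogeneous e f" "homogeneous e g" "\<exists>w\<in>snd ` D. pev g w \<noteq> 0"
      unfolding image_function_field_def by blast
    have "Fract (lift2 f) (lift2 g) \<in> K0" using K0_I[OF *(2,3)] *(4) nv[OF *(3)] by blast
    thus "A \<in> (\<lambda>x. cls x) ` K0" unfolding *(1) by (rule imageI)
  next
    fix A assume "A \<in> (\<lambda>x. cls x) ` K0"
    then obtain x where x: "A = cls x" "x \<in> K0" by (rule imageE)
    obtain f g e where *: "x = Fract (lift2 f) (lift2 g)" "homogeneous e f" "homogeneous e g" "nv (lift2 g)"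
      using x(2) by (rule K0_E)
    show "A \<in> image_function_field D"
      unfolding image_function_field_def x(1) *(1) using *(2-4) nv[OF *(3)] by blast
  qed
qed

lemma lift2_simps: "lift2 (f + g) = lift2 f + lift2 g" "lift2 (f * g) = lift2 f * lift2 g" "lift2 (- f) = - lift2 f"
  "lift2 (1 :: 'a tpoly) = 1" "lift2 (0 :: 'a tpoly) = 0"
  for f g :: "'a tpoly"
  by (rule bev_eqI, simp)+

lemma homogeneous_1: "homogeneous 0 (1 :: 'a tpoly)"
  by (simp add: homogeneous_iff)

lemma K0_subset: "K0 \<subseteq> local_carrier D"
  using local_carrierI[OF bihomogeneous_lift2 bihomogeneous_lift2] by (auto elim!: K0_E)

lemma K0_closed:
  assumes "x \<in> K0" "y \<in> K0"
  shows "x + y \<in> K0" "x * y \<in> K0" "- x \<in> K0"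
proof -
  obtain f g e where x: "x = Fract (lift2 f) (lift2 g)" "homogeneous e f" "homogeneous e g" "nv (lift2 g)"
    using assms(1) by (rule K0_E)
  obtain f' g' e' where y: "y = Fract (lift2 f') (lift2 g')" "homogeneous e' f'" "homogeneous e' g'" "nv (lift2 g')"
    using assms(2) by (rule K0_E)
  have n: "lift2 g \<noteq> 0" "lift2 g' \<noteq> 0" using nv_nonzero[OF x(4)] nv_nonzero[OF y(4)] .
  have nn: "nv (lift2 (g * g'))" using nv_mult[OF x(4) y(4)] by (simp add: lift2_simps)
  have "x + y = Fract (lift2 (f * g' + f' * g)) (lift2 (g * g'))" unfolding x(1) y(1) lift2_simps using n by simp
  moreover have "homogeneous (e + e') (f' * g)" using homogeneous_mult[OF y(2) x(3)] by (simp add: add.commute)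
  ultimately show "x + y \<in> K0"
    using K0_I[OF homogeneous_add[OF homogeneous_mult[OF x(2) y(3)]] homogeneous_mult[OF x(3) y(3)] nn] by metis
  show "x * y \<in> K0" using K0_I[OF homogeneous_mult[OF x(2) y(2)] homogeneous_mult[OF x(3) y(3)] nn]
    by (simp add: x(1) y(1) lift2_simps)
  show "- x \<in> K0" using K0_I[OF homogeneous_uminus[OF x(2)] x(3,4)] by (simp add: x(1) lift2_simps)
qed

lemma K0_1: "1 \<in> K0"
  using K0_I[OF homogeneous_1 homogeneous_1] nv_1 by (simp add: lift2_simps One_fract_def)

abbreviation "K \<equiv> image_function_field D"

lemma subfield_K: "subfield K L"
proof -
  interpret L: field L by (rule field_L)
  interpret R: cring R by (rule cring_R)
  interpret H: ring_hom_ring R L "\<lambda>x. cls x" by (rule cls_hom)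
  have "subring K0 R"
    by (rule R.subringI) (use K0_subset K0_closed K0_1 R_uminus in auto)
  hence "subring K L" unfolding K_eq by (rule H.img_is_subring)
  thus ?thesis
  proof (rule L.subfieldI')
    fix k assume k: "k \<in> K - {\<zero>\<^bsub>L\<^esub>}"
    then obtain x where x: "k = cls x" "x \<in> K0" unfolding K_eq by blast
    have xc: "x \<in> local_carrier D" using x(2) K0_subset by blast
    obtain f g e where fg: "x = Fract (lift2 f) (lift2 g)" "homogeneous e f" "homogeneous e g" "nv (lift2 g)"
      using x(2) by (rule K0_E)
    have "x \<notin> M" using k cls_simps(6)[OF xc xc] by (simp add: x(1))
    hence "nv (lift2 f)" using Fract_in_M_iff[OF bihomogeneous_lift2[OF fg(2)] bihomogeneous_lift2[OF fg(3)] fg(4)] by (simp add: fg(1) nv_def)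
    hence i: "inverse x \<in> K0" using K0_I[OF fg(3,2)] by (simp add: fg(1))
    hence ic: "inverse x \<in> local_carrier D" using K0_subset by blast
    have "x \<noteq> 0" using unit_if_not_M(1)[OF xc \<open>x \<notin> M\<close>] .
    hence "cls x \<otimes>\<^bsub>L\<^esub> cls (inverse x) = \<one>\<^bsub>L\<^esub>" using cls_simps(3,4)[OF xc ic] by simp
    hence "inv\<^bsub>L\<^esub> k = cls (inverse x)" unfolding x(1)
      by (intro L.comm_inv_char) (use cls_simps(1)[OF xc xc] cls_simps(1)[OF ic ic] in auto)
    thus "inv\<^bsub>L\<^esub> k \<in> K" unfolding K_eq using i by blast
  qed
qed

text \<open>\<open>\<theta>\<close> generates the residue field of \<open>D\<close> over that of the image, from which its square
  \<open>q(X, Y) / Z\<^sup>2\<close> comes.\<close>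

definition \<theta>0 :: "'a tpoly tpoly fract" where "\<theta>0 = Fract (lift1 LL) (lift1 (V * varz))"

lemma Vz: "homogeneous (Suc n) (V * varz)" "nv (lift1 (V * varz))"
  using homogeneous_mult[OF V_hom homogeneous_vars(3)] by (simp_all add: nv_def G_dvd_mult nV nz)

lemma \<theta>0_carrier: "\<theta>0 \<in> local_carrier D"
  unfolding \<theta>0_def by (rule local_carrierI[OF bihomogeneous_lift1[OF LL_hom] bihomogeneous_lift1[OF Vz(1)] Vz(2)])

lemma \<theta>_square: "cls \<theta>0 \<otimes>\<^bsub>L\<^esub> cls \<theta>0 \<in> K"
proof -
  have h: "homogeneous 2 (varz\<^sup>2 :: 'a tpoly)" using homogeneous_power[OF homogeneous_vars(3), of 2] by simp
  have g: "gsub (lift2 (varz\<^sup>2)) = pz\<^sup>2" "gsub (lift2 q) = LL\<^sup>2 * q"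
    by (rule pev_eqI', simp add: pev_gsub pp_def px_def py_def)+
  have npz: "\<not> G dvd pz" using nU nz by (simp add: pz_def G_dvd_mult)
  have nv: "nv (lift2 (varz\<^sup>2))" unfolding nv_def g using npz by (simp add: power2_eq_square G_dvd_mult)
  have "cls \<theta>0 \<otimes>\<^bsub>L\<^esub> cls \<theta>0 = cls (\<theta>0 * \<theta>0)" using cls_simps(3)[OF \<theta>0_carrier \<theta>0_carrier] by simp
  also have "\<theta>0 * \<theta>0 = Fract (lift1 LL * lift1 LL) (lift1 (V * varz) * lift1 (V * varz))"
    unfolding \<theta>0_def by (rule mult_fract)
  also have "cls \<dots> = cls (Fract (lift2 q) (lift2 (varz\<^sup>2)))"
  proof (rule cls_Fract_eq)
    show "bihomogeneous (Suc n + Suc n) (0 + 0) (lift1 LL * lift1 LL)"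
      by (intro bihomogeneous_mult bihomogeneous_lift1 LL_hom)
    show "bihomogeneous (Suc n + Suc n) (0 + 0) (lift1 (V * varz) * lift1 (V * varz))"
      by (intro bihomogeneous_mult bihomogeneous_lift1 Vz)
    show "nv (lift1 (V * varz) * lift1 (V * varz))" by (rule nv_mult[OF Vz(2) Vz(2)])
    show "bihomogeneous 0 2 (lift2 q)" by (rule bihomogeneous_lift2[OF homogeneous_q])
    show "bihomogeneous 0 2 (lift2 (varz\<^sup>2 :: 'a tpoly))" by (rule bihomogeneous_lift2[OF h])
    have "gsub (lift1 LL * lift1 LL) * gsub (lift2 (varz\<^sup>2)) - gsub (lift2 q) * gsub (lift1 (V * varz) * lift1 (V * varz)) =
        LL\<^sup>2 * varz\<^sup>2 * (U\<^sup>2 - q * V\<^sup>2)"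
      unfolding g gsub_simps pz_def by (simp add: power2_eq_square algebra_simps)
    thus "G dvd gsub (lift1 LL * lift1 LL) * gsub (lift2 (varz\<^sup>2)) - gsub (lift2 q) * gsub (lift1 (V * varz) * lift1 (V * varz))"
      using dvd_norm by simp
  qed (rule nv)
  finally show ?thesis unfolding K_eq using K0_I[OF homogeneous_q h nv] by blast
qed

definition T :: "'a tpoly tpoly fract set set" where
  "T = {k \<oplus>\<^bsub>L\<^esub> l \<otimes>\<^bsub>L\<^esub> cls \<theta>0 |k l. k \<in> K \<and> l \<in> K}"

lemmas T_closed = field.quadratic_extension[OF field_L subfield_K cls_simps(1)[OF \<theta>0_carrier \<theta>0_carrier] \<theta>_square, folded T_def]

text \<open>The preimage of T in the local ring, where fractions can be added and multiplied
  directly.\<close>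

definition T0 :: "'a tpoly tpoly fract set" where "T0 = {x \<in> local_carrier D. cls x \<in> T}"

lemma T0_D: "x \<in> T0 \<Longrightarrow> x \<in> local_carrier D" "x \<in> T0 \<Longrightarrow> cls x \<in> T"
  by (simp_all add: T0_def)

lemma T0_I: "x \<in> local_carrier D \<Longrightarrow> cls x \<in> T \<Longrightarrow> x \<in> T0"
  by (simp add: T0_def)

lemma T0_closed: "x \<in> T0 \<Longrightarrow> y \<in> T0 \<Longrightarrow> x + y \<in> T0" "x \<in> T0 \<Longrightarrow> y \<in> T0 \<Longrightarrow> x * y \<in> T0" "K0 \<subseteq> T0" "\<theta>0 \<in> T0"
proof -
  {
    assume xy: "x \<in> T0" "y \<in> T0"
    note c = T0_D(1)[OF xy(1)] T0_D(1)[OF xy(2)]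
    show "x + y \<in> T0"
      using T_closed(3)[OF T0_D(2)[OF xy(1)] T0_D(2)[OF xy(2)]]
      by (intro T0_I local_carrier_closed c) (simp only: cls_simps(2)[OF c])
    show "x * y \<in> T0"
      using T_closed(4)[OF T0_D(2)[OF xy(1)] T0_D(2)[OF xy(2)]]
      by (intro T0_I local_carrier_closed c) (simp only: cls_simps(3)[OF c])
  }
  show "K0 \<subseteq> T0"
  proof
    fix x assume x: "x \<in> K0"
    hence "cls x \<in> K" unfolding K_eq by (rule imageI)
    thus "x \<in> T0" using x K0_subset T_closed(1) by (intro T0_I) blast+
  qed
  show "\<theta>0 \<in> T0" by (rule T0_I[OF \<theta>0_carrier T_closed(2)])
qed

lemma T0_divide:
  assumes "x \<in> local_carrier D" "y \<in> T0" "y \<notin> M" "cls (x * y) \<in> T"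
  shows "x \<in> T0"
proof -
  interpret L: field L by (rule field_L)
  have y: "y \<in> local_carrier D" "cls y \<in> T" using assms(2) by (auto simp: T0_def)
  note c = cls_simps(1)[OF assms(1) y(1)] cls_simps(1)[OF y(1) y(1)]
  have "cls y \<noteq> \<zero>\<^bsub>L\<^esub>" using cls_simps(6)[OF y(1) y(1)] assms(3) by blast
  hence i: "inv\<^bsub>L\<^esub> (cls y) \<in> T" "inv\<^bsub>L\<^esub> (cls y) \<in> carrier L" "cls y \<otimes>\<^bsub>L\<^esub> inv\<^bsub>L\<^esub> (cls y) = \<one>\<^bsub>L\<^esub>"
    using T_closed(5)[OF y(2)] c(2) by (auto simp: L.field_Units)
  have "cls x = cls (x * y) \<otimes>\<^bsub>L\<^esub> inv\<^bsub>L\<^esub> (cls y)"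
    using i(2,3) c by (simp add: cls_simps(3)[OF assms(1) y(1)] L.m_assoc)
  also have "\<dots> \<in> T" by (rule T_closed(4)[OF assms(4) i(1)])
  finally show ?thesis using assms(1) by (simp add: T0_def)
qed

definition den :: "nat \<Rightarrow> nat \<Rightarrow> 'a tpoly tpoly" where "den a b = lift1 (varz ^ a) * varz ^ b"

lemma den_add: "den a b * den a' b' = den (a + a') (b + b')"
  by (rule bev_eqI) (simp add: den_def power_add mult_ac)

lemma nv_Z: "nv varz"
  using nU nz by (simp add: nv_def gsub_def pz_def G_dvd_mult)

lemma bihomogeneous_XYZ: "bihomogeneous 0 1 (varx :: 'a tpoly tpoly)" "bihomogeneous 0 1 (vary :: 'a tpoly tpoly)"
  "bihomogeneous 0 1 (varz :: 'a tpoly tpoly)"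
  by (auto simp: bihomogeneous_iff)

lemma bihomogeneous_xyz: "bihomogeneous 1 0 (lift1 varx :: 'a tpoly tpoly)" "bihomogeneous 1 0 (lift1 vary :: 'a tpoly tpoly)"
  "bihomogeneous 1 0 (lift1 varz :: 'a tpoly tpoly)"
  using homogeneous_vars by (auto intro!: bihomogeneous_lift1)

lemma den: "bihomogeneous a b (den a b)" "nv (den a b)"
proof -
  show "bihomogeneous a b (den a b)"
    by (auto simp: bihomogeneous_iff den_def power_mult_distrib)
  show "nv (den a b)" using nv_Z nz by (auto simp: nv_def den_def G_dvd_mult dest!: prime_elem_dvd_power[OF G_prime])
qed

text \<open>Every form, divided by its standard denominator, turns out to lie in the quadratic
  extension. It is enough to see this for constants and the six coordinates, since the property
  passes to products and to sums of equal bidegree.\<close>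

definition inT :: "nat \<Rightarrow> nat \<Rightarrow> 'a tpoly tpoly \<Rightarrow> bool" where
  "inT a b f \<longleftrightarrow> bihomogeneous a b f \<and> Fract f (den a b) \<in> T0"

lemma inT_mult: "inT a b f \<Longrightarrow> inT a' b' g \<Longrightarrow> inT (a + a') (b + b') (f * g)"
  using bihomogeneous_mult[of a b f a' b' g] T0_closed(2)[of "Fract f (den a b)" "Fract g (den a' b')"]
  unfolding inT_def mult_fract den_add by blast

lemma inT_add: "inT a b f \<Longrightarrow> inT a b g \<Longrightarrow> inT a b (f + g)"
  using bihomogeneous_add[of a b f g] T0_closed(1)[of "Fract f (den a b)" "Fract g (den a b)"]
  unfolding inT_def Fract_add_same[OF nv_nonzero[OF den(2)]] by blast

lemma inT_power: "inT a b f \<Longrightarrow> inT (k * a) (k * b) (f ^ k)"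
proof (induction k)
  case 0
  have "den 0 0 = 1" by (rule bev_eqI) (simp add: den_def)
  thus ?case using K0_1 T0_closed(3) bihomogeneous_1 by (auto simp: inT_def One_fract_def)
next
  case (Suc k)
  thus ?case using inT_mult[of a b f "k * a" "k * b" "f ^ k"] by simp
qed

lemma den_simps: "den 0 0 = 1" "den 1 0 = lift1 varz" "den 0 1 = varz" "den (Suc 0) 0 = lift1 varz" "den 0 (Suc 0) = varz"
  by (rule bev_eqI, simp add: den_def)+

lemma inT_const: "inT 0 0 (lift1 (const3 c))"
proof -
  have "Fract (lift2 (const3 c)) (lift2 1) \<in> K0" by (rule K0_I[of 0]) (use homogeneous_const3 homogeneous_1 nv_1 in \<open>simp_all add: lift2_simps\<close>)
  moreover have "lift2 (const3 c) = lift1 (const3 c)" by (rule bev_eqI) simp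
  ultimately show ?thesis
    using T0_closed(3) bihomogeneous_lift1[OF homogeneous_const3] by (auto simp: inT_def den_simps lift2_simps)
qed

lemma lift2_vars: "lift2 (varx :: 'a tpoly) = varx" "lift2 (vary :: 'a tpoly) = vary" "lift2 (varz :: 'a tpoly) = varz"
  by (rule bev_eqI, simp)+

lemma inT_XYZ: "inT 0 1 varx" "inT 0 1 vary" "inT 0 1 varz"
proof -
  have "Fract (lift2 varx) (lift2 varz) \<in> K0" "Fract (lift2 vary) (lift2 varz) \<in> K0" "Fract (lift2 varz) (lift2 varz) \<in> K0"
    by (rule K0_I[OF homogeneous_vars(1) homogeneous_vars(3)] K0_I[OF homogeneous_vars(2) homogeneous_vars(3)]
          K0_I[OF homogeneous_vars(3) homogeneous_vars(3)], simp add: lift2_vars nv_Z)+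
  thus "inT 0 1 varx" "inT 0 1 vary" "inT 0 1 varz"
    using T0_closed(3) bihomogeneous_XYZ by (auto simp: inT_def den_simps lift2_vars)
qed

text \<open>With \<open>\<theta> = s / z + 1\<close> the coordinates of \<open>v\<close> are those of \<open>w\<close> times \<open>(\<theta> - 1) / \<theta>\<close>.\<close>

lemma inT_xyz: "inT 1 0 (lift1 varx)" "inT 1 0 (lift1 vary)" "inT 1 0 (lift1 varz)"
proof -
  have nz1: "nv (lift1 varz)" using nz by (simp add: nv_def)
  have "\<theta>0 \<notin> M"
    using Fract_in_M_iff[OF bihomogeneous_lift1[OF LL_hom] bihomogeneous_lift1[OF Vz(1)] Vz(2)] n_LL by (simp add: \<theta>0_def)
  \<comment> \<open>\<eta> is \<theta> - 1, that is s / z, and x \<theta> / z = X \<eta> / Z on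
    D.\<close>
  define \<eta> where "\<eta> = Fract (lift1 U) (lift1 (V * varz))"
  have "\<eta> = \<theta>0 + (- 1)"
  proof -
    have "lift1 LL = lift1 U + lift1 (V * varz)" by (rule bev_eqI) (simp add: LL_def)
    hence "\<theta>0 = \<eta> + Fract (lift1 (V * varz)) (lift1 (V * varz))"
      unfolding \<theta>0_def \<eta>_def by (simp only: Fract_add_same[OF nv_nonzero[OF Vz(2)]])
    also have "Fract (lift1 (V * varz)) (lift1 (V * varz)) = 1" using nv_nonzero[OF Vz(2)] by (simp add: One_fract_def eq_fract)
    finally show ?thesis by simp
  qed
  moreover have "- 1 \<in> T0" using T0_closed(3) K0_closed(3)[OF K0_1 K0_1] by blast
  ultimately have \<eta>: "\<eta> \<in> T0" using T0_closed(1)[OF T0_closed(4)] by (simp only:)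
  have main: "inT 1 0 (lift1 x)" if x: "homogeneous (Suc 0) x" and X: "inT 0 1 X" "gsub X = LL * x" for x X
  proof -
    have x1: "bihomogeneous 1 0 (lift1 x)" using bihomogeneous_lift1[OF x] by simp
    have XZ: "Fract X varz \<in> T0" "bihomogeneous 0 1 X" using X(1) by (simp_all add: inT_def den_simps)
    have "Fract (lift1 x) (lift1 varz) \<in> T0"
    proof (rule T0_divide[OF local_carrierI[OF x1 bihomogeneous_xyz(3) nz1] T0_closed(4) \<open>\<theta>0 \<notin> M\<close>])
      have "cls (Fract (lift1 x) (lift1 varz) * \<theta>0) = cls (Fract X varz * \<eta>)"
        unfolding \<theta>0_def \<eta>_def mult_fract
      proof (rule cls_Fract_eq)
        show "bihomogeneous (1 + Suc n) (0 + 0) (lift1 x * lift1 LL)" by (intro bihomogeneous_mult bihomogeneous_lift1[OF LL_hom] x1)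
        show "bihomogeneous (1 + Suc n) (0 + 0) (lift1 varz * lift1 (V * varz))"
          by (intro bihomogeneous_mult bihomogeneous_lift1[OF Vz(1)] bihomogeneous_xyz)
        show "bihomogeneous (0 + Suc n) (1 + 0) (X * lift1 U)" by (intro bihomogeneous_mult bihomogeneous_lift1[OF U_hom] XZ)
        show "bihomogeneous (0 + Suc n) (1 + 0) (varz * lift1 (V * varz))"
          by (intro bihomogeneous_mult bihomogeneous_lift1[OF Vz(1)] bihomogeneous_XYZ)
        show "nv (lift1 varz * lift1 (V * varz))" "nv (varz * lift1 (V * varz))" by (intro nv_mult nz1 nv_Z Vz)+
        have "gsub varz = pz" by (simp add: gsub_def)
        hence "gsub (lift1 x * lift1 LL) * gsub (varz * lift1 (V * varz)) = gsub (X * lift1 U) * gsub (lift1 varz * lift1 (V * varz))"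
          by (simp add: X(2) pz_def mult_ac)
        thus "G dvd gsub (lift1 x * lift1 LL) * gsub (varz * lift1 (V * varz)) - gsub (X * lift1 U) * gsub (lift1 varz * lift1 (V * varz))"
          by (simp only: diff_self dvd_0_right)
      qed
      also have "\<dots> \<in> T" using T0_closed(2)[OF XZ(1) \<eta>] by (simp add: T0_def)
      finally show "cls (Fract (lift1 x) (lift1 varz) * \<theta>0) \<in> T" .
    qed
    thus ?thesis using x1 by (simp add: inT_def den_simps)
  qed
  show "inT 1 0 (lift1 varx)" "inT 1 0 (lift1 vary)"
    by (rule main[OF homogeneous_vars(1) inT_XYZ(1)], simp add: gsub_def px_def)
      (rule main[OF homogeneous_vars(2) inT_XYZ(2)], simp add: gsub_def py_def)
  have "Fract (lift1 varz) (lift1 varz) = (1 :: 'a tpoly tpoly fract)" using nv_nonzero[OF nz1] by (simp add: One_fract_def eq_fract)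
  thus "inT 1 0 (lift1 varz)" using K0_1 T0_closed(3) bihomogeneous_xyz(3) by (auto simp: inT_def den_simps)
qed

lemma decomposable_inT: "decomposable (\<lambda>(a, b). inT a b) f"
proof -
  have 0: "inT a b 0" for a b
  proof -
    have "0 \<in> K0" using K0_closed(1)[OF K0_1 K0_closed(3)[OF K0_1 K0_1]] by simp
    hence "Fract 0 (den a b) \<in> T0" unfolding fract_collapse using T0_closed(3) by blast
    thus ?thesis by (simp add: inT_def)
  qed
  show ?thesis
  proof (induction f rule: bpoly_sum_induct)
    case (mono c i j l i' j' l')
    have "mono3 (mono3 c i j l) i' j' l' =
        (lift1 (const3 c) * (lift1 varx ^ i * lift1 vary ^ j * lift1 varz ^ l)) * (varx ^ i' * vary ^ j' * varz ^ l')"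
      unfolding mono3_altdef by (rule bev_eqI) (simp add: mult.assoc)
    moreover have "inT ((0 + (i * 1 + j * 1 + l * 1)) + (i' * 0 + j' * 0 + l' * 0)) ((0 + (i * 0 + j * 0 + l * 0)) + (i' * 1 + j' * 1 + l' * 1))
        ((lift1 (const3 c) * (lift1 varx ^ i * lift1 vary ^ j * lift1 varz ^ l)) * (varx ^ i' * vary ^ j' * varz ^ l'))"
      by (intro inT_mult inT_power inT_const inT_xyz inT_XYZ)
    ultimately show ?case using 0 by (intro decomposable_single[of _ "(i + j + l, i' + j' + l')"]) auto
  next
    case (add p q)
    thus ?case by (rule decomposable_add) (auto intro: inT_add)
  qed (auto intro!: decomposable_single[of _ "(0, 0)"] simp: 0)
qed

lemma inT_if_bihomogeneous:
  assumes f: "bihomogeneous a b f"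
  shows "inT a b f"
proof -
  obtain S cf where S: "finite S" "\<And>i. inT (fst i) (snd i) (cf i)" "\<And>i. i \<notin> S \<Longrightarrow> cf i = 0" "f = sum cf S"
    using decomposable_inT[of f] unfolding decomposable_def split_def by blast
  have "f = sum cf {k\<in>S. fst k = a \<and> snd k = b}"
    unfolding S(4) by (rule bihomogeneous_select[OF S(1)]) (use S(2) f in \<open>auto simp: inT_def S(4)\<close>)
  also have "\<dots> = sum cf {(a, b)}"
    by (rule sum.mono_neutral_left) (use S(3) in auto)
  also have "\<dots> = cf (a, b)" by simp
  finally show ?thesis using S(2)[of "(a, b)"] by simp
qed

lemma T_eq: "T = carrier L"
proof
  interpret L: field L by (rule field_L)
  show "T \<subseteq> carrier L"
    using subringE(1)[OF subfieldE(1)[OF subfield_K]] cls_simps(1)[OF \<theta>0_carrier \<theta>0_carrier] by (auto simp: T_def)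
  show "carrier L \<subseteq> T"
  proof
    fix A assume "A \<in> carrier L"
    then obtain x where x: "x \<in> local_carrier D" "A = cls x" using L_carrier by blast
    obtain f g a b where fg: "x = Fract f g" "bihomogeneous a b f" "bihomogeneous a b g" "nv g"
      using x(1) by (rule local_carrierE)
    have 1: "Fract f (den a b) \<in> T0" "Fract g (den a b) \<in> T0"
      using inT_if_bihomogeneous fg(2,3) by (simp_all add: inT_def)
    have "x * Fract g (den a b) = Fract f (den a b)"
      using mult_fract_cancel[OF nv_nonzero[OF fg(4)], of f "den a b"] by (simp add: fg(1) mult.commute)
    moreover have "Fract g (den a b) \<notin> M"
      using Fract_in_M_iff[OF fg(3) den] fg(4) by (simp add: nv_def)
    ultimately have "x \<in> T0" using T0_divide[OF x(1) 1(2)] 1(1) by (simp add: T0_def)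
    thus "A \<in> T" by (simp add: x(2) T0_def)
  qed
qed

text \<open>Finiteness makes the description in \<open>degree2\<close> well defined, and a field has
  positive dimension over a subfield.\<close>

lemma degree2_D: "degree2 D > 0"
proof -
  interpret L: field L by (rule field_L)
  have "L.finite_dimension K (carrier L)" using T_closed(6) T_eq by blast
  from L.unique_dimension[OF subfield_K this] have "L.dimension (degree2 D) K (carrier L)"
    unfolding degree2_def by (rule theI')
  moreover have "\<not> L.dimension 0 K (carrier L)"
    using L.dimension_zero[OF subfield_K, of "carrier L"] L.one_not_zero L.one_closed by (metis singletonD)
  ultimately show ?thesis by (metis gr0I)
qed

end

subsection \<open>The components of the conchoid\<close>

text \<open>Otherwise a chain of length one in D' could be continued by D.\<close>

lemma irred_curve_subset_eq:
  assumes D: "irred_curve C D" and D': "irred_curve C D'" "D' \<subseteq> D"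
  shows "D' = D"
proof (rule ccontr)
  assume ne: "D' \<noteq> D"
  define chain where "chain = (\<lambda>S n Z. (\<forall>i\<le>n. irred_closed C (Z i) \<and> Z i \<subseteq> S) \<and> (\<forall>i<n. Z i \<subset> Z (Suc i)))"
  have dim: "krull_dim C S = (SUP n\<in>{n. \<exists>Z. chain S n Z}. enat n)" for S
    by (simp only: krull_dim_def chain_def)
  have "\<exists>n Z. chain D' n Z \<and> n \<noteq> 0"
  proof (rule ccontr)
    assume *: "\<not> ?thesis"
    have "(SUP n\<in>{n. \<exists>Z. chain D' n Z}. enat n) \<le> 0"
    proof (rule SUP_least)
      fix n assume "n \<in> {n. \<exists>Z. chain D' n Z}"
      hence "n = 0" using * by blast
      thus "enat n \<le> 0" by (simp add: zero_enat_def)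
    qed
    thus False using D'(1) unfolding irred_curve_def dim by simp
  qed
  then obtain n Z where Z: "chain D' n Z" "n \<noteq> 0" by (elim exE conjE)
  have "chain D 2 (\<lambda>i. if i = 0 then Z 0 else if i = 1 then Z 1 else D)"
    unfolding chain_def
  proof (intro conjI allI impI)
    fix i :: nat
    have Z01: "irred_closed C (Z 0)" "irred_closed C (Z 1)" "Z 0 \<subseteq> D'" "Z 1 \<subseteq> D'" "Z 0 \<subset> Z 1"
      using Z by (simp_all add: chain_def)
    show "irred_closed C (if i = 0 then Z 0 else if i = 1 then Z 1 else D)"
      using Z01 D by (simp add: irred_curve_def)
    show "(if i = 0 then Z 0 else if i = 1 then Z 1 else D) \<subseteq> D"
      using Z01 D'(2) by auto
    assume "i < 2"
    hence "i = 0 \<or> i = 1" by auto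
    thus "(if i = 0 then Z 0 else if i = 1 then Z 1 else D) \<subset> (if Suc i = 0 then Z 0 else if Suc i = 1 then Z 1 else D)"
      using Z01 D'(2) ne by auto
  qed
  hence "2 \<in> {n. \<exists>Z. chain D n Z}" by blast
  hence "enat 2 \<le> krull_dim C D" unfolding dim by (rule SUP_upper)
  thus False using D by (simp add: irred_curve_def one_enat_def)
qed

lemma pullback1_nonneg: "pullback1 F G D \<ge> 0"
  by (simp add: pullback1_def)

text \<open>If G is nonzero at some point of D, then G / G = 1 is among the local equations, so the
  quotient is trivial and its length is 0.\<close>

lemma pullback1_nonzero:
  fixes F G :: "'a::alg_closed_field tpoly"
  assumes G: "homogeneous d G" and nz: "pullback1 F G D \<noteq> 0"
  shows "irred_curve closed2 D" "D \<subseteq> W_surface F" "fst ` D \<subseteq> zeros G"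
proof -
  show D: "irred_curve closed2 D" "D \<subseteq> W_surface F" using nz by (auto simp: pullback1_def split: if_splits)
  have "pev G v = 0" if vw: "(v, w) \<in> D" for v w
  proof (rule ccontr)
    assume G0: "pev G v \<noteq> 0"
    let ?S = "W_local_ideal F D \<union> pullback_local_eqs G D"
    have "\<exists>(v, w)\<in>D. pev G v \<noteq> 0" using vw G0 by blast
    hence "Fract (lift1 G) (lift1 G) \<in> pullback_local_eqs G D"
      unfolding pullback_local_eqs_def using G by blast
    moreover have "bev (lift1 G) v w \<noteq> 0" using G0 by simp
    hence "lift1 G \<noteq> 0" by (metis bev_0)
    hence "Fract (lift1 G) (lift1 G) = 1" by (simp add: One_fract_def eq_fract)
    ultimately have "1 \<in> ?S" by simp
    have whole: "I = carrier (local_ring D)" if "ideal I (local_ring D)" "Idl\<^bsub>local_ring D\<^esub> ?S \<subseteq> I" for I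
    proof (rule ideal.one_imp_carrier[OF that(1)])
      have "1 \<in> Idl\<^bsub>local_ring D\<^esub> ?S" using \<open>1 \<in> ?S\<close> unfolding genideal_def by blast
      hence "1 \<in> I" using that(2) by blast
      thus "\<one>\<^bsub>local_ring D\<^esub> \<in> I" by (simp add: local_ring_def)
    qed
    define chain where "chain = (\<lambda>n I. (\<forall>i\<le>n. ideal (I i) (local_ring D) \<and> Idl\<^bsub>local_ring D\<^esub> ?S \<subseteq> I i) \<and> (\<forall>i<n. I i \<subset> I (Suc i)))"
    have "n = 0" if c: "chain n I" for n I
    proof (rule ccontr)
      assume "n \<noteq> 0"
      hence "I 0 \<subset> I 1" "ideal (I 0) (local_ring D)" "ideal (I 1) (local_ring D)"
        "Idl\<^bsub>local_ring D\<^esub> ?S \<subseteq> I 0" "Idl\<^bsub>local_ring D\<^esub> ?S \<subseteq> I 1" using c by (simp_all add: chain_def)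
      thus False using whole[of "I 0"] whole[of "I 1"] by blast
    qed
    hence "(SUP n\<in>{n. \<exists>I. chain n I}. enat n) \<le> 0" by (intro SUP_least) (auto simp: zero_enat_def)
    moreover have "quot_length (local_ring D) (Idl\<^bsub>local_ring D\<^esub> ?S) = (SUP n\<in>{n. \<exists>I. chain n I}. enat n)"
      unfolding quot_length_def chain_def ..
    ultimately have "quot_length (local_ring D) (Idl\<^bsub>local_ring D\<^esub> ?S) = 0" by simp
    hence "pullback1 F G D = 0" by (simp add: pullback1_def zero_enat_def)
    thus False using nz by simp
  qed
  moreover have "v \<noteq> (0, 0, 0)" if "(v, w) \<in> D" for v w
    using that D(2) unfolding W_surface_def by blast
  ultimately show "fst ` D \<subseteq> zeros G" by (auto simp: in_zeros)
qed

lemma conchoid_nonneg: "conchoid F G E \<ge> 0"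
  by (auto simp: conchoid_def pushforward2_def pullback1_nonneg intro!: sum_nonneg)

lemma conchoid_nonzero:
  fixes F G :: "'a::alg_closed_field tpoly"
  assumes "homogeneous d G" "conchoid F G E \<noteq> 0"
  obtains D where "irred_curve closed1 E" "irred_curve closed2 D" "D \<subseteq> W_surface F" "fst ` D \<subseteq> zeros G" "snd ` D = E"
proof -
  have E: "irred_curve closed1 E" using assms(2) by (auto simp: conchoid_def pushforward2_def split: if_splits)
  hence "(\<Sum>D | pullback1 F G D \<noteq> 0 \<and> snd ` D = E. pullback1 F G D * int (degree2 D)) \<noteq> 0"
    using assms(2) by (simp add: conchoid_def pushforward2_def)
  then obtain D where "pullback1 F G D \<noteq> 0" "snd ` D = E" by (rule sum.not_neutral_contains_not_neutral) auto
  thus thesis using that E pullback1_nonzero[OF assms(1)] by blast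
qed

context conic
begin

lemma zeros_distinct: "zeros F \<noteq> zeros l1" "zeros F \<noteq> zeros l2" "zeros l1 \<noteq> zeros l2"
proof -
  have "(0, 0, 1) \<in> zeros l1 \<and> (0, 0, 1) \<in> zeros l2 \<and> (0, 0, 1) \<notin> zeros F" using eps by (simp add: in_zeros)
  thus "zeros F \<noteq> zeros l1" "zeros F \<noteq> zeros l2" by blast+
  have "(- b1, a1, 0) \<in> zeros l1" using det by (auto simp: in_zeros)
  moreover have "(- b1, a1, 0) \<notin> zeros l2" using det by (simp add: in_zeros algebra_simps)
  ultimately show "zeros l1 \<noteq> zeros l2" by blast
qed

text \<open>The multiplicities of the three removed curves are forced, because these curves are
  distinct. Finiteness of the support is what \<open>effective\<close> demands.\<close>

lemma proper_conchoid_eq: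
  assumes G: "homogeneous d G"
    and fin: "finite {E. E \<notin> {zeros F, zeros l1, zeros l2} \<and> conchoid F G E \<noteq> 0}"
  shows "proper_conchoid F l1 l2 G = (\<lambda>E. if E \<in> {zeros F, zeros l1, zeros l2} then 0 else conchoid F G E)"
    (is "_ = ?K")
  unfolding proper_conchoid_def
proof (rule the_equality)
  have "effective ?K"
    unfolding effective_def
  proof (intro conjI allI impI)
    have "{E. ?K E \<noteq> 0} = {E. E \<notin> {zeros F, zeros l1, zeros l2} \<and> conchoid F G E \<noteq> 0}" by auto
    thus "finite {E. ?K E \<noteq> 0}" using fin by simp
    fix E assume E: "?K E \<noteq> 0"
    hence nz: "conchoid F G E \<noteq> 0" by (auto split: if_splits)
    show "?K E > 0" using E conchoid_nonneg[of F G E] by (auto split: if_splits)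
    show "irred_curve closed1 E" using conchoid_nonzero[OF G nz] by blast
  qed
  moreover have "\<forall>E. conchoid F G E = conchoid F G (zeros F) * prime_divisor (zeros F) E +
      conchoid F G (zeros l1) * prime_divisor (zeros l1) E + conchoid F G (zeros l2) * prime_divisor (zeros l2) E + ?K E"
    using zeros_distinct by (auto simp: prime_divisor_def)
  ultimately show "effective ?K \<and> ?K (zeros F) = 0 \<and> ?K (zeros l1) = 0 \<and> ?K (zeros l2) = 0 \<and>
     (\<exists>a b1 b2. \<forall>E. conchoid F G E = a * prime_divisor (zeros F) E + b1 * prime_divisor (zeros l1) E +
        b2 * prime_divisor (zeros l2) E + ?K E)"
    by (intro conjI exI[of _ "conchoid F G (zeros F)"] exI[of _ "conchoid F G (zeros l1)"] exI[of _ "conchoid F G (zeros l2)"])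
      (assumption | simp)+
next
  fix K :: "'a vec3 divisor"
  assume "effective K \<and> K (zeros F) = 0 \<and> K (zeros l1) = 0 \<and> K (zeros l2) = 0 \<and>
     (\<exists>a b1 b2. \<forall>E. conchoid F G E = a * prime_divisor (zeros F) E + b1 * prime_divisor (zeros l1) E +
        b2 * prime_divisor (zeros l2) E + K E)"
  then obtain a c1 c2 where K: "K (zeros F) = 0" "K (zeros l1) = 0" "K (zeros l2) = 0"
    "\<And>E. conchoid F G E = a * prime_divisor (zeros F) E + c1 * prime_divisor (zeros l1) E +
        c2 * prime_divisor (zeros l2) E + K E" by blast
  show "K = ?K"
  proof
    fix E
    show "K E = ?K E"
    proof (cases "E \<in> {zeros F, zeros l1, zeros l2}")
      case True
      thus ?thesis using K(1-3) by auto
    next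
      case False
      thus ?thesis using K(4)[of E] by (simp add: prime_divisor_def)
    qed
  qed
qed

end

section \<open>Curves of the incidence surface lying over a split curve\<close>

context split_curve
begin

lemma D_scale: "(v, w) \<in> D \<Longrightarrow> c \<noteq> 0 \<Longrightarrow> (v, smul c w) \<in> D"
proof -
  assume vw: "(v, w) \<in> D" and c: "c \<noteq> 0"
  have "bev f v (smul c w) = 0" if "bihomogeneous a b f" "G dvd gsub f" for a b f
    using bihomogeneous_bev[OF that(1), of 1 v c w] D_bev[OF vw that] by simp
  moreover have "smul c w \<noteq> (0, 0, 0)" using D_nonzero(2)[OF vw] c by (cases w) auto
  ultimately show ?thesis using D_nonzero(1)[OF vw] unfolding D_def by blast
qed

lemma good_point_in_D:
  assumes v: "v \<in> zeros G" "pev bad v \<noteq> 0" and w: "w = smul c (psi (pev U v / pev V v) v)" "c \<noteq> 0"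
  shows "(v, w) \<in> D"
proof -
  obtain x y z where xyz: "v = (x, y, z)" by (cases v)
  note g = good_point[OF v xyz]
  have "(v, pp v) \<in> D" by (rule graph_in_D[OF v(1) g(12)])
  hence "(v, smul (c / pev V v) (pp v)) \<in> D" by (rule D_scale) (use w(2) g(2) in simp)
  also have "smul (c / pev V v) (pp v) = w" unfolding g(11) w(1) using g(2) by (simp add: xyz)
  finally show ?thesis .
qed

text \<open>On the line through A and v the incidence equation says that two squares are equal; the
  two signs belong to s and - s.\<close>

lemma W_over_good_point:
  assumes v: "v \<in> zeros G" "pev bad v \<noteq> 0" and W: "(v, w) \<in> W_surface F"
  defines "s \<equiv> pev U v / pev V v"
  obtains c where "c \<noteq> 0" "w = smul c (psi s v) \<or> w = smul c (psi (- s) v)"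
proof -
  obtain x y z where xyz: "v = (x, y, z)" by (cases v)
  obtain X Y Z where w: "w = (X, Y, Z)" by (cases w)
  note g = good_point[OF v xyz, folded s_def]
  have xy0: "x \<noteq> 0 \<or> y \<noteq> 0" using g(4) by auto
  have cross: "x * Y = y * X" using W by (simp add: W_surface_iff xyz w bev_W_eq2)
  obtain t where t: "X = t * x" "Y = t * y"
  proof (cases "x = 0")
    case False
    thus thesis using that[of "X / x"] cross by (simp add: field_simps)
  next
    case True
    thus thesis using that[of "Y / y"] cross xy0 by (simp add: field_simps)
  qed
  have "qf (z * X - x * Z) (z * Y - y * Z) = qf ((z * t - Z) * x) ((z * t - Z) * y)" by (simp add: t algebra_simps)
  also have "\<dots> = ((z * t - Z) * s)\<^sup>2" by (simp only: qf_scale g(7)[symmetric] power_mult_distrib)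
  finally have "((z * t - Z) * s)\<^sup>2 = (z * Z)\<^sup>2"
    using W eps by (simp add: W_surface_iff xyz w bev_W1)
  hence e: "(z * t - Z) * s = z * Z \<or> (z * t - Z) * s = - (z * Z)" by (simp only: power2_eq_iff)
  have Z0: "Z \<noteq> 0"
  proof
    assume "Z = 0"
    hence "t = 0" using e g(3,8) by auto
    hence "w = (0, 0, 0)" using \<open>Z = 0\<close> by (simp add: w t)
    thus False using W by (simp add: W_surface_iff)
  qed
  define k where "k = Z / (z * s)"
  have k: "k \<noteq> 0" "Z = k * (s * z)" using Z0 g(3,8) by (simp_all add: k_def)
  from e show thesis
  proof
    assume "(z * t - Z) * s = z * Z"
    hence "(z * s) * t = (z * s) * (k * (s + z))" by (simp add: k(2) algebra_simps)
    hence "t = k * (s + z)" using g(3,8) by simp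
    thus thesis using that[OF k(1)] by (simp add: w t xyz k(2) mult_ac)
  next
    assume "(z * t - Z) * s = - (z * Z)"
    hence "(z * s) * t = (z * s) * (- (k * (z - s)))" by (simp add: k(2) algebra_simps)
    moreover have "z * s \<noteq> 0" using g(3,8) by simp
    ultimately have "t = - (k * (z - s))" using mult_left_cancel by blast
    thus thesis using that[of "- k"] k(1) by (simp add: w t xyz k(2) mult_ac)
  qed
qed

text \<open>D' is covered by the two halves and the fibres over the finitely many bad points, so by
  irreducibility it lies in one of these sets. In a fibre its image would be finite by
  \<open>finite_fibre\<close>.\<close>

lemma curves_over:
  assumes D': "irred_curve closed2 D'" "D' \<subseteq> W_surface F" "fst ` D' \<subseteq> zeros G"
    and E: "irred_curve closed1 (snd ` D')" "snd ` D' \<noteq> zeros F" "snd ` D' \<noteq> zeros l1" "snd ` D' \<noteq> zeros l2"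
  shows "D' = D \<or> D' = split_curve.D G (- U) V"
proof -
  interpret neg: split_curve a1 b1 a2 b2 \<epsilon> \<mu> G "- U" V d n by (rule split_curve_neg)
  have bad: "pev neg.bad v = 0 \<longleftrightarrow> pev bad v = 0" for v by (simp add: bad_def neg.bad_def)
  let ?B = "{v \<in> zeros G. pev bad v = 0}"
  have finB: "finite (ppoint ` ?B)"
    using finite_common_zeros[OF G_irr G_hom bad_hom n_bad] by (rule finite_subset[rotated]) (auto simp: in_zeros)
  let ?\<F> = "{D, neg.D} \<union> (\<lambda>P. P \<times> {w. w \<noteq> (0, 0, 0)}) ` ppoint ` ?B"
  have "D' \<subseteq> \<Union> ?\<F>"
  proof
    fix P assume "P \<in> D'"
    then obtain v w where vw: "P = (v, w)" "(v, w) \<in> D'" by (cases P) blast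
    have v: "v \<in> zeros G" using D'(3) vw(2) by force
    have W: "(v, w) \<in> W_surface F" using D'(2) vw(2) by blast
    show "P \<in> \<Union> ?\<F>"
    proof (cases "pev bad v = 0")
      case True
      have "w \<noteq> (0, 0, 0)" using W by (simp add: W_surface_iff)
      hence "P \<in> ppoint v \<times> {w. w \<noteq> (0, 0, 0)}" by (simp add: vw(1))
      moreover have "ppoint v \<times> {w. w \<noteq> (0, 0, 0)} \<in> ?\<F>" using True v by blast
      ultimately show ?thesis by (rule UnionI[rotated])
    next
      case False
      obtain c where c: "c \<noteq> 0" "w = smul c (psi (pev U v / pev V v) v) \<or> w = smul c (psi (- (pev U v / pev V v)) v)"
        using W_over_good_point[OF v False W] .
      have "(v, w) \<in> D \<or> (v, w) \<in> neg.D"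
        using c(2)
      proof
        assume "w = smul c (psi (pev U v / pev V v) v)"
        thus ?thesis using good_point_in_D[OF v False _ c(1)] by blast
      next
        assume "w = smul c (psi (- (pev U v / pev V v)) v)"
        hence "w = smul c (psi (pev (- U) v / pev V v) v)" by simp
        thus ?thesis using neg.good_point_in_D[OF v _ _ c(1)] False bad by blast
      qed
      thus ?thesis by (auto simp: vw(1))
    qed
  qed
  moreover have "?\<F> \<subseteq> closed2"
  proof -
    have "ppoint v \<times> {w. w \<noteq> (0, 0, 0)} \<in> closed2" if "v \<in> ?B" for v
      by (rule fst_point_closed2) (use that in \<open>simp add: in_zeros\<close>)
    thus ?thesis using D_closed neg.D_closed by blast
  qed
  moreover have "finite ?\<F>" using finB by simp
  moreover have "irred_closed closed2 D'" using D'(1) by (simp add: irred_curve_def)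
  ultimately obtain S where S: "S \<in> ?\<F>" "D' \<subseteq> S" using closed2.irred_Union[of D' ?\<F>] by blast
  from S(1) consider "S = D" | "S = neg.D" | v where "v \<in> ?B" "S = ppoint v \<times> {w. w \<noteq> (0, 0, 0)}" by blast
  thus ?thesis
  proof cases
    case 1
    thus ?thesis using irred_curve_subset_eq[OF D_curve D'(1)] S(2) by simp
  next
    case 2
    thus ?thesis using irred_curve_subset_eq[OF neg.D_curve D'(1)] S(2) by simp
  next
    case 3
    obtain p e where p: "irreducible p" "homogeneous e p" "snd ` D' = zeros p"
      using irred_curve_closed1E[OF E(1)] by blast
    have v0: "v \<noteq> (0, 0, 0)" using 3(1) by (simp add: in_zeros)
    have sub: "snd ` D' \<subseteq> {w \<in> zeros p. (v, w) \<in> W_surface F}"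
    proof
      fix w assume w: "w \<in> snd ` D'"
      then obtain v' where vw: "(v', w) \<in> D'" by auto
      hence "v' \<in> ppoint v" using S(2) 3(2) by blast
      then obtain c where "c \<noteq> 0" "v' = smul c v" by (auto simp: ppoint_altdef)
      moreover have "(v', w) \<in> W_surface F" using vw D'(2) by blast
      ultimately have "(v, w) \<in> W_surface F" using W_scale by blast
      thus "w \<in> {w \<in> zeros p. (v, w) \<in> W_surface F}" using w p(3) by blast
    qed
    have "finite (ppoint ` {w \<in> zeros p. (v, w) \<in> W_surface F})"
      by (rule finite_fibre[OF p(1,2) _ _ _ v0]) (use E(2-4) p(3) in simp_all)
    hence "finite (ppoint ` snd ` D')" by (rule finite_subset[OF image_mono[OF sub]])
    thus ?thesis using closed1.irred_curve_infinite[OF E(1)] by blast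
  qed
qed

text \<open>D contributes a positive term and no term is negative. The index set has to be finite,
  since a sum over an infinite set would be 0 by convention.\<close>

lemma conchoid_EE: "conchoid F G EE > 0"
proof -
  let ?S = "{D'. pullback1 F G D' \<noteq> 0 \<and> snd ` D' = EE}"
  have "?S \<subseteq> {D, split_curve.D G (- U) V}"
  proof
    fix D' assume "D' \<in> ?S"
    hence D': "pullback1 F G D' \<noteq> 0" "snd ` D' = EE" by blast+
    have "D' = D \<or> D' = split_curve.D G (- U) V"
      by (rule curves_over[OF pullback1_nonzero[OF G_hom D'(1)]]) (use D'(2) EE_curve EE_not_B EE_not_L in simp_all)
    thus "D' \<in> {D, split_curve.D G (- U) V}" by blast
  qed
  hence fin: "finite ?S" by (rule finite_subset) simp
  have DS: "D \<in> ?S" by (simp add: pullback_D snd_D)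
  have "0 < pullback1 F G D * int (degree2 D)" using degree2_D by (simp add: pullback_D)
  also have "\<dots> \<le> (\<Sum>D'\<in>?S. pullback1 F G D' * int (degree2 D'))"
    by (rule member_le_sum[OF DS _ fin]) (simp add: pullback1_nonneg)
  finally show ?thesis using EE_curve by (simp add: conchoid_def pushforward2_def)
qed

lemma proper_conchoid_reducible:
  assumes char: "\<And>m. 0 < m \<Longrightarrow> m \<le> d \<Longrightarrow> of_nat m \<noteq> (0::'a)"
  shows "reducible_curve (proper_conchoid F l1 l2 G)"
proof -
  interpret neg: split_curve a1 b1 a2 b2 \<epsilon> \<mu> G "- U" V d n by (rule split_curve_neg)
  let ?S = "{E. E \<notin> {zeros F, zeros l1, zeros l2} \<and> conchoid F G E \<noteq> 0}"
  have "?S \<subseteq> {EE, neg.EE}"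
  proof
    fix E assume E: "E \<in> ?S"
    then obtain D' where D': "irred_curve closed1 E" "irred_curve closed2 D'" "D' \<subseteq> W_surface F" "fst ` D' \<subseteq> zeros G" "snd ` D' = E"
      using conchoid_nonzero[OF G_hom] by blast
    have "D' = D \<or> D' = neg.D" by (rule curves_over[OF D'(2-4)]) (use D'(1,5) E in auto)
    thus "E \<in> {EE, neg.EE}" using D'(5) snd_D neg.snd_D by blast
  qed
  hence "finite ?S" by (rule finite_subset) simp
  from proper_conchoid_eq[OF G_hom this]
  have K: "proper_conchoid F l1 l2 G EE = conchoid F G EE" "proper_conchoid F l1 l2 G neg.EE = conchoid F G neg.EE"
    using EE_not_B EE_not_L neg.EE_not_B neg.EE_not_L by auto
  have "EE \<noteq> neg.EE" by (rule EE_neq_neg[OF char])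
  thus ?thesis unfolding reducible_curve_def using K conchoid_EE neg.conchoid_EE by (metis less_irrefl)
qed

end

subsection \<open>Curves that split\<close>

text \<open>Compare powers of the scaling factor at a point where neither form vanishes. This
  relates the degrees of H1 and H2 through the homogeneity of G.\<close>

lemma homogeneous_difference:
  fixes P Q :: "'a::alg_closed_field tpoly"
  assumes P: "homogeneous a P" "P \<noteq> 0" and Q: "homogeneous b Q" "Q \<noteq> 0" and PQ: "homogeneous c (P - Q)"
  shows "a = b"
proof (rule ccontr)
  assume ab: "a \<noteq> b"
  have "P * Q \<noteq> 0" using P(2) Q(2) by simp
  then obtain v where "pev (P * Q) v \<noteq> 0" by (rule pev_nonzero_ex)
  hence v: "pev P v \<noteq> 0" "pev Q v \<noteq> 0" by auto
  let ?k = "\<lambda>i. if i = a then pev P v else - pev Q v"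
  have sum: "(\<Sum>i\<in>{a, b}. t ^ i * ?k i) = t ^ c * pev (P - Q) v" for t
    using ab homogeneous_pev[OF PQ, of t v] by (simp add: homogeneous_pev[OF P(1)] homogeneous_pev[OF Q(1)])
  have "a = c"
  proof (rule ccontr)
    assume "a \<noteq> c"
    hence "?k a = 0" by (intro sum_powers_eq_single[of "{a, b}" ?k c "pev (P - Q) v" a]) (use sum in auto)
    thus False using v by simp
  qed
  moreover have "b = c"
  proof (rule ccontr)
    assume "b \<noteq> c"
    hence "?k b = 0" by (intro sum_powers_eq_single[of "{a, b}" ?k c "pev (P - Q) v" b]) (use sum in auto)
    thus False using v ab by simp
  qed
  ultimately show False using ab by simp
qed

context conic
begin

lemma not_dvd_line:
  assumes G: "irreducible G" "\<not> degenerate_curve F G" and ab: "a \<noteq> 0 \<or> b \<noteq> 0"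
  shows "\<not> G dvd linform a b 0"
proof
  assume "G dvd linform a b 0"
  moreover have "irreducible (linform a b 0)" using ab by (intro irreducible_linform) auto
  ultimately obtain c where c: "c \<noteq> 0" "linform a b 0 = const3 c * G"
    using irreducible_dvd_irreducible[OF G(1)] by blast
  have "G = const3 (inverse c) * (const3 c * G)" by (rule pev_eqI) (use c(1) in simp)
  hence G': "G = const3 (inverse c) * linform a b 0" by (simp only: c(2))
  have "homogeneous (0 + Suc 0) G" unfolding G' by (intro homogeneous_mult homogeneous_const3 homogeneous_linform)
  moreover have "pev G ptA = 0" unfolding G' by (simp add: ptA_def)
  ultimately show False using G(2) by (simp add: degenerate_curve_def)
qed

text \<open>The homothetic image of B in \<open>degenerate_curve\<close> has the irreducible
  equation q = 4 z^2, so divisibility by G would mean equality of curves.\<close>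

lemma not_dvd_B:
  assumes G: "irreducible G" "\<not> degenerate_curve F G"
  shows "\<not> G dvd F" "\<not> G dvd q - const3 4 * varz\<^sup>2"
proof -
  show "\<not> G dvd F"
    using irreducible_dvd_zeros_eq[OF G(1) F_irreducible] G(2) by (auto simp: degenerate_curve_def)
  have four: "(4::'a) = 2\<^sup>2" by simp
  have "(4::'a) \<noteq> 0" unfolding four by (rule power_not_zero[OF two])
  hence irr: "irreducible (q - const3 4 * varz\<^sup>2)" by (rule q_irreducible_aux)
  have "zeros (q - const3 4 * varz\<^sup>2) = {(2 * x, 2 * y, z) |x y z. (x, y, z) \<in> zeros F}"
  proof (rule Set.set_eqI)
    fix w :: "'a vec3"
    obtain X Y Z where w: "w = (X, Y, Z)" by (cases w)
    have half: "X = 2 * (X / 2)" "Y = 2 * (Y / 2)" using two by simp_all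
    have "w \<in> zeros (q - const3 4 * varz\<^sup>2) \<longleftrightarrow> (X / 2, Y / 2, Z) \<in> zeros F"
    proof -
      have "qf X Y = 2\<^sup>2 * qf (X / 2) (Y / 2)" using qf_scale[of 2 "X / 2" "Y / 2"] by (simp only: half[symmetric])
      hence "qf X Y - 4 * Z\<^sup>2 = 2\<^sup>2 * (qf (X / 2) (Y / 2) - Z\<^sup>2)" by (simp add: algebra_simps)
      moreover have "(2::'a)\<^sup>2 \<noteq> 0" by (rule power_not_zero[OF two])
      ultimately have "qf X Y - 4 * Z\<^sup>2 = 0 \<longleftrightarrow> qf (X / 2) (Y / 2) - Z\<^sup>2 = 0" by (simp only: mult_eq_0_iff simp_thms)
      thus ?thesis using eps two by (simp add: in_zeros w)
    qed
    also have "\<dots> \<longleftrightarrow> w \<in> {(2 * x, 2 * y, z) |x y z. (x, y, z) \<in> zeros F}"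
    proof
      assume "(X / 2, Y / 2, Z) \<in> zeros F"
      thus "w \<in> {(2 * x, 2 * y, z) |x y z. (x, y, z) \<in> zeros F}" unfolding w using half by blast
    next
      assume "w \<in> {(2 * x, 2 * y, z) |x y z. (x, y, z) \<in> zeros F}"
      then obtain x y z where "w = (2 * x, 2 * y, z)" "(x, y, z) \<in> zeros F" by blast
      thus "(X / 2, Y / 2, Z) \<in> zeros F" using two by (simp add: w)
    qed
    finally show "w \<in> zeros (q - const3 4 * varz\<^sup>2) \<longleftrightarrow> w \<in> {(2 * x, 2 * y, z) |x y z. (x, y, z) \<in> zeros F}" .
  qed
  thus "\<not> G dvd q - const3 4 * varz\<^sup>2"
    using irreducible_dvd_zeros_eq[OF G(1) irr] G(2) by (auto simp: degenerate_curve_def)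
qed

text \<open>On the curve the root of q is H1 / (\<nu> H2) for even degree. For odd degree it is l1
  H1 / (\<nu> H2), since l1 G is (l1 H1)^2 - l1 l2 H2^2. The constant with \<nu>^2 = 1 / \<mu>
  converts l1 l2 into q.\<close>

lemma splitting_imp_split_curve:
  assumes G: "irreducible G" "homogeneous \<delta> G" "\<not> degenerate_curve F G"
    and H: "homogeneous d1 H1" "homogeneous d2 H2"
    and form: "(even \<delta> \<and> G = H1\<^sup>2 - l1 * l2 * H2\<^sup>2) \<or> (odd \<delta> \<and> G = l1 * H1\<^sup>2 - l2 * H2\<^sup>2)"
  shows "\<exists>U V n. split_curve a1 b1 a2 b2 \<epsilon> \<mu> G U V \<delta> n"
proof -
  have prime: "prime_elem G" using G(1) by simp
  have mult: "G dvd a * b \<longleftrightarrow> G dvd a \<or> G dvd b" for a b by (rule prime_elem_dvd_mult_iff[OF prime])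
  have sq: "G dvd a\<^sup>2 \<longleftrightarrow> G dvd a" for a by (simp add: power2_eq_square mult)
  \<comment> \<open>This excludes that G divides both H1 and H2. As G divides one of them exactly if
    it divides the other, it divides neither.\<close>
  have not_sq: "\<not> G\<^sup>2 dvd G"
  proof
    assume "G\<^sup>2 dvd G"
    hence "G * G dvd G * 1" by (simp add: power2_eq_square)
    hence "G dvd 1" using G(1) unfolding dvd_mult_cancel_left by auto
    thus False using G(1) by (simp add: irreducible_def)
  qed
  note line = not_dvd_line[OF G(1,3)]
  have nl: "\<not> G dvd l1" "\<not> G dvd l2"
    using line det unfolding l1_def l2_def by (metis mult_zero_left mult_zero_right diff_0_right diff_self)+
  have both: "\<not> (G dvd H1 \<and> G dvd H2)"
  proof
    assume "G dvd H1 \<and> G dvd H2"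
    hence "G\<^sup>2 dvd H1\<^sup>2" "G\<^sup>2 dvd H2\<^sup>2" by (simp_all add: dvd_power_same)
    hence "G\<^sup>2 dvd G" using form by (metis dvd_diff dvd_mult)
    thus False using not_sq by blast
  qed
  have nH: "\<not> G dvd H1" "\<not> G dvd H2"
  proof -
    have d: "G dvd H1 \<longleftrightarrow> G dvd H2"
      using form
    proof
      assume "even \<delta> \<and> G = H1\<^sup>2 - l1 * l2 * H2\<^sup>2"
      hence "H1\<^sup>2 = G + l1 * l2 * H2\<^sup>2" by simp
      hence "G dvd H1\<^sup>2 \<longleftrightarrow> G dvd l1 * l2 * H2\<^sup>2" by (simp add: dvd_add_right_iff)
      thus ?thesis using nl by (simp add: mult sq)
    next
      assume "odd \<delta> \<and> G = l1 * H1\<^sup>2 - l2 * H2\<^sup>2"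
      hence "l1 * H1\<^sup>2 = G + l2 * H2\<^sup>2" by simp
      hence "G dvd l1 * H1\<^sup>2 \<longleftrightarrow> G dvd l2 * H2\<^sup>2" by (simp add: dvd_add_right_iff)
      thus ?thesis using nl by (simp add: mult sq)
    qed
    thus "\<not> G dvd H1" "\<not> G dvd H2" using both by blast+
  qed
  have H0: "H1 \<noteq> 0" "H2 \<noteq> 0" using nH by auto
  have l0: "l1 \<noteq> 0" "l2 \<noteq> 0" using nl by auto
  have lh: "homogeneous (Suc 0) l1" "homogeneous (Suc 0) l2" by (simp_all add: l1_def l2_def)
  have H2s: "homogeneous (d1 + d1) (H1\<^sup>2)" "homogeneous (d2 + d2) (H2\<^sup>2)"
    unfolding power2_eq_square by (intro homogeneous_mult H)+
  \<comment> \<open>The line at infinity has odd degree, and the odd form vanishes at A, which is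
    not on that line.\<close>
  have nz: "\<not> G dvd varz"
  proof
    assume "G dvd varz"
    then obtain c where c: "c \<noteq> 0" "varz = const3 c * G" using irreducible_dvd_irreducible[OF G(1) varz_irreducible] by blast
    have "homogeneous (0 + \<delta>) (varz :: 'a tpoly)" unfolding c(2) by (intro homogeneous_mult homogeneous_const3 G(2))
    moreover have "varz \<noteq> (0 :: 'a tpoly)" using varz_irreducible by auto
    ultimately have "\<delta> = 1" using homogeneous_unique[of \<delta> "varz :: 'a tpoly" "Suc 0"] homogeneous_vars(3) by simp
    hence "G = l1 * H1\<^sup>2 - l2 * H2\<^sup>2" using form by auto
    hence "pev (const3 c * G) (0, 0, 1) = 0" by simp
    thus False unfolding c(2)[symmetric] by simp
  qed
  obtain \<nu> where "\<nu>\<^sup>2 = inverse \<mu>" by (rule sqrt_ex)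
  hence nu: "\<mu> * \<nu>\<^sup>2 = 1" using mu by simp
  have nu0: "\<nu> \<noteq> 0" using nu by auto
  have nV: "\<not> G dvd const3 \<nu> * H2"
  proof
    assume "G dvd const3 \<nu> * H2"
    hence "G dvd const3 \<nu>" using nH(2) mult by blast
    hence "G dvd 1" using const3_dvd_1[OF nu0] dvd_trans by blast
    thus False using G(1) by (simp add: irreducible_def)
  qed
  have qV: "q * (const3 \<nu> * H2)\<^sup>2 = l1 * l2 * H2\<^sup>2"
  proof -
    have "q * (const3 \<nu> * H2)\<^sup>2 = const3 (\<mu> * \<nu>\<^sup>2) * (l1 * l2 * H2\<^sup>2)"
      by (rule pev_eqI) (simp add: q_def power_mult_distrib mult_ac)
    also have "\<dots> = l1 * l2 * H2\<^sup>2" by (rule pev_eqI) (simp add: nu)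
    finally show ?thesis .
  qed
  have base: "conic a1 b1 a2 b2 \<epsilon> \<mu>" by unfold_locales
  from form show ?thesis
  proof
    assume e: "even \<delta> \<and> G = H1\<^sup>2 - l1 * l2 * H2\<^sup>2"
    have "homogeneous (Suc 0 + Suc 0 + (d2 + d2)) (l1 * l2 * H2\<^sup>2)" by (intro homogeneous_mult lh H2s)
    moreover have "homogeneous \<delta> (H1\<^sup>2 - l1 * l2 * H2\<^sup>2)" using G(2) e by simp
    ultimately have "d1 + d1 = Suc 0 + Suc 0 + (d2 + d2)"
      using homogeneous_difference[OF H2s(1)] H0 l0 by auto
    hence d1: "d1 = Suc d2" by simp
    have "split_curve a1 b1 a2 b2 \<epsilon> \<mu> G H1 (const3 \<nu> * H2) \<delta> d2"
    proof (intro split_curve.intro base split_curve_axioms.intro)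
      show "G dvd H1\<^sup>2 - q * (const3 \<nu> * H2)\<^sup>2" unfolding qV using e by simp
      show "homogeneous d2 (const3 \<nu> * H2)" using homogeneous_mult[OF homogeneous_const3 H(2)] by simp
    qed (use G H d1 nH nV line nz not_dvd_B[OF G(1,3)] in auto)
    thus ?thesis by blast
  next
    assume o: "odd \<delta> \<and> G = l1 * H1\<^sup>2 - l2 * H2\<^sup>2"
    have "homogeneous (Suc 0 + (d1 + d1)) (l1 * H1\<^sup>2)" "homogeneous (Suc 0 + (d2 + d2)) (l2 * H2\<^sup>2)"
      by (intro homogeneous_mult lh H2s)+
    moreover have "homogeneous \<delta> (l1 * H1\<^sup>2 - l2 * H2\<^sup>2)" using G(2) o by simp
    ultimately have "Suc 0 + (d1 + d1) = Suc 0 + (d2 + d2)"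
      using homogeneous_difference H0 l0 by (metis mult_eq_0_iff power_not_zero)
    hence d1: "d1 = d2" by simp
    have "split_curve a1 b1 a2 b2 \<epsilon> \<mu> G (l1 * H1) (const3 \<nu> * H2) \<delta> d2"
    proof (intro split_curve.intro base split_curve_axioms.intro)
      have "(l1 * H1)\<^sup>2 - q * (const3 \<nu> * H2)\<^sup>2 = l1 * (l1 * H1\<^sup>2 - l2 * H2\<^sup>2)"
        unfolding qV by (simp add: power2_eq_square algebra_simps)
      thus "G dvd (l1 * H1)\<^sup>2 - q * (const3 \<nu> * H2)\<^sup>2" using o by (metis dvd_triv_right)
      show "homogeneous (Suc d2) (l1 * H1)" using homogeneous_mult[OF lh(1) H(1)] by (simp add: d1)
      show "homogeneous d2 (const3 \<nu> * H2)" using homogeneous_mult[OF homogeneous_const3 H(2)] by simp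
      show "\<not> G dvd l1 * H1" using nl nH by (simp add: mult)
    qed (use G nV line nz not_dvd_B[OF G(1,3)] in auto)
    thus ?thesis by blast
  qed
qed

end

subsection \<open>The normal form of the conic\<close>

lemma ddz_add: "ddz (p + q) = ddz p + ddz q" for p q :: "'a::field tpoly"
  by (simp add: ddz_def pderiv_add)

lemma ddz_mono3:
  fixes c :: "'a::field"
  shows "ddz (mono3 c i j 0) = 0" "ddz (mono3 c i j 1) = mono3 c i j 0" "ddz (mono3 c i j 2) = mono3 c i j 1 + mono3 c i j 1"
proof -
  show "ddz (mono3 c i j 0) = 0" "ddz (mono3 c i j 1) = mono3 c i j 0"
    by (simp_all add: ddz_def mono3_def pderiv_monom)
  have "pderiv (monom r 2) = monom r 1 + monom r 1" for r :: "'a poly poly"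
  proof -
    have "pderiv (monom r 2) = monom (of_nat 2 * r) (2 - 1)" by (rule pderiv_monom)
    also have "of_nat 2 * r = r + r" by (simp only: of_nat_numeral mult_2)
    also have "monom (r + r) (2 - 1) = monom r 1 + monom r 1" by (simp only: add_monom diff_Suc_Suc minus_nat.diff_0 numeral_2_eq_2 One_nat_def)
    finally show ?thesis .
  qed
  thus "ddz (mono3 c i j 2) = mono3 c i j 1 + mono3 c i j 1" by (simp only: ddz_def mono3_def)
qed

text \<open>The polar of A is given by the derivative in z. Since it is the line z = 0, there are no
  terms in x z and y z, and the remaining binary quadratic form, which vanishes at P1 and P2, is a
  multiple of l1 l2.\<close>

lemma conic_normal_form:
  fixes F l1 l2 :: "'a::alg_closed_field tpoly"
  assumes conic: "smooth_conic_with_center_A F"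
    and points: "zeros F \<inter> Linf = ppoint P1 \<union> ppoint P2" "ppoint P1 \<noteq> ppoint P2"
    and lines: "line_eq_through l1 ptA P1" "line_eq_through l2 ptA P2"
  obtains a1 b1 a2 b2 \<epsilon> \<mu> where "conic a1 b1 a2 b2 \<epsilon> \<mu>" "l1 = linform a1 b1 0" "l2 = linform a2 b2 0"
    "F = const3 \<epsilon> * (const3 \<mu> * (linform a1 b1 0 * linform a2 b2 0) - varz\<^sup>2)"
proof -
  obtain a b c d e f where F: "F = mono3 a 2 0 0 + mono3 b 1 1 0 + mono3 c 0 2 0 + mono3 d 1 0 1 + mono3 e 0 1 1 + mono3 f 0 0 2"
    using conic homogeneous_2_quadratic[of F] unfolding smooth_conic_with_center_A_def by blast
  have "ddz F = mono3 d 1 0 0 + mono3 e 0 1 0 + (mono3 f 0 0 1 + mono3 f 0 0 1)"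
    unfolding F ddz_add ddz_mono3 by simp
  hence dz: "pev (ddz F) (x, y, z) = d * x + e * y + 2 * f * z" for x y z
    by (simp add: algebra_simps)
  have "polar ptA F = Linf" using conic by (simp add: smooth_conic_with_center_A_def)
  hence eq: "(x, y, z) \<in> polar ptA F \<longleftrightarrow> (x, y, z) \<in> zeros varz" for x y z by (simp add: Linf_def)
  hence pol: "d * x + e * y + 2 * f * z = 0 \<longleftrightarrow> z = 0" if "(x, y, z) \<noteq> (0, 0, 0)" for x y z
    using that eq[of x y z] by (auto simp: polar_def ptA_def dz in_zeros)
  \<comment> \<open>Here \<open>f2\<close> also supplies that the characteristic is not 2.\<close>
  have de: "d = 0" "e = 0" and f2: "2 * f \<noteq> 0" using pol[of 1 0 0] pol[of 0 1 0] pol[of 0 0 1] by simp_all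
  define Q where "Q = (\<lambda>x y. a * x\<^sup>2 + b * (x * y) + c * y\<^sup>2)"
  have pF: "pev F (x, y, z) = Q x y + f * z\<^sup>2" for x y z by (simp add: F de Q_def algebra_simps)
  have at_inf: "\<exists>p q. P = (p, q, 0) \<and> (p \<noteq> 0 \<or> q \<noteq> 0) \<and> Q p q = 0" if "P \<in> zeros F \<inter> Linf" for P
  proof -
    obtain p q r where P: "P = (p, q, r)" by (cases P)
    have "r = 0" using that by (simp add: Linf_def in_zeros P)
    moreover from this have "Q p q = 0" "p \<noteq> 0 \<or> q \<noteq> 0" using that by (auto simp: in_zeros P pF)
    ultimately show ?thesis using P by blast
  qed
  have "P1 \<in> zeros F \<inter> Linf" "P2 \<in> zeros F \<inter> Linf" unfolding points(1) by simp_all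
  from at_inf[OF this(1)] at_inf[OF this(2)]
  obtain p1 q1 p2 q2 where P1: "P1 = (p1, q1, 0)" "p1 \<noteq> 0 \<or> q1 \<noteq> 0" "Q p1 q1 = 0"
    and P2: "P2 = (p2, q2, 0)" "p2 \<noteq> 0 \<or> q2 \<noteq> 0" "Q p2 q2 = 0" by blast
  define D where "D = p1 * q2 - p2 * q1"
  have D: "D \<noteq> 0"
  proof
    assume "D = 0"
    have "P1 \<noteq> (0, 0, 0)" using P1 by auto
    moreover have "P2 \<noteq> (0, 0, 0)" using P2 by auto
    moreover have "\<forall>g\<in>cross_forms P1. pev g P2 = 0" using \<open>D = 0\<close> by (simp add: P1(1) P2(1) D_def algebra_simps)
    ultimately have "P2 \<in> ppoint P1" using in_ppoint_iff[of P1 P2] by blast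
    then obtain k where "k \<noteq> 0" "P2 = smul k P1" by (auto simp: ppoint_altdef)
    thus False using points(2) by simp
  qed
  have line: "\<exists>a b. l = linform a b 0 \<and> (a \<noteq> 0 \<or> b \<noteq> 0) \<and> a * p + b * q = 0" if lp: "line_eq_through l ptA (p, q, 0)" for l p q
  proof -
    have "homogeneous (Suc 0) l" using lp by (simp add: line_eq_through_def)
    then obtain a b c where l: "l = linform a b c" by (rule homogeneous_1_linform)
    have "c = 0" "a * p + b * q = 0" using lp by (simp_all add: line_eq_through_def l ptA_def)
    moreover have "l \<noteq> 0" using lp by (simp add: line_eq_through_def)
    ultimately show ?thesis using l by auto
  qed
  obtain a1 b1 where l1: "l1 = linform a1 b1 0" "a1 \<noteq> 0 \<or> b1 \<noteq> 0" "a1 * p1 + b1 * q1 = 0"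
    using line lines(1) unfolding P1(1) by blast
  obtain a2 b2 where l2: "l2 = linform a2 b2 0" "a2 \<noteq> 0 \<or> b2 \<noteq> 0" "a2 * p2 + b2 * q2 = 0"
    using line lines(2) unfolding P2(1) by blast
  define m1 where "m1 = a1 * p2 + b1 * q2"
  define m2 where "m2 = a2 * p1 + b2 * q1"
  have m1: "m1 \<noteq> 0"
  proof
    assume "m1 = 0"
    have "a1 * D = (a1 * p1 + b1 * q1) * q2 - m1 * q1" "b1 * D = m1 * p1 - (a1 * p1 + b1 * q1) * p2"
      by (simp_all add: D_def m1_def algebra_simps)
    thus False using \<open>m1 = 0\<close> l1 D by simp
  qed
  have m2: "m2 \<noteq> 0"
  proof
    assume "m2 = 0"
    have "a2 * D = m2 * q2 - (a2 * p2 + b2 * q2) * q1" "b2 * D = (a2 * p2 + b2 * q2) * p1 - m2 * p2"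
      by (simp_all add: D_def m2_def algebra_simps)
    thus False using \<open>m2 = 0\<close> l2 D by simp
  qed
  have "(a1 * b2 - a2 * b1) * D = (a1 * p1 + b1 * q1) * (a2 * p2 + b2 * q2) - m1 * m2"
    by (simp add: D_def m1_def m2_def algebra_simps)
  hence det: "a1 * b2 - a2 * b1 \<noteq> 0" using l1(3) m1 m2 by auto
  define B where "B = a * (2 * (p1 * p2)) + b * (p1 * q2 + p2 * q1) + c * (2 * (q1 * q2))"
  have QB: "Q x y * (m1 * m2) = B * ((a1 * x + b1 * y) * (a2 * x + b2 * y))" for x y
  proof -
    define \<alpha> where "\<alpha> = (x * q2 - y * p2) / D"
    define \<beta> where "\<beta> = (p1 * y - q1 * x) / D"
    have e: "x * q2 - y * p2 = \<alpha> * D" "p1 * y - q1 * x = \<beta> * D" using D by (simp_all add: \<alpha>_def \<beta>_def)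
    have "x * D = (x * q2 - y * p2) * p1 + (p1 * y - q1 * x) * p2" by (simp add: D_def algebra_simps)
    also have "\<dots> = (\<alpha> * p1 + \<beta> * p2) * D" unfolding e by (simp add: algebra_simps)
    finally have x: "x = \<alpha> * p1 + \<beta> * p2" using D mult_right_cancel by blast
    have "y * D = (x * q2 - y * p2) * q1 + (p1 * y - q1 * x) * q2" by (simp add: D_def algebra_simps)
    also have "\<dots> = (\<alpha> * q1 + \<beta> * q2) * D" unfolding e by (simp add: algebra_simps)
    finally have y: "y = \<alpha> * q1 + \<beta> * q2" using D mult_right_cancel by blast
    note xy = x y
    have "Q x y = \<alpha>\<^sup>2 * Q p1 q1 + \<beta>\<^sup>2 * Q p2 q2 + \<alpha> * \<beta> * B"
      unfolding xy Q_def B_def by (simp add: power2_eq_square algebra_simps)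
    also have "\<dots> = \<alpha> * \<beta> * B" by (simp add: P1(3) P2(3))
    finally have 1: "Q x y = \<alpha> * \<beta> * B" .
    have "a1 * x + b1 * y = \<alpha> * (a1 * p1 + b1 * q1) + \<beta> * m1" "a2 * x + b2 * y = \<alpha> * m2 + \<beta> * (a2 * p2 + b2 * q2)"
      unfolding xy m1_def m2_def by (simp_all add: algebra_simps)
    hence "a1 * x + b1 * y = \<beta> * m1" "a2 * x + b2 * y = \<alpha> * m2" by (simp_all add: l1(3) l2(3))
    thus ?thesis unfolding 1 by (simp add: mult_ac)
  qed
  \<comment> \<open>If B = 0, the conic contains the whole line at infinity, in particular the third
    point P1 + P2.\<close>
  have B: "B \<noteq> 0"
  proof
    assume "B = 0"
    hence Q0: "Q x y = 0" for x y using QB[of x y] m1 m2 by simp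
    let ?S = "(p1 + p2, q1 + q2, 0)"
    have "?S \<noteq> (0, 0, 0)"
    proof
      assume "?S = (0, 0, 0)"
      hence "p2 = - p1" "q2 = - q1" by (auto simp: add_eq_0_iff)
      thus False using D by (simp add: D_def)
    qed
    hence "?S \<in> zeros F \<inter> Linf" by (simp add: in_zeros Linf_def pF Q0)
    hence "?S \<in> ppoint P1 \<or> ?S \<in> ppoint P2" unfolding points(1) by blast
    then obtain k where "p1 + p2 = k * p1 \<and> q1 + q2 = k * q1 \<or> p1 + p2 = k * p2 \<and> q1 + q2 = k * q2"
      by (auto simp: ppoint_altdef P1(1) P2(1))
    hence "p1 * (q1 + q2) - q1 * (p1 + p2) = 0 \<or> p2 * (q1 + q2) - q2 * (p1 + p2) = 0" by auto
    thus False using D by (auto simp: D_def algebra_simps)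
  qed
  have f: "f \<noteq> 0" using f2 by auto
  \<comment> \<open>Q is B / (m1 m2) times l1 l2, and F = Q + f z^2 is rewritten as - f (\<mu> l1 l2
    - z^2).\<close>
  let ?\<mu> = "- (B / (m1 * m2 * f))"
  have "conic a1 b1 a2 b2 (- f) ?\<mu>"
    by unfold_locales (use det f2 f B m1 m2 in auto)
  moreover have "F = const3 (- f) * (const3 ?\<mu> * (linform a1 b1 0 * linform a2 b2 0) - varz\<^sup>2)"
  proof (rule pev_eqI)
    fix v :: "'a vec3"
    obtain x y z where v: "v = (x, y, z)" by (cases v)
    have "Q x y = B * ((a1 * x + b1 * y) * (a2 * x + b2 * y)) / (m1 * m2)" using QB[of x y] m1 m2 by (simp add: eq_divide_eq)
    hence "Q x y + f * z\<^sup>2 = - f * (?\<mu> * ((a1 * x + b1 * y) * (a2 * x + b2 * y)) - z\<^sup>2)"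
      using f by (simp add: right_diff_distrib)
    thus "pev F v = pev (const3 (- f) * (const3 ?\<mu> * (linform a1 b1 0 * linform a2 b2 0) - varz\<^sup>2)) v"
      by (simp only: v pF pev_mult pev_diff pev_const3 pev_linform pev_power pev_varz mult_zero_left add_0_right fst_conv snd_conv)
  qed
  ultimately show thesis using that l1(1) l2(1) by blast
qed

theorem theorem6p1:
  fixes F G l1 l2 :: "'a::alg_closed_field tpoly" and P1 P2 :: "'a vec3" and \<delta> :: nat
  assumes conic: "smooth_conic_with_center_A F"
    and points: "zeros F \<inter> Linf = ppoint P1 \<union> ppoint P2" "ppoint P1 \<noteq> ppoint P2"
    and lines: "line_eq_through l1 ptA P1" "line_eq_through l2 ptA P2"
    and curve: "irreducible G" "homogeneous \<delta> G" "\<delta> \<ge> 1"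
    and char: "CHAR('a) = 0 \<or> (CHAR('a) > 2 \<and> CHAR('a) > \<delta>)"
    and nondegenerate: "\<not> degenerate_curve F G"
  shows "reducible_curve (proper_conchoid F l1 l2 G) \<longleftrightarrow>
    (\<exists>H1 H2. (\<exists>d1. homogeneous d1 H1) \<and> (\<exists>d2. homogeneous d2 H2) \<and>
       ((even \<delta> \<and> G = H1\<^sup>2 - l1 * l2 * H2\<^sup>2) \<or>
        (odd \<delta> \<and> G = l1 * H1\<^sup>2 - l2 * H2\<^sup>2)))"
proof -
  obtain a1 b1 a2 b2 \<epsilon> \<mu> where nf: "conic a1 b1 a2 b2 \<epsilon> \<mu>" "l1 = linform a1 b1 0" "l2 = linform a2 b2 0"
    "F = const3 \<epsilon> * (const3 \<mu> * (linform a1 b1 0 * linform a2 b2 0) - varz\<^sup>2)"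
    using conic_normal_form[OF conic points lines] .
  interpret C: conic a1 b1 a2 b2 \<epsilon> \<mu> by (rule nf(1))
  have l: "l1 = C.l1" "l2 = C.l2" by (simp_all add: nf(2,3) C.l1_def C.l2_def)
  have F: "F = C.F" by (simp add: nf(4) C.F_def C.q_def C.l1_def C.l2_def)
  note nd = nondegenerate[unfolded F]
  have nl: "\<not> G dvd C.l1" "\<not> G dvd C.l2"
    using C.not_dvd_line[OF curve(1) nd] C.det unfolding C.l1_def C.l2_def
    by (metis mult_zero_left mult_zero_right diff_0_right diff_self)+
  let ?S = "{E. E \<notin> {zeros C.F, zeros C.l1, zeros C.l2} \<and> conchoid C.F G E \<noteq> 0}"
  have S: "irred_curve closed1 E \<and> C.covered G E" if "E \<in> ?S" for E
  proof -
    have "conchoid C.F G E \<noteq> 0" using that by simp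
    then obtain D where D: "irred_curve closed1 E" "irred_curve closed2 D" "D \<subseteq> W_surface C.F" "fst ` D \<subseteq> zeros G" "snd ` D = E"
      by (rule conchoid_nonzero[OF curve(2)])
    have "\<exists>v\<in>zeros G. (v, w) \<in> W_surface C.F" if w: "w \<in> E" for w
    proof -
      obtain v where vw: "(v, w) \<in> D" using w D(5) by auto
      have "v \<in> zeros G" using D(4) imageI[OF vw, of fst] by auto
      thus ?thesis using D(3) vw by blast
    qed
    thus ?thesis using D(1) by (simp add: C.covered_def)
  qed
  show ?thesis unfolding F l
  proof
    assume red: "reducible_curve (proper_conchoid C.F C.l1 C.l2 G)"
    \<comment> \<open>\<open>proper_conchoid\<close> is a definite description that is evaluated for
      finite support. If there were at most one candidate curve, the support would be finite, and
      the evaluated divisor would have at most one component.\<close>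
    have "\<exists>E E'. E \<in> ?S \<and> E' \<in> ?S \<and> E \<noteq> E'"
    proof (rule ccontr)
      assume *: "\<not> ?thesis"
      have "finite ?S"
      proof (cases "?S = {}")
        case True
        show ?thesis unfolding True by (rule finite.emptyI)
      next
        case False
        then obtain E where "E \<in> ?S" by blast
        hence "?S \<subseteq> {E}" using * by blast
        thus ?thesis by (rule finite_subset) simp
      qed
      note K = C.proper_conchoid_eq[OF curve(2) this]
      obtain E E' where E: "E \<noteq> E'" "proper_conchoid C.F C.l1 C.l2 G E \<noteq> 0" "proper_conchoid C.F C.l1 C.l2 G E' \<noteq> 0"
        using red unfolding reducible_curve_def by blast
      have "E \<in> ?S" "E' \<in> ?S" using E(2,3) unfolding K by (auto split: if_splits)
      thus False using * E(1) by blast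
    qed
    then obtain E E' where E: "E \<in> ?S" "E' \<in> ?S" "E \<noteq> E'" by blast
    show "\<exists>H1 H2. (\<exists>d1. homogeneous d1 H1) \<and> (\<exists>d2. homogeneous d2 H2) \<and>
       ((even \<delta> \<and> G = H1\<^sup>2 - C.l1 * C.l2 * H2\<^sup>2) \<or> (odd \<delta> \<and> G = C.l1 * H1\<^sup>2 - C.l2 * H2\<^sup>2))"
      by (rule C.two_covered_imp_splitting[OF curve(1,2) nl, of E E']) (use S[OF E(1)] S[OF E(2)] E in auto)
  next
    assume "\<exists>H1 H2. (\<exists>d1. homogeneous d1 H1) \<and> (\<exists>d2. homogeneous d2 H2) \<and>
       ((even \<delta> \<and> G = H1\<^sup>2 - C.l1 * C.l2 * H2\<^sup>2) \<or> (odd \<delta> \<and> G = C.l1 * H1\<^sup>2 - C.l2 * H2\<^sup>2))"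
    then obtain U V n where "split_curve a1 b1 a2 b2 \<epsilon> \<mu> G U V \<delta> n"
      using C.splitting_imp_split_curve[OF curve(1,2) nd] by blast
    moreover have "of_nat m \<noteq> (0::'a)" if "0 < m" "m \<le> \<delta>" for m
    proof
      assume "of_nat m = (0::'a)"
      hence "CHAR('a) dvd m" by (simp add: of_nat_eq_0_iff_char_dvd)
      thus False using char that by (auto dest: dvd_imp_le)
    qed
    ultimately show "reducible_curve (proper_conchoid C.F C.l1 C.l2 G)"
      by (rule split_curve.proper_conchoid_reducible)
  qed
qed

end
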